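(* Consider the $L^2$ gradient flow ($\mathcal G=-I$) and the semi-discrete SAV-GL scheme described in the context. Assume hypotheses $\mathcal H_1$ and $\mathcal H_2$ of the context. If the underlying general linear time discretization (GLTD) is algebraically stable and diagonally stable and its generalized stage order is $\hat q$, then there is a constant $C>0$ independent of $\tau$ such that, for all sufficiently small time stepsizes $\tau$ and all $1\le n\le K-1$, $$\sum_{i=1}^r\left(\left\|E_i^{[n+1]}\right\|^2+\left|D_i^{[n+1]}\right|^2\right)+\tau\sum_{i=1}^s\left(\left\|E_{n,i}\right\|^2+\left|D_{n,i}\right|^2\right)\le C\,\tau^{\min\{2\hat q,2\nu\}},$$ where $E_{n,i}=u(\cdot,t_{n,i})-U_{n,i}$, $D_{n,i}=z(t_{n,i})-Z_{n,i}$, $E_i^{[n]}=u_i(t_n)-u_i^{[n]}$, $D_i^{[n]}=z_i(t_n)-z_i^{[n]}$, and $\nu$ is the number of extrapolation points.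
   Context: Setting. $\Omega$ is a bounded open domain; $(\cdot,\cdot)$, $\|\cdot\|$ are the $L^2(\Omega)$ inner product and norm. $\mathcal F(u)=\frac12(\mathcal Lu,u)+\mathcal F_1(u)$, $\mathcal F_1(u)=\int_\Omega F(u)dx$, with $F$ a polynomial, $\mathcal L$ a symmetric non-negative linear self-adjoint elliptic operator, and $C_0$ a constant with $\mathcal F_1(u)+C_0>0$. Boundary conditions are periodic or such that integration by parts introduces no boundary terms. Put $W(v)=\frac{1}{\sqrt{\mathcal F_1(v)+C_0}}\frac{\delta\mathcal F_1}{\delta u}(v)$. The reformulated $L^2$ gradient flow on $[0,T]$ is $\partial_tu=-(\mathcal Lu+zW(u))$, $\frac{dz}{dt}=\frac12(W(u),\partial_tu)$, $z=\sqrt{\mathcal F_1(u)+C_0}$. Let $\tau=T/K$, $K$ a positive integer, $t_n=n\tau$, $t_{n,i}=t_n+c_i\tau$. GLTD. For $u'=f(u)$: $U_{n,i}=\tau\sum_{j=1}^sd^{11}_{ij}f(U_{n,j})+\sum_{j=1}^rd^{12}_{ij}u_j^{[n]}$ ($1\le i\le s$), $u_i^{[n+1]}=\tau\sum_{j=1}^sd^{21}_{ij}f(U_{n,j})+\sum_{j=1}^rd^{22}_{ij}u_j^{[n]}$ ($1\le i\le r$), with real matrices $\mathbf D_{\imath\jmath}=(d^{\imath\jmath}_{ij})$, abscissae $c_i$, and vectors $\mathbf w_j=(w_{1j},\dots,w_{rj})^T$, $0\le j\le p$; $U_{n,i}$ approximates $u(t_{n,i})$ and $u_i^{[n]}$ approximates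 $u_i(t_n):=\sum_{j=0}^pw_{ij}\tau^ju^{(j)}(t_n)$ (similarly $z_i(t_n):=\sum_{j=0}^pw_{ij}\tau^jz^{(j)}(t_n)$). Consistency: $\mathbf D_{12}\mathbf w_0=\mathbf e$, $\mathbf D_{22}\mathbf w_0=\mathbf w_0$, $\mathbf D_{21}\mathbf e+\mathbf D_{22}\mathbf w_1=\mathbf w_0+\mathbf w_1$, $\mathbf D_{11}\mathbf e+\mathbf D_{12}\mathbf w_1=\mathbf c$, with $\mathbf e=(1,\dots,1)^T$. Algebraically stable: there are a symmetric positive definite $\mathbf G\in\mathbb R^{r\times r}$ and a non-negative definite diagonal $\mathbf H\in\mathbb R^{s\times s}$ such that $\begin{bmatrix}\mathbf G-\mathbf D_{22}^T\mathbf G\mathbf D_{22}&\mathbf D_{12}^T\mathbf H-\mathbf D_{22}^T\mathbf G\mathbf D_{21}\\ \mathbf H\mathbf D_{12}-\mathbf D_{21}^T\mathbf G\mathbf D_{22}&\mathbf D_{11}^T\mathbf H+\mathbf H\mathbf D_{11}-\mathbf D_{21}^T\mathbf G\mathbf D_{21}\end{bmatrix}$ is non-negative definite. Diagonally stable: there is a positive definite diagonal $\tilde{\mathbf H}\in\mathbb R^{s\times s}$ with $\tilde{\mathbf H}\mathbf D_{11}+\mathbf D_{11}^T\tilde{\mathbf H}$ positive definite. Generalized stage order: the largest integer $\hat q$ for which there exist functions $\hat u_i(t_n)$ ($1\le i\le r$) with $u_i(t_n)-\hat u_i(t_n)=\mathcal O(\tau^{\hat q})$ such that $\rho_{n,i}=\mathcal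 O(\tau^{\hat q+1})$ and $\rho_i^{[n]}=\mathcal O(\tau^{\hat q+1})$, where $u(t_{n,i})=\tau\sum_jd^{11}_{ij}u'(t_{n,j})+\sum_jd^{12}_{ij}\hat u_j(t_n)+\rho_{n,i}$ and $\hat u_i(t_{n+1})=\tau\sum_jd^{21}_{ij}u'(t_{n,j})+\sum_jd^{22}_{ij}\hat u_j(t_n)+\rho_i^{[n]}$, for smooth $u$. SAV-GL scheme. For $n\ge1$: $U_{n,i}=\tau\sum_jd^{11}_{ij}\dot U_{n,j}+\sum_jd^{12}_{ij}u_j^{[n]}$, $Z_{n,i}=\tau\sum_jd^{11}_{ij}\dot Z_{n,j}+\sum_jd^{12}_{ij}z_j^{[n]}$ ($1\le i\le s$); $u_i^{[n+1]}=\tau\sum_jd^{21}_{ij}\dot U_{n,j}+\sum_jd^{22}_{ij}u_j^{[n]}$, $z_i^{[n+1]}=\tau\sum_jd^{21}_{ij}\dot Z_{n,j}+\sum_jd^{22}_{ij}z_j^{[n]}$ ($1\le i\le r$); with $\dot U_{n,i}=-(\mathcal LU_{n,i}+Z_{n,i}W(\bar U_{n,i}))$, $\dot Z_{n,i}=\frac12(W(\bar U_{n,i}),\dot U_{n,i})$. Here $\bar U_{n,i}$ is a $\nu$-point extrapolation ($\nu\le s+r$): a linear combination, with coefficients independent of $\tau$ and $n$, of $\nu$ of the values $U_{n-1,j}$ ($1\le j\le s$) and $u_j^{[n]}$ ($1\le j\le r$), such that the same combination of $u(\cdot,t_{n-1,j})$ and $u_j(t_n)$ differs from $u(\cdot,t_{n,i})$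 by $\mathcal O(\tau^\nu)$ for smooth $u$. $\mathcal H_1$: the exact solutions $u,z$ are bounded and sufficiently smooth (continuous bounded derivatives up to some finite order depending only on the method and $\nu$), and $W$ is locally Lipschitz continuous, i.e. for each $R$ there is $L_R$ with $\|W(v)-W(w)\|\le L_R\|v-w\|$ for all admissible $v,w$ with $\|v\|,\|w\|\le R$. $\mathcal H_2$: the starting values are sufficiently accurate, to the order of the generalized stage order: $\sum_{i=1}^s(\|E_{0,i}\|+|D_{0,i}|)+\sum_{i=1}^r(\|E_i^{[1]}\|+|D_i^{[1]}|)\le C\tau^{\hat q}$. *)

theory Defs
  imports "HOL-Analysis.Analysis" "HOL-Computational_Algebra.Polynomial"
begin

section \<open>The space of square-integrable functions on a domain\<close>

text \<open>
  Elements of \<open>L\<^sup>2(\<Omega>)\<close> are represented by functions on the whole space; only their values on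
  \<open>\<Omega>\<close> matter, and equality in \<open>L\<^sup>2(\<Omega>)\<close> is equality almost everywhere on \<open>\<Omega>\<close>.
\<close>

definition L2 :: "'a::euclidean_space set \<Rightarrow> ('a \<Rightarrow> real) set" where
  "L2 \<Omega> = {v. v \<in> borel_measurable (lebesgue_on \<Omega>) \<and> integrable (lebesgue_on \<Omega>) (\<lambda>x. (v x)\<^sup>2)}"

definition L2_inner :: "'a::euclidean_space set \<Rightarrow> ('a \<Rightarrow> real) \<Rightarrow> ('a \<Rightarrow> real) \<Rightarrow> real" where
  "L2_inner \<Omega> v w = (LINT x|lebesgue_on \<Omega>. v x * w x)"

definition L2_norm :: "'a::euclidean_space set \<Rightarrow> ('a \<Rightarrow> real) \<Rightarrow> real" where
  "L2_norm \<Omega> v = sqrt (L2_inner \<Omega> v v)"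

definition eqL2 :: "'a::euclidean_space set \<Rightarrow> ('a \<Rightarrow> real) \<Rightarrow> ('a \<Rightarrow> real) \<Rightarrow> bool" where
  "eqL2 \<Omega> v w \<longleftrightarrow> (AE x in lebesgue_on \<Omega>. v x = w x)"

definition L2_continuous ::
    "'a::euclidean_space set \<Rightarrow> real set \<Rightarrow> (real \<Rightarrow> 'a \<Rightarrow> real) \<Rightarrow> bool" where
  "L2_continuous \<Omega> J v \<longleftrightarrow>
     (\<forall>t\<in>J. ((\<lambda>s. L2_norm \<Omega> (\<lambda>x. v s x - v t x)) \<longlongrightarrow> 0) (at t within J))"

definition has_L2_derivative ::
    "'a::euclidean_space set \<Rightarrow> real set \<Rightarrow> (real \<Rightarrow> 'a \<Rightarrow> real) \<Rightarrow> ('a \<Rightarrow> real) \<Rightarrow> real \<Rightarrow> bool" where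
  "has_L2_derivative \<Omega> J v g t \<longleftrightarrow>
     ((\<lambda>s. L2_norm \<Omega> (\<lambda>x. (v s x - v t x) / (s - t) - g x)) \<longlongrightarrow> 0) (at t within J)"


section \<open>Test functions, elliptic operators, variational derivatives\<close>

text \<open>
  Multi-indices are written as lists of standard basis vectors: \<open>[b\<^sub>1, \<dots>, b\<^sub>k]\<close> stands for
  \<open>\<partial>\<^sub>b\<^sub>1 \<dots> \<partial>\<^sub>b\<^sub>k\<close>.
\<close>

definition partial_deriv :: "'a::euclidean_space \<Rightarrow> ('a \<Rightarrow> real) \<Rightarrow> 'a \<Rightarrow> real" where
  "partial_deriv b f = (\<lambda>x. frechet_derivative f (at x) b)"

definition iter_partial :: "'a::euclidean_space list \<Rightarrow> ('a \<Rightarrow> real) \<Rightarrow> 'a \<Rightarrow> real" where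
  "iter_partial bs f = foldr partial_deriv bs f"

definition test_function :: "'a::euclidean_space set \<Rightarrow> ('a \<Rightarrow> real) \<Rightarrow> bool" where
  "test_function \<Omega> \<phi> \<longleftrightarrow>
     (\<forall>bs. set bs \<subseteq> Basis \<longrightarrow> (\<forall>x. iter_partial bs \<phi> differentiable (at x))) \<and>
     compact (closure {x. \<phi> x \<noteq> 0}) \<and> closure {x. \<phi> x \<noteq> 0} \<subseteq> \<Omega>"

text \<open>
  \<open>L\<close> acts on test functions as a linear differential operator of some order \<open>k \<ge> 1\<close> whose
  principal symbol does not vanish for \<open>\<xi> \<noteq> 0\<close>. For a symmetric \<open>L\<close> this determines \<open>L v\<close> for all
  \<open>v\<close> in the domain \<open>D\<close>, as a distribution on \<open>\<Omega>\<close>.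
\<close>

definition elliptic_operator ::
    "'a::euclidean_space set \<Rightarrow> ('a \<Rightarrow> real) set \<Rightarrow> (('a \<Rightarrow> real) \<Rightarrow> 'a \<Rightarrow> real) \<Rightarrow> bool" where
  "elliptic_operator \<Omega> D L \<longleftrightarrow>
     (\<exists>k::nat. \<exists>a :: 'a list \<Rightarrow> 'a \<Rightarrow> real. 1 \<le> k \<and>
        (\<forall>bs. continuous_on \<Omega> (a bs)) \<and>
        (\<forall>\<phi>. test_function \<Omega> \<phi> \<longrightarrow> \<phi> \<in> D \<and>
           eqL2 \<Omega> (L \<phi>)
             (\<lambda>x. \<Sum>bs\<in>{bs. set bs \<subseteq> Basis \<and> length bs \<le> k}. a bs x * iter_partial bs \<phi> x)) \<and>
        (\<forall>x\<in>\<Omega>. \<forall>\<xi>. \<xi> \<noteq> 0 \<longrightarrow>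
           (\<Sum>bs\<in>{bs. set bs \<subseteq> Basis \<and> length bs = k}. a bs x * (\<Prod>b\<leftarrow>bs. \<xi> \<bullet> b)) \<noteq> 0))"

text \<open>
  A non-negative self-adjoint (unbounded) operator on \<open>L\<^sup>2(\<Omega>)\<close> with dense domain \<open>D\<close>. The boundary
  conditions are part of \<open>D\<close>: that integration by parts produces no boundary terms is the
  symmetry \<open>(L v, w) = (v, L w)\<close> for \<open>v, w \<in> D\<close>. The last clause says that the domain of the
  adjoint is contained in \<open>D\<close>.
\<close>

definition nonneg_selfadjoint_operator ::
    "'a::euclidean_space set \<Rightarrow> ('a \<Rightarrow> real) set \<Rightarrow> (('a \<Rightarrow> real) \<Rightarrow> 'a \<Rightarrow> real) \<Rightarrow> bool" where
  "nonneg_selfadjoint_operator \<Omega> D L \<longleftrightarrow>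
     D \<subseteq> L2 \<Omega> \<and> (\<forall>v\<in>D. L v \<in> L2 \<Omega>) \<and>
     (\<forall>v\<in>D. \<forall>w. eqL2 \<Omega> w v \<longrightarrow> w \<in> D \<and> eqL2 \<Omega> (L w) (L v)) \<and>
     (\<lambda>x. 0) \<in> D \<and>
     (\<forall>v\<in>D. \<forall>w\<in>D. \<forall>a b. (\<lambda>x. a * v x + b * w x) \<in> D \<and>
        eqL2 \<Omega> (L (\<lambda>x. a * v x + b * w x)) (\<lambda>x. a * L v x + b * L w x)) \<and>
     (\<forall>g\<in>L2 \<Omega>. \<forall>\<epsilon>>0. \<exists>v\<in>D. L2_norm \<Omega> (\<lambda>x. g x - v x) < \<epsilon>) \<and>
     (\<forall>v\<in>D. \<forall>w\<in>D. L2_inner \<Omega> (L v) w = L2_inner \<Omega> v (L w)) \<and>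
     (\<forall>v\<in>D. 0 \<le> L2_inner \<Omega> (L v) v) \<and>
     (\<forall>v\<in>L2 \<Omega>. \<forall>g\<in>L2 \<Omega>.
        (\<forall>w\<in>D. L2_inner \<Omega> (L w) v = L2_inner \<Omega> w g) \<longrightarrow> v \<in> D \<and> eqL2 \<Omega> (L v) g)"

definition is_variational_derivative ::
    "'a::euclidean_space set \<Rightarrow> (('a \<Rightarrow> real) \<Rightarrow> real) \<Rightarrow> ('a \<Rightarrow> real) \<Rightarrow> ('a \<Rightarrow> real) \<Rightarrow> bool" where
  "is_variational_derivative \<Omega> \<Phi> v g \<longleftrightarrow>
     (\<forall>\<phi>. test_function \<Omega> \<phi> \<longrightarrow>
        ((\<lambda>\<epsilon>. \<Phi> (\<lambda>x. v x + \<epsilon> * \<phi> x)) has_real_derivative L2_inner \<Omega> g \<phi>) (at 0))"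

text \<open>Unique up to equality almost everywhere on \<open>\<Omega>\<close> where it exists.\<close>

definition variational_derivative ::
    "'a::euclidean_space set \<Rightarrow> (('a \<Rightarrow> real) \<Rightarrow> real) \<Rightarrow> ('a \<Rightarrow> real) \<Rightarrow> 'a \<Rightarrow> real" where
  "variational_derivative \<Omega> \<Phi> v = (SOME g. g \<in> L2 \<Omega> \<and> is_variational_derivative \<Omega> \<Phi> v g)"

lemma test_function_bounded:
  assumes "test_function \<Omega> \<phi>"
  shows "continuous_on UNIV \<phi>" and "\<exists>B. \<forall>x. \<bar>\<phi> x\<bar> \<le> B"
proof -
  have "\<phi> differentiable (at x)" for x
  proof -
    have "\<forall>bs. set bs \<subseteq> Basis \<longrightarrow> (\<forall>x. iter_partial bs \<phi> differentiable (at x))"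
      using assms unfolding test_function_def by (rule conjunct1)
    from this[rule_format, of "[]" x] show ?thesis by (simp add: iter_partial_def)
  qed
  then show cont: "continuous_on UNIV \<phi>"
    by (intro continuous_at_imp_continuous_on ballI differentiable_imp_continuous_within)
  let ?S = "closure {x. \<phi> x \<noteq> 0}"
  have comp: "compact (\<phi> ` ?S)"
    using assms unfolding test_function_def
    by (intro compact_continuous_image continuous_on_subset[OF cont]) auto
  from compact_imp_bounded[OF comp, unfolded bounded_iff]
  obtain B where B: "\<forall>y\<in>\<phi> ` ?S. norm y \<le> B" by (elim exE)
  have "\<bar>\<phi> x\<bar> \<le> max B 0" for x
  proof (cases "\<phi> x = 0")
    case False
    then have "x \<in> ?S" by (intro closure_subset[THEN subsetD]) simp
    then have "norm (\<phi> x) \<le> B" using B by blast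
    then show ?thesis by simp
  qed simp
  then show "\<exists>B. \<forall>x. \<bar>\<phi> x\<bar> \<le> B" by blast
qed

text \<open>
  For \<open>\<Phi>(v) = \<integral>\<^sub>\<Omega> p(v) dx\<close> the variational derivative is \<open>p'(v)\<close> as expected.
\<close>

lemma is_variational_derivative_poly:
  assumes int: "\<And>k. k \<le> degree p \<Longrightarrow> integrable (lebesgue_on \<Omega>) (\<lambda>x. v x ^ k)"
    and meas: "v \<in> borel_measurable (lebesgue_on \<Omega>)"
  shows "is_variational_derivative \<Omega> (\<lambda>v. LINT x|lebesgue_on \<Omega>. poly p (v x)) v
           (\<lambda>x. poly (pderiv p) (v x))"
  unfolding is_variational_derivative_def
proof (intro allI impI)
  fix \<phi> :: "'a \<Rightarrow> real" assume "test_function \<Omega> \<phi>"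
  note cont = test_function_bounded(1)[OF this] and bdd = test_function_bounded(2)[OF this]
  from bdd obtain B where B: "\<And>x. \<bar>\<phi> x\<bar> \<le> B" by blast
  let ?M = "lebesgue_on \<Omega>"
  have phi_meas: "\<phi> \<in> borel_measurable ?M"
    using borel_measurable_continuous_onI[OF cont]
    by (intro measurable_restrict_space1 measurable_completion) simp
  have int2: "integrable ?M (\<lambda>x. \<phi> x ^ j * v x ^ k)" if "k \<le> degree p" for j k
  proof (rule Bochner_Integration.integrable_bound)
    show "integrable ?M (\<lambda>x. B ^ j * v x ^ k)" using int[OF that] by simp
    show "(\<lambda>x. \<phi> x ^ j * v x ^ k) \<in> borel_measurable ?M" using phi_meas meas by simp
    show "AE x in ?M. norm (\<phi> x ^ j * v x ^ k) \<le> norm (B ^ j * v x ^ k)"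
    proof (rule AE_I2)
      fix x
      have "\<bar>\<phi> x\<bar> ^ j \<le> \<bar>B\<bar> ^ j" using B[of x] by (intro power_mono) linarith+
      then show "norm (\<phi> x ^ j * v x ^ k) \<le> norm (B ^ j * v x ^ k)"
        unfolding real_norm_def abs_mult power_abs by (rule mult_right_mono) simp
    qed
  qed
  define c where "c k j = real (k choose j) * (LINT x|?M. \<phi> x ^ j * v x ^ (k - j))" for k j
  have expand: "(LINT x|?M. poly p (v x + \<epsilon> * \<phi> x))
      = (\<Sum>k\<le>degree p. coeff p k * (\<Sum>j\<le>k. c k j * \<epsilon> ^ j))" for \<epsilon>
  proof -
    have "poly p (v x + \<epsilon> * \<phi> x) = (\<Sum>k\<le>degree p. coeff p k *
         (\<Sum>j\<le>k. (real (k choose j) * \<epsilon> ^ j) * (\<phi> x ^ j * v x ^ (k - j))))" for x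
      unfolding poly_altdef
      by (subst add.commute, subst binomial_ring)
         (simp add: power_mult_distrib mult_ac)
    then show ?thesis
      by (simp add: int2 c_def sum_distrib_left mult_ac Bochner_Integration.integral_sum)
  qed
  have D: "((\<lambda>\<epsilon>. \<Sum>j\<le>k. c k j * \<epsilon> ^ j) has_real_derivative real k * (LINT x|?M. \<phi> x * v x ^ (k - 1))) (at 0)"
    for k
  proof -
    have "((\<lambda>\<epsilon>. \<Sum>j\<le>k. c k j * \<epsilon> ^ j) has_real_derivative
           (\<Sum>j\<le>k. c k j * (real j * 0 ^ (j - Suc 0)))) (at 0)"
      by (rule DERIV_sum, rule DERIV_cmult, rule DERIV_pow)
    also have "(\<Sum>j\<le>k. c k j * (real j * 0 ^ (j - Suc 0))) = (\<Sum>j\<in>{..k} \<inter> {1}. c k j)"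
      by (intro sum.mono_neutral_cong_right) (auto simp: power_0_left)
    also have "\<dots> = real k * (LINT x|?M. \<phi> x * v x ^ (k - 1))"
      by (cases k) (auto simp: c_def)
    finally show ?thesis .
  qed
  have "L2_inner \<Omega> (\<lambda>x. poly (pderiv p) (v x)) \<phi>
      = (LINT x|?M. (\<Sum>k\<le>degree p. coeff p k * (real k * (\<phi> x * v x ^ (k - 1)))))"
  proof -
    have "poly (pderiv p) y = (\<Sum>k\<le>degree p. coeff p k * (real k * y ^ (k - 1)))" for y
    proof -
      have "((\<lambda>y. \<Sum>k\<le>degree p. coeff p k * y ^ k) has_real_derivative
              (\<Sum>k\<le>degree p. coeff p k * (real k * y ^ (k - Suc 0)))) (at y)"
        by (rule DERIV_sum, rule DERIV_cmult, rule DERIV_pow)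
      then have "(poly p has_real_derivative
              (\<Sum>k\<le>degree p. coeff p k * (real k * y ^ (k - Suc 0)))) (at y)"
        by (simp only: poly_altdef[abs_def])
      with poly_DERIV[of p y] show ?thesis unfolding One_nat_def by (rule DERIV_unique)
    qed
    then have "poly (pderiv p) (v x) * \<phi> x
        = (\<Sum>k\<le>degree p. coeff p k * (real k * (\<phi> x * v x ^ (k - 1))))" for x
      by (simp only: sum_distrib_right) (intro sum.cong refl, simp only: mult_ac)
    then show ?thesis by (simp only: L2_inner_def)
  qed
  also have "\<dots> = (\<Sum>k\<le>degree p. coeff p k * (real k * (LINT x|?M. \<phi> x * v x ^ (k - 1))))"
  proof -
    have "integrable ?M (\<lambda>x. coeff p k * (real k * (\<phi> x * v x ^ (k - 1))))" if "k \<le> degree p" for k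
      using int2[of "k - 1" 1] that by (intro integrable_mult_right) simp
    then show ?thesis
      by (subst Bochner_Integration.integral_sum) (simp_all only: atMost_iff integral_mult_right_zero)
  qed
  finally have eq: "L2_inner \<Omega> (\<lambda>x. poly (pderiv p) (v x)) \<phi>
      = (\<Sum>k\<le>degree p. coeff p k * (real k * (LINT x|?M. \<phi> x * v x ^ (k - 1))))" .
  show "((\<lambda>\<epsilon>. LINT x|?M. poly p (v x + \<epsilon> * \<phi> x)) has_real_derivative
          L2_inner \<Omega> (\<lambda>x. poly (pderiv p) (v x)) \<phi>) (at 0)"
    unfolding expand eq by (rule DERIV_sum, rule DERIV_cmult, rule D)
qed


section \<open>The gradient flow\<close>

text \<open>
  \<open>shift\<close> is the constant \<open>C\<^sub>0\<close>, \<open>lop\<close> the operator \<open>L\<close> with domain \<open>lop_dom\<close>.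
  \<open>adm\<close> is the class of admissible functions: those on which \<open>F\<^sub>1\<close> and \<open>W\<close> are evaluated. It is left
  as a parameter, subject to \<open>F\<^sub>1\<close> and \<open>W\<close> being well-defined on it, because \<open>F(v)\<close> need not be
  integrable and \<open>F'(v)\<close> need not be square-integrable for every \<open>v \<in> L\<^sup>2(\<Omega>)\<close>.
\<close>

record 'a sav_problem =
  region :: "'a set"
  lop_dom :: "('a \<Rightarrow> real) set"
  lop :: "('a \<Rightarrow> real) \<Rightarrow> 'a \<Rightarrow> real"
  potential :: "real poly"
  shift :: real
  adm :: "('a \<Rightarrow> real) set"

definition F1 :: "('a::euclidean_space) sav_problem \<Rightarrow> ('a \<Rightarrow> real) \<Rightarrow> real" where
  "F1 P v = (LINT x|lebesgue_on (region P). poly (potential P) (v x))"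

definition W :: "('a::euclidean_space) sav_problem \<Rightarrow> ('a \<Rightarrow> real) \<Rightarrow> 'a \<Rightarrow> real" where
  "W P v = (\<lambda>x. variational_derivative (region P) (F1 P) v x / sqrt (F1 P v + shift P))"

definition sav_setting :: "('a::euclidean_space) sav_problem \<Rightarrow> bool" where
  "sav_setting P \<longleftrightarrow>
     open (region P) \<and> connected (region P) \<and> bounded (region P) \<and> region P \<noteq> {} \<and>
     nonneg_selfadjoint_operator (region P) (lop_dom P) (lop P) \<and>
     elliptic_operator (region P) (lop_dom P) (lop P) \<and>
     adm P \<subseteq> L2 (region P) \<and>
     (\<forall>v\<in>adm P.
        integrable (lebesgue_on (region P)) (\<lambda>x. poly (potential P) (v x)) \<and>
        (\<exists>g\<in>L2 (region P). is_variational_derivative (region P) (F1 P) v g) \<and>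
        0 < F1 P v + shift P)"

definition W_locally_lipschitz :: "('a::euclidean_space) sav_problem \<Rightarrow> bool" where
  "W_locally_lipschitz P \<longleftrightarrow>
     (\<forall>R. \<exists>LR. \<forall>v\<in>adm P. \<forall>w\<in>adm P.
        L2_norm (region P) v \<le> R \<and> L2_norm (region P) w \<le> R \<longrightarrow>
        L2_norm (region P) (\<lambda>x. W P v x - W P w x) \<le> LR * L2_norm (region P) (\<lambda>x. v x - w x))"

text \<open>
  An exact solution is given together with its time derivatives: \<open>du j t\<close> and \<open>dz j t\<close> are the
  \<open>j\<close>-th derivatives of \<open>u\<close> and \<open>z\<close> at time \<open>t\<close> (\<open>du 0 = u\<close>, \<open>dz 0 = z\<close>), one-sided at end points
  of the time interval \<open>J\<close>. Time derivatives of \<open>u\<close> are those of an \<open>L\<^sup>2(\<Omega>)\<close>-valued function; this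
  covers classical solutions with bounded continuous derivatives in \<open>t\<close>.
\<close>

definition exact_solution ::
    "('a::euclidean_space) sav_problem \<Rightarrow> real set \<Rightarrow>
     (nat \<Rightarrow> real \<Rightarrow> 'a \<Rightarrow> real) \<Rightarrow> (nat \<Rightarrow> real \<Rightarrow> real) \<Rightarrow> bool" where
  "exact_solution P J du dz \<longleftrightarrow>
     (\<forall>t\<in>J.
        du 0 t \<in> lop_dom P \<and> du 0 t \<in> adm P \<and> du 1 t \<in> L2 (region P) \<and>
        has_L2_derivative (region P) J (du 0) (du 1 t) t \<and>
        (dz 0 has_real_derivative dz 1 t) (at t within J) \<and>
        eqL2 (region P) (du 1 t) (\<lambda>x. - (lop P (du 0 t) x + dz 0 t * W P (du 0 t) x)) \<and>
        dz 1 t = 1 / 2 * L2_inner (region P) (W P (du 0 t)) (du 1 t) \<and>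
        dz 0 t = sqrt (F1 P (du 0 t) + shift P))"

definition smooth_bounded_solution ::
    "('a::euclidean_space) sav_problem \<Rightarrow> real set \<Rightarrow> nat \<Rightarrow>
     (nat \<Rightarrow> real \<Rightarrow> 'a \<Rightarrow> real) \<Rightarrow> (nat \<Rightarrow> real \<Rightarrow> real) \<Rightarrow> bool" where
  "smooth_bounded_solution P J m du dz \<longleftrightarrow>
     (\<forall>j\<le>m. (\<forall>t\<in>J. du j t \<in> L2 (region P)) \<and>
        L2_continuous (region P) J (du j) \<and> continuous_on J (dz j) \<and>
        (\<exists>B. \<forall>t\<in>J. L2_norm (region P) (du j t) \<le> B \<and> \<bar>dz j t\<bar> \<le> B)) \<and>
     (\<forall>j<m. \<forall>t\<in>J.
        has_L2_derivative (region P) J (du j) (du (Suc j) t) t \<and>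
        (dz j has_real_derivative dz (Suc j) t) (at t within J))"


section \<open>General linear time discretizations\<close>

record ('s::finite, 'r::finite) gltd =
  D11 :: "real^'s^'s"
  D12 :: "real^'r^'s"
  D21 :: "real^'s^'r"
  D22 :: "real^'r^'r"
  absc :: "real^'s"
  wdeg :: nat
  wvec :: "nat \<Rightarrow> real^'r"

text \<open>Consistency refers to the vector with index 1, so \<open>wdeg \<ge> 1\<close>.\<close>

definition gltd_consistent :: "('s::finite, 'r::finite) gltd \<Rightarrow> bool" where
  "gltd_consistent M \<longleftrightarrow>
     1 \<le> wdeg M \<and>
     D12 M *v wvec M 0 = 1 \<and>
     D22 M *v wvec M 0 = wvec M 0 \<and>
     D21 M *v 1 + D22 M *v wvec M 1 = wvec M 0 + wvec M 1 \<and>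
     D11 M *v 1 + D12 M *v wvec M 1 = absc M"

definition positive_definite :: "real^'n^'n \<Rightarrow> bool" where
  "positive_definite A \<longleftrightarrow> transpose A = A \<and> (\<forall>x. x \<noteq> 0 \<longrightarrow> 0 < x \<bullet> (A *v x))"

definition nonneg_definite :: "real^'n^'n \<Rightarrow> bool" where
  "nonneg_definite A \<longleftrightarrow> transpose A = A \<and> (\<forall>x. 0 \<le> x \<bullet> (A *v x))"

definition diagonal :: "real^'n^'n \<Rightarrow> bool" where
  "diagonal A \<longleftrightarrow> (\<forall>i j. i \<noteq> j \<longrightarrow> A $ i $ j = 0)"

definition block_matrix ::
    "real^'r^'r \<Rightarrow> real^'s^'r \<Rightarrow> real^'r^'s \<Rightarrow> real^'s^'s \<Rightarrow> real^('r + 's)^('r + 's)" where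
  "block_matrix A B C E =
     (\<chi> i j. case i of
        Inl k \<Rightarrow> (case j of Inl l \<Rightarrow> A $ k $ l | Inr l \<Rightarrow> B $ k $ l)
      | Inr k \<Rightarrow> (case j of Inl l \<Rightarrow> C $ k $ l | Inr l \<Rightarrow> E $ k $ l))"

definition algebraically_stable :: "('s::finite, 'r::finite) gltd \<Rightarrow> bool" where
  "algebraically_stable M \<longleftrightarrow>
     (\<exists>(G :: real^'r^'r) (H :: real^'s^'s).
        positive_definite G \<and> diagonal H \<and> nonneg_definite H \<and>
        nonneg_definite (block_matrix
          (G - transpose (D22 M) ** G ** D22 M)
          (transpose (D12 M) ** H - transpose (D22 M) ** G ** D21 M)
          (H ** D12 M - transpose (D21 M) ** G ** D22 M)
          (transpose (D11 M) ** H + H ** D11 M - transpose (D21 M) ** G ** D21 M)))"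

definition diagonally_stable :: "('s::finite, 'r::finite) gltd \<Rightarrow> bool" where
  "diagonally_stable M \<longleftrightarrow>
     (\<exists>H :: real^'s^'s. diagonal H \<and> positive_definite H \<and>
        positive_definite (H ** D11 M + transpose (D11 M) ** H))"

text \<open>
  The exact external quantity \<open>u\<^sub>i = \<Sum>\<^sub>j w\<^sub>i\<^sub>j \<tau>\<^sup>j u\<^sup>(\<^sup>j\<^sup>)\<close>, given the sequence \<open>d\<close> of derivatives of \<open>u\<close> at
  the time in question.
\<close>

definition external_value ::
    "('s::finite, 'r::finite) gltd \<Rightarrow> real \<Rightarrow> (nat \<Rightarrow> real) \<Rightarrow> 'r \<Rightarrow> real" where
  "external_value M \<tau> d i = (\<Sum>j\<le>wdeg M. wvec M j $ i * \<tau> ^ j * d j)"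

definition stage_time :: "('s::finite, 'r::finite) gltd \<Rightarrow> real \<Rightarrow> nat \<Rightarrow> 's \<Rightarrow> real" where
  "stage_time M \<tau> n i = real n * \<tau> + absc M $ i * \<tau>"

definition smooth_real :: "(real \<Rightarrow> real) \<Rightarrow> bool" where
  "smooth_real g \<longleftrightarrow> (\<forall>k t. (deriv ^^ k) g differentiable (at t))"

text \<open>
  Order conditions are required for scalar smooth \<open>g\<close> and with constants uniform over the grid
  points of every bounded time interval \<open>[0, T]\<close>. In the next definition \<open>ghat \<tau> n i\<close> is the value
  at \<open>t\<^sub>n = n \<tau>\<close> of the \<open>i\<close>-th modified external quantity, and the three estimates bound
  its distance from the original one and the two residuals.
\<close>

definition has_generalized_stage_order :: "('s::finite, 'r::finite) gltd \<Rightarrow> nat \<Rightarrow> bool" where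
  "has_generalized_stage_order M q \<longleftrightarrow>
     (\<forall>g. smooth_real g \<longrightarrow> (\<forall>T>0.
       \<exists>ghat :: real \<Rightarrow> nat \<Rightarrow> 'r \<Rightarrow> real. \<exists>C. \<exists>\<tau>\<^sub>0>0. \<forall>\<tau>. 0 < \<tau> \<and> \<tau> < \<tau>\<^sub>0 \<longrightarrow>
         (\<forall>n. real n * \<tau> \<le> T \<longrightarrow>
           (\<forall>i. \<bar>external_value M \<tau> (\<lambda>k. (deriv ^^ k) g (real n * \<tau>)) i - ghat \<tau> n i\<bar> \<le> C * \<tau> ^ q) \<and>
           (\<forall>i. \<bar>g (stage_time M \<tau> n i)
                 - (\<tau> * (\<Sum>j\<in>UNIV. D11 M $ i $ j * deriv g (stage_time M \<tau> n j))
                    + (\<Sum>j\<in>UNIV. D12 M $ i $ j * ghat \<tau> n j))\<bar> \<le> C * \<tau> ^ (q + 1)) \<and>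
           (\<forall>i. \<bar>ghat \<tau> (n + 1) i
                 - (\<tau> * (\<Sum>j\<in>UNIV. D21 M $ i $ j * deriv g (stage_time M \<tau> n j))
                    + (\<Sum>j\<in>UNIV. D22 M $ i $ j * ghat \<tau> n j))\<bar> \<le> C * \<tau> ^ (q + 1)))))"

definition generalized_stage_order :: "('s::finite, 'r::finite) gltd \<Rightarrow> nat \<Rightarrow> bool" where
  "generalized_stage_order M q \<longleftrightarrow>
     has_generalized_stage_order M q \<and> (\<forall>q'. has_generalized_stage_order M q' \<longrightarrow> q' \<le> q)"

text \<open>
  The extrapolated value for stage \<open>i\<close> combines the stage values of step \<open>n - 1\<close> with weights
  \<open>\<alpha> $ i $ j\<close> and the external values of step \<open>n\<close> with weights \<open>\<beta> $ i $ j\<close>; \<open>S\<close> and \<open>R\<close> select the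
  \<open>\<nu>\<close> values that are used.
\<close>

definition extrapolation ::
    "('s::finite, 'r::finite) gltd \<Rightarrow> nat \<Rightarrow> real^'s^'s \<Rightarrow> real^'r^'s \<Rightarrow> bool" where
  "extrapolation M \<nu> \<alpha> \<beta> \<longleftrightarrow>
     1 \<le> \<nu> \<and> \<nu> \<le> CARD('s) + CARD('r) \<and>
     (\<forall>i. \<exists>S R. card S + card R = \<nu> \<and>
        (\<forall>j. j \<notin> S \<longrightarrow> \<alpha> $ i $ j = 0) \<and> (\<forall>j. j \<notin> R \<longrightarrow> \<beta> $ i $ j = 0)) \<and>
     (\<forall>g. smooth_real g \<longrightarrow> (\<forall>T>0. \<exists>C. \<exists>\<tau>\<^sub>0>0. \<forall>\<tau>. 0 < \<tau> \<and> \<tau> < \<tau>\<^sub>0 \<longrightarrow>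
        (\<forall>n i. 1 \<le> n \<and> real n * \<tau> \<le> T \<longrightarrow>
           \<bar>g (stage_time M \<tau> n i)
             - ((\<Sum>j\<in>UNIV. \<alpha> $ i $ j * g (stage_time M \<tau> (n - 1) j))
                + (\<Sum>j\<in>UNIV. \<beta> $ i $ j *
                     external_value M \<tau> (\<lambda>k. (deriv ^^ k) g (real n * \<tau>)) j))\<bar> \<le> C * \<tau> ^ \<nu>)))"


section \<open>The SAV-GL scheme\<close>

text \<open>
  Below, \<open>U n i\<close>, \<open>Z n i\<close> are the stage values and \<open>v n i\<close>, \<open>y n i\<close> the external values
  \<open>u\<^sub>i\<^sup>[\<^sup>n\<^sup>]\<close>, \<open>z\<^sub>i\<^sup>[\<^sup>n\<^sup>]\<close> of the numerical solution.
\<close>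

definition Ubar ::
    "real^'s^'s \<Rightarrow> real^'r^'s \<Rightarrow> (nat \<Rightarrow> 's \<Rightarrow> 'a \<Rightarrow> real) \<Rightarrow> (nat \<Rightarrow> 'r \<Rightarrow> 'a \<Rightarrow> real) \<Rightarrow>
     nat \<Rightarrow> 's \<Rightarrow> 'a \<Rightarrow> real" where
  "Ubar \<alpha> \<beta> U v n i =
     (\<lambda>x. (\<Sum>j\<in>UNIV. \<alpha> $ i $ j * U (n - 1) j x) + (\<Sum>j\<in>UNIV. \<beta> $ i $ j * v n j x))"

definition Udot ::
    "('a::euclidean_space) sav_problem \<Rightarrow> real^'s^'s \<Rightarrow> real^'r^'s \<Rightarrow>
     (nat \<Rightarrow> 's \<Rightarrow> 'a \<Rightarrow> real) \<Rightarrow> (nat \<Rightarrow> 's \<Rightarrow> real) \<Rightarrow> (nat \<Rightarrow> 'r \<Rightarrow> 'a \<Rightarrow> real) \<Rightarrow>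
     nat \<Rightarrow> 's \<Rightarrow> 'a \<Rightarrow> real" where
  "Udot P \<alpha> \<beta> U Z v n i = (\<lambda>x. - (lop P (U n i) x + Z n i * W P (Ubar \<alpha> \<beta> U v n i) x))"

definition Zdot ::
    "('a::euclidean_space) sav_problem \<Rightarrow> real^'s^'s \<Rightarrow> real^'r^'s \<Rightarrow>
     (nat \<Rightarrow> 's \<Rightarrow> 'a \<Rightarrow> real) \<Rightarrow> (nat \<Rightarrow> 's \<Rightarrow> real) \<Rightarrow> (nat \<Rightarrow> 'r \<Rightarrow> 'a \<Rightarrow> real) \<Rightarrow>
     nat \<Rightarrow> 's \<Rightarrow> real" where
  "Zdot P \<alpha> \<beta> U Z v n i =
     1 / 2 * L2_inner (region P) (W P (Ubar \<alpha> \<beta> U v n i)) (Udot P \<alpha> \<beta> U Z v n i)"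

text \<open>
  The starting values are \<open>U 0\<close>, \<open>Z 0\<close>, \<open>v 1\<close>, \<open>y 1\<close>; the steps are those with \<open>1 \<le> n \<le> K - 1\<close>.
  The membership requirements are what is needed for \<open>lop P (U n i)\<close> and \<open>W P (Ubar \<dots>)\<close> to be
  defined.
\<close>

definition sav_gl_solution ::
    "('s::finite, 'r::finite) gltd \<Rightarrow> real^'s^'s \<Rightarrow> real^'r^'s \<Rightarrow> ('a::euclidean_space) sav_problem \<Rightarrow>
     real \<Rightarrow> nat \<Rightarrow>
     (nat \<Rightarrow> 's \<Rightarrow> 'a \<Rightarrow> real) \<Rightarrow> (nat \<Rightarrow> 's \<Rightarrow> real) \<Rightarrow>
     (nat \<Rightarrow> 'r \<Rightarrow> 'a \<Rightarrow> real) \<Rightarrow> (nat \<Rightarrow> 'r \<Rightarrow> real) \<Rightarrow> bool" where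
  "sav_gl_solution M \<alpha> \<beta> P \<tau> K U Z v y \<longleftrightarrow>
     (\<forall>i. U 0 i \<in> L2 (region P)) \<and> (\<forall>i. v 1 i \<in> L2 (region P)) \<and>
     (\<forall>n. 1 \<le> n \<and> n \<le> K - 1 \<longrightarrow>
        (\<forall>i. U n i \<in> lop_dom P \<and> Ubar \<alpha> \<beta> U v n i \<in> adm P) \<and>
        (\<forall>i. eqL2 (region P) (U n i)
           (\<lambda>x. \<tau> * (\<Sum>j\<in>UNIV. D11 M $ i $ j * Udot P \<alpha> \<beta> U Z v n j x)
                + (\<Sum>j\<in>UNIV. D12 M $ i $ j * v n j x))) \<and>
        (\<forall>i. Z n i =
           \<tau> * (\<Sum>j\<in>UNIV. D11 M $ i $ j * Zdot P \<alpha> \<beta> U Z v n j)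
           + (\<Sum>j\<in>UNIV. D12 M $ i $ j * y n j)) \<and>
        (\<forall>i. eqL2 (region P) (v (n + 1) i)
           (\<lambda>x. \<tau> * (\<Sum>j\<in>UNIV. D21 M $ i $ j * Udot P \<alpha> \<beta> U Z v n j x)
                + (\<Sum>j\<in>UNIV. D22 M $ i $ j * v n j x))) \<and>
        (\<forall>i. y (n + 1) i =
           \<tau> * (\<Sum>j\<in>UNIV. D21 M $ i $ j * Zdot P \<alpha> \<beta> U Z v n j)
           + (\<Sum>j\<in>UNIV. D22 M $ i $ j * y n j)))"

definition stage_err_u ::
    "('s::finite, 'r::finite) gltd \<Rightarrow> real \<Rightarrow> (nat \<Rightarrow> real \<Rightarrow> 'a \<Rightarrow> real) \<Rightarrow>
     (nat \<Rightarrow> 's \<Rightarrow> 'a \<Rightarrow> real) \<Rightarrow> nat \<Rightarrow> 's \<Rightarrow> 'a \<Rightarrow> real" where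
  "stage_err_u M \<tau> du U n i = (\<lambda>x. du 0 (stage_time M \<tau> n i) x - U n i x)"

definition stage_err_z ::
    "('s::finite, 'r::finite) gltd \<Rightarrow> real \<Rightarrow> (nat \<Rightarrow> real \<Rightarrow> real) \<Rightarrow>
     (nat \<Rightarrow> 's \<Rightarrow> real) \<Rightarrow> nat \<Rightarrow> 's \<Rightarrow> real" where
  "stage_err_z M \<tau> dz Z n i = dz 0 (stage_time M \<tau> n i) - Z n i"

definition ext_err_u ::
    "('s::finite, 'r::finite) gltd \<Rightarrow> real \<Rightarrow> (nat \<Rightarrow> real \<Rightarrow> 'a \<Rightarrow> real) \<Rightarrow>
     (nat \<Rightarrow> 'r \<Rightarrow> 'a \<Rightarrow> real) \<Rightarrow> nat \<Rightarrow> 'r \<Rightarrow> 'a \<Rightarrow> real" where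
  "ext_err_u M \<tau> du v n i = (\<lambda>x. external_value M \<tau> (\<lambda>k. du k (real n * \<tau>) x) i - v n i x)"

definition ext_err_z ::
    "('s::finite, 'r::finite) gltd \<Rightarrow> real \<Rightarrow> (nat \<Rightarrow> real \<Rightarrow> real) \<Rightarrow>
     (nat \<Rightarrow> 'r \<Rightarrow> real) \<Rightarrow> nat \<Rightarrow> 'r \<Rightarrow> real" where
  "ext_err_z M \<tau> dz y n i = external_value M \<tau> (\<lambda>k. dz k (real n * \<tau>)) i - y n i"

end

theory Submission
  imports Defs
begin

text \<open>
  The errors of the scheme satisfy a linear recursion that is perturbed by a locally Lipschitz term.
  Let \<open>E\<close> be the stage errors in \<open>u\<close>, \<open>X = \<tau> (u' - U')\<close> the errors of the stage increments (with
  \<open>U'\<close> the stage derivatives of the scheme), \<open>e\<close> the errors of the external values, and \<open>D\<close>, \<open>Y\<close>,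
  \<open>d\<close> their counterparts for \<open>z\<close>. Then
  \<open>E = D\<^sub>1\<^sub>1 X + D\<^sub>1\<^sub>2 e + \<rho>\<close>, \<open>e\<^sup>+ = D\<^sub>2\<^sub>1 X + D\<^sub>2\<^sub>2 e + \<sigma>\<close> and \<open>X\<^sub>i = - \<tau> (L E\<^sub>i + f\<^sub>i)\<close>, where \<open>f\<close> contains
  the differences of \<open>z W(u)\<close>. A Gram matrix argument (\<open>euclidean_model\<close>) transfers the two
  stability conditions from real vectors to any positive semidefinite form. In the inner product,
  diagonal stability and \<open>L \<ge> 0\<close> bound the stages by \<open>e\<close>, \<open>\<rho>\<close> and \<open>\<tau> f\<close> (\<open>stage_bound\<close>), and
  algebraic stability bounds the growth of the \<open>G\<close>-norm of \<open>e\<close> in a step by a multiple of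
  \<open>\<rho>\<close>, \<open>\<sigma>\<close> and \<open>\<tau> f\<close> (\<open>step_bound\<close>). This is ready for a Gronwall argument.

  The equation for \<open>z\<close> is the difficulty. There \<open>Y\<close> is essentially \<open>1/2 (W, X)\<close>, and since \<open>L\<close> is
  unbounded, \<open>X\<close> is only known to be of the size of the errors, without a factor \<open>\<tau>\<close>; summed over
  \<open>T / \<tau>\<close> steps this loses a power of \<open>\<tau>\<close>. Two devices recover it. First, \<open>d\<close> is replaced by
  \<open>d - 1/2 (W(u(t\<^sub>n)), e)\<close>, because \<open>e\<close> is driven by the same increments: in the recursion
  of this quantity \<open>X\<close> is paired only with the difference of \<open>W\<close> at the extrapolated values and
  at \<open>u(t\<^sub>n)\<close>, which is small (\<open>corrected_step\<close>). Second, \<open>X = X\<^sub>1 + X\<^sub>2\<close>, where \<open>X\<^sub>1\<close> solves the linear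
  recursion with the initial errors and all residuals but \<open>f = 0\<close>, and hence is as small as these data,
  while \<open>X\<^sub>2\<close> starts from zero and has only the source \<open>f\<close> (\<open>splitting\<close>). For \<open>X\<^sub>2\<close> algebraic stability
  can be used in the energy form \<open>(L x, y)\<close>, and it yields
  \<open>\<Sum> h\<^sub>i \<parallel>X\<^sub>2\<^sub>,\<^sub>i\<parallel>\<^sup>2 \<le> 4 \<tau>\<^sup>2 \<Sum> h\<^sub>i \<parallel>f\<^sub>i\<parallel>\<^sup>2\<close>, which is the missing factor \<open>\<tau>\<close> in quadratic mean. The weights \<open>h\<^sub>i\<close>
  may vanish, but then so does the corresponding column of \<open>D\<^sub>2\<^sub>1\<close>. Gronwall's lemma for the squares
  of the errors closes the estimate as long as the extrapolated values stay close to the exact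
  solution, and the estimate itself guarantees this for the next step (\<open>error_bound\<close>).

  The powers of \<open>\<tau>\<close> come from Taylor expansion. Applied to monomials, the definition of the
  generalized stage order forces algebraic conditions on the coefficients. For exponents below \<open>q\<close>
  they follow by comparing powers of \<open>\<tau>\<close>; for the exponent \<open>q\<close> the functions in the definition are
  determined only up to terms of order \<open>\<tau>\<^sup>q\<close>, and an average over the time steps provides a
  time-independent choice (\<open>top_order_condition\<close>). Conversely, these conditions give residuals
  of order \<open>\<tau>\<^sup>q\<^sup>+\<^sup>1\<close> for functions with values in a Hilbert space, if \<open>e\<close> is measured against
  modified external values that differ from \<open>u\<^sub>i(t\<^sub>n)\<close> by terms of order \<open>\<tau>\<^sup>q\<close>. Consistency yields
  \<open>q \<ge> 1\<close>, so the errors tend to zero with \<open>\<tau>\<close> and the bootstrap above can start.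

  Finally, functions on \<open>\<Omega>\<close> become elements of a complete inner product space by continuation by
  zero and identification up to null sets; the operator \<open>L\<close> is continued by zero to the functions
  that vanish on \<open>\<Omega>\<close> (\<open>selfadjoint_extension\<close>).
\<close>

section \<open>Real quadratic inequalities in semidefinite forms\<close>

text \<open>
  The Kronecker product \<open>A \<otimes> I\<close>: a method with real coefficients acts on vectors whose entries are
  functions.
\<close>

definition mact :: "real^'n^'m \<Rightarrow> ('h::real_vector)^'n \<Rightarrow> 'h^'m" (infixr "\<star>" 75) where
  "A \<star> x = (\<chi> i. \<Sum>j\<in>UNIV. A $ i $ j *\<^sub>R x $ j)"

lemma mact_nth [simp]: "(A \<star> x) $ i = (\<Sum>j\<in>UNIV. A $ i $ j *\<^sub>R x $ j)"
  by (simp add: mact_def)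

lemma mact_real: "A \<star> x = A *v (x :: real^'n)"
  by (simp add: vec_eq_iff matrix_vector_mult_def)

lemma mact_add: "A \<star> (x + y) = A \<star> x + A \<star> y"
  by (simp add: vec_eq_iff scaleR_add_right sum.distrib)

lemma mact_diff: "A \<star> (x - y) = A \<star> x - A \<star> y"
  by (simp add: vec_eq_iff scaleR_diff_right sum_subtractf)

lemma mact_scaleR: "A \<star> (c *\<^sub>R x) = c *\<^sub>R (A \<star> x)"
  by (simp add: vec_eq_iff scaleR_sum_right mult.commute)

lemma mact_zero [simp]: "A \<star> 0 = 0"
  by (simp add: vec_eq_iff)

lemma mact_mat1 [simp]: "mat 1 \<star> x = x"
  by (simp add: vec_eq_iff mat_def if_distrib[where f="\<lambda>c. c *\<^sub>R _"] cong: if_cong)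

lemma mact_mult: "(A ** B) \<star> x = A \<star> (B \<star> x)"
proof -
  have "(\<Sum>j\<in>UNIV. (\<Sum>k\<in>UNIV. A $ i $ k * B $ k $ j) *\<^sub>R x $ j)
      = (\<Sum>k\<in>UNIV. A $ i $ k *\<^sub>R (\<Sum>j\<in>UNIV. B $ k $ j *\<^sub>R x $ j))" for i
    by (simp add: scaleR_sum_left scaleR_sum_right) (rule sum.swap)
  then show ?thesis by (simp add: vec_eq_iff matrix_matrix_mult_def)
qed

lemma mact_in_subspace:
  assumes "subspace V" "\<And>j. x $ j \<in> V"
  shows "(A \<star> x) $ i \<in> V"
  using assms by (simp add: subspace_sum subspace_scale)

lemma mact_linear_image:
  assumes "linear g"
  shows "(\<chi> i. g ((A \<star> x) $ i)) = A \<star> (\<chi> i. g (x $ i))"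
  by (simp add: vec_eq_iff linear_sum[OF assms] linear_scale[OF assms])

lemma norm_vec_le_sum: "norm (x :: 'h::real_normed_vector^'n) \<le> (\<Sum>i\<in>UNIV. norm (x $ i))"
  unfolding norm_vec_def by (rule L2_set_le_sum) simp

lemma norm_vec_le_const:
  assumes "\<And>i. norm ((x :: 'h::real_normed_vector^'n) $ i) \<le> c"
  shows "norm x \<le> real CARD('n) * c"
  using norm_vec_le_sum[of x] sum_mono[of UNIV "\<lambda>i. norm (x $ i)" "\<lambda>_. c"] assms by simp

lemma mact_bounded:
  "\<exists>K>0. \<forall>x :: 'h::real_normed_vector^'n. norm (A \<star> x) \<le> K * norm x"
proof (intro exI conjI allI)
  let ?K = "1 + (\<Sum>i\<in>UNIV. \<Sum>j\<in>UNIV. \<bar>A $ i $ j\<bar>)"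
  show "?K > 0" by (simp add: add_pos_nonneg sum_nonneg)
  fix x :: "'h^'n"
  have "norm (A \<star> x) \<le> (\<Sum>i\<in>UNIV. norm (\<Sum>j\<in>UNIV. A $ i $ j *\<^sub>R x $ j))"
    using norm_vec_le_sum[of "A \<star> x"] by simp
  also have "\<dots> \<le> (\<Sum>i\<in>UNIV. \<Sum>j\<in>UNIV. \<bar>A $ i $ j\<bar> * norm x)"
  proof (intro sum_mono sum_norm_le)
    fix i j
    show "norm (A $ i $ j *\<^sub>R x $ j) \<le> \<bar>A $ i $ j\<bar> * norm x"
      by (simp add: mult_left_mono Finite_Cartesian_Product.norm_nth_le)
  qed
  also have "\<dots> \<le> ?K * norm x"
    by (simp add: sum_distrib_right[symmetric] mult_right_mono)
  finally show "norm (A \<star> x) \<le> ?K * norm x" .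
qed

text \<open>
  Induction on the index set splits off one square, as in a Cholesky step. A pivot \<open>m a a\<close> may vanish;
  then the whole row vanishes, because otherwise the form would be linear and not constant in \<open>x a\<close>
  and would take negative values.
\<close>

lemma psd_gram_factor:
  fixes m :: "'i \<Rightarrow> 'i \<Rightarrow> real"
  assumes "finite I" "\<And>i j. m i j = m j i"
    and "\<And>x. 0 \<le> (\<Sum>i\<in>I. \<Sum>j\<in>I. m i j * x i * x j)"
  shows "\<exists>c. \<forall>i\<in>I. \<forall>j\<in>I. m i j = (\<Sum>k\<in>I. c k i * c k j)"
  using assms
proof (induction I arbitrary: m rule: finite_induct)
  case empty
  then show ?case by simp
next
  case (insert a I)
  note sym = insert.prems(1) and psd = insert.prems(2)
  have expand: "(\<Sum>i\<in>insert a I. \<Sum>j\<in>insert a I. m i j * x i * x j)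
      = m a a * x a * x a + 2 * x a * (\<Sum>j\<in>I. m a j * x j) + (\<Sum>i\<in>I. \<Sum>j\<in>I. m i j * x i * x j)" for x
  proof -
    have "(\<Sum>i\<in>I. m i a * x i * x a) = x a * (\<Sum>j\<in>I. m a j * x j)"
      by (simp add: sum_distrib_left mult_ac sym[of _ a])
    moreover have "(\<Sum>j\<in>I. m a j * x a * x j) = x a * (\<Sum>j\<in>I. m a j * x j)"
      by (simp add: sum_distrib_left mult_ac)
    ultimately show ?thesis
      using insert.hyps by (simp add: sum.distrib algebra_simps)
  qed
  have upd: "(\<Sum>j\<in>I. m a j * (x(a:=t)) j) = (\<Sum>j\<in>I. m a j * x j)"
    "(\<Sum>i\<in>I. \<Sum>j\<in>I. m i j * (x(a:=t)) i * (x(a:=t)) j) = (\<Sum>i\<in>I. \<Sum>j\<in>I. m i j * x i * x j)" for x t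
    using insert.hyps by (auto intro!: sum.cong)
  have quad: "0 \<le> m a a * t\<^sup>2 + 2 * t * (\<Sum>j\<in>I. m a j * x j) + (\<Sum>i\<in>I. \<Sum>j\<in>I. m i j * x i * x j)" for x t
    using psd[of "x(a:=t)"] unfolding expand upd by (simp add: power2_eq_square mult_ac)
  have "m a a \<ge> 0" using quad[of 1 "\<lambda>_. 0"] by simp
  define p where "p = sqrt (m a a)"
  define b where "b i = m a i / p" for i
  have p2: "p * p = m a a" using \<open>m a a \<ge> 0\<close> by (simp add: p_def)
  have row: "m a i = p * b i" if "i \<in> I" for i
  proof (cases "m a a = 0")
    case True
    have "m a i = 0"
    proof (rule ccontr)
      assume ne: "m a i \<noteq> 0"
      have s: "(\<Sum>j\<in>I. m a j * (if j = i then 1 else 0)) = m a i"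
        using that insert.hyps by (simp add: if_distrib[where f="\<lambda>c. _ * c"] cong: if_cong)
      define w where "w = (\<Sum>j\<in>I. \<Sum>k\<in>I. m j k * (if j = i then 1 else 0) * (if k = i then 1 else 0))"
      have "0 \<le> 2 * t * m a i + w" for t
        using quad[of t "\<lambda>j. if j = i then 1 else 0"] True s by (simp add: w_def)
      from this[of "- (\<bar>w\<bar> + 1) / (2 * m a i)"]
      have "0 \<le> (- (2 * \<bar>w\<bar>) - 2) / 2 + w" using ne by simp
      then have "\<bar>w\<bar> + 1 \<le> w" by (simp add: field_simps)
      then show False by simp
    qed
    then show ?thesis by (simp add: b_def)
  next
    case False
    then have "p \<noteq> 0" using p2 by auto
    then show ?thesis by (simp add: b_def)
  qed
  define m' where "m' i j = m i j - b i * b j" for i j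
  have "0 \<le> (\<Sum>i\<in>I. \<Sum>j\<in>I. m' i j * x i * x j)" for x
  proof -
    let ?B = "\<Sum>i\<in>I. b i * x i"
    have 1: "(\<Sum>i\<in>I. \<Sum>j\<in>I. m' i j * x i * x j) = (\<Sum>i\<in>I. \<Sum>j\<in>I. m i j * x i * x j) - ?B\<^sup>2"
      by (simp add: m'_def algebra_simps sum_subtractf power2_eq_square sum_product)
    have 2: "(\<Sum>j\<in>I. m a j * x j) = p * ?B"
      by (simp add: sum_distrib_left row mult.assoc cong: sum.cong)
    show ?thesis
    proof (cases "p = 0")
      case True
      then have "?B = 0" by (simp add: b_def)
      then show ?thesis using quad[of 0 x] 1 by simp
    next
      case False
      have "0 \<le> m a a * (- ?B / p)\<^sup>2 + 2 * (- ?B / p) * (p * ?B) + (\<Sum>i\<in>I. \<Sum>j\<in>I. m i j * x i * x j)"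
        using quad[of "- ?B / p" x] unfolding 2 .
      then show ?thesis unfolding 1 using False p2[symmetric]
        by (simp add: power2_eq_square field_simps)
    qed
  qed
  moreover have "m' i j = m' j i" for i j by (simp add: m'_def sym[of i j] mult.commute)
  ultimately obtain c where c: "\<And>i j. i \<in> I \<Longrightarrow> j \<in> I \<Longrightarrow> m' i j = (\<Sum>k\<in>I. c k i * c k j)"
    using insert.IH[of m'] by blast
  define c' where "c' k i = (if k = a then (if i = a then p else b i) else (if i = a then 0 else c k i))" for k i
  have "m i j = (\<Sum>k\<in>insert a I. c' k i * c' k j)" if "i \<in> insert a I" "j \<in> insert a I" for i j
  proof -
    have s: "(\<Sum>k\<in>insert a I. c' k i * c' k j) = c' a i * c' a j + (\<Sum>k\<in>I. c' k i * c' k j)"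
      using insert.hyps by simp
    have s': "(\<Sum>k\<in>I. c' k i * c' k j) = (if i = a \<or> j = a then 0 else (\<Sum>k\<in>I. c k i * c k j))"
      using insert.hyps by (auto simp: c'_def intro!: sum.neutral sum.cong)
    show ?thesis
    proof (cases "i = a \<or> j = a")
      case True
      then show ?thesis using that row[of i] row[of j] sym[of i j] p2 unfolding s s'
        by (auto simp: c'_def mult.commute)
    next
      case False
      then show ?thesis using that c[of i j] unfolding s s' by (simp add: c'_def m'_def)
    qed
  qed
  then show ?case by blast
qed

text \<open>
  The form is defined on a subspace only, because it stands for the inner product as well as for the
  energy form \<open>(L x, y)\<close> on the domain of an unbounded operator.
\<close>

locale psd_form =
  fixes V :: "'h::real_vector set" and B :: "'h \<Rightarrow> 'h \<Rightarrow> real"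
  assumes subspace: "subspace V"
    and sym: "x \<in> V \<Longrightarrow> y \<in> V \<Longrightarrow> B x y = B y x"
    and add: "x \<in> V \<Longrightarrow> y \<in> V \<Longrightarrow> z \<in> V \<Longrightarrow> B (x + y) z = B x z + B y z"
    and scale: "x \<in> V \<Longrightarrow> z \<in> V \<Longrightarrow> B (r *\<^sub>R x) z = r * B x z"
    and nonneg: "x \<in> V \<Longrightarrow> 0 \<le> B x x"
begin

lemma zero: "z \<in> V \<Longrightarrow> B 0 z = 0"
  using scale[of z z 0] by simp

lemma sum_left:
  assumes "finite I" "\<And>i. i \<in> I \<Longrightarrow> x i \<in> V" "z \<in> V"
  shows "B (\<Sum>i\<in>I. x i) z = (\<Sum>i\<in>I. B (x i) z)"
  using assms(1,2)
proof (induction I rule: finite_induct)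
  case (insert i I)
  then show ?case using add[of "x i" "sum x I" z] assms(3) subspace_sum[OF subspace, of I x] by simp
qed (simp add: zero assms)

lemma comb:
  assumes "\<And>a. \<xi> a \<in> V"
  shows "B (\<Sum>a\<in>UNIV. d a *\<^sub>R \<xi> a) (\<Sum>b\<in>UNIV. e b *\<^sub>R \<xi> b)
       = (\<Sum>a\<in>UNIV. \<Sum>b\<in>UNIV. d a * e b * B (\<xi> a) (\<xi> (b :: 'n::finite)))"
proof -
  have V: "(\<Sum>b\<in>UNIV. e b *\<^sub>R \<xi> b) \<in> V" for e :: "'n \<Rightarrow> real"
    by (intro subspace_sum[OF subspace] subspace_scale[OF subspace] assms)
  have V': "r *\<^sub>R \<xi> b \<in> V" for r b by (intro subspace_scale[OF subspace] assms)
  have "B (\<Sum>a\<in>UNIV. d a *\<^sub>R \<xi> a) (\<Sum>b\<in>UNIV. e b *\<^sub>R \<xi> b)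
      = (\<Sum>a\<in>UNIV. d a * B (\<xi> a) (\<Sum>b\<in>UNIV. e b *\<^sub>R \<xi> b))"
    by (simp add: sum_left V V' scale assms)
  moreover have "B (\<xi> a) (\<Sum>b\<in>UNIV. e b *\<^sub>R \<xi> b) = (\<Sum>b\<in>UNIV. e b * B (\<xi> a) (\<xi> b))" for a
  proof -
    have "B (\<xi> a) (\<Sum>b\<in>UNIV. e b *\<^sub>R \<xi> b) = B (\<Sum>b\<in>UNIV. e b *\<^sub>R \<xi> b) (\<xi> a)"
      by (rule sym[OF assms V])
    also have "\<dots> = (\<Sum>b\<in>UNIV. e b * B (\<xi> b) (\<xi> a))"
      by (simp add: V' sum_left scale assms)
    finally show ?thesis by (simp add: sym[OF assms assms, of _ a])
  qed
  ultimately show ?thesis by (simp add: sum_distrib_left mult.assoc)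
qed

text \<open>
  Finitely many vectors have a Euclidean model: the Gram matrix of the vectors is non-negative
  definite and hence a sum of squares \<open>\<Sum>\<^sub>k c\<^sub>k c\<^sub>k\<^sup>T\<close>. The numbers \<open>c\<^sub>k\<close> are coordinates
  in which \<open>B\<close> is the dot product, so that a quadratic inequality with real coefficients that holds
  for all real vectors holds for \<open>B\<close> as well.
\<close>

lemma euclidean_model:
  fixes x :: "'h^'r::finite" and y :: "'h^'s::finite"
  assumes x: "\<And>i. x $ i \<in> V" and y: "\<And>i. y $ i \<in> V"
  shows "\<exists>(c :: 'r + 's \<Rightarrow> real^'r) (d :: 'r + 's \<Rightarrow> real^'s).
    \<forall>(P :: real^'r) (Q :: real^'s) P' Q'.
      B ((\<Sum>j\<in>UNIV. P $ j *\<^sub>R x $ j) + (\<Sum>j\<in>UNIV. Q $ j *\<^sub>R y $ j))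
        ((\<Sum>j\<in>UNIV. P' $ j *\<^sub>R x $ j) + (\<Sum>j\<in>UNIV. Q' $ j *\<^sub>R y $ j))
      = (\<Sum>k\<in>UNIV. (P \<bullet> c k + Q \<bullet> d k) * (P' \<bullet> c k + Q' \<bullet> d k))"
proof -
  define \<xi> where "\<xi> = case_sum (($) x) (($) y)"
  have \<xi>: "\<xi> a \<in> V" for a using x y by (cases a) (auto simp: \<xi>_def)
  have split: "(\<Sum>a\<in>(UNIV :: ('r + 's) set). g a) = (\<Sum>i\<in>UNIV. g (Inl i)) + (\<Sum>i\<in>UNIV. g (Inr i))"
    for g :: "'r + 's \<Rightarrow> 'b::comm_monoid_add"
    unfolding UNIV_sum by (subst sum.union_disjoint) (auto simp: sum.reindex)
  have "0 \<le> (\<Sum>a\<in>UNIV. \<Sum>b\<in>UNIV. B (\<xi> a) (\<xi> b) * t a * t b)" for t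
  proof -
    have "(\<Sum>a\<in>UNIV. t a *\<^sub>R \<xi> a) \<in> V"
      by (intro subspace_sum[OF subspace] subspace_scale[OF subspace] \<xi>)
    from nonneg[OF this] show ?thesis by (simp add: comb \<xi> mult_ac)
  qed
  then have "\<exists>c. \<forall>a\<in>UNIV. \<forall>b\<in>UNIV. B (\<xi> a) (\<xi> b) = (\<Sum>k\<in>(UNIV :: ('r + 's) set). c k a * c k b)"
    by (intro psd_gram_factor[of UNIV "\<lambda>a b. B (\<xi> a) (\<xi> b)"]) (simp_all add: sym \<xi>)
  then obtain c where c: "B (\<xi> a) (\<xi> b) = (\<Sum>k\<in>(UNIV :: ('r + 's) set). c k a * c k b)" for a b by auto
  have *: "B (\<Sum>a\<in>UNIV. d a *\<^sub>R \<xi> a) (\<Sum>b\<in>UNIV. e b *\<^sub>R \<xi> b)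
      = (\<Sum>k\<in>UNIV. (\<Sum>a\<in>UNIV. d a * c k a) * (\<Sum>b\<in>UNIV. e b * c k b))" for d e
  proof -
    have "(\<Sum>k\<in>UNIV. (\<Sum>a\<in>UNIV. d a * c k a) * (\<Sum>b\<in>UNIV. e b * c k b))
        = (\<Sum>k\<in>UNIV. \<Sum>a\<in>UNIV. \<Sum>b\<in>UNIV. d a * e b * (c k a * c k b))"
      by (simp add: sum_product mult_ac)
    also have "\<dots> = (\<Sum>a\<in>UNIV. \<Sum>k\<in>UNIV. \<Sum>b\<in>UNIV. d a * e b * (c k a * c k b))"
      by (rule sum.swap)
    also have "\<dots> = (\<Sum>a\<in>UNIV. \<Sum>b\<in>UNIV. \<Sum>k\<in>UNIV. d a * e b * (c k a * c k b))"
      by (intro sum.cong refl sum.swap)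
    finally show ?thesis unfolding comb[OF \<xi>] c sum_distrib_left ..
  qed
  show ?thesis
  proof (intro exI allI)
    fix P P' :: "real^'r" and Q Q' :: "real^'s"
    show "B ((\<Sum>j\<in>UNIV. P $ j *\<^sub>R x $ j) + (\<Sum>j\<in>UNIV. Q $ j *\<^sub>R y $ j))
        ((\<Sum>j\<in>UNIV. P' $ j *\<^sub>R x $ j) + (\<Sum>j\<in>UNIV. Q' $ j *\<^sub>R y $ j))
      = (\<Sum>k\<in>UNIV. (P \<bullet> (\<chi> i. c k (Inl i)) + Q \<bullet> (\<chi> i. c k (Inr i)))
           * (P' \<bullet> (\<chi> i. c k (Inl i)) + Q' \<bullet> (\<chi> i. c k (Inr i))))"
      using *[of "case_sum (($) P) (($) Q)" "case_sum (($) P') (($) Q')"]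
      unfolding split by (simp add: \<xi>_def inner_vec_def)
  qed
qed

end

lemma psd_form_inner: "psd_form UNIV (inner :: 'h::real_inner \<Rightarrow> 'h \<Rightarrow> real)"
  by unfold_locales (simp_all add: inner_commute inner_add_right)

section \<open>Solvability of the linear stage equations\<close>

text \<open>
  A minimizing sequence for the distance of \<open>b\<close> to \<open>R\<close> is a Cauchy sequence by the parallelogram
  law, and \<open>b\<close> minus its limit is orthogonal to \<open>R\<close> and not zero.
\<close>

lemma orthogonal_of_not_dense:
  fixes R :: "'h::{real_inner,complete_space} set"
  assumes R: "subspace R" and b: "b \<notin> closure R"
  shows "\<exists>p. p \<noteq> 0 \<and> (\<forall>s\<in>R. p \<bullet> s = 0)"
proof -
  have ne: "R \<noteq> {}" using R subspace_0 by blast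
  define d where "d = infdist b R"
  have d: "d \<le> norm (b - r)" if "r \<in> R" for r
    using infdist_le[OF that, of b] by (simp add: d_def dist_norm)
  have "d \<ge> 0" by (simp add: d_def infdist_nonneg)
  have "\<exists>r\<in>R. (norm (b - r))\<^sup>2 < d\<^sup>2 + inverse (real (Suc k))" for k
  proof -
    have "d < sqrt (d\<^sup>2 + inverse (real (Suc k)))"
      using \<open>d \<ge> 0\<close> by (intro real_less_rsqrt) simp
    then obtain r where "r \<in> R" "dist b r < sqrt (d\<^sup>2 + inverse (real (Suc k)))"
      using ne unfolding d_def infdist_notempty[OF ne]
      by (subst (asm) cINF_less_iff) (auto intro: bdd_belowI[where m=0])
    moreover from this have "(norm (b - r))\<^sup>2 < (sqrt (d\<^sup>2 + inverse (real (Suc k))))\<^sup>2"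
      by (intro power_strict_mono) (auto simp: dist_norm)
    ultimately show ?thesis by (auto simp: add_nonneg_pos intro!: bexI[of _ r])
  qed
  then obtain r where r: "\<And>k. r k \<in> R" "\<And>k. (norm (b - r k))\<^sup>2 < d\<^sup>2 + inverse (real (Suc k))"
    by metis
  have par: "(norm (r k - r l))\<^sup>2 \<le> 2 * inverse (real (Suc k)) + 2 * inverse (real (Suc l))" for k l
  proof -
    have "(1/2) *\<^sub>R (r k + r l) \<in> R" using R r by (simp add: subspace_add subspace_scale)
    then have "d\<^sup>2 \<le> (norm (b - (1/2) *\<^sub>R (r k + r l)))\<^sup>2"
      using d \<open>d \<ge> 0\<close> by (intro power_mono) auto
    moreover have "(norm (r k - r l))\<^sup>2 + 4 * (norm (b - (1/2) *\<^sub>R (r k + r l)))\<^sup>2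
        = 2 * (norm (b - r k))\<^sup>2 + 2 * (norm (b - r l))\<^sup>2"
      by (simp add: power2_norm_eq_inner inner_simps inner_commute field_simps)
    ultimately show ?thesis using r(2)[of k] r(2)[of l] by linarith
  qed
  have "Cauchy r"
  proof (rule metric_CauchyI)
    fix e :: real assume "e > 0"
    then obtain N where N: "inverse (real (Suc N)) < e\<^sup>2 / 4" using reals_Archimedean[of "e\<^sup>2/4"] by auto
    have "dist (r k) (r l) < e" if "N \<le> k" "N \<le> l" for k l
    proof -
      have "inverse (real (Suc k)) \<le> inverse (real (Suc N))" "inverse (real (Suc l)) \<le> inverse (real (Suc N))"
        using that by (auto intro: le_imp_inverse_le)
      then have "(norm (r k - r l))\<^sup>2 < e\<^sup>2" using par[of k l] N by linarith
      then show ?thesis using \<open>e > 0\<close> by (auto simp: dist_norm intro: power_less_imp_less_base)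
    qed
    then show "\<exists>N. \<forall>k\<ge>N. \<forall>l\<ge>N. dist (r k) (r l) < e" by blast
  qed
  then obtain r0 where lim: "r \<longlonglongrightarrow> r0" by (auto simp: Cauchy_convergent_iff convergent_def)
  define p where "p = b - r0"
  have "(\<lambda>k. (norm (b - r k))\<^sup>2) \<longlonglongrightarrow> (norm p)\<^sup>2"
    unfolding p_def by (intro tendsto_intros lim)
  moreover have "(\<lambda>k. d\<^sup>2 + inverse (real (Suc k))) \<longlonglongrightarrow> d\<^sup>2 + 0"
    by (intro tendsto_intros LIMSEQ_inverse_real_of_nat)
  ultimately have "(norm p)\<^sup>2 \<le> d\<^sup>2 + 0"
    by (rule LIMSEQ_le) (use r(2) less_imp_le in blast)
  then have pd: "(norm p)\<^sup>2 \<le> d\<^sup>2" by simp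
  have min: "(norm p)\<^sup>2 \<le> (norm (p - s))\<^sup>2" if "s \<in> R" for s
  proof -
    have "(\<lambda>k. (norm (b - (r k + s)))\<^sup>2) \<longlonglongrightarrow> (norm (b - (r0 + s)))\<^sup>2"
      by (intro tendsto_intros lim)
    moreover have "d\<^sup>2 \<le> (norm (b - (r k + s)))\<^sup>2" for k
      using d[of "r k + s"] \<open>d \<ge> 0\<close> R r that by (intro power_mono) (auto simp: subspace_add)
    ultimately have "d\<^sup>2 \<le> (norm (b - (r0 + s)))\<^sup>2" by (auto intro: LIMSEQ_le_const)
    moreover have "b - (r0 + s) = p - s" by (simp add: p_def)
    ultimately show ?thesis using pd by (metis order_trans)
  qed
  have "p \<bullet> s = 0" if "s \<in> R" for s
  proof (cases "s = 0")
    case False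
    define t where "t = (p \<bullet> s) / (s \<bullet> s)"
    have "t *\<^sub>R s \<in> R" using R that by (simp add: subspace_scale)
    from min[OF this] have "0 \<le> t * (t * (s \<bullet> s)) - 2 * (t * (p \<bullet> s))"
      by (simp add: power2_norm_eq_inner inner_simps inner_commute)
    also have "t * (s \<bullet> s) = p \<bullet> s" using False by (simp add: t_def)
    finally have "(p \<bullet> s)\<^sup>2 / (s \<bullet> s) \<le> 0" by (simp add: t_def power2_eq_square)
    then show ?thesis using False
      by (simp add: divide_le_0_iff) (metis inner_gt_zero_iff linorder_not_le power2_less_0 power_eq_0_iff zero_less_power2)
  qed simp
  moreover have "p \<noteq> 0"
    using b lim r(1) by (auto simp: p_def closure_sequential)
  ultimately show ?thesis by blast
qed

text \<open>
  The last assumption is self-adjointness: the adjoint of \<open>L\<close> does not extend \<open>L\<close> properly. Below it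
  shows that limits of approximate solutions, and vectors orthogonal to the range, lie in the domain.
\<close>

locale nonneg_selfadjoint =
  fixes D :: "'h::{real_inner,complete_space} set" and L :: "'h \<Rightarrow> 'h"
  assumes domain: "subspace D"
    and L_add: "x \<in> D \<Longrightarrow> y \<in> D \<Longrightarrow> L (x + y) = L x + L y"
    and L_scale: "x \<in> D \<Longrightarrow> L (r *\<^sub>R x) = r *\<^sub>R L x"
    and symmetric: "x \<in> D \<Longrightarrow> y \<in> D \<Longrightarrow> L x \<bullet> y = x \<bullet> L y"
    and L_nonneg: "x \<in> D \<Longrightarrow> 0 \<le> L x \<bullet> x"
    and adjoint: "(\<And>w. w \<in> D \<Longrightarrow> L w \<bullet> v = w \<bullet> g) \<Longrightarrow> v \<in> D \<and> L v = g"
begin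

lemma L_diff: "x \<in> D \<Longrightarrow> y \<in> D \<Longrightarrow> L (x - y) = L x - L y"
  using L_add[of x "- y"] L_scale[of y "- 1"] subspace_neg[OF domain, of y] by simp

lemma energy_form: "psd_form D (\<lambda>x y. L x \<bullet> y)"
proof
  fix x y assume "x \<in> D" "y \<in> D"
  then show "L x \<bullet> y = L y \<bullet> x" by (simp add: symmetric inner_commute[of "L y"])
qed (simp_all add: domain L_add L_scale L_nonneg inner_add_left)

end

text \<open>
  The Euclidean model of the entries of \<open>x\<close> writes both sides as sums over \<open>k\<close> of the same expressions
  in real vectors \<open>c\<^sub>k\<close>.
\<close>

lemma lift_coercive:
  fixes A :: "real^'s^'s" and x :: "'h::real_inner^'s" and h :: "real^'s"
  assumes "\<And>y :: real^'s. \<kappa> * (norm y)\<^sup>2 \<le> (\<Sum>i\<in>UNIV. h $ i * (y $ i * (A *v y) $ i))"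
  shows "\<kappa> * (norm x)\<^sup>2 \<le> (\<Sum>i\<in>UNIV. h $ i * (x $ i \<bullet> (A \<star> x) $ i))"
proof -
  interpret psd_form UNIV "inner :: 'h \<Rightarrow> 'h \<Rightarrow> real" by (rule psd_form_inner)
  from euclidean_model[of x x] obtain c d :: "'s + 's \<Rightarrow> real^'s" where
    c: "\<And>P Q P' Q'. ((\<Sum>j\<in>UNIV. P $ j *\<^sub>R x $ j) + (\<Sum>j\<in>UNIV. Q $ j *\<^sub>R x $ j))
        \<bullet> ((\<Sum>j\<in>UNIV. P' $ j *\<^sub>R x $ j) + (\<Sum>j\<in>UNIV. Q' $ j *\<^sub>R x $ j))
      = (\<Sum>k\<in>UNIV. (P \<bullet> c k + Q \<bullet> d k) * (P' \<bullet> c k + Q' \<bullet> d k))" by auto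
  have id: "(\<Sum>j\<in>UNIV. axis i 1 $ j *\<^sub>R x $ j) = x $ i" for i
    by (simp add: axis_def if_distrib[where f="\<lambda>c. c *\<^sub>R _"] cong: if_cong)
  have 1: "x $ i \<bullet> x $ i = (\<Sum>k\<in>UNIV. (c k $ i)\<^sup>2)" for i
    using c[of "axis i 1" 0 "axis i 1" 0] by (simp add: id inner_axis' power2_eq_square)
  have 2: "x $ i \<bullet> (A \<star> x) $ i = (\<Sum>k\<in>UNIV. c k $ i * (A *v c k) $ i)" for i
    using c[of "axis i 1" 0 "A $ i" 0] by (simp add: id inner_axis' matrix_vector_mul_component)
  have "\<kappa> * (norm x)\<^sup>2 = (\<Sum>k\<in>UNIV. \<kappa> * (norm (c k))\<^sup>2)"
    unfolding power2_norm_eq_inner inner_vec_def 1 sum_distrib_left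
    by (subst sum.swap) (simp add: power2_eq_square)
  also have "\<dots> \<le> (\<Sum>k\<in>UNIV. \<Sum>i\<in>UNIV. h $ i * (c k $ i * (A *v c k) $ i))"
    by (intro sum_mono assms)
  also have "\<dots> = (\<Sum>i\<in>UNIV. h $ i * (x $ i \<bullet> (A \<star> x) $ i))"
    unfolding 2 sum_distrib_left by (rule sum.swap)
  finally show ?thesis .
qed

text \<open>
  The operator \<open>A \<otimes> I + \<tau> L\<close> has closed range, since coercivity and \<open>L \<ge> 0\<close> bound \<open>E\<close> by its
  image. The range is dense: a vector \<open>p\<close> orthogonal to it solves the adjoint equation
  \<open>A\<^sup>T p + \<tau> L p = 0\<close>, and testing the \<open>i\<close>-th component with \<open>p\<^sub>i / h\<^sub>i\<close> shows that coercivity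
  of \<open>A\<close> forces \<open>p = 0\<close>.
\<close>

lemma (in nonneg_selfadjoint) stage_equations_solvable:
  fixes A :: "real^'s^'s" and h :: "real^'s" and b :: "'h^'s"
  assumes h: "\<And>i. 0 < h $ i" and \<kappa>: "0 < \<kappa>" and \<tau>: "0 < \<tau>"
    and coercive: "\<And>y :: real^'s. \<kappa> * (norm y)\<^sup>2 \<le> (\<Sum>i\<in>UNIV. h $ i * (y $ i * (A *v y) $ i))"
  shows "\<exists>E. (\<forall>i. E $ i \<in> D) \<and> A \<star> E + \<tau> *\<^sub>R (\<chi> i. L (E $ i)) = b"
proof -
  define T where "T E = A \<star> E + \<tau> *\<^sub>R (\<chi> i. L (E $ i))" for E :: "'h^'s"
  define DD where "DD = {E :: 'h^'s. \<forall>i. E $ i \<in> D}"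
  have DD: "subspace DD"
    using domain by (auto simp: DD_def subspace_def)
  have T_add: "T (x + y) = T x + T y" if "x \<in> DD" "y \<in> DD" for x y
    using that by (auto simp: T_def DD_def mact_add L_add vec_eq_iff algebra_simps sum.distrib)
  have T_scale: "T (r *\<^sub>R x) = r *\<^sub>R T x" if "x \<in> DD" for x r
    using that by (auto simp: T_def DD_def mact_scaleR L_scale vec_eq_iff scaleR_add_right mult.commute scaleR_sum_right)
  have T_diff: "T (x - y) = T x - T y" if "x \<in> DD" "y \<in> DD" for x y
    using T_add[of x "- y"] T_scale[of y "- 1"] that subspace_neg[OF DD, of y] by simp
  have range: "subspace (T ` DD)"
  proof (rule subspaceI)
    have "T 0 = 0" using T_scale[of 0 0] subspace_0[OF DD] by simp
    then show "0 \<in> T ` DD" using subspace_0[OF DD] by (metis imageI)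
    show "x + y \<in> T ` DD" if "x \<in> T ` DD" "y \<in> T ` DD" for x y
      using that T_add subspace_add[OF DD] by (metis (no_types, lifting) imageE imageI)
    show "c *\<^sub>R x \<in> T ` DD" if "x \<in> T ` DD" for x c
      using that T_scale subspace_scale[OF DD] by (metis (no_types, lifting) imageE imageI)
  qed
  define H where "H = (\<Sum>i\<in>UNIV. h $ i)"
  have H: "H > 0" unfolding H_def by (intro sum_pos h) auto
  have bound: "\<kappa> * norm E \<le> H * norm (T E)" if E: "E \<in> DD" for E
  proof (cases "E = 0")
    case False
    have "\<kappa> * (norm E)\<^sup>2 \<le> (\<Sum>i\<in>UNIV. h $ i * (E $ i \<bullet> (A \<star> E) $ i))"
      by (rule lift_coercive[OF coercive])
    also have "\<dots> \<le> (\<Sum>i\<in>UNIV. h $ i * (norm E * norm (T E)))"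
    proof (intro sum_mono mult_left_mono less_imp_le[OF h])
      fix i
      have "0 \<le> \<tau> * (L (E $ i) \<bullet> E $ i)" using E \<tau> by (simp add: DD_def L_nonneg)
      then have "E $ i \<bullet> (A \<star> E) $ i \<le> E $ i \<bullet> T E $ i"
        by (simp add: T_def inner_add_right inner_commute del: mact_nth)
      also have "\<dots> \<le> norm (E $ i) * norm (T E $ i)" by (rule norm_cauchy_schwarz)
      also have "\<dots> \<le> norm E * norm (T E)"
        by (intro mult_mono Finite_Cartesian_Product.norm_nth_le) auto
      finally show "E $ i \<bullet> (A \<star> E) $ i \<le> norm E * norm (T E)" .
    qed
    also have "\<dots> = H * norm (T E) * norm E" by (simp add: H_def sum_distrib_right[symmetric])
    finally show ?thesis using False by (simp add: power2_eq_square)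
  qed (use H in simp)
  have dense: "b \<in> closure (T ` DD)"
  proof (rule ccontr)
    assume "b \<notin> closure (T ` DD)"
    from orthogonal_of_not_dense[OF range this] obtain p where
      p: "p \<noteq> 0" "\<And>E. E \<in> DD \<Longrightarrow> p \<bullet> T E = 0" by auto
    have adj: "p $ i \<in> D \<and> L (p $ i) = - (1 / \<tau>) *\<^sub>R (transpose A \<star> p) $ i" for i
    proof (rule adjoint)
      fix w assume w: "w \<in> D"
      have L0: "L 0 = 0" using L_scale[of w 0] w by simp
      \<comment> \<open>testing with a vector that has a single nonzero entry isolates the \<open>i\<close>-th component\<close>
      define E where "E = (\<chi> j. if j = i then w else 0)"
      have "E \<in> DD" using w subspace_0[OF domain] by (simp add: DD_def E_def)
      then have "0 = p \<bullet> T E" using p by simp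
      also have "T E = (\<chi> k. A $ k $ i *\<^sub>R w + (if k = i then \<tau> *\<^sub>R L w else 0))"
        by (simp add: T_def E_def vec_eq_iff L0 if_distrib[where f="\<lambda>c. _ *\<^sub>R c"] if_distrib[where f=L] cong: if_cong)
      also have "p \<bullet> \<dots> = (\<Sum>k\<in>UNIV. A $ k $ i * (p $ k \<bullet> w)) + \<tau> * (p $ i \<bullet> L w)"
        by (simp add: inner_vec_def inner_add_right sum.distrib if_distrib[where f="\<lambda>c. inner _ c"] cong: if_cong)
      finally have "L w \<bullet> p $ i = - (1 / \<tau>) * (\<Sum>k\<in>UNIV. A $ k $ i * (p $ k \<bullet> w))"
        using \<tau> by (simp add: field_simps inner_commute)
      then show "L w \<bullet> p $ i = w \<bullet> (- (1 / \<tau>) *\<^sub>R (transpose A \<star> p) $ i)"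
        by (simp only: inner_scaleR_right mact_nth transpose_def vec_lambda_beta inner_sum_right
            vector_scaleR_component) (simp add: inner_commute[of w])
    qed
    define q where "q = (\<chi> i. (1 / h $ i) *\<^sub>R p $ i)"
    have pq: "p $ i = h $ i *\<^sub>R q $ i" for i using h[of i] by (simp add: q_def)
    have "0 \<le> (\<Sum>i\<in>UNIV. (1 / h $ i) * (\<tau> * (L (p $ i) \<bullet> p $ i)))"
      using adj h \<tau> by (intro sum_nonneg mult_nonneg_nonneg L_nonneg) (auto intro: less_imp_le)
    also have "\<dots> = - (\<Sum>i\<in>UNIV. (transpose A \<star> p) $ i \<bullet> q $ i)"
      using \<tau> by (simp add: adj q_def sum_negf del: mact_nth)
    also have "(\<Sum>i\<in>UNIV. (transpose A \<star> p) $ i \<bullet> q $ i) = (\<Sum>i\<in>UNIV. \<Sum>j\<in>UNIV. A $ j $ i * (p $ j \<bullet> q $ i))"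
      by (simp add: transpose_def inner_sum_left)
    also have "\<dots> = (\<Sum>j\<in>UNIV. \<Sum>i\<in>UNIV. A $ j $ i * (p $ j \<bullet> q $ i))" by (rule sum.swap)
    also have "\<dots> = (\<Sum>j\<in>UNIV. h $ j * (q $ j \<bullet> (A \<star> q) $ j))"
      by (simp add: pq inner_sum_right sum_distrib_left mult_ac)
    finally have "\<kappa> * (norm q)\<^sup>2 \<le> 0" using lift_coercive[OF coercive, of q] by linarith
    then have "q = 0" using \<kappa> by (simp add: mult_le_0_iff)
    then have "p = 0" by (simp add: vec_eq_iff pq)
    then show False using p by simp
  qed
  then obtain y where y: "\<And>k. y k \<in> T ` DD" and ylim: "y \<longlonglongrightarrow> b"
    by (auto simp: closure_sequential)
  have "\<forall>k. \<exists>e. e \<in> DD \<and> y k = T e" using y by auto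
  from choice[OF this] obtain E where E: "\<And>k. E k \<in> DD" and yE: "\<And>k. y k = T (E k)" by auto
  have TE: "(\<lambda>k. T (E k)) \<longlonglongrightarrow> b" using ylim unfolding yE .
  have "Cauchy E"
  proof (rule metric_CauchyI)
    fix e :: real assume e: "e > 0"
    from LIMSEQ_imp_Cauchy[OF TE] obtain N where
      N: "\<And>k l. k \<ge> N \<Longrightarrow> l \<ge> N \<Longrightarrow> dist (T (E k)) (T (E l)) < e * \<kappa> / H"
      using e H \<kappa> by (force simp: Cauchy_def dest: spec[of _ "e * \<kappa> / H"])
    have "dist (E k) (E l) < e" if "k \<ge> N" "l \<ge> N" for k l
    proof -
      have "\<kappa> * norm (E k - E l) \<le> H * norm (T (E k) - T (E l))"
        using bound[of "E k - E l"] T_diff E subspace_diff[OF DD] by simp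
      also have "\<dots> < H * (e * \<kappa> / H)"
        using N[OF that] H by (intro mult_strict_left_mono) (auto simp: dist_norm)
      finally show ?thesis using H \<kappa> by (simp add: dist_norm mult.commute)
    qed
    then show "\<exists>N. \<forall>k\<ge>N. \<forall>l\<ge>N. dist (E k) (E l) < e" by blast
  qed
  then obtain E0 where E0: "E \<longlonglongrightarrow> E0" by (auto simp: Cauchy_convergent_iff convergent_def)
  have lim: "E0 $ i \<in> D \<and> L (E0 $ i) = (1 / \<tau>) *\<^sub>R ((b - A \<star> E0) $ i)" for i
  proof (rule adjoint)
    fix w assume w: "w \<in> D"
    have 1: "(\<lambda>k. L w \<bullet> E k $ i) \<longlonglongrightarrow> L w \<bullet> E0 $ i" by (intro tendsto_intros E0)
    have "L w \<bullet> E k $ i = w \<bullet> ((1 / \<tau>) *\<^sub>R ((T (E k) - A \<star> E k) $ i))" for k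
      using E[of k] w \<tau> by (simp add: DD_def T_def symmetric)
    moreover have "(\<lambda>k. w \<bullet> ((1 / \<tau>) *\<^sub>R ((T (E k) - A \<star> E k) $ i)))
        \<longlonglongrightarrow> w \<bullet> ((1 / \<tau>) *\<^sub>R ((b - A \<star> E0) $ i))"
      unfolding mact_nth vector_minus_component by (intro tendsto_intros E0 TE)
    ultimately have "(\<lambda>k. L w \<bullet> E k $ i) \<longlonglongrightarrow> w \<bullet> ((1 / \<tau>) *\<^sub>R ((b - A \<star> E0) $ i))" by simp
    then show "L w \<bullet> E0 $ i = w \<bullet> ((1 / \<tau>) *\<^sub>R ((b - A \<star> E0) $ i))"
      by (rule LIMSEQ_unique[OF 1])
  qed
  show ?thesis
  proof (intro exI conjI allI)
    show "E0 $ i \<in> D" for i using lim by simp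
    show "A \<star> E0 + \<tau> *\<^sub>R (\<chi> i. L (E0 $ i)) = b"
      using \<tau> by (simp add: vec_eq_iff lim del: mact_nth)
  qed
qed

section \<open>Stability of the linear recursion\<close>

text \<open>
  Algebraic and diagonal stability in the form in which they are used. The matrix \<open>G\<close> is factored as
  \<open>Cg\<^sup>T Cg\<close>, so that \<open>\<parallel>Cg x\<parallel>\<close> is the \<open>G\<close>-norm, \<open>Ci\<close> is a left inverse of \<open>Cg\<close>, and the block matrix of
  algebraic stability becomes a statement about the growth of the \<open>G\<close>-norm in a step with
  stage increments \<open>y\<close> and external values \<open>x\<close>. Diagonal stability appears as the coercivity of
  \<open>Ai = A11\<^sup>-\<^sup>1\<close> with the weights \<open>hh\<close>.
\<close>

locale stable_method =
  fixes A11 :: "real^'s::finite^'s" and A12 :: "real^'r::finite^'s"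
    and A21 :: "real^'s^'r" and A22 :: "real^'r^'r"
    and Cg Ci :: "real^'r^'r" and h :: "real^'s"
    and Ai :: "real^'s^'s" and hh :: "real^'s" and \<kappa> :: real
  assumes h_nonneg: "0 \<le> h $ i"
    and algebraic: "(norm (Cg *v (A21 *v y + A22 *v x)))\<^sup>2
        \<le> (norm (Cg *v x))\<^sup>2 + 2 * (\<Sum>i\<in>UNIV. h $ i * (y $ i * (A11 *v y + A12 *v x) $ i))"
    and Ci: "Ci ** Cg = mat 1"
    and Ai: "Ai ** A11 = mat 1" "A11 ** Ai = mat 1"
    and hh_pos: "0 < hh $ i" and \<kappa>_pos: "0 < \<kappa>"
    and coercive: "\<kappa> * (norm z)\<^sup>2 \<le> (\<Sum>i\<in>UNIV. hh $ i * (z $ i * (Ai *v z) $ i))"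
begin

text \<open>
  In the inner product this inequality gives the stability of the recursion, in the energy form
  \<open>(L x, y)\<close> it gives a bound for the increments.
\<close>

lemma lift_algebraic:
  fixes x :: "'h::real_vector^'r" and y :: "'h^'s"
  assumes "psd_form V B" "\<And>i. x $ i \<in> V" "\<And>i. y $ i \<in> V"
  shows "(\<Sum>i\<in>UNIV. B ((Cg \<star> (A21 \<star> y + A22 \<star> x)) $ i) ((Cg \<star> (A21 \<star> y + A22 \<star> x)) $ i))
      \<le> (\<Sum>i\<in>UNIV. B ((Cg \<star> x) $ i) ((Cg \<star> x) $ i))
        + 2 * (\<Sum>i\<in>UNIV. h $ i * B (y $ i) ((A11 \<star> y + A12 \<star> x) $ i))"
proof -
  interpret psd_form V B by fact
  from euclidean_model[of x y] assms obtain c :: "'r + 's \<Rightarrow> real^'r" and d :: "'r + 's \<Rightarrow> real^'s" where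
    model: "\<And>P Q P' Q'. B ((\<Sum>j\<in>UNIV. P $ j *\<^sub>R x $ j) + (\<Sum>j\<in>UNIV. Q $ j *\<^sub>R y $ j))
        ((\<Sum>j\<in>UNIV. P' $ j *\<^sub>R x $ j) + (\<Sum>j\<in>UNIV. Q' $ j *\<^sub>R y $ j))
      = (\<Sum>k\<in>UNIV. (P \<bullet> c k + Q \<bullet> d k) * (P' \<bullet> c k + Q' \<bullet> d k))" by auto
  have id: "(\<Sum>j\<in>UNIV. axis i 1 $ j *\<^sub>R y $ j) = y $ i" for i
    by (simp add: axis_def if_distrib[where f="\<lambda>c. c *\<^sub>R _"] cong: if_cong)
  have new: "(Cg \<star> (A21 \<star> y + A22 \<star> x)) $ i
      = (\<Sum>j\<in>UNIV. (Cg ** A22) $ i $ j *\<^sub>R x $ j) + (\<Sum>j\<in>UNIV. (Cg ** A21) $ i $ j *\<^sub>R y $ j)" for i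
    unfolding mact_nth[symmetric] mact_mult mact_add by (simp add: add.commute del: mact_nth)
  have stage: "(A11 \<star> y + A12 \<star> x) $ i
      = (\<Sum>j\<in>UNIV. A12 $ i $ j *\<^sub>R x $ j) + (\<Sum>j\<in>UNIV. A11 $ i $ j *\<^sub>R y $ j)" for i
    by (simp add: add.commute)
  have 1: "B ((Cg \<star> (A21 \<star> y + A22 \<star> x)) $ i) ((Cg \<star> (A21 \<star> y + A22 \<star> x)) $ i)
      = (\<Sum>k\<in>UNIV. ((Cg *v (A21 *v d k + A22 *v c k)) $ i)\<^sup>2)" for i
    unfolding new model
    by (simp add: matrix_vector_mul_component[symmetric] matrix_vector_mul_assoc[symmetric]
        matrix_vector_right_distrib power2_eq_square add.commute)
  have 2: "B ((Cg \<star> x) $ i) ((Cg \<star> x) $ i) = (\<Sum>k\<in>UNIV. ((Cg *v c k) $ i)\<^sup>2)" for i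
    using model[of "Cg $ i" 0 "Cg $ i" 0]
    by (simp add: matrix_vector_mul_component[symmetric] power2_eq_square)
  have 3: "B (y $ i) ((A11 \<star> y + A12 \<star> x) $ i)
      = (\<Sum>k\<in>UNIV. d k $ i * (A11 *v d k + A12 *v c k) $ i)" for i
    using model[of 0 "axis i 1" "A12 $ i" "A11 $ i"] unfolding stage
    by (simp add: id inner_axis' matrix_vector_mul_component[symmetric] add.commute)
  have sq: "(\<Sum>i\<in>UNIV. \<Sum>k\<in>UNIV. (f k $ i)\<^sup>2) = (\<Sum>k\<in>UNIV. (norm (f k))\<^sup>2)" for f :: "'r + 's \<Rightarrow> real^'r"
    unfolding power2_norm_eq_inner inner_vec_def by (subst sum.swap) (simp add: power2_eq_square)
  have "(\<Sum>k\<in>UNIV. (norm (Cg *v (A21 *v d k + A22 *v c k)))\<^sup>2)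
      \<le> (\<Sum>k\<in>UNIV. (norm (Cg *v c k))\<^sup>2 + 2 * (\<Sum>i\<in>UNIV. h $ i * (d k $ i * (A11 *v d k + A12 *v c k) $ i)))"
    by (intro sum_mono algebraic)
  also have "\<dots> = (\<Sum>k\<in>UNIV. (norm (Cg *v c k))\<^sup>2)
      + 2 * (\<Sum>i\<in>UNIV. h $ i * (\<Sum>k\<in>UNIV. d k $ i * (A11 *v d k + A12 *v c k) $ i))"
    unfolding sum.distrib sum_distrib_left by (subst (2) sum.swap) simp
  finally show ?thesis unfolding 1 2 3 sq .
qed

lemma norm_le_gnorm: "\<exists>K>0. \<forall>x :: 'h::real_normed_vector^'r. norm x \<le> K * norm (Cg \<star> x)"
proof -
  obtain K where "K > 0" "\<And>x :: 'h^'r. norm (Ci \<star> x) \<le> K * norm x"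
    using mact_bounded[of Ci, where ?'h='h] by blast
  from this(1) this(2)[of "Cg \<star> _"] show ?thesis
    by (auto simp: mact_mult[symmetric] Ci)
qed

lemma gnorm_A22: "norm (Cg \<star> (A22 \<star> x)) \<le> norm (Cg \<star> (x :: real^'r))"
  using algebraic[of 0 x] by (simp add: mact_real power2_le_iff_abs_le)

text \<open>
  If \<open>h $ j = 0\<close>, then the algebraic inequality with \<open>x = 0\<close> and the \<open>j\<close>-th unit vector as \<open>y\<close>
  shows that the \<open>j\<close>-th column vanishes. Hence bounds for \<open>\<Sum>\<^sub>j h\<^sub>j \<parallel>X\<^sub>j\<parallel>\<^sup>2\<close> control
  everything that the increments contribute to a step.
\<close>

lemma A21_column_bound: "\<exists>K>0. \<forall>i j. \<bar>A21 $ i $ j\<bar> \<le> K * sqrt (h $ j)"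
proof -
  have zero: "A21 $ i $ j = 0" if "h $ j = 0" for i j
  proof -
    have "(norm (Cg *v (A21 *v axis j 1)))\<^sup>2 \<le> 2 * (\<Sum>i\<in>UNIV. h $ i * (axis j 1 $ i * (A11 *v axis j 1) $ i))"
      using algebraic[of "axis j 1" 0] by simp
    also have "(\<Sum>i\<in>UNIV. h $ i * (axis j 1 $ i * (A11 *v axis j 1) $ i)) = 0"
      using that by (intro sum.neutral) (auto simp: axis_def)
    finally have "Cg *v (A21 *v axis j 1) = 0" by simp
    then have "(Ci ** Cg) *v (A21 *v axis j 1) = 0" by (simp add: matrix_vector_mul_assoc[symmetric])
    then have "A21 *v axis j 1 = 0" by (simp add: Ci)
    then show ?thesis by (simp add: matrix_vector_mult_basis column_def vec_eq_iff)
  qed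
  define K where "K = 1 + (\<Sum>i\<in>UNIV. \<Sum>j\<in>UNIV. \<bar>A21 $ i $ j\<bar> / sqrt (h $ j))"
  have "\<bar>A21 $ i $ j\<bar> \<le> K * sqrt (h $ j)" for i j
  proof (cases "h $ j = 0")
    case False
    then have pos: "sqrt (h $ j) > 0" using h_nonneg[of j] by simp
    have nn: "0 \<le> \<bar>A21 $ i $ j\<bar> / sqrt (h $ j)" for i j using h_nonneg[of j] by simp
    have "\<bar>A21 $ i $ j\<bar> / sqrt (h $ j) \<le> (\<Sum>j\<in>UNIV. \<bar>A21 $ i $ j\<bar> / sqrt (h $ j))"
      by (rule member_le_sum) (auto simp: nn)
    also have "\<dots> \<le> (\<Sum>i\<in>UNIV. \<Sum>j\<in>UNIV. \<bar>A21 $ i $ j\<bar> / sqrt (h $ j))"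
      by (rule member_le_sum[where f="\<lambda>i. \<Sum>j\<in>UNIV. \<bar>A21 $ i $ j\<bar> / sqrt (h $ j)"]) (auto intro!: sum_nonneg nn)
    finally have "\<bar>A21 $ i $ j\<bar> / sqrt (h $ j) \<le> K" by (simp add: K_def)
    then show ?thesis using pos by (simp add: field_simps)
  qed (use zero in simp)
  moreover have "K > 0" unfolding K_def using h_nonneg by (intro add_pos_nonneg sum_nonneg) auto
  ultimately show ?thesis by blast
qed

end

locale stable_scheme = nonneg_selfadjoint D L + stable_method A11 A12 A21 A22 Cg Ci h Ai hh \<kappa>
  for D :: "'h::{real_inner,complete_space} set" and L
    and A11 :: "real^'s::finite^'s" and A12 :: "real^'r::finite^'s"
    and A21 :: "real^'s^'r" and A22 :: "real^'r^'r"
    and Cg Ci :: "real^'r^'r" and h :: "real^'s"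
    and Ai :: "real^'s^'s" and hh :: "real^'s" and \<kappa> :: real
begin

text \<open>
  The stages of one step of the linear recursion, with stage values \<open>E\<close>, increments \<open>X\<close>, incoming external
  values \<open>e\<close>, residual \<open>\<rho>\<close> and source \<open>f\<close>.
\<close>

definition stage :: "real \<Rightarrow> 'h^'s \<Rightarrow> 'h^'s \<Rightarrow> 'h^'r \<Rightarrow> 'h^'s \<Rightarrow> 'h^'s \<Rightarrow> bool" where
  "stage \<tau> E X e \<rho> f \<longleftrightarrow> (\<forall>i. E $ i \<in> D \<and> X $ i = - (\<tau> *\<^sub>R (L (E $ i) + f $ i))) \<and>
     E = A11 \<star> X + A12 \<star> e + \<rho>"

lemma stage_increment: "stage \<tau> E X e \<rho> f \<Longrightarrow> X = Ai \<star> (E - (A12 \<star> e + \<rho>))"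
  by (auto simp: stage_def mact_mult[symmetric] Ai)

lemma stage_dissipation:
  assumes "stage \<tau> E X e \<rho> f" "0 \<le> \<tau>"
  shows "E $ i \<bullet> X $ i \<le> \<tau> * norm f * norm E"
proof -
  have E: "E $ i \<in> D" and X: "X $ i = - (\<tau> *\<^sub>R (L (E $ i) + f $ i))"
    using assms(1) unfolding stage_def by blast+
  have "E $ i \<bullet> X $ i = - (\<tau> * (L (E $ i) \<bullet> E $ i)) - \<tau> * (f $ i \<bullet> E $ i)"
    by (simp add: X inner_simps inner_commute algebra_simps)
  also have "\<dots> \<le> \<tau> * (norm (f $ i) * norm (E $ i))"
  proof -
    have "- (f $ i \<bullet> E $ i) \<le> norm (f $ i) * norm (E $ i)"
      using Cauchy_Schwarz_ineq2[of "f $ i" "E $ i"] by linarith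
    then have "\<tau> * - (f $ i \<bullet> E $ i) \<le> \<tau> * (norm (f $ i) * norm (E $ i))"
      by (rule mult_left_mono) fact
    moreover have "0 \<le> \<tau> * (L (E $ i) \<bullet> E $ i)" using L_nonneg[OF E] assms by simp
    ultimately show ?thesis by simp
  qed
  also have "\<dots> \<le> \<tau> * (norm f * norm E)"
    using assms by (intro mult_left_mono mult_mono Finite_Cartesian_Product.norm_nth_le) auto
  finally show ?thesis by (simp add: mult.assoc)
qed

text \<open>
  Since \<open>L \<ge> 0\<close>, the products \<open>E\<^sub>i \<bullet> X\<^sub>i\<close> are nonpositive up to the source, so that coercivity of \<open>A11\<^sup>-\<^sup>1\<close>
  bounds \<open>E\<close> without any bound for \<open>L E\<close>. The increments are then bounded because they are
  a linear combination of \<open>E\<close>, \<open>e\<close> and \<open>\<rho>\<close>.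
\<close>

lemma stage_bound:
  "\<exists>K>0. \<forall>\<tau> E X e \<rho> f. 0 \<le> \<tau> \<longrightarrow> stage \<tau> E X e \<rho> f \<longrightarrow>
     norm E \<le> K * (norm e + norm \<rho> + \<tau> * norm f) \<and> norm X \<le> K * (norm e + norm \<rho> + \<tau> * norm f)"
proof -
  obtain Ka where Ka: "Ka > 0" "\<And>x :: 'h^'s. norm (Ai \<star> x) \<le> Ka * norm x"
    using mact_bounded[of Ai, where ?'h='h] by blast
  obtain Kb where Kb: "Kb > 0" "\<And>x :: 'h^'r. norm (A12 \<star> x) \<le> Kb * norm x"
    using mact_bounded[of A12, where ?'h='h] by blast
  define H where "H = (\<Sum>i\<in>UNIV. hh $ i)"
  have H: "H > 0" unfolding H_def by (intro sum_pos hh_pos) auto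
  define K1 where "K1 = (Ka + 1) * (Kb + 1)"
  have K1: "K1 \<ge> 1" "Ka * Kb \<le> K1" "Ka \<le> K1"
    using Ka Kb by (auto simp: K1_def algebra_simps)
  define KE where "KE = H * K1 / \<kappa>"
  define K where "K = KE + Ka * KE + K1"
  have KE: "KE > 0" using H K1 \<kappa>_pos by (simp add: KE_def)
  have "norm E \<le> K * s \<and> norm X \<le> K * s"
    if \<tau>: "0 \<le> \<tau>" and st: "stage \<tau> E X e \<rho> f" and s: "s = norm e + norm \<rho> + \<tau> * norm f" for \<tau> E X e \<rho> f s
  proof -
    define b where "b = A12 \<star> e + \<rho>"
    have X: "X = Ai \<star> E - Ai \<star> b" using stage_increment[OF st] by (simp add: b_def mact_diff)
    have nf: "0 \<le> \<tau> * norm f" using \<tau> by simp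
    have "s \<ge> 0" using nf s by simp
    have b: "norm b \<le> Kb * norm e + norm \<rho>"
      using norm_triangle_ineq[of "A12 \<star> e" \<rho>] Kb(2)[of e] by (simp add: b_def)
    have Ab: "norm (Ai \<star> b) + \<tau> * norm f \<le> K1 * s"
    proof -
      have "norm (Ai \<star> b) \<le> Ka * (Kb * norm e + norm \<rho>)"
        using Ka(2)[of b] mult_left_mono[OF b, of Ka] Ka(1) by linarith
      also have "\<dots> = (Ka * Kb) * norm e + Ka * norm \<rho>" by (simp add: algebra_simps)
      also have "\<dots> \<le> K1 * norm e + K1 * norm \<rho>"
        using K1 by (intro add_mono mult_right_mono) auto
      moreover have "\<tau> * norm f \<le> K1 * (\<tau> * norm f)" using K1(1) nf by (simp add: mult_le_cancel_right1)
      ultimately show ?thesis by (simp add: s algebra_simps)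
    qed
    have E: "norm E \<le> KE * s"
    proof (cases "E = 0")
      case True
      then show ?thesis using KE \<open>s \<ge> 0\<close> by simp
    next
      case False
      have "\<kappa> * (norm E)\<^sup>2 \<le> (\<Sum>i\<in>UNIV. hh $ i * (E $ i \<bullet> (Ai \<star> E) $ i))"
        by (rule lift_coercive[OF coercive])
      also have "\<dots> \<le> (\<Sum>i\<in>UNIV. hh $ i * (K1 * s * norm E))"
      proof (intro sum_mono mult_left_mono less_imp_le[OF hh_pos])
        fix i
        have "E $ i \<bullet> (Ai \<star> E) $ i = E $ i \<bullet> X $ i + E $ i \<bullet> (Ai \<star> b) $ i"
          by (simp add: X inner_diff_right del: mact_nth)
        also have "\<dots> \<le> \<tau> * norm f * norm E + norm E * norm (Ai \<star> b)"
        proof (rule add_mono[OF stage_dissipation[OF st \<tau>]])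
          have "E $ i \<bullet> (Ai \<star> b) $ i \<le> norm (E $ i) * norm ((Ai \<star> b) $ i)" by (rule norm_cauchy_schwarz)
          also have "\<dots> \<le> norm E * norm (Ai \<star> b)"
            by (intro mult_mono Finite_Cartesian_Product.norm_nth_le) auto
          finally show "E $ i \<bullet> (Ai \<star> b) $ i \<le> norm E * norm (Ai \<star> b)" .
        qed
        also have "\<dots> = (norm (Ai \<star> b) + \<tau> * norm f) * norm E" by (simp add: algebra_simps)
        also have "\<dots> \<le> K1 * s * norm E" by (intro mult_right_mono Ab) auto
        finally show "E $ i \<bullet> (Ai \<star> E) $ i \<le> K1 * s * norm E" .
      qed
      also have "\<dots> = H * K1 * s * norm E" by (simp add: H_def sum_distrib_right[symmetric])
      finally have "\<kappa> * norm E \<le> H * K1 * s" using False by (simp add: power2_eq_square)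
      then show ?thesis using \<kappa>_pos by (simp add: KE_def field_simps)
    qed
    have "norm X \<le> Ka * (KE * s) + K1 * s"
      using norm_triangle_ineq4[of "Ai \<star> E" "Ai \<star> b"] Ka(2)[of E] mult_left_mono[OF E, of Ka] Ab nf Ka(1)
      unfolding X by linarith
    moreover have "0 \<le> Ka * (KE * s)" "0 \<le> K1 * s" "0 \<le> KE * s"
      using Ka(1) KE K1 \<open>s \<ge> 0\<close> by (auto intro!: mult_nonneg_nonneg)
    ultimately show ?thesis using E unfolding K_def by (simp add: algebra_simps)
  qed
  moreover have "K > 0" using KE K1 Ka by (simp add: K_def add_pos_pos)
  ultimately show ?thesis by blast
qed

text \<open>
  Algebraic stability bounds the squared \<open>G\<close>-norm after the step. The perturbations enter it as products
  with the old norm and as squares, so a complete square can be found, and the old norm keeps the factor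
  \<open>1\<close>; thus the bound can be iterated over \<open>T / \<tau>\<close> steps.
\<close>

lemma step_bound:
  "\<exists>K>0. \<forall>\<tau> E X e \<rho> f \<sigma>. 0 \<le> \<tau> \<longrightarrow> stage \<tau> E X e \<rho> f \<longrightarrow>
     norm (Cg \<star> (A21 \<star> X + A22 \<star> e + \<sigma>)) \<le> norm (Cg \<star> e) + K * (norm \<rho> + norm \<sigma> + \<tau> * norm f)"
proof -
  obtain K1 where K1: "K1 > 0" "\<And>\<tau> E X e \<rho> f. 0 \<le> \<tau> \<Longrightarrow> stage \<tau> E X e \<rho> f \<Longrightarrow>
     norm E \<le> K1 * (norm e + norm \<rho> + \<tau> * norm f) \<and> norm X \<le> K1 * (norm e + norm \<rho> + \<tau> * norm f)"
    using stage_bound by blast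
  obtain Kg where Kg: "Kg > 0" "\<And>x :: 'h^'r. norm x \<le> Kg * norm (Cg \<star> x)"
    using norm_le_gnorm by blast
  obtain Kc where Kc: "Kc > 0" "\<And>x :: 'h^'r. norm (Cg \<star> x) \<le> Kc * norm x"
    using mact_bounded[of Cg, where ?'h='h] by blast
  define H where "H = (\<Sum>i\<in>UNIV. h $ i)"
  have H: "H \<ge> 0" unfolding H_def by (intro sum_nonneg h_nonneg)
  define K2 where "K2 = H * K1 * Kg + 2 * H * K1 + 1"
  have HK: "0 \<le> H * K1" "0 \<le> H * K1 * Kg" using H K1 Kg by auto
  have K2: "K2 \<ge> 1" "H * K1 * Kg \<le> K2" using HK by (auto simp: K2_def)
  have K2': "2 * (H * K1) \<le> K2\<^sup>2"
  proof -
    have "2 * (H * K1) \<le> K2" using HK by (simp add: K2_def)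
    also have "K2 \<le> K2\<^sup>2" using K2 by (simp add: power2_eq_square)
    finally show ?thesis .
  qed
  have "norm (Cg \<star> (A21 \<star> X + A22 \<star> e + \<sigma>)) \<le> norm (Cg \<star> e) + (K2 + Kc) * (norm \<rho> + norm \<sigma> + \<tau> * norm f)"
    if \<tau>: "0 \<le> \<tau>" and st: "stage \<tau> E X e \<rho> f" for \<tau> E X e \<rho> f \<sigma>
  proof -
    define \<delta> where "\<delta> = norm \<rho> + \<tau> * norm f"
    define y where "y = norm (Cg \<star> e)"
    define s where "s = norm e + norm \<rho> + \<tau> * norm f"
    have nf: "0 \<le> \<tau> * norm f" using \<tau> by simp
    have \<delta>: "\<delta> \<ge> 0" using nf by (simp add: \<delta>_def)
    have y: "y \<ge> 0" by (simp add: y_def)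
    have s: "s \<le> Kg * y + \<delta>" "0 \<le> s" using Kg(2)[of e] nf by (auto simp: s_def y_def \<delta>_def)
    have EX: "norm E \<le> K1 * s" "norm X \<le> K1 * s" using K1(2)[OF \<tau> st] by (auto simp: s_def)
    have sq: "(\<Sum>i\<in>UNIV. x $ i \<bullet> x $ i) = (norm x)\<^sup>2" for x :: "'h^'r"
      by (simp add: power2_norm_eq_inner inner_vec_def)
    have "(norm (Cg \<star> (A21 \<star> X + A22 \<star> e)))\<^sup>2
        \<le> y\<^sup>2 + 2 * (\<Sum>i\<in>UNIV. h $ i * (X $ i \<bullet> (A11 \<star> X + A12 \<star> e) $ i))"
      using lift_algebraic[OF psd_form_inner, of e X] unfolding sq y_def by simp
    also have "A11 \<star> X + A12 \<star> e = E - \<rho>" using st by (simp add: stage_def)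
    also have "(\<Sum>i\<in>UNIV. h $ i * (X $ i \<bullet> (E - \<rho>) $ i)) \<le> (\<Sum>i\<in>UNIV. h $ i * (K1 * s * \<delta>))"
    proof (intro sum_mono mult_left_mono h_nonneg)
      fix i
      have "X $ i \<bullet> (E - \<rho>) $ i \<le> \<tau> * norm f * norm E + norm X * norm \<rho>"
      proof -
        have "- (X $ i \<bullet> \<rho> $ i) \<le> norm (X $ i) * norm (\<rho> $ i)"
          using Cauchy_Schwarz_ineq2[of "X $ i" "\<rho> $ i"] by linarith
        also have "\<dots> \<le> norm X * norm \<rho>"
          by (intro mult_mono Finite_Cartesian_Product.norm_nth_le) auto
        finally show ?thesis using stage_dissipation[OF st \<tau>, of i] by (simp add: inner_diff_right inner_commute)
      qed
      also have "\<dots> \<le> \<tau> * norm f * (K1 * s) + K1 * s * norm \<rho>"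
        using EX \<tau> by (intro add_mono mult_left_mono mult_right_mono) auto
      also have "\<dots> = K1 * s * \<delta>" by (simp add: \<delta>_def algebra_simps)
      finally show "X $ i \<bullet> (E - \<rho>) $ i \<le> K1 * s * \<delta>" .
    qed
    also have "(\<Sum>i\<in>UNIV. h $ i * (K1 * s * \<delta>)) = (H * K1 * \<delta>) * s"
      by (simp add: H_def sum_distrib_right[symmetric])
    also have "\<dots> \<le> (H * K1 * \<delta>) * (Kg * y + \<delta>)" using s HK \<delta> by (intro mult_left_mono) auto
    also have "y\<^sup>2 + 2 * \<dots> = y\<^sup>2 + 2 * (H * K1 * Kg) * (y * \<delta>) + 2 * (H * K1) * \<delta>\<^sup>2"
      by (simp add: algebra_simps power2_eq_square)
    also have "\<dots> \<le> y\<^sup>2 + 2 * K2 * (y * \<delta>) + K2\<^sup>2 * \<delta>\<^sup>2"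
      using K2 K2' y \<delta> by (intro add_mono mult_right_mono) auto
    also have "\<dots> = (y + K2 * \<delta>)\<^sup>2" by (simp add: algebra_simps power2_eq_square)
    finally have "(norm (Cg \<star> (A21 \<star> X + A22 \<star> e)))\<^sup>2 \<le> (y + K2 * \<delta>)\<^sup>2"
      by simp
    then have "norm (Cg \<star> (A21 \<star> X + A22 \<star> e)) \<le> y + K2 * \<delta>"
      by (rule power2_le_imp_le) (use y \<delta> K2 in simp)
    then have "norm (Cg \<star> (A21 \<star> X + A22 \<star> e + \<sigma>)) \<le> y + K2 * \<delta> + Kc * norm \<sigma>"
      using norm_triangle_ineq[of "Cg \<star> (A21 \<star> X + A22 \<star> e)" "Cg \<star> \<sigma>"] Kc(2)[of \<sigma>] by (simp add: mact_add)
    moreover have "0 \<le> Kc * \<delta>" "0 \<le> K2 * norm \<sigma>" using Kc K2 \<delta> by auto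
    ultimately show ?thesis by (simp add: y_def \<delta>_def algebra_simps)
  qed
  moreover have "K2 + Kc > 0" using K2 Kc by simp
  ultimately show ?thesis by blast
qed

end

section \<open>Splitting the stage increments\<close>

context stable_scheme
begin

definition energy :: "'h^'r \<Rightarrow> real" where
  "energy e = (\<Sum>i\<in>UNIV. L ((Cg \<star> e) $ i) \<bullet> (Cg \<star> e) $ i)"

lemma energy_nonneg: "(\<And>i. e $ i \<in> D) \<Longrightarrow> 0 \<le> energy e"
  unfolding energy_def by (intro sum_nonneg L_nonneg mact_in_subspace domain)

lemma L_zero [simp]: "L 0 = 0"
  using L_scale[of 0 0] subspace_0[OF domain] by simp

text \<open>
  Algebraic stability in the energy form. The symmetry of \<open>L\<close> turns the right-hand side into
  \<open>(X\<^sub>i, L E\<^sub>i) = - \<tau> (\<parallel>L E\<^sub>i\<parallel>\<^sup>2 + (f\<^sub>i, L E\<^sub>i)) \<le> \<tau> \<parallel>f\<^sub>i\<parallel>\<^sup>2 - \<parallel>X\<^sub>i\<parallel>\<^sup>2 / (4 \<tau>)\<close>.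
  The increments must lie in the domain of \<open>L\<close> for this, and they do so because the stages have no
  residual.
\<close>

lemma smoothing_step:
  assumes st: "stage \<tau> E X e 0 f" and \<tau>: "0 < \<tau>" and e: "\<And>i. e $ i \<in> D"
  shows "(A21 \<star> X + A22 \<star> e) $ i \<in> D"
    and "(\<Sum>i\<in>UNIV. h $ i * (norm (X $ i))\<^sup>2) + 2 * \<tau> * energy (A21 \<star> X + A22 \<star> e)
      \<le> 2 * \<tau> * energy e + 4 * \<tau>\<^sup>2 * (\<Sum>i\<in>UNIV. h $ i * (norm (f $ i))\<^sup>2)"
proof -
  have E: "E $ i \<in> D" and Xi: "X $ i = - (\<tau> *\<^sub>R (L (E $ i) + f $ i))" for i
    using st unfolding stage_def by blast+
  have EA: "A11 \<star> X + A12 \<star> e = E" using st unfolding stage_def by simp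
  have X: "X $ i \<in> D" for i
    unfolding stage_increment[OF st]
    by (intro mact_in_subspace[OF domain]) (auto intro!: subspace_diff[OF domain] E mact_in_subspace[OF domain] e simp del: mact_nth)
  show "(A21 \<star> X + A22 \<star> e) $ i \<in> D"
    unfolding vector_add_component by (intro subspace_add[OF domain] mact_in_subspace[OF domain] X e)
  have "energy (A21 \<star> X + A22 \<star> e) \<le> energy e + 2 * (\<Sum>i\<in>UNIV. h $ i * (L (X $ i) \<bullet> E $ i))"
    using lift_algebraic[OF energy_form, of e X] X e unfolding EA energy_def by simp
  also have "(\<Sum>i\<in>UNIV. h $ i * (L (X $ i) \<bullet> E $ i))
      \<le> (\<Sum>i\<in>UNIV. h $ i * (\<tau> * (norm (f $ i))\<^sup>2 - (norm (X $ i))\<^sup>2 / (4 * \<tau>) ))"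
  proof (intro sum_mono mult_left_mono h_nonneg)
    fix i
    have par: "(norm (L (E $ i) + f $ i))\<^sup>2 = (norm (L (E $ i)))\<^sup>2 + 2 * (f $ i \<bullet> L (E $ i)) + (norm (f $ i))\<^sup>2"
      by (simp add: power2_norm_eq_inner inner_simps inner_commute)
    have nX: "(norm (X $ i))\<^sup>2 = \<tau>\<^sup>2 * (norm (L (E $ i) + f $ i))\<^sup>2"
      by (simp add: Xi power_mult_distrib)
    have cs: "- (2 * (f $ i \<bullet> L (E $ i))) \<le> (norm (L (E $ i)))\<^sup>2 + (norm (f $ i))\<^sup>2"
      using zero_le_power2[of "norm (L (E $ i) + f $ i)"] unfolding par by linarith
    have "L (X $ i) \<bullet> E $ i = - \<tau> * ((norm (L (E $ i)))\<^sup>2 + f $ i \<bullet> L (E $ i))"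
      by (simp add: symmetric[OF X E]) (simp add: Xi power2_norm_eq_inner inner_simps algebra_simps)
    also have "\<dots> \<le> \<tau> * ((norm (f $ i))\<^sup>2 - (norm (L (E $ i) + f $ i))\<^sup>2 / 4)"
    proof -
      have "- ((norm (L (E $ i)))\<^sup>2 + f $ i \<bullet> L (E $ i)) \<le> (norm (f $ i))\<^sup>2 - (norm (L (E $ i) + f $ i))\<^sup>2 / 4"
      proof -
        \<comment> \<open>with \<open>a = \<parallel>L E\<^sub>i\<parallel>\<^sup>2\<close>, \<open>b = \<parallel>f\<^sub>i\<parallel>\<^sup>2\<close> and \<open>x = (f\<^sub>i, L E\<^sub>i)\<close>\<close>
        have "- (a + x) \<le> b - (a + 2 * x + b) / 4" if "- (2 * x) \<le> a + b" "0 \<le> a" "0 \<le> b" for a b x :: real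
          using that by (simp add: field_simps)
        from this[OF cs] show ?thesis unfolding par by simp
      qed
      then have "\<tau> * - ((norm (L (E $ i)))\<^sup>2 + f $ i \<bullet> L (E $ i)) \<le> \<tau> * ((norm (f $ i))\<^sup>2 - (norm (L (E $ i) + f $ i))\<^sup>2 / 4)"
        using \<tau> by (intro mult_left_mono) auto
      then show ?thesis by (simp only: mult_minus_left mult_minus_right)
    qed
    also have "\<dots> = \<tau> * (norm (f $ i))\<^sup>2 - (norm (X $ i))\<^sup>2 / (4 * \<tau>)"
      unfolding nX using \<tau> by (simp add: field_simps power2_eq_square)
    finally show "L (X $ i) \<bullet> E $ i \<le> \<tau> * (norm (f $ i))\<^sup>2 - (norm (X $ i))\<^sup>2 / (4 * \<tau>)" .
  qed
  also have "\<dots> = \<tau> * (\<Sum>i\<in>UNIV. h $ i * (norm (f $ i))\<^sup>2) - (\<Sum>i\<in>UNIV. h $ i * (norm (X $ i))\<^sup>2) / (4 * \<tau>)"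
    by (simp add: sum_subtractf sum_distrib_left sum_divide_distrib algebra_simps)
  finally have "2 * \<tau> * energy (A21 \<star> X + A22 \<star> e)
     \<le> 2 * \<tau> * (energy e + 2 * (\<tau> * (\<Sum>i\<in>UNIV. h $ i * (norm (f $ i))\<^sup>2) - (\<Sum>i\<in>UNIV. h $ i * (norm (X $ i))\<^sup>2) / (4 * \<tau>)))"
    using \<tau> by (intro mult_left_mono) auto
  also have "\<dots> = 2 * \<tau> * energy e + 4 * \<tau>\<^sup>2 * (\<Sum>i\<in>UNIV. h $ i * (norm (f $ i))\<^sup>2) - (\<Sum>i\<in>UNIV. h $ i * (norm (X $ i))\<^sup>2)"
    using \<tau> by (simp add: field_simps power2_eq_square)
  finally show "(\<Sum>i\<in>UNIV. h $ i * (norm (X $ i))\<^sup>2) + 2 * \<tau> * energy (A21 \<star> X + A22 \<star> e)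
      \<le> 2 * \<tau> * energy e + 4 * \<tau>\<^sup>2 * (\<Sum>i\<in>UNIV. h $ i * (norm (f $ i))\<^sup>2)" by linarith
qed

lemma stage_exists:
  assumes "0 < \<tau>"
  shows "\<exists>E X. stage \<tau> E X e \<rho> 0"
proof -
  define b where "b = A12 \<star> e + \<rho>"
  \<comment> \<open>multiplication by \<open>A11\<^sup>-\<^sup>1\<close> leaves an equation for \<open>E\<close> alone, whose matrix is coercive\<close>
  from stage_equations_solvable[OF hh_pos \<kappa>_pos assms coercive, where b="Ai \<star> b"]
  obtain E where E: "\<And>i. E $ i \<in> D" and eq: "Ai \<star> E + \<tau> *\<^sub>R (\<chi> i. L (E $ i)) = Ai \<star> b" by blast
  define X where "X = - (\<tau> *\<^sub>R (\<chi> i. L (E $ i)))"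
  have "E = A11 \<star> X + b"
  proof -
    have "A11 \<star> (Ai \<star> E) - A11 \<star> X = A11 \<star> (Ai \<star> b)"
      unfolding eq[symmetric] mact_diff[symmetric] by (simp add: X_def)
    then show ?thesis by (simp add: mact_mult[symmetric] Ai algebra_simps)
  qed
  then have "stage \<tau> E X e \<rho> 0"
    using E by (simp add: stage_def X_def b_def add.assoc del: mact_nth)
  then show ?thesis by blast
qed

text \<open>
  The part \<open>X1\<close> belongs to the recursion with the same initial value and the same residuals but
  without source, and \<open>step_bound\<close> shows that it is of the size of these data. The part \<open>X2\<close>
  belongs to the difference of the two recursions, which starts from zero and has no residuals, so that
  \<open>smoothing_step\<close> applies in every step and the energies telescope.
\<close>

lemma splitting:
  "\<exists>K>0. \<forall>\<tau> N E X e \<rho> \<sigma> f. 0 < \<tau> \<longrightarrow>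
     (\<forall>n. 1 \<le> n \<and> n \<le> N \<longrightarrow> stage \<tau> (E n) (X n) (e n) (\<rho> n) (f n) \<and>
        e (Suc n) = A21 \<star> X n + A22 \<star> e n + \<sigma> n) \<longrightarrow>
     (\<exists>X1 X2 :: nat \<Rightarrow> 'h^'s. \<forall>n. 1 \<le> n \<and> n \<le> N \<longrightarrow> X n = X1 n + X2 n \<and>
        norm (X1 n) \<le> K * (norm (e 1) + (\<Sum>k=1..n. norm (\<rho> k) + norm (\<sigma> k))) \<and>
        (\<Sum>k=1..n. \<Sum>i\<in>UNIV. h $ i * (norm (X2 k $ i))\<^sup>2)
          \<le> 4 * \<tau>\<^sup>2 * (\<Sum>k=1..n. \<Sum>i\<in>UNIV. h $ i * (norm (f k $ i))\<^sup>2))"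
proof -
  obtain K1 where K1: "K1 > 0" "\<And>\<tau> E X e \<rho> f. 0 \<le> \<tau> \<Longrightarrow> stage \<tau> E X e \<rho> f \<Longrightarrow>
     norm E \<le> K1 * (norm e + norm \<rho> + \<tau> * norm f) \<and> norm X \<le> K1 * (norm e + norm \<rho> + \<tau> * norm f)"
    using stage_bound by blast
  obtain K2 where K2: "K2 > 0" "\<And>\<tau> E X e \<rho> f \<sigma>. 0 \<le> \<tau> \<Longrightarrow> stage \<tau> E X e \<rho> f \<Longrightarrow>
     norm (Cg \<star> (A21 \<star> X + A22 \<star> e + \<sigma>)) \<le> norm (Cg \<star> e) + K2 * (norm \<rho> + norm \<sigma> + \<tau> * norm f)"
    using step_bound by blast
  obtain Kg where Kg: "Kg > 0" "\<And>x :: 'h^'r. norm x \<le> Kg * norm (Cg \<star> x)"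
    using norm_le_gnorm by blast
  obtain Kc where Kc: "Kc > 0" "\<And>x :: 'h^'r. norm (Cg \<star> x) \<le> Kc * norm x"
    using mact_bounded[of Cg, where ?'h='h] by blast
  define K where "K = K1 * (Kg * (Kc + K2) + 1)"
  have "K > 0" using K1 K2 Kg Kc by (simp add: K_def add_pos_pos)
  moreover have "\<exists>X1 X2 :: nat \<Rightarrow> 'h^'s. \<forall>n. 1 \<le> n \<and> n \<le> N \<longrightarrow> X n = X1 n + X2 n \<and>
        norm (X1 n) \<le> K * (norm (e 1) + (\<Sum>k=1..n. norm (\<rho> k) + norm (\<sigma> k))) \<and>
        (\<Sum>k=1..n. \<Sum>i\<in>UNIV. h $ i * (norm (X2 k $ i))\<^sup>2)
          \<le> 4 * \<tau>\<^sup>2 * (\<Sum>k=1..n. \<Sum>i\<in>UNIV. h $ i * (norm (f k $ i))\<^sup>2)"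
    if \<tau>: "0 < \<tau>" and eqs: "\<forall>n. 1 \<le> n \<and> n \<le> N \<longrightarrow> stage \<tau> (E n) (X n) (e n) (\<rho> n) (f n) \<and>
        e (Suc n) = A21 \<star> X n + A22 \<star> e n + \<sigma> n" for \<tau> N E X e \<rho> \<sigma> f
  proof -
    \<comment> \<open>\<open>g n\<close> are the external values of the recursion without source at step \<open>n + 1\<close>\<close>
    have "\<exists>g. \<forall>n. (n = 0 \<longrightarrow> g n = e 1) \<and>
        (\<exists>E' X'. stage \<tau> E' X' (g n) (\<rho> (Suc n)) 0 \<and> g (Suc n) = A21 \<star> X' + A22 \<star> g n + \<sigma> (Suc n))"
      by (rule dependent_nat_choice) (use stage_exists[OF \<tau>] in auto)
    then obtain g where g0: "g 0 = e 1" and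
      "\<forall>n. \<exists>E' X'. stage \<tau> E' X' (g n) (\<rho> (Suc n)) 0 \<and> g (Suc n) = A21 \<star> X' + A22 \<star> g n + \<sigma> (Suc n)"
      by blast
    then have "\<forall>n. \<exists>Y. stage \<tau> (fst Y) (snd Y) (g n) (\<rho> (Suc n)) 0 \<and>
        g (Suc n) = A21 \<star> snd Y + A22 \<star> g n + \<sigma> (Suc n)" by simp
    from choice[OF this] obtain Y where
      Y: "\<forall>n. stage \<tau> (fst (Y n)) (snd (Y n)) (g n) (\<rho> (Suc n)) 0 \<and>
        g (Suc n) = A21 \<star> snd (Y n) + A22 \<star> g n + \<sigma> (Suc n)" by blast
    define E' where "E' n = fst (Y n)" for n
    define X' where "X' n = snd (Y n)" for n
    have st': "stage \<tau> (E' n) (X' n) (g n) (\<rho> (Suc n)) 0" for n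
      unfolding E'_def X'_def by (rule Y[THEN spec, THEN conjunct1])
    have g: "g (Suc n) = A21 \<star> X' n + A22 \<star> g n + \<sigma> (Suc n)" for n
      unfolding X'_def by (rule Y[THEN spec, THEN conjunct2])
    define S where "S n = (\<Sum>k=1..n. norm (\<rho> k) + norm (\<sigma> k))" for n
    have S: "0 \<le> S n" for n unfolding S_def by (intro sum_nonneg) auto
    have Sstep: "S (Suc n) = S n + (norm (\<rho> (Suc n)) + norm (\<sigma> (Suc n)))" for n
      by (simp add: S_def)
    have grow: "norm (Cg \<star> g n) \<le> Kc * norm (e 1) + K2 * S n" for n
    proof (induction n)
      case 0
      then show ?case using Kc by (simp add: g0 S_def)
    next
      case (Suc n)
      have "norm (Cg \<star> g (Suc n)) \<le> norm (Cg \<star> g n) + K2 * (norm (\<rho> (Suc n)) + norm (\<sigma> (Suc n)))"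
        using K2(2)[OF less_imp_le[OF \<tau>] st', of n "\<sigma> (Suc n)"] by (simp add: g)
      with Suc show ?case by (simp add: Sstep algebra_simps)
    qed
    have X': "norm (X' n) \<le> K * (norm (e 1) + S (Suc n))" for n
    proof -
      have "norm (g n) \<le> Kg * norm (Cg \<star> g n)" by (rule Kg)
      also have "\<dots> \<le> Kg * ((Kc + K2) * (norm (e 1) + S (Suc n)))"
      proof (intro mult_left_mono)
        have "K2 * S n \<le> K2 * S (Suc n)" "0 \<le> Kc * S (Suc n)" "0 \<le> K2 * norm (e 1)"
          using K2 Kc S Sstep[of n] by (auto intro!: mult_left_mono)
        then show "norm (Cg \<star> g n) \<le> (Kc + K2) * (norm (e 1) + S (Suc n))"
          using grow[of n] by (simp add: algebra_simps)
      qed (use Kg in simp)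
      finally have "norm (g n) + norm (\<rho> (Suc n)) \<le> (Kg * (Kc + K2) + 1) * (norm (e 1) + S (Suc n))"
        using Sstep[of n] S[of n] norm_ge_zero[of "e 1"] norm_ge_zero[of "\<sigma> (Suc n)"]
        unfolding distrib_right mult_1_left mult.assoc by linarith
      then have "K1 * (norm (g n) + norm (\<rho> (Suc n))) \<le> K * (norm (e 1) + S (Suc n))"
        unfolding K_def mult.assoc using K1 by (intro mult_left_mono) auto
      then show ?thesis using K1(2)[OF less_imp_le[OF \<tau>] st', of n] by simp
    qed
    define e2 where "e2 n = e n - g (n - 1)" for n
    define X2 where "X2 n = X n - X' (n - 1)" for n
    have st2: "stage \<tau> (E n - E' (n - 1)) (X2 n) (e2 n) 0 (f n)"
      and next2: "e2 (Suc n) = A21 \<star> X2 n + A22 \<star> e2 n" if n: "1 \<le> n" "n \<le> N" for n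
    proof -
      obtain m where m: "n = Suc m" using n by (cases n) auto
      have a: "stage \<tau> (E n) (X n) (e n) (\<rho> n) (f n)" using eqs n by blast
      have b: "stage \<tau> (E' m) (X' m) (g m) (\<rho> n) 0" using st'[of m] by (simp add: m)
      show "stage \<tau> (E n - E' (n - 1)) (X2 n) (e2 n) 0 (f n)"
        unfolding stage_def
      proof (intro conjI allI)
        fix i
        have D: "E n $ i \<in> D" "E' m $ i \<in> D" using a b unfolding stage_def by blast+
        then show "(E n - E' (n - 1)) $ i \<in> D" by (simp add: m subspace_diff[OF domain])
        have "X n $ i = - (\<tau> *\<^sub>R (L (E n $ i) + f n $ i))" "X' m $ i = - (\<tau> *\<^sub>R (L (E' m $ i) + 0 $ i))"
          using a b unfolding stage_def by blast+
        then show "X2 n $ i = - (\<tau> *\<^sub>R (L ((E n - E' (n - 1)) $ i) + f n $ i))"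
          using D by (simp add: X2_def m L_diff scaleR_add_right scaleR_diff_right)
        have "E n = A11 \<star> X n + A12 \<star> e n + \<rho> n" "E' m = A11 \<star> X' m + A12 \<star> g m + \<rho> n"
          using a b unfolding stage_def by blast+
        then show "E n - E' (n - 1) = A11 \<star> X2 n + A12 \<star> e2 n + 0"
          by (simp add: X2_def e2_def m mact_diff)
      qed
      show "e2 (Suc n) = A21 \<star> X2 n + A22 \<star> e2 n"
        using eqs n g[of m] by (simp add: e2_def X2_def m mact_diff)
    qed
    have e2D: "(\<forall>i. e2 (Suc n) $ i \<in> D)" if "n \<le> N" for n
      using that
    proof (induction n)
      case 0
      then show ?case by (simp add: e2_def g0 subspace_0[OF domain])
    next
      case (Suc n)
      then show ?case using smoothing_step(1)[OF st2 \<tau>, of "Suc n"] next2[of "Suc n"] by auto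
    qed
    have en: "(\<Sum>k=1..n. \<Sum>i\<in>UNIV. h $ i * (norm (X2 k $ i))\<^sup>2) + 2 * \<tau> * energy (e2 (Suc n))
          \<le> 4 * \<tau>\<^sup>2 * (\<Sum>k=1..n. \<Sum>i\<in>UNIV. h $ i * (norm (f k $ i))\<^sup>2)" if "n \<le> N" for n
      using that
    proof (induction n)
      case 0
      then show ?case by (simp add: e2_def g0 energy_def)
    next
      case (Suc n)
      then have "(\<Sum>i\<in>UNIV. h $ i * (norm (X2 (Suc n) $ i))\<^sup>2) + 2 * \<tau> * energy (e2 (Suc (Suc n)))
          \<le> 2 * \<tau> * energy (e2 (Suc n)) + 4 * \<tau>\<^sup>2 * (\<Sum>i\<in>UNIV. h $ i * (norm (f (Suc n) $ i))\<^sup>2)"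
        using smoothing_step(2)[OF st2 \<tau>, of "Suc n"] next2[of "Suc n"] e2D[of n] by simp
      with Suc show ?case by (simp add: distrib_left)
    qed
    show ?thesis
    proof (intro exI allI impI conjI)
      fix n assume n: "1 \<le> n \<and> n \<le> N"
      show "X n = X' (n - 1) + X2 n" by (simp add: X2_def)
      show "norm (X' (n - 1)) \<le> K * (norm (e 1) + (\<Sum>k=1..n. norm (\<rho> k) + norm (\<sigma> k)))"
        using X'[of "n - 1"] n by (simp add: S_def)
      have "0 \<le> 2 * \<tau> * energy (e2 (Suc n))" using energy_nonneg e2D[of n] n \<tau> by simp
      then show "(\<Sum>k=1..n. \<Sum>i\<in>UNIV. h $ i * (norm (X2 k $ i))\<^sup>2)
          \<le> 4 * \<tau>\<^sup>2 * (\<Sum>k=1..n. \<Sum>i\<in>UNIV. h $ i * (norm (f k $ i))\<^sup>2)"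
        using en[of n] n by linarith
    qed
  qed
  ultimately show ?thesis by blast
qed

end

section \<open>Error estimate in a Hilbert space\<close>

text \<open>
  The errors in \<open>u\<close> are \<open>errE\<close> (stages), \<open>errX\<close> (increments) and \<open>erre\<close> (external values), with residuals
  \<open>resE\<close>, \<open>rese\<close> and source \<open>src\<close>; the errors in \<open>z\<close> are \<open>errD\<close>, \<open>errY\<close> and \<open>errd\<close>, with residuals \<open>resD\<close>, \<open>resd\<close>.
  \<open>Wbar\<close> is \<open>W\<close> at the extrapolated stage values, \<open>Wref\<close> is \<open>W\<close> at the exact solution at the
  beginning of the step, and \<open>extr\<close> is the norm of the extrapolation error. All are sequences in the
  number of the step.
\<close>

record ('h, 's::finite, 'r::finite) error_data =
  errE :: "nat \<Rightarrow> 'h^'s"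
  errX :: "nat \<Rightarrow> 'h^'s"
  erre :: "nat \<Rightarrow> 'h^'r"
  resE :: "nat \<Rightarrow> 'h^'s"
  rese :: "nat \<Rightarrow> 'h^'r"
  src :: "nat \<Rightarrow> 'h^'s"
  errD :: "nat \<Rightarrow> real^'s"
  errY :: "nat \<Rightarrow> real^'s"
  errd :: "nat \<Rightarrow> real^'r"
  resD :: "nat \<Rightarrow> real^'s"
  resd :: "nat \<Rightarrow> real^'r"
  Wbar :: "nat \<Rightarrow> 'h^'s"
  Wref :: "nat \<Rightarrow> 'h"
  extr :: "nat \<Rightarrow> real"

lemma discrete_gronwall:
  fixes x :: "nat \<Rightarrow> real"
  assumes "0 \<le> b" and "\<And>n. 1 \<le> n \<Longrightarrow> n \<le> m \<Longrightarrow> x n \<le> a + b * (\<Sum>k=1..<n. x k)"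
    and "1 \<le> m"
  shows "x m \<le> a * (1 + b) ^ (m - 1)"
proof -
  have *: "a + b * (\<Sum>k=1..<Suc n. x k) \<le> a * (1 + b) ^ n" if "n < m" for n
    using that
  proof (induction n)
    case (Suc n)
    then have IH: "a + b * (\<Sum>k=1..<Suc n. x k) \<le> a * (1 + b) ^ n" by simp
    have "x (Suc n) \<le> a + b * (\<Sum>k=1..<Suc n. x k)" using assms(2)[of "Suc n"] Suc.prems by simp
    then have "b * x (Suc n) \<le> b * (a * (1 + b) ^ n)" using IH assms(1) by (intro mult_left_mono) auto
    then show ?case using IH by (simp add: algebra_simps)
  qed simp
  show ?thesis using assms(2)[of m] *[of "m - 1"] assms(3) by simp
qed

lemma sum_square_le: "(\<Sum>k=1..<n. x k)\<^sup>2 \<le> real (n - 1) * (\<Sum>k=1..<n. (x k)\<^sup>2)" for x :: "nat \<Rightarrow> real"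
  using sum_squared_le_sum_of_squares[of x "{1..<n}"] by (simp add: mult.commute)

definition vinner :: "'h::real_inner \<Rightarrow> 'h^'n \<Rightarrow> real^'n" where
  "vinner w x = (\<chi> i. w \<bullet> x $ i)"

lemma vinner_add: "vinner w (x + y) = vinner w x + vinner w y"
  by (simp add: vinner_def vec_eq_iff inner_add_right)

lemma vinner_diff_left: "vinner (v - w) x = vinner v x - vinner w x"
  by (simp add: vinner_def vec_eq_iff inner_diff_left)

lemma vinner_mact: "vinner w (A \<star> x) = A \<star> vinner w x"
  unfolding vinner_def using mact_linear_image[OF bounded_linear.linear[OF bounded_linear_inner_right]] by blast

lemma norm_vinner_le: "norm (vinner w (x :: 'h::real_inner^'r)) \<le> real CARD('r) * (norm w * norm x)"
proof (rule norm_vec_le_const)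
  fix i
  have "\<bar>w \<bullet> x $ i\<bar> \<le> norm w * norm (x $ i)" by (rule Cauchy_Schwarz_ineq2)
  also have "\<dots> \<le> norm w * norm x"
    by (intro mult_left_mono Finite_Cartesian_Product.norm_nth_le) auto
  finally show "norm (vinner w x $ i) \<le> norm w * norm x" by (simp add: vinner_def)
qed

context stable_scheme
begin

text \<open>
  Everything about the nonlinear scheme that enters the error estimate. The bounds that use the Lipschitz
  condition of \<open>W\<close> are conditional on \<open>extr d n \<le> 1\<close>, because the condition is local: only then are the
  extrapolated values known to stay in a fixed ball. In the
  application \<open>c\<close> is independent of \<open>\<tau>\<close>.
\<close>

definition error_system :: "real \<Rightarrow> nat \<Rightarrow> real \<Rightarrow> nat \<Rightarrow> ('h, 's, 'r) error_data \<Rightarrow> bool" where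
  "error_system c \<mu> \<tau> N d \<longleftrightarrow>
     0 < \<tau> \<and> \<tau> \<le> 1 \<and> 1 \<le> \<mu> \<and> real N * \<tau> \<le> c \<and>
     norm (errE d 0) \<le> c * \<tau> ^ \<mu> \<and> norm (erre d 1) \<le> c * \<tau> ^ \<mu> \<and> norm (errd d 1) \<le> c * \<tau> ^ \<mu> \<and>
     (\<forall>n. 1 \<le> n \<and> n \<le> Suc N \<longrightarrow> norm (Wref d n) \<le> c) \<and>
     (\<forall>n. 1 \<le> n \<and> n \<le> N \<longrightarrow>
        stage \<tau> (errE d n) (errX d n) (erre d n) (resE d n) (src d n) \<and>
        erre d (Suc n) = A21 \<star> errX d n + A22 \<star> erre d n + rese d n \<and>
        errD d n = A11 \<star> errY d n + A12 \<star> errd d n + resD d n \<and>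
        errd d (Suc n) = A21 \<star> errY d n + A22 \<star> errd d n + resd d n \<and>
        norm (resE d n) \<le> c * \<tau> ^ Suc \<mu> \<and> norm (rese d n) \<le> c * \<tau> ^ Suc \<mu> \<and>
        norm (resD d n) \<le> c * \<tau> ^ Suc \<mu> \<and> norm (resd d n) \<le> c * \<tau> ^ Suc \<mu> \<and>
        norm (Wref d (Suc n) - Wref d n) \<le> c * \<tau> \<and>
        0 \<le> extr d n \<and> extr d n \<le> c * (norm (errE d (n - 1)) + norm (erre d n) + \<tau> ^ \<mu>) \<and>
        (extr d n \<le> 1 \<longrightarrow>
           norm (src d n) \<le> c * (extr d n + norm (errD d n)) \<and>
           (\<forall>i. norm (Wbar d n $ i) \<le> c \<and> norm (Wbar d n $ i - Wref d n) \<le> c * (extr d n + \<tau>) \<and>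
              \<bar>errY d n $ i - 1 / 2 * (Wbar d n $ i \<bullet> errX d n $ i)\<bar> \<le> c * \<tau> * extr d n)))"

text \<open>
  A bound for all data on which step \<open>n\<close> depends; it does not involve the stages of step \<open>n\<close>.
\<close>

definition level :: "nat \<Rightarrow> real \<Rightarrow> ('h, 's, 'r) error_data \<Rightarrow> nat \<Rightarrow> real" where
  "level \<mu> \<tau> d n = norm (errE d (n - 1)) + norm (erre d n) + norm (errd d n) + \<tau> ^ \<mu>"

lemma level_ge:
  assumes "0 < \<tau>"
  shows "0 \<le> level \<mu> \<tau> d n" "norm (errE d (n - 1)) \<le> level \<mu> \<tau> d n" "norm (erre d n) \<le> level \<mu> \<tau> d n"
    "norm (errd d n) \<le> level \<mu> \<tau> d n" "\<tau> ^ \<mu> \<le> level \<mu> \<tau> d n"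
    "norm (errE d (n - 1)) + norm (erre d n) + \<tau> ^ \<mu> \<le> level \<mu> \<tau> d n"
  using zero_le_power[of \<tau> \<mu>] assms by (auto simp: level_def)

text \<open>
  The bounds are circular: the source contains \<open>errD\<close>, which depends on \<open>errY\<close>, hence on \<open>errX\<close>, hence
  on \<open>\<tau>\<close> times the source. The factor \<open>\<tau>\<close> breaks the circle for small step sizes.
\<close>

lemma local_bounds:
  assumes c: "0 < c"
  shows "\<exists>K>0. \<exists>\<tau>0>0. \<forall>\<mu> \<tau> N d n. error_system c \<mu> \<tau> N d \<and> \<tau> < \<tau>0 \<and> 1 \<le> n \<and> n \<le> N \<and> extr d n \<le> 1 \<longrightarrow>
     norm (src d n) \<le> K * level \<mu> \<tau> d n \<and> norm (errX d n) \<le> K * level \<mu> \<tau> d n \<and>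
     norm (errE d n) \<le> K * (norm (erre d n) + \<tau> * level \<mu> \<tau> d n) \<and>
     norm (errD d n) \<le> K * level \<mu> \<tau> d n \<and> norm (erre d (Suc n)) \<le> K * level \<mu> \<tau> d n"
proof -
  obtain K1 where K1: "K1 > 0" "\<And>\<tau> E X e \<rho> f. 0 \<le> \<tau> \<Longrightarrow> stage \<tau> E X e \<rho> f \<Longrightarrow>
     norm E \<le> K1 * (norm e + norm \<rho> + \<tau> * norm f) \<and> norm X \<le> K1 * (norm e + norm \<rho> + \<tau> * norm f)"
    using stage_bound by blast
  obtain Ka where Ka: "Ka > 0" "\<And>x :: real^'s. norm (A11 \<star> x) \<le> Ka * norm x"
    using mact_bounded[of A11, where ?'h=real] by blast
  obtain Kb where Kb: "Kb > 0" "\<And>x :: real^'r. norm (A12 \<star> x) \<le> Kb * norm x"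
    using mact_bounded[of A12, where ?'h=real] by blast
  obtain Kd where Kd: "Kd > 0" "\<And>x :: 'h^'s. norm (A21 \<star> x) \<le> Kd * norm x"
    using mact_bounded[of A21, where ?'h='h] by blast
  obtain Ke where Ke: "Ke > 0" "\<And>x :: 'h^'r. norm (A22 \<star> x) \<le> Ke * norm x"
    using mact_bounded[of A22, where ?'h='h] by blast
  define s where "s = real CARD('s)"
  have s: "s \<ge> 1" by (simp add: s_def Suc_leI)
  define B where "B = Ka * (s * c)"
  have B: "B > 0" using Ka s c by (simp add: B_def)
  define F where "F = K1 * (1 + c + c * c)"
  have F: "F > 0" using K1 c by (simp add: F_def add_pos_pos)
  define Q where "Q = B * (c + F) + Kb + c"
  \<comment> \<open>\<open>\<tau> R\<close> is the factor gained in one turn of the circle; it is absorbed when \<open>\<tau> R \<le> 1/2\<close>\<close>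
  define R where "R = B * (K1 * c)"
  have Q: "Q > 0" using B c F Kb by (simp add: Q_def add_pos_pos)
  have R: "R > 0" using B K1 c by (simp add: R_def)
  define KD where "KD = 2 * Q"
  define KF where "KF = c * (c + KD)"
  define KX where "KX = K1 * (1 + c + KF)"
  define KN where "KN = Kd * KX + Ke + c"
  define K where "K = KD + KF + KX + KN"
  have pos: "KD > 0" "KF > 0" "KX > 0" "KN > 0"
    using Q c K1 Kd Ke by (auto simp: KD_def KF_def KX_def KN_def intro!: add_pos_pos mult_pos_pos)
  have "norm (src d n) \<le> K * level \<mu> \<tau> d n \<and> norm (errX d n) \<le> K * level \<mu> \<tau> d n \<and>
     norm (errE d n) \<le> K * (norm (erre d n) + \<tau> * level \<mu> \<tau> d n) \<and>
     norm (errD d n) \<le> K * level \<mu> \<tau> d n \<and> norm (erre d (Suc n)) \<le> K * level \<mu> \<tau> d n"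
    if sys: "error_system c \<mu> \<tau> N d" and small: "\<tau> < 1 / (2 * R)" and n: "1 \<le> n" "n \<le> N" and ex: "extr d n \<le> 1"
    for \<mu> \<tau> N d n
  proof -
    define p where "p = level \<mu> \<tau> d n"
    define \<beta> where "\<beta> = extr d n"
    define x where "x = norm (errX d n)"
    define D' where "D' = norm (errD d n)"
    define \<phi> where "\<phi> = norm (src d n)"
    from sys have \<tau>: "0 < \<tau>" "\<tau> \<le> 1" unfolding error_system_def by blast+
    note p = level_ge[OF \<tau>(1), where \<mu>=\<mu> and d=d and n=n, folded p_def]
    have at_n: "stage \<tau> (errE d n) (errX d n) (erre d n) (resE d n) (src d n)"
        "erre d (Suc n) = A21 \<star> errX d n + A22 \<star> erre d n + rese d n"
        "errD d n = A11 \<star> errY d n + A12 \<star> errd d n + resD d n"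
        "norm (resE d n) \<le> c * \<tau> ^ Suc \<mu>" "norm (rese d n) \<le> c * \<tau> ^ Suc \<mu>" "norm (resD d n) \<le> c * \<tau> ^ Suc \<mu>"
        "0 \<le> \<beta>" "\<beta> \<le> c * (norm (errE d (n - 1)) + norm (erre d n) + \<tau> ^ \<mu>)"
        "\<phi> \<le> c * (\<beta> + D')"
        "\<And>i. norm (Wbar d n $ i) \<le> c"
        "\<And>i. \<bar>errY d n $ i - 1 / 2 * (Wbar d n $ i \<bullet> errX d n $ i)\<bar> \<le> c * \<tau> * \<beta>"
      using sys n ex unfolding error_system_def \<beta>_def D'_def \<phi>_def by blast+
    have \<beta>: "\<beta> \<le> c * p" using at_n(8) mult_left_mono[OF p(6), of c] c by linarith
    have res: "c * \<tau> ^ Suc \<mu> \<le> \<tau> * (c * p)" "c * \<tau> ^ Suc \<mu> \<le> c * p"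
    proof -
      have "\<tau> * (c * \<tau> ^ \<mu>) \<le> \<tau> * (c * p)" using \<tau> c p(5) by (intro mult_left_mono) auto
      then show *: "c * \<tau> ^ Suc \<mu> \<le> \<tau> * (c * p)" by (simp add: mult_ac)
      have "\<tau> * (c * p) \<le> c * p" using \<tau> c p(1) by (simp add: mult_left_le_one_le)
      with * show "c * \<tau> ^ Suc \<mu> \<le> c * p" by linarith
    qed
    have nn: "0 \<le> \<phi>" "0 \<le> D'" "0 \<le> x" by (auto simp: \<phi>_def D'_def x_def)
    have \<phi>: "\<phi> \<le> c * (c * p) + c * D'"
      using at_n(9) mult_left_mono[OF \<beta> less_imp_le[OF c]] unfolding distrib_left by linarith
    have EX: "norm (errE d n) \<le> K1 * (norm (erre d n) + \<tau> * (c * p) + \<tau> * \<phi>)"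
      "x \<le> K1 * (norm (erre d n) + \<tau> * (c * p) + \<tau> * \<phi>)"
    proof -
      have "K1 * (norm (erre d n) + norm (resE d n) + \<tau> * \<phi>) \<le> K1 * (norm (erre d n) + \<tau> * (c * p) + \<tau> * \<phi>)"
        using at_n(4) res(1) K1(1) by (intro mult_left_mono) auto
      then show "norm (errE d n) \<le> K1 * (norm (erre d n) + \<tau> * (c * p) + \<tau> * \<phi>)"
        "x \<le> K1 * (norm (erre d n) + \<tau> * (c * p) + \<tau> * \<phi>)"
        using K1(2)[OF less_imp_le[OF \<tau>(1)] at_n(1)] unfolding x_def \<phi>_def by linarith+
    qed
    have x1: "x \<le> F * p + \<tau> * (K1 * c) * D'"
    proof -
      have "\<tau> * (c * p) \<le> c * p" "\<tau> * (c * (c * p)) \<le> c * (c * p)"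
        using \<tau> c p(1) by (simp_all add: mult_left_le_one_le)
      moreover have "\<tau> * \<phi> \<le> \<tau> * (c * (c * p) + c * D')" using \<phi> \<tau> by (intro mult_left_mono) auto
      ultimately have "norm (erre d n) + \<tau> * (c * p) + \<tau> * \<phi> \<le> p + c * p + c * (c * p) + \<tau> * (c * D')"
        using p(3) unfolding distrib_left by linarith
      then have "K1 * (norm (erre d n) + \<tau> * (c * p) + \<tau> * \<phi>) \<le> K1 * (p + c * p + c * (c * p) + \<tau> * (c * D'))"
        using K1(1) by (intro mult_left_mono) auto
      then show ?thesis using EX(2) by (simp add: F_def algebra_simps)
    qed
    have \<chi>: "norm (errY d n) \<le> s * (c * (c * p) + c * x)"
    proof -
      have "norm (errY d n $ i) \<le> c * (c * p) + c * x" for i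
      proof -
        have "\<bar>Wbar d n $ i \<bullet> errX d n $ i\<bar> \<le> norm (Wbar d n $ i) * norm (errX d n $ i)"
          by (rule Cauchy_Schwarz_ineq2)
        also have "\<dots> \<le> c * x" unfolding x_def
          using at_n(10)[of i] c by (intro mult_mono Finite_Cartesian_Product.norm_nth_le) auto
        finally have "\<bar>Wbar d n $ i \<bullet> errX d n $ i\<bar> \<le> c * x" .
        moreover have "c * \<tau> * \<beta> \<le> c * (c * p)"
        proof -
          have "\<tau> * \<beta> \<le> 1 * (c * p)" using \<tau> \<beta> at_n(7) by (intro mult_mono) auto
          then have "c * (\<tau> * \<beta>) \<le> c * (1 * (c * p))" using c by (intro mult_left_mono) auto
          then show ?thesis by (simp add: mult.assoc)
        qed
        moreover have "0 \<le> c * x" using c nn by simp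
        ultimately show ?thesis using at_n(11)[of i] by simp
      qed
      then show ?thesis unfolding s_def by (rule norm_vec_le_const)
    qed
    have D1: "D' \<le> Q * p + \<tau> * R * D'"
    proof -
      have "D' \<le> Ka * norm (errY d n) + Kb * norm (errd d n) + c * \<tau> ^ Suc \<mu>"
        unfolding D'_def at_n(3)
        using norm_triangle_ineq[of "A11 \<star> errY d n + A12 \<star> errd d n" "resD d n"]
          norm_triangle_ineq[of "A11 \<star> errY d n" "A12 \<star> errd d n"] Ka(2)[of "errY d n"] Kb(2)[of "errd d n"] at_n(6)
        by linarith
      also have "\<dots> \<le> Ka * (s * (c * (c * p) + c * x)) + Kb * p + c * p"
        using \<chi> p(4) Ka(1) Kb(1) res(2) by (intro add_mono mult_left_mono[of _ _ Ka] mult_left_mono[of _ _ Kb]) auto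
      also have "Ka * (s * (c * (c * p) + c * x)) = B * (c * p) + B * x" by (simp add: B_def algebra_simps)
      also have "B * x \<le> B * (F * p + \<tau> * (K1 * c) * D')" using x1 B by (intro mult_left_mono) auto
      finally show ?thesis by (simp add: Q_def R_def algebra_simps)
    qed
    have D: "D' \<le> KD * p"
    proof -
      have "\<tau> * R \<le> 1 / 2" using small R by (simp add: field_simps)
      then have "\<tau> * R * D' \<le> 1 / 2 * D'" using nn by (intro mult_right_mono) auto
      then show ?thesis using D1 by (simp add: KD_def)
    qed
    have \<phi>2: "\<phi> \<le> KF * p"
    proof -
      have "KF * p = c * (c * p) + c * (KD * p)" by (simp add: KF_def algebra_simps)
      then show ?thesis using \<phi> mult_left_mono[OF D less_imp_le[OF c]] by linarith
    qed
    have E2: "K1 * (norm (erre d n) + \<tau> * (c * p) + \<tau> * \<phi>) \<le> KX * (norm (erre d n) + \<tau> * p)"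
    proof -
      have "\<tau> * \<phi> \<le> \<tau> * (KF * p)" by (intro mult_left_mono \<phi>2 less_imp_le[OF \<tau>(1)])
      then have "\<tau> * \<phi> \<le> KF * (\<tau> * p)" by (simp only: mult.left_commute)
      moreover have "0 \<le> \<tau> * p" "0 \<le> c * norm (erre d n)" "0 \<le> KF * norm (erre d n)"
        using \<tau> p(1) c pos by auto
      ultimately have "norm (erre d n) + \<tau> * (c * p) + \<tau> * \<phi> \<le> (1 + c + KF) * (norm (erre d n) + \<tau> * p)"
        by (simp add: algebra_simps)
      then have "K1 * (norm (erre d n) + \<tau> * (c * p) + \<tau> * \<phi>) \<le> K1 * ((1 + c + KF) * (norm (erre d n) + \<tau> * p))"
        using K1(1) by (intro mult_left_mono) auto
      then show ?thesis by (simp add: KX_def mult.assoc)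
    qed
    have x2: "x \<le> KX * p"
    proof -
      have "norm (erre d n) + \<tau> * (c * p) + \<tau> * \<phi> \<le> p + c * p + KF * p"
      proof -
        have "\<tau> * (c * p) \<le> c * p" "\<tau> * \<phi> \<le> \<phi>" using \<tau> c p(1) nn by (simp_all add: mult_left_le_one_le)
        then show ?thesis using p(3) \<phi>2 by linarith
      qed
      then have "K1 * (norm (erre d n) + \<tau> * (c * p) + \<tau> * \<phi>) \<le> K1 * (p + c * p + KF * p)"
        using K1(1) by (intro mult_left_mono) auto
      then show ?thesis using EX(2) by (simp add: KX_def algebra_simps)
    qed
    have nxt: "norm (erre d (Suc n)) \<le> KN * p"
    proof -
      have "norm (erre d (Suc n)) \<le> Kd * x + Ke * norm (erre d n) + c * \<tau> ^ Suc \<mu>"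
        unfolding at_n(2) x_def
        using norm_triangle_ineq[of "A21 \<star> errX d n + A22 \<star> erre d n" "rese d n"]
          norm_triangle_ineq[of "A21 \<star> errX d n" "A22 \<star> erre d n"] Kd(2)[of "errX d n"] Ke(2)[of "erre d n"] at_n(5)
        by linarith
      also have "\<dots> \<le> Kd * (KX * p) + Ke * p + c * p"
        using x2 p(3) Kd(1) Ke(1) res(2) by (intro add_mono mult_left_mono[of _ _ Kd] mult_left_mono[of _ _ Ke]) auto
      finally show ?thesis by (simp add: KN_def algebra_simps)
    qed
    have le: "KD * p \<le> K * p" "KF * p \<le> K * p" "KX * p \<le> K * p" "KN * p \<le> K * p"
      "KX * (norm (erre d n) + \<tau> * p) \<le> K * (norm (erre d n) + \<tau> * p)"
      using pos p(1) \<tau> by (auto intro!: mult_right_mono add_nonneg_nonneg simp: K_def)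
    show ?thesis
      using le \<phi>2 x2 D nxt EX(1) E2 unfolding p_def[symmetric] \<phi>_def x_def D'_def by linarith
  qed
  moreover have "K > 0" "1 / (2 * R) > 0" using pos R by (auto simp: K_def)
  ultimately show ?thesis by blast
qed

end

lemma sum_upto_bound:
  fixes a b :: "nat \<Rightarrow> real"
  assumes "\<And>k. 1 \<le> k \<Longrightarrow> k < m \<Longrightarrow> a (Suc k) \<le> a k + b k" and "1 \<le> n" "n \<le> m"
  shows "a n \<le> a 1 + (\<Sum>k=1..<n. b k)"
  using assms(2,3)
proof (induction n rule: dec_induct)
  case (step n)
  then show ?case using assms(1)[of n] by simp
qed simp

lemma three_squares: "(a + b + c)\<^sup>2 \<le> 3 * (a\<^sup>2 + b\<^sup>2 + c\<^sup>2)" for a b c :: real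
proof -
  have "0 \<le> (a - b)\<^sup>2 + (b - c)\<^sup>2 + (a - c)\<^sup>2" by simp
  then show ?thesis by (simp add: power2_eq_square algebra_simps)
qed

context stable_scheme
begin

text \<open>
  Up to small terms \<open>errY\<close> is \<open>1/2 (Wbar, errX)\<close>, and \<open>errd\<close> and \<open>erre\<close> obey the same recursion with
  the increments \<open>errY\<close> and \<open>errX\<close>. Subtracting \<open>1/2 (Wref, erre)\<close> therefore leaves only the pairing of
  \<open>errX\<close> with \<open>Wbar - Wref\<close>.
\<close>

definition corrected :: "('h, 's, 'r) error_data \<Rightarrow> nat \<Rightarrow> real^'r" where
  "corrected d n = errd d n - (1 / 2) *\<^sub>R vinner (Wref d n) (erre d n)"

text \<open>
  The difference \<open>Wbar - Wref\<close> is bounded by a multiple of \<open>extr + \<tau>\<close> and by a constant. The first bound is used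
  for the pairing with \<open>X1\<close>, which is of order \<open>\<tau>\<^sup>\<mu>\<close> and \<open>\<mu> \<ge> 1\<close>, so that the product is \<open>\<tau>\<close> times the
  level; the second one for the pairing with \<open>X2\<close>. The slow variation of \<open>Wref\<close> contributes a
  further \<open>\<tau>\<close> times the level.
\<close>

lemma corrected_step:
  assumes c: "0 < c" and M: "0 < M"
  shows "\<exists>K>0. \<forall>\<mu> \<tau> N d n X1 X2. error_system c \<mu> \<tau> N d \<and> 1 \<le> n \<and> n \<le> N \<and> extr d n \<le> 1 \<and>
      norm (erre d (Suc n)) \<le> M * level \<mu> \<tau> d n \<and> errX d n = X1 + X2 \<and> norm X1 \<le> M * \<tau> ^ \<mu> \<longrightarrow>
      norm (Cg \<star> corrected d (Suc n)) \<le> norm (Cg \<star> corrected d n)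
        + K * (\<tau> * level \<mu> \<tau> d n + sqrt (\<Sum>i\<in>UNIV. h $ i * (norm (X2 $ i))\<^sup>2))"
proof -
  obtain Kc where Kc: "Kc > 0" "\<And>x :: real^'r. norm (Cg \<star> x) \<le> Kc * norm x"
    using mact_bounded[of Cg, where ?'h=real] by blast
  obtain Kh where Kh: "Kh > 0" "\<And>i j. \<bar>A21 $ i $ j\<bar> \<le> Kh * sqrt (h $ j)"
    using A21_column_bound by blast
  define s r where "s = real CARD('s)" and "r = real CARD('r)"
  have sr: "s \<ge> 1" "r \<ge> 1" by (simp_all add: s_def r_def Suc_leI)
  define Hs where "Hs = (\<Sum>j\<in>UNIV. Kh * sqrt (h $ j))"
  have Hs: "Hs \<ge> 0" unfolding Hs_def using Kh h_nonneg by (intro sum_nonneg) auto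
  define K\<omega> where "K\<omega> = c * c + c * M * (c + 1)"
  have K\<omega>: "K\<omega> > 0" using c M by (simp add: K\<omega>_def add_pos_pos)
  define Ka where "Ka = r * (Hs * K\<omega>) + c + r * (c * c) + r * (c * M)"
  define Kb where "Kb = r * (s * (Kh * c))"
  have Kab: "Ka > 0" "Kb > 0"
    using sr Hs K\<omega> c M Kh by (auto simp: Ka_def Kb_def intro!: add_nonneg_pos mult_pos_pos)
  have "norm (Cg \<star> corrected d (Suc n)) \<le> norm (Cg \<star> corrected d n)
        + (Kc * (Ka + Kb)) * (\<tau> * level \<mu> \<tau> d n + sqrt (\<Sum>i\<in>UNIV. h $ i * (norm (X2 $ i))\<^sup>2))"
    if sys: "error_system c \<mu> \<tau> N d" and n: "1 \<le> n" "n \<le> N" and ex: "extr d n \<le> 1"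
      and e': "norm (erre d (Suc n)) \<le> M * level \<mu> \<tau> d n" and X: "errX d n = X1 + X2"
      and X1: "norm X1 \<le> M * \<tau> ^ \<mu>" for \<mu> \<tau> N d n X1 X2
  proof -
    define p where "p = level \<mu> \<tau> d n"
    define \<beta> where "\<beta> = extr d n"
    define \<xi> where "\<xi> = sqrt (\<Sum>i\<in>UNIV. h $ i * (norm (X2 $ i))\<^sup>2)"
    from sys have \<tau>: "0 < \<tau>" "\<tau> \<le> 1" and \<mu>: "1 \<le> \<mu>" unfolding error_system_def by blast+
    note p = level_ge[OF \<tau>(1), where \<mu>=\<mu> and d=d and n=n, folded p_def]
    have at_n: "erre d (Suc n) = A21 \<star> errX d n + A22 \<star> erre d n + rese d n"
        "errd d (Suc n) = A21 \<star> errY d n + A22 \<star> errd d n + resd d n"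
        "norm (rese d n) \<le> c * \<tau> ^ Suc \<mu>" "norm (resd d n) \<le> c * \<tau> ^ Suc \<mu>"
        "norm (Wref d (Suc n) - Wref d n) \<le> c * \<tau>"
        "0 \<le> \<beta>" "\<beta> \<le> c * (norm (errE d (n - 1)) + norm (erre d n) + \<tau> ^ \<mu>)"
        "\<And>i. norm (Wbar d n $ i - Wref d n) \<le> c * (\<beta> + \<tau>)"
        "\<And>i. \<bar>errY d n $ i - 1 / 2 * (Wbar d n $ i \<bullet> errX d n $ i)\<bar> \<le> c * \<tau> * \<beta>"
      using sys n ex unfolding error_system_def \<beta>_def by blast+
    have Wn: "norm (Wref d n) \<le> c" using sys n le_SucI unfolding error_system_def by blast
    have \<beta>: "\<beta> \<le> c * p" using at_n(7) mult_left_mono[OF p(6), of c] c by linarith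
    have \<tau>\<mu>: "\<tau> ^ \<mu> \<le> \<tau>" using \<mu> \<tau> power_decreasing[of 1 \<mu> \<tau>] by simp
    have res: "c * \<tau> ^ Suc \<mu> \<le> c * (\<tau> * p)"
      using c \<tau> p(5) by (simp add: mult_left_mono)
    have \<tau>p: "0 \<le> \<tau> * p" using \<tau> p(1) by simp
    \<comment> \<open>\<open>\<omega>\<close> are the increments that drive the corrected quantity\<close>
    define \<omega> where "\<omega> = errY d n - (1 / 2) *\<^sub>R vinner (Wref d n) (errX d n)"
    define \<delta> where "\<delta> = vinner (Wref d (Suc n) - Wref d n) (erre d (Suc n))"
    have "vinner (Wref d (Suc n)) (erre d (Suc n)) = vinner (Wref d n) (erre d (Suc n)) + \<delta>"
      by (simp add: \<delta>_def vinner_diff_left)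
    then have rec: "corrected d (Suc n) = A22 \<star> corrected d n
        + (A21 \<star> \<omega> + resd d n - (1 / 2) *\<^sub>R vinner (Wref d n) (rese d n) - (1 / 2) *\<^sub>R \<delta>)"
      unfolding corrected_def at_n(2)
      by (simp add: at_n(1) vinner_add vinner_mact \<omega>_def mact_diff mact_scaleR scaleR_add_right del: mact_nth)
    have \<omega>: "\<bar>\<omega> $ j\<bar> \<le> K\<omega> * (\<tau> * p) + c * norm (X2 $ j)" for j
    proof -
      define \<Delta> where "\<Delta> = Wbar d n $ j - Wref d n"
      have \<Delta>: "norm \<Delta> \<le> c * (\<beta> + \<tau>)" "norm \<Delta> \<le> 2 * c"
      proof -
        show "norm \<Delta> \<le> c * (\<beta> + \<tau>)" unfolding \<Delta>_def by (rule at_n(8))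
        also have "\<dots> \<le> c * 2" using ex \<tau> c by (intro mult_left_mono) (auto simp: \<beta>_def)
        finally show "norm \<Delta> \<le> 2 * c" by simp
      qed
      have "\<omega> $ j = (errY d n $ j - 1 / 2 * (Wbar d n $ j \<bullet> errX d n $ j)) + 1 / 2 * (\<Delta> \<bullet> X1 $ j) + 1 / 2 * (\<Delta> \<bullet> X2 $ j)"
        by (simp add: \<omega>_def vinner_def X \<Delta>_def inner_simps field_simps)
      moreover have "\<bar>\<Delta> \<bullet> X1 $ j\<bar> \<le> c * M * (c + 1) * (\<tau> * p)"
      proof -
        have "\<bar>\<Delta> \<bullet> X1 $ j\<bar> \<le> norm \<Delta> * norm (X1 $ j)" by (rule Cauchy_Schwarz_ineq2)
        also have "\<dots> \<le> (c * (\<beta> + \<tau>)) * (M * \<tau> ^ \<mu>)"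
          using \<Delta>(1) X1 Finite_Cartesian_Product.norm_nth_le[of X1 j] c at_n(6) \<tau> by (intro mult_mono) auto
        also have "\<dots> = (c * M) * (\<beta> * \<tau> ^ \<mu> + \<tau> * \<tau> ^ \<mu>)" by (simp add: algebra_simps)
        also have "\<dots> \<le> (c * M) * ((c * p) * \<tau> + \<tau> * p)"
          using c M \<beta> \<tau>\<mu> \<tau> p(1,5) at_n(6) by (intro mult_left_mono add_mono mult_mono) auto
        finally show ?thesis by (simp add: algebra_simps)
      qed
      moreover have "\<bar>\<Delta> \<bullet> X2 $ j\<bar> \<le> 2 * c * norm (X2 $ j)"
        using Cauchy_Schwarz_ineq2[of \<Delta> "X2 $ j"] mult_right_mono[OF \<Delta>(2), of "norm (X2 $ j)"] by simp
      moreover have "c * \<tau> * \<beta> \<le> c * c * (\<tau> * p)"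
      proof -
        have "(c * \<tau>) * \<beta> \<le> (c * \<tau>) * (c * p)" using c \<tau> \<beta> by (intro mult_left_mono) auto
        then show ?thesis by (simp only: mult_ac)
      qed
      moreover have "0 \<le> c * M * (c + 1) * (\<tau> * p)" using c M \<tau>p by simp
      moreover have "K\<omega> * (\<tau> * p) = c * c * (\<tau> * p) + c * M * (c + 1) * (\<tau> * p)"
        by (simp add: K\<omega>_def algebra_simps)
      ultimately show ?thesis using at_n(9)[of j] by (simp only: abs_le_iff) linarith
    qed
    have \<xi>: "sqrt (h $ j) * norm (X2 $ j) \<le> \<xi>" for j
    proof -
      have "h $ j * (norm (X2 $ j))\<^sup>2 \<le> (\<Sum>i\<in>UNIV. h $ i * (norm (X2 $ i))\<^sup>2)"
        using h_nonneg by (intro member_le_sum) auto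
      then have "sqrt (h $ j * (norm (X2 $ j))\<^sup>2) \<le> \<xi>" unfolding \<xi>_def by (rule real_sqrt_le_mono)
      then show ?thesis by (simp add: real_sqrt_mult)
    qed
    have A21\<omega>: "norm (A21 \<star> \<omega>) \<le> r * (Hs * K\<omega> * (\<tau> * p) + s * (Kh * c * \<xi>))"
      unfolding r_def
    proof (rule norm_vec_le_const)
      fix i
      have "norm ((A21 \<star> \<omega>) $ i) \<le> (\<Sum>j\<in>UNIV. Kh * sqrt (h $ j) * (K\<omega> * (\<tau> * p)) + Kh * c * \<xi>)"
        unfolding mact_nth
      proof (rule sum_norm_le)
        fix j
        have "norm (A21 $ i $ j *\<^sub>R \<omega> $ j) = \<bar>A21 $ i $ j\<bar> * \<bar>\<omega> $ j\<bar>" by (simp add: abs_mult)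
        also have "\<dots> \<le> (Kh * sqrt (h $ j)) * (K\<omega> * (\<tau> * p) + c * norm (X2 $ j))"
          using Kh \<omega> h_nonneg by (intro mult_mono) auto
        also have "\<dots> = Kh * sqrt (h $ j) * (K\<omega> * (\<tau> * p)) + Kh * c * (sqrt (h $ j) * norm (X2 $ j))"
          by (simp add: algebra_simps)
        also have "\<dots> \<le> Kh * sqrt (h $ j) * (K\<omega> * (\<tau> * p)) + Kh * c * \<xi>"
          using \<xi>[of j] Kh(1) c by (intro add_left_mono mult_left_mono) auto
        finally show "norm (A21 $ i $ j *\<^sub>R \<omega> $ j) \<le> Kh * sqrt (h $ j) * (K\<omega> * (\<tau> * p)) + Kh * c * \<xi>" .
      qed
      also have "\<dots> = Hs * K\<omega> * (\<tau> * p) + s * (Kh * c * \<xi>)"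
        by (simp add: sum.distrib Hs_def s_def sum_distrib_right mult.assoc)
      finally show "norm ((A21 \<star> \<omega>) $ i) \<le> Hs * K\<omega> * (\<tau> * p) + s * (Kh * c * \<xi>)" .
    qed
    have b1: "norm (vinner (Wref d n) (rese d n)) \<le> r * (c * c) * (\<tau> * p)"
    proof -
      have "norm (vinner (Wref d n) (rese d n)) \<le> r * (norm (Wref d n) * norm (rese d n))"
        unfolding r_def by (rule norm_vinner_le)
      also have "\<dots> \<le> r * (c * (c * (\<tau> * p)))"
        using order_trans[OF at_n(3) res] Wn sr c by (intro mult_left_mono mult_mono) auto
      finally show ?thesis by (simp only: mult.assoc)
    qed
    have b2: "norm \<delta> \<le> r * (c * M) * (\<tau> * p)"
    proof -
      have "norm \<delta> \<le> r * (norm (Wref d (Suc n) - Wref d n) * norm (erre d (Suc n)))"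
        unfolding \<delta>_def r_def by (rule norm_vinner_le)
      also have "\<dots> \<le> r * ((c * \<tau>) * (M * p))"
        using at_n(5) e' sr c \<tau> by (intro mult_left_mono mult_mono) (auto simp: p_def)
      finally show ?thesis by (simp only: mult_ac)
    qed
    have \<xi>0: "0 \<le> \<xi>" unfolding \<xi>_def by (intro real_sqrt_ge_zero sum_nonneg mult_nonneg_nonneg h_nonneg) auto
    define R where "R = A21 \<star> \<omega> + resd d n - (1 / 2) *\<^sub>R vinner (Wref d n) (rese d n) - (1 / 2) *\<^sub>R \<delta>"
    have "norm R \<le> norm (A21 \<star> \<omega>) + norm (resd d n) + norm (vinner (Wref d n) (rese d n)) + norm \<delta>"
    proof -
      have "norm R \<le> norm (A21 \<star> \<omega>) + norm (resd d n) + norm ((1 / 2) *\<^sub>R vinner (Wref d n) (rese d n)) + norm ((1 / 2) *\<^sub>R \<delta>)"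
        unfolding R_def by (intro norm_triangle_ineq[THEN order_trans] norm_triangle_ineq4[THEN order_trans] add_mono order_refl)
      moreover have "norm ((1 / 2) *\<^sub>R x) \<le> norm x" for x :: "real^'r" by simp
      ultimately show ?thesis by (smt (verit))
    qed
    also have "\<dots> \<le> Ka * (\<tau> * p) + Kb * \<xi>"
    proof -
      have "Ka * (\<tau> * p) + Kb * \<xi> = r * (Hs * K\<omega> * (\<tau> * p) + s * (Kh * c * \<xi>)) + c * (\<tau> * p)
          + r * (c * c) * (\<tau> * p) + r * (c * M) * (\<tau> * p)"
        by (simp add: Ka_def Kb_def algebra_simps)
      then show ?thesis using A21\<omega> b1 b2 at_n(4) res by linarith
    qed
    also have "\<dots> \<le> (Ka + Kb) * (\<tau> * p + \<xi>)"
      using Kab \<tau>p \<xi>0 by (simp add: algebra_simps)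
    finally have "Kc * norm R \<le> Kc * ((Ka + Kb) * (\<tau> * p + \<xi>))" using Kc by (intro mult_left_mono) auto
    moreover have "norm (Cg \<star> corrected d (Suc n)) \<le> norm (Cg \<star> corrected d n) + Kc * norm R"
      unfolding rec R_def[symmetric] mact_add
      using norm_triangle_ineq[of "Cg \<star> (A22 \<star> corrected d n)" "Cg \<star> R"] gnorm_A22[of "corrected d n"] Kc(2)[of R]
      by linarith
    ultimately show ?thesis unfolding p_def[symmetric] \<xi>_def[symmetric] by (simp only: mult.assoc)
  qed
  moreover have "Kc * (Ka + Kb) > 0" using Kc Kab by simp
  ultimately show ?thesis by blast
qed

end

context stable_scheme
begin

text \<open>
  The part \<open>X2\<close> of the increments is controlled only in quadratic mean over time, so Gronwall's lemma is applied
  to the squares of the levels: the sums over earlier steps of \<open>\<tau>\<close> times the level and of the weighted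
  norms of \<open>X2\<close>, when squared, are both bounded by \<open>\<tau>\<close> times the sum of the squared levels, by the
  Cauchy-Schwarz inequality and \<open>N \<tau> \<le> c\<close>.
\<close>

lemma level_bound:
  assumes c: "0 < c"
  shows "\<exists>K>0. \<exists>\<tau>0>0. \<forall>\<mu> \<tau> N d m. error_system c \<mu> \<tau> N d \<and> \<tau> < \<tau>0 \<and> 1 \<le> m \<and> m \<le> Suc N \<and>
      (\<forall>k. 1 \<le> k \<and> k < m \<longrightarrow> extr d k \<le> 1) \<longrightarrow> level \<mu> \<tau> d m \<le> K * \<tau> ^ \<mu>"
proof -
  obtain Kl \<tau>0 where Kl: "Kl > 0" and \<tau>0: "\<tau>0 > 0" and
    local: "\<And>\<mu> \<tau> N d n. error_system c \<mu> \<tau> N d \<Longrightarrow> \<tau> < \<tau>0 \<Longrightarrow> 1 \<le> n \<Longrightarrow> n \<le> N \<Longrightarrow> extr d n \<le> 1 \<Longrightarrow>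
     norm (src d n) \<le> Kl * level \<mu> \<tau> d n \<and> norm (errX d n) \<le> Kl * level \<mu> \<tau> d n \<and>
     norm (errE d n) \<le> Kl * (norm (erre d n) + \<tau> * level \<mu> \<tau> d n) \<and>
     norm (errD d n) \<le> Kl * level \<mu> \<tau> d n \<and> norm (erre d (Suc n)) \<le> Kl * level \<mu> \<tau> d n"
    using local_bounds[OF c] by blast
  obtain Ks where Ks: "Ks > 0" and
    split: "\<And>\<tau> N E X e \<rho> \<sigma> f. 0 < \<tau> \<Longrightarrow>
     (\<forall>n. 1 \<le> n \<and> n \<le> N \<longrightarrow> stage \<tau> (E n) (X n) (e n) (\<rho> n) (f n) \<and>
        e (Suc n) = A21 \<star> X n + A22 \<star> e n + \<sigma> n) \<Longrightarrow>
     (\<exists>X1 X2 :: nat \<Rightarrow> 'h^'s. \<forall>n. 1 \<le> n \<and> n \<le> N \<longrightarrow> X n = X1 n + X2 n \<and>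
        norm (X1 n) \<le> Ks * (norm (e 1) + (\<Sum>k=1..n. norm (\<rho> k) + norm (\<sigma> k))) \<and>
        (\<Sum>k=1..n. \<Sum>i\<in>UNIV. h $ i * (norm (X2 k $ i))\<^sup>2)
          \<le> 4 * \<tau>\<^sup>2 * (\<Sum>k=1..n. \<Sum>i\<in>UNIV. h $ i * (norm (f k $ i))\<^sup>2))"
    using splitting by blast
  define M where "M = Kl + Ks * (c + 2 * (c * c))"
  have M: "M > 0" using Kl Ks c by (simp add: M_def add_pos_pos)
  obtain K4 where K4: "K4 > 0" and
    corr: "\<And>\<mu> \<tau> N d n X1 X2. error_system c \<mu> \<tau> N d \<Longrightarrow> 1 \<le> n \<Longrightarrow> n \<le> N \<Longrightarrow> extr d n \<le> 1 \<Longrightarrow>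
      norm (erre d (Suc n)) \<le> M * level \<mu> \<tau> d n \<Longrightarrow> errX d n = X1 + X2 \<Longrightarrow> norm X1 \<le> M * \<tau> ^ \<mu> \<Longrightarrow>
      norm (Cg \<star> corrected d (Suc n)) \<le> norm (Cg \<star> corrected d n)
        + K4 * (\<tau> * level \<mu> \<tau> d n + sqrt (\<Sum>i\<in>UNIV. h $ i * (norm (X2 $ i))\<^sup>2))"
    using corrected_step[OF c M] by blast
  obtain K2 where K2: "K2 > 0" "\<And>\<tau> E X e \<rho> f \<sigma>. 0 \<le> \<tau> \<Longrightarrow> stage \<tau> E X e \<rho> f \<Longrightarrow>
     norm (Cg \<star> (A21 \<star> X + A22 \<star> e + \<sigma>)) \<le> norm (Cg \<star> e) + K2 * (norm \<rho> + norm \<sigma> + \<tau> * norm f)"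
    using step_bound by blast
  obtain Kg where Kg: "Kg > 0" "\<And>x :: 'h^'r. norm x \<le> Kg * norm (Cg \<star> x)"
    using norm_le_gnorm by blast
  obtain Kg' where Kg': "Kg' > 0" "\<And>x :: real^'r. norm x \<le> Kg' * norm (Cg \<star> x)"
    using norm_le_gnorm by blast
  obtain Kc where Kc: "Kc > 0" "\<And>x :: 'h^'r. norm (Cg \<star> x) \<le> Kc * norm x"
    using mact_bounded[of Cg, where ?'h='h] by blast
  obtain Kc' where Kc': "Kc' > 0" "\<And>x :: real^'r. norm (Cg \<star> x) \<le> Kc' * norm x"
    using mact_bounded[of Cg, where ?'h=real] by blast
  define H where "H = (\<Sum>i\<in>UNIV. h $ i)"
  have H: "H \<ge> 0" unfolding H_def by (intro sum_nonneg h_nonneg)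
  define r where "r = real CARD('r)"
  have r: "r \<ge> 1" by (simp add: r_def Suc_leI)
  define Ke where "Ke = Kg * (Kc * c + K2 * (2 * c + Kl))"
  define Kd where "Kd = Kg' * (Kc' * (c + r * (c * c)) + K4) + r * (c * Ke)"
  define Kt where "Kt = Ke + Kd"
  define Kw where "Kw = 3 * Kt\<^sup>2 * (1 + c + c * (4 * H * Kl\<^sup>2))"
  define Kp where "Kp = 3 * (c\<^sup>2 + 2 * Kl\<^sup>2 * (Kw + 1) + Kw + 1)"
  have Ke: "Ke > 0" using Kg Kc c K2 Kl by (simp add: Ke_def add_pos_pos)
  have Kd: "Kd > 0" using Kg' Kc' c r K4 Ke by (simp add: Kd_def add_pos_pos)
  have Kt: "Kt > 0" using Ke Kd by (simp add: Kt_def)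
  have Kw: "Kw \<ge> 0" using H c by (simp add: Kw_def)
  have Kp: "Kp > 0" using Kw by (simp add: Kp_def add_nonneg_pos)
  define K where "K = sqrt (Kp * exp (Kp * c))"
  have "level \<mu> \<tau> d m \<le> K * \<tau> ^ \<mu>"
    if sys: "error_system c \<mu> \<tau> N d" and small: "\<tau> < \<tau>0" and m: "1 \<le> m" "m \<le> Suc N"
      and ex: "\<And>k. 1 \<le> k \<Longrightarrow> k < m \<Longrightarrow> extr d k \<le> 1" for \<mu> \<tau> N d m
  proof -
    define p where "p n = level \<mu> \<tau> d n" for n
    define t where "t = \<tau> ^ \<mu>"
    from sys have \<tau>: "0 < \<tau>" "\<tau> \<le> 1" and \<mu>: "1 \<le> \<mu>" and N: "real N * \<tau> \<le> c" and
      init: "norm (errE d 0) \<le> c * t" "norm (erre d 1) \<le> c * t" "norm (errd d 1) \<le> c * t"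
      unfolding error_system_def t_def by blast+
    have t: "t > 0" using \<tau> by (simp add: t_def)
    note p = level_ge[OF \<tau>(1), where \<mu>=\<mu> and d=d, folded p_def t_def]
    have steps: "stage \<tau> (errE d k) (errX d k) (erre d k) (resE d k) (src d k)"
        "erre d (Suc k) = A21 \<star> errX d k + A22 \<star> erre d k + rese d k"
        "norm (resE d k) \<le> c * (\<tau> * t)" "norm (rese d k) \<le> c * (\<tau> * t)"
      if "1 \<le> k" "k \<le> N" for k
      using sys that unfolding error_system_def t_def power_Suc by blast+
    have loc: "norm (src d k) \<le> Kl * p k" "norm (errE d k) \<le> Kl * (norm (erre d k) + \<tau> * p k)"
      "norm (erre d (Suc k)) \<le> Kl * p k" if "1 \<le> k" "k < m" for k
      using local[OF sys small, of k] ex[of k] that m unfolding p_def by auto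
    have N1: "real (n - 1) * \<tau> \<le> c" if "n \<le> m" for n
    proof -
      have "real (n - 1) \<le> real N" using that m by simp
      then show ?thesis using N \<tau> mult_right_mono[of "real (n - 1)" "real N" \<tau>] by linarith
    qed
    define G where "G n = (\<Sum>k=1..<n. (p k)\<^sup>2)" for n
    define \<Phi> where "\<Phi> n = t\<^sup>2 + \<tau> * G n" for n
    define T1 where "T1 n = (\<Sum>k=1..<n. \<tau> * p k)" for n
    have G: "0 \<le> G n" for n unfolding G_def by (intro sum_nonneg) simp
    have T1: "0 \<le> T1 n" for n unfolding T1_def using \<tau> p(1) by (intro sum_nonneg) simp
    have T1sq: "(T1 n)\<^sup>2 \<le> c * (\<tau> * G n)" if n: "n \<le> m" for n
    proof -
      have "(T1 n)\<^sup>2 = \<tau>\<^sup>2 * (\<Sum>k=1..<n. p k)\<^sup>2"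
        by (simp add: T1_def sum_distrib_left[symmetric] power_mult_distrib)
      also have "\<dots> \<le> \<tau>\<^sup>2 * (real (n - 1) * G n)" unfolding G_def by (intro mult_left_mono sum_square_le) simp
      also have "\<dots> = (real (n - 1) * \<tau>) * (\<tau> * G n)" by (simp add: power2_eq_square)
      also have "\<dots> \<le> c * (\<tau> * G n)" using N1[OF n] G \<tau> by (intro mult_right_mono) auto
      finally show ?thesis .
    qed
    have e_bound: "norm (erre d n) \<le> Ke * (t + T1 n)" if n: "1 \<le> n" "n \<le> m" for n
    proof -
      have "norm (Cg \<star> erre d n) \<le> norm (Cg \<star> erre d 1) + (\<Sum>k=1..<n. (K2 * (2 * c + Kl)) * (\<tau> * p k))"
      proof (rule sum_upto_bound[where a="\<lambda>n. norm (Cg \<star> erre d n)", OF _ n])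
        fix k assume k: "1 \<le> k" "k < m"
        then have kN: "k \<le> N" using m by simp
        have "norm (resE d k) + norm (rese d k) + \<tau> * norm (src d k) \<le> (2 * c + Kl) * (\<tau> * p k)"
        proof -
          have "c * (\<tau> * t) \<le> c * (\<tau> * p k)" using c \<tau> p(5) by (intro mult_left_mono) auto
          moreover have "\<tau> * norm (src d k) \<le> \<tau> * (Kl * p k)" using loc(1)[OF k] \<tau> by (intro mult_left_mono) auto
          ultimately show ?thesis using steps(3,4)[OF k(1) kN] unfolding distrib_right
            by (simp add: mult.left_commute)
        qed
        then have "K2 * (norm (resE d k) + norm (rese d k) + \<tau> * norm (src d k)) \<le> K2 * ((2 * c + Kl) * (\<tau> * p k))"
          using K2 by (intro mult_left_mono) auto
        then show "norm (Cg \<star> erre d (Suc k)) \<le> norm (Cg \<star> erre d k) + (K2 * (2 * c + Kl)) * (\<tau> * p k)"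
          using K2(2)[OF less_imp_le[OF \<tau>(1)] steps(1)[OF k(1) kN], of "rese d k"]
          unfolding steps(2)[OF k(1) kN] mult.assoc by linarith
      qed
      also have "\<dots> \<le> Kc * (c * t) + (K2 * (2 * c + Kl)) * T1 n"
        using Kc(2)[of "erre d 1"] mult_left_mono[OF init(2) less_imp_le[OF Kc(1)]]
        unfolding T1_def sum_distrib_left[symmetric] by linarith
      also have "\<dots> \<le> (Kc * c + K2 * (2 * c + Kl)) * (t + T1 n)"
        using Kc c K2 Kl t T1[of n] by (simp add: algebra_simps)
      finally have "Kg * norm (Cg \<star> erre d n) \<le> Kg * ((Kc * c + K2 * (2 * c + Kl)) * (t + T1 n))"
        using Kg by (intro mult_left_mono) auto
      then show ?thesis using Kg(2)[of "erre d n"] unfolding Ke_def mult.assoc by linarith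
    qed
    from split[OF \<tau>(1), of N "errE d" "errX d" "erre d" "resE d" "src d" "rese d"] steps(1,2)
    obtain X1 X2 :: "nat \<Rightarrow> 'h^'s" where X: "\<And>n. 1 \<le> n \<Longrightarrow> n \<le> N \<Longrightarrow> errX d n = X1 n + X2 n \<and>
        norm (X1 n) \<le> Ks * (norm (erre d 1) + (\<Sum>k=1..n. norm (resE d k) + norm (rese d k))) \<and>
        (\<Sum>k=1..n. \<Sum>i\<in>UNIV. h $ i * (norm (X2 k $ i))\<^sup>2)
          \<le> 4 * \<tau>\<^sup>2 * (\<Sum>k=1..n. \<Sum>i\<in>UNIV. h $ i * (norm (src d k $ i))\<^sup>2)" by blast
    have X1: "norm (X1 n) \<le> M * t" if n: "1 \<le> n" "n \<le> N" for n
    proof -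
      have "(\<Sum>k=1..n. norm (resE d k) + norm (rese d k)) \<le> (\<Sum>k=1..n. 2 * (c * (\<tau> * t)))"
        using steps(3,4) n by (intro sum_mono) (smt (verit) atLeastAtMost_iff order_trans)
      also have "\<dots> = (real n * \<tau>) * (2 * c * t)" by simp
      also have "\<dots> \<le> c * (2 * c * t)"
      proof (rule mult_right_mono)
        have "real n * \<tau> \<le> real N * \<tau>" using n \<tau> by (intro mult_right_mono) auto
        then show "real n * \<tau> \<le> c" using N by linarith
      qed (use c t in simp)
      finally have "Ks * (norm (erre d 1) + (\<Sum>k=1..n. norm (resE d k) + norm (rese d k)))
          \<le> Ks * (c * t + c * (2 * c * t))"
        using init(2) Ks by (intro mult_left_mono add_mono) auto
      also have "\<dots> \<le> M * t" using Kl t by (simp add: M_def algebra_simps)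
      finally show ?thesis using X[OF n] by linarith
    qed
    define \<xi> where "\<xi> n = sqrt (\<Sum>i\<in>UNIV. h $ i * (norm (X2 n $ i))\<^sup>2)" for n
    have \<xi>2: "(\<xi> n)\<^sup>2 = (\<Sum>i\<in>UNIV. h $ i * (norm (X2 n $ i))\<^sup>2)" for n
      unfolding \<xi>_def using h_nonneg by (intro real_sqrt_pow2 sum_nonneg) auto
    define T2 where "T2 n = (\<Sum>k=1..<n. \<xi> k)" for n
    have T2: "0 \<le> T2 n" for n unfolding T2_def \<xi>_def using h_nonneg by (intro sum_nonneg) (auto intro!: sum_nonneg)
    \<comment> \<open>here the factor \<open>\<tau>\<^sup>2\<close> from \<open>splitting\<close> pays for both the number of steps and the factor \<open>\<tau>\<close> on the right\<close>
    have T2sq: "(T2 n)\<^sup>2 \<le> c * (4 * H * Kl\<^sup>2) * (\<tau> * G n)" if n: "1 \<le> n" "n \<le> m" for n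
    proof -
      have set: "{1..<n} = {1..n - 1}" using n by auto
      have "(\<Sum>k=1..<n. (\<xi> k)\<^sup>2) \<le> 4 * \<tau>\<^sup>2 * (\<Sum>k=1..<n. \<Sum>i\<in>UNIV. h $ i * (norm (src d k $ i))\<^sup>2)"
      proof (cases "n = 1")
        case False
        then show ?thesis unfolding set \<xi>2 using X[of "n - 1"] n m by auto
      qed simp
      also have "\<dots> \<le> 4 * \<tau>\<^sup>2 * (\<Sum>k=1..<n. H * (Kl\<^sup>2 * (p k)\<^sup>2))"
      proof (intro mult_left_mono sum_mono)
        fix k assume k: "k \<in> {1..<n}"
        have "h $ i * (norm (src d k $ i))\<^sup>2 \<le> h $ i * (Kl\<^sup>2 * (p k)\<^sup>2)" for i
        proof (rule mult_left_mono[OF _ h_nonneg])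
          have "norm (src d k $ i) \<le> Kl * p k"
            using Finite_Cartesian_Product.norm_nth_le[of "src d k" i] loc(1)[of k] k n by simp
          then have "(norm (src d k $ i))\<^sup>2 \<le> (Kl * p k)\<^sup>2" by (intro power_mono) auto
          then show "(norm (src d k $ i))\<^sup>2 \<le> Kl\<^sup>2 * (p k)\<^sup>2" by (simp add: power_mult_distrib)
        qed
        then have "(\<Sum>i\<in>UNIV. h $ i * (norm (src d k $ i))\<^sup>2) \<le> (\<Sum>i\<in>UNIV. h $ i * (Kl\<^sup>2 * (p k)\<^sup>2))"
          by (intro sum_mono) auto
        then show "(\<Sum>i\<in>UNIV. h $ i * (norm (src d k $ i))\<^sup>2) \<le> H * (Kl\<^sup>2 * (p k)\<^sup>2)"
          by (simp add: H_def sum_distrib_right)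
      qed simp
      also have "\<dots> = 4 * \<tau>\<^sup>2 * (H * (Kl\<^sup>2 * G n))" by (simp add: G_def sum_distrib_left[symmetric])
      finally have "real (n - 1) * (\<Sum>k=1..<n. (\<xi> k)\<^sup>2) \<le> real (n - 1) * (4 * \<tau>\<^sup>2 * (H * (Kl\<^sup>2 * G n)))"
        by (intro mult_left_mono) auto
      with sum_square_le[of \<xi> n] have "(T2 n)\<^sup>2 \<le> real (n - 1) * (4 * \<tau>\<^sup>2 * (H * (Kl\<^sup>2 * G n)))"
        unfolding T2_def by linarith
      also have "\<dots> = (real (n - 1) * \<tau>) * (4 * H * Kl\<^sup>2 * (\<tau> * G n))" by (simp add: power2_eq_square)
      also have "\<dots> \<le> c * (4 * H * Kl\<^sup>2 * (\<tau> * G n))" using N1[OF n(2)] G \<tau> H by (intro mult_right_mono) auto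
      finally show ?thesis by (simp only: mult.assoc)
    qed
    have d_bound: "norm (errd d n) \<le> Kd * (t + T1 n + T2 n)" if n: "1 \<le> n" "n \<le> m" for n
    proof -
      have Wn: "norm (Wref d n) \<le> c" if "1 \<le> n" "n \<le> m" for n
        using sys that m unfolding error_system_def by (meson le_trans)
      have v: "norm ((1 / 2) *\<^sub>R vinner (Wref d n) (erre d n)) \<le> r * (c * norm (erre d n))"
        if "1 \<le> n" "n \<le> m" for n
      proof -
        have "norm (vinner (Wref d n) (erre d n)) \<le> r * (norm (Wref d n) * norm (erre d n))"
          unfolding r_def by (rule norm_vinner_le)
        also have "\<dots> \<le> r * (c * norm (erre d n))"
          using Wn[OF that] r by (intro mult_left_mono mult_right_mono) auto
        moreover have "norm ((1 / 2) *\<^sub>R x) \<le> norm x" for x :: "real^'r" by simp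
        ultimately show ?thesis by (meson order_trans)
      qed
      have c1: "norm (corrected d 1) \<le> (c + r * (c * c)) * t"
      proof -
        have "r * (c * norm (erre d 1)) \<le> r * (c * (c * t))" using init(2) r c by (intro mult_left_mono) auto
        then show ?thesis
          using norm_triangle_ineq4[of "errd d 1" "(1 / 2) *\<^sub>R vinner (Wref d 1) (erre d 1)"] init(3) v[of 1] m
          unfolding corrected_def by (simp add: algebra_simps)
      qed
      have "norm (Cg \<star> corrected d n) \<le> norm (Cg \<star> corrected d 1) + (\<Sum>k=1..<n. K4 * (\<tau> * p k + \<xi> k))"
      proof (rule sum_upto_bound[where a="\<lambda>n. norm (Cg \<star> corrected d n)", OF _ n])
        fix k assume k: "1 \<le> k" "k < m"
        then have kN: "k \<le> N" using m by simp
        have "Kl * p k \<le> M * p k" using p(1) Ks c by (intro mult_right_mono) (auto simp: M_def)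
        then have "norm (erre d (Suc k)) \<le> M * level \<mu> \<tau> d k" using loc(3)[OF k] by (simp add: p_def)
        moreover have "errX d k = X1 k + X2 k" using X[OF k(1) kN] by blast
        ultimately show "norm (Cg \<star> corrected d (Suc k)) \<le> norm (Cg \<star> corrected d k) + K4 * (\<tau> * p k + \<xi> k)"
          using corr[OF sys k(1) kN ex[OF k]] X1[OF k(1) kN] unfolding p_def \<xi>_def t_def by blast
      qed
      also have "(\<Sum>k=1..<n. K4 * (\<tau> * p k + \<xi> k)) = K4 * (T1 n + T2 n)"
        by (simp add: T1_def T2_def sum_distrib_left[symmetric] sum.distrib)
      also have "norm (Cg \<star> corrected d 1) \<le> Kc' * ((c + r * (c * c)) * t)"
        using Kc'(2)[of "corrected d 1"] mult_left_mono[OF c1 less_imp_le[OF Kc'(1)]] by linarith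
      also have "Kc' * ((c + r * (c * c)) * t) + K4 * (T1 n + T2 n)
          \<le> (Kc' * (c + r * (c * c)) + K4) * (t + T1 n + T2 n)"
      proof -
        have "0 \<le> Kc' * (c + r * (c * c))" using Kc' c r by simp
        then have "0 \<le> Kc' * (c + r * (c * c)) * (T1 n + T2 n)" "0 \<le> K4 * t"
          using T1[of n] T2[of n] K4 t by (simp_all del: mult_nonneg_nonneg add: mult_nonneg_nonneg)
        then show ?thesis by (simp add: algebra_simps)
      qed
      finally have "Kg' * norm (Cg \<star> corrected d n) \<le> Kg' * ((Kc' * (c + r * (c * c)) + K4) * (t + T1 n + T2 n))"
        using Kg' by (intro mult_left_mono) auto
      then have "norm (corrected d n) \<le> Kg' * (Kc' * (c + r * (c * c)) + K4) * (t + T1 n + T2 n)"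
        using Kg'(2)[of "corrected d n"] unfolding mult.assoc by linarith
      moreover have "r * (c * norm (erre d n)) \<le> r * (c * (Ke * (t + T1 n + T2 n)))"
      proof -
        have "norm (erre d n) \<le> Ke * (t + T1 n + T2 n)"
          using e_bound[OF n] T2[of n] Ke by (simp add: distrib_left) (smt (verit) mult_nonneg_nonneg)
        then show ?thesis using r c by (intro mult_left_mono) auto
      qed
      moreover have "errd d n = corrected d n + (1 / 2) *\<^sub>R vinner (Wref d n) (erre d n)"
        by (simp add: corrected_def)
      then have "norm (errd d n) \<le> norm (corrected d n) + r * (c * norm (erre d n))"
        using norm_triangle_ineq[of "corrected d n" "(1 / 2) *\<^sub>R vinner (Wref d n) (erre d n)"] v[OF n] by simp
      moreover have "Kd * (t + T1 n + T2 n) = Kg' * (Kc' * (c + r * (c * c)) + K4) * (t + T1 n + T2 n)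
          + r * (c * (Ke * (t + T1 n + T2 n)))"
        by (simp only: Kd_def distrib_right mult.assoc)
      ultimately show ?thesis by linarith
    qed
    have s_bound: "(norm (erre d n) + norm (errd d n))\<^sup>2 \<le> Kw * \<Phi> n" if n: "1 \<le> n" "n \<le> m" for n
    proof -
      have "norm (erre d n) + norm (errd d n) \<le> Kt * (t + T1 n + T2 n)"
        using e_bound[OF n] d_bound[OF n] mult_nonneg_nonneg[OF less_imp_le[OF Ke] T2[of n]]
        by (simp add: Kt_def distrib_left distrib_right)
      then have "(norm (erre d n) + norm (errd d n))\<^sup>2 \<le> (Kt * (t + T1 n + T2 n))\<^sup>2"
        by (intro power_mono) auto
      also have "\<dots> = Kt\<^sup>2 * (t + T1 n + T2 n)\<^sup>2" by (rule power_mult_distrib)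
      also have "\<dots> \<le> Kt\<^sup>2 * (3 * (t\<^sup>2 + (T1 n)\<^sup>2 + (T2 n)\<^sup>2))" by (intro mult_left_mono three_squares) simp
      also have "\<dots> \<le> Kt\<^sup>2 * (3 * (t\<^sup>2 + c * (\<tau> * G n) + c * (4 * H * Kl\<^sup>2) * (\<tau> * G n)))"
        using T1sq[OF n(2)] T2sq[OF n] by (intro mult_left_mono) auto
      also have "\<dots> \<le> Kt\<^sup>2 * (3 * ((1 + c + c * (4 * H * Kl\<^sup>2)) * \<Phi> n))"
      proof -
        have "0 \<le> \<tau> * G n" "0 \<le> c * t\<^sup>2" "0 \<le> c * (4 * H * Kl\<^sup>2) * t\<^sup>2" using c H G \<tau> by auto
        then have "t\<^sup>2 + c * (\<tau> * G n) + c * (4 * H * Kl\<^sup>2) * (\<tau> * G n) \<le> (1 + c + c * (4 * H * Kl\<^sup>2)) * \<Phi> n"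
          unfolding \<Phi>_def distrib_left distrib_right mult_1_left by linarith
        then show ?thesis by (intro mult_left_mono) auto
      qed
      finally show ?thesis unfolding Kw_def by (simp only: mult_ac)
    qed
    have \<Phi>_mono: "\<Phi> (n - 1) + \<tau> * (p (n - 1))\<^sup>2 = \<Phi> n" if "2 \<le> n" for n
    proof -
      obtain k where "n = Suc (Suc k)" using \<open>2 \<le> n\<close> by (metis add_2_eq_Suc le_Suc_ex)
      then show ?thesis by (simp add: \<Phi>_def G_def distrib_left)
    qed
    have E_bound: "(norm (errE d (n - 1)))\<^sup>2 \<le> (c\<^sup>2 + 2 * Kl\<^sup>2 * (Kw + 1)) * \<Phi> n" if n: "1 \<le> n" "n \<le> m" for n
    proof (cases "n = 1")
      case True
      have "(norm (errE d 0))\<^sup>2 \<le> (c * t)\<^sup>2" using init(1) by (intro power_mono) auto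
      moreover have "\<Phi> 1 = t\<^sup>2" by (simp add: \<Phi>_def G_def)
      moreover have "0 \<le> 2 * Kl\<^sup>2 * (Kw + 1) * t\<^sup>2" using Kw by simp
      ultimately show ?thesis using True by (simp add: power_mult_distrib algebra_simps)
    next
      case False
      then have n2: "2 \<le> n" using n by simp
      have \<Phi>: "0 \<le> \<Phi> n" "\<Phi> (n - 1) \<le> \<Phi> n" "\<tau> * (p (n - 1))\<^sup>2 \<le> \<Phi> n"
      proof -
        have "0 \<le> \<Phi> k" for k using G[of k] \<tau> by (simp add: \<Phi>_def)
        moreover have "0 \<le> \<tau> * (p (n - 1))\<^sup>2" using \<tau> by simp
        ultimately show "0 \<le> \<Phi> n" "\<Phi> (n - 1) \<le> \<Phi> n" "\<tau> * (p (n - 1))\<^sup>2 \<le> \<Phi> n"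
          using \<Phi>_mono[OF n2] by (smt (verit))+
      qed
      have "norm (errE d (n - 1)) \<le> Kl * (norm (erre d (n - 1)) + \<tau> * p (n - 1))"
        using loc(2)[of "n - 1"] n2 n by simp
      then have "(norm (errE d (n - 1)))\<^sup>2 \<le> (Kl * (norm (erre d (n - 1)) + \<tau> * p (n - 1)))\<^sup>2"
        by (intro power_mono) auto
      also have "\<dots> \<le> Kl\<^sup>2 * (2 * ((norm (erre d (n - 1)))\<^sup>2 + (\<tau> * p (n - 1))\<^sup>2))"
      proof -
        have "(a + b)\<^sup>2 \<le> 2 * (a\<^sup>2 + b\<^sup>2)" for a b :: real
          using zero_le_power2[of "a - b"] by (simp add: power2_eq_square algebra_simps)
        then show ?thesis unfolding power_mult_distrib[of Kl] by (intro mult_left_mono) auto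
      qed
      also have "\<dots> \<le> Kl\<^sup>2 * (2 * (Kw * \<Phi> n + \<Phi> n))"
      proof -
        have "(norm (erre d (n - 1)))\<^sup>2 \<le> (norm (erre d (n - 1)) + norm (errd d (n - 1)))\<^sup>2"
          by (intro power_mono) auto
        also have "\<dots> \<le> Kw * \<Phi> (n - 1)" using s_bound[of "n - 1"] n2 n by simp
        also have "\<dots> \<le> Kw * \<Phi> n" using \<Phi> Kw by (intro mult_left_mono) auto
        finally have 1: "(norm (erre d (n - 1)))\<^sup>2 \<le> Kw * \<Phi> n" .
        have "(\<tau> * p (n - 1))\<^sup>2 = \<tau> * (\<tau> * (p (n - 1))\<^sup>2)" by (simp add: power2_eq_square mult_ac)
        also have "\<dots> \<le> \<tau> * (p (n - 1))\<^sup>2" using \<tau> by (intro mult_left_le_one_le) auto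
        finally have "(\<tau> * p (n - 1))\<^sup>2 \<le> \<Phi> n" using \<Phi>(3) by linarith
        with 1 show ?thesis by (intro mult_left_mono add_mono) auto
      qed
      also have "\<dots> \<le> (c\<^sup>2 + 2 * Kl\<^sup>2 * (Kw + 1)) * \<Phi> n" using \<Phi>(1) by (simp add: algebra_simps)
      finally show ?thesis .
    qed
    have "(p n)\<^sup>2 \<le> Kp * t\<^sup>2 + (Kp * \<tau>) * (\<Sum>k=1..<n. (p k)\<^sup>2)" if n: "1 \<le> n" "n \<le> m" for n
    proof -
      have "p n = norm (errE d (n - 1)) + (norm (erre d n) + norm (errd d n)) + t"
        by (simp add: p_def level_def t_def)
      then have "(p n)\<^sup>2 \<le> 3 * ((norm (errE d (n - 1)))\<^sup>2 + (norm (erre d n) + norm (errd d n))\<^sup>2 + t\<^sup>2)"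
        by (simp only: three_squares)
      also have "\<dots> \<le> 3 * ((c\<^sup>2 + 2 * Kl\<^sup>2 * (Kw + 1)) * \<Phi> n + Kw * \<Phi> n + \<Phi> n)"
      proof -
        have "t\<^sup>2 \<le> \<Phi> n" using G[of n] \<tau> by (simp add: \<Phi>_def)
        then show ?thesis using E_bound[OF n] s_bound[OF n] by (intro mult_left_mono add_mono) auto
      qed
      also have "\<dots> = Kp * \<Phi> n" by (simp add: Kp_def algebra_simps)
      also have "\<dots> = Kp * t\<^sup>2 + (Kp * \<tau>) * (\<Sum>k=1..<n. (p k)\<^sup>2)"
        by (simp add: \<Phi>_def G_def distrib_left)
      finally show ?thesis .
    qed
    from discrete_gronwall[of "Kp * \<tau>" m "\<lambda>n. (p n)\<^sup>2" "Kp * t\<^sup>2", OF _ this m(1)]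
    have "(p m)\<^sup>2 \<le> Kp * t\<^sup>2 * (1 + Kp * \<tau>) ^ (m - 1)" using Kp \<tau> by simp
    also have "\<dots> \<le> Kp * t\<^sup>2 * exp (Kp * c)"
    proof (rule mult_left_mono)
      have "(1 + Kp * \<tau>) ^ (m - 1) \<le> exp (Kp * \<tau>) ^ (m - 1)"
        using Kp \<tau> by (intro power_mono exp_ge_add_one_self) auto
      also have "\<dots> = exp (Kp * (real (m - 1) * \<tau>))" by (simp add: exp_of_nat_mult[symmetric] mult_ac)
      also have "\<dots> \<le> exp (Kp * c)" using N1[of m] Kp by simp
      finally show "(1 + Kp * \<tau>) ^ (m - 1) \<le> exp (Kp * c)" .
    qed (use Kp in simp)
    also have "\<dots> = (K * t)\<^sup>2" using Kp by (simp add: K_def power_mult_distrib)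
    finally have "p m \<le> K * t"
      by (rule power2_le_imp_le) (use Kp t in \<open>simp add: K_def\<close>)
    then show ?thesis by (simp add: p_def t_def)
  qed
  moreover have "K > 0" using Kp by (simp add: K_def)
  ultimately show ?thesis using \<tau>0 by blast
qed

text \<open>
  The condition \<open>extr d k \<le> 1\<close> is established by induction on the step: \<open>extr d k\<close> is bounded by the level at
  \<open>k\<close>, which \<open>level_bound\<close> estimates by \<open>\<tau>\<^sup>\<mu>\<close> using the condition for the steps before \<open>k\<close> only, and
  \<open>\<tau>\<^sup>\<mu> \<le> \<tau>\<close> is small.
\<close>

lemma error_bound:
  assumes c: "0 < c"
  shows "\<exists>K>0. \<exists>\<tau>0>0. \<forall>\<mu> \<tau> N d. error_system c \<mu> \<tau> N d \<and> \<tau> < \<tau>0 \<longrightarrow>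
      (\<forall>n. 1 \<le> n \<and> n \<le> N \<longrightarrow> norm (erre d (Suc n)) \<le> K * \<tau> ^ \<mu> \<and> norm (errd d (Suc n)) \<le> K * \<tau> ^ \<mu> \<and>
        norm (errE d n) \<le> K * \<tau> ^ \<mu> \<and> norm (errD d n) \<le> K * \<tau> ^ \<mu>)"
proof -
  obtain Kl \<tau>1 where Kl: "Kl > 0" and \<tau>1: "\<tau>1 > 0" and
    local: "\<And>\<mu> \<tau> N d n. error_system c \<mu> \<tau> N d \<Longrightarrow> \<tau> < \<tau>1 \<Longrightarrow> 1 \<le> n \<Longrightarrow> n \<le> N \<Longrightarrow> extr d n \<le> 1 \<Longrightarrow>
     norm (errD d n) \<le> Kl * level \<mu> \<tau> d n"
    using local_bounds[OF c] by blast
  obtain Kp \<tau>2 where Kp: "Kp > 0" and \<tau>2: "\<tau>2 > 0" and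
    lev: "\<And>\<mu> \<tau> N d m. error_system c \<mu> \<tau> N d \<Longrightarrow> \<tau> < \<tau>2 \<Longrightarrow> 1 \<le> m \<Longrightarrow> m \<le> Suc N \<Longrightarrow>
      (\<forall>k. 1 \<le> k \<and> k < m \<longrightarrow> extr d k \<le> 1) \<Longrightarrow> level \<mu> \<tau> d m \<le> Kp * \<tau> ^ \<mu>"
    using level_bound[OF c] by blast
  define \<tau>0 where "\<tau>0 = min \<tau>1 (min \<tau>2 (1 / (c * Kp)))"
  define K where "K = Kp + Kl * Kp"
  have "norm (erre d (Suc n)) \<le> K * \<tau> ^ \<mu> \<and> norm (errd d (Suc n)) \<le> K * \<tau> ^ \<mu> \<and>
        norm (errE d n) \<le> K * \<tau> ^ \<mu> \<and> norm (errD d n) \<le> K * \<tau> ^ \<mu>"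
    if sys: "error_system c \<mu> \<tau> N d" and small: "\<tau> < \<tau>0" and n: "1 \<le> n" "n \<le> N" for \<mu> \<tau> N d n
  proof -
    from sys have \<tau>: "0 < \<tau>" "\<tau> \<le> 1" and \<mu>: "1 \<le> \<mu>" unfolding error_system_def by blast+
    have \<tau>': "\<tau> < \<tau>1" "\<tau> < \<tau>2" "\<tau> < 1 / (c * Kp)" using small by (auto simp: \<tau>0_def)
    have ex: "extr d k \<le> 1" if "1 \<le> k" "k \<le> N" for k
      using that
    proof (induction k rule: less_induct)
      case (less k)
      have "extr d k \<le> c * (norm (errE d (k - 1)) + norm (erre d k) + \<tau> ^ \<mu>)"
        using sys less.prems unfolding error_system_def by blast
      also have "\<dots> \<le> c * level \<mu> \<tau> d k" using level_ge(6)[OF \<tau>(1)] c by (intro mult_left_mono) auto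
      also have "\<dots> \<le> c * (Kp * \<tau> ^ \<mu>)"
        using lev[OF sys \<tau>'(2), of k] less c by (intro mult_left_mono) auto
      also have "\<dots> \<le> c * (Kp * \<tau>)"
        using power_decreasing[OF \<mu>, of \<tau>] \<tau> c Kp by (intro mult_left_mono) auto
      also have "\<dots> \<le> 1" using \<tau>'(3) c Kp by (simp add: field_simps)
      finally show ?case .
    qed
    have l: "level \<mu> \<tau> d n \<le> Kp * \<tau> ^ \<mu>" "level \<mu> \<tau> d (Suc n) \<le> Kp * \<tau> ^ \<mu>"
      using lev[OF sys \<tau>'(2)] ex n by auto
    have "Kl * level \<mu> \<tau> d n \<le> Kl * (Kp * \<tau> ^ \<mu>)" using l(1) Kl by (intro mult_left_mono) auto
    then have "norm (errD d n) \<le> Kl * (Kp * \<tau> ^ \<mu>)" using local[OF sys \<tau>'(1) n ex[OF n]] by linarith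
    moreover have "0 \<le> Kp * \<tau> ^ \<mu>" "0 \<le> Kl * (Kp * \<tau> ^ \<mu>)" using Kp Kl \<tau> by auto
    ultimately show ?thesis
      using l(2) level_ge(2,3,4)[OF \<tau>(1), of d "Suc n" \<mu>] unfolding K_def by (auto simp: distrib_right)
  qed
  moreover have "K > 0" "\<tau>0 > 0" using Kp Kl c \<tau>1 \<tau>2 by (auto simp: K_def \<tau>0_def add_pos_pos)
  ultimately show ?thesis by blast
qed

end

section \<open>Taylor expansion of the residuals\<close>

text \<open>
  The \<open>j\<close>-th derivative of the monomial \<open>s\<^sup>k / k!\<close>, which is also the coefficient of the \<open>k\<close>-th derivative
  in the Taylor expansion of the \<open>j\<close>-th one.
\<close>

definition tay :: "nat \<Rightarrow> nat \<Rightarrow> real \<Rightarrow> real" where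
  "tay j k s = (if j \<le> k then s ^ (k - j) / fact (k - j) else 0)"

lemma tay_deriv: "(tay j k has_real_derivative tay (Suc j) k s) (at s within S)"
proof (cases "j < k")
  case True
  then obtain d where k: "k = Suc (j + d)" using less_imp_Suc_add by blast
  have "((\<lambda>s. s ^ Suc d / fact (Suc d)) has_real_derivative (real (Suc d) * s ^ (Suc d - Suc 0) / fact (Suc d))) (at s within S)"
    by (intro DERIV_cdivide DERIV_pow)
  then have "((\<lambda>s. s ^ Suc d / fact (Suc d)) has_real_derivative (real (Suc d) * s ^ d / fact (Suc d))) (at s within S)"
    by (simp only: diff_Suc_Suc diff_zero)
  also have "real (Suc d) * s ^ d / fact (Suc d) = s ^ d / (fact d :: real)"
    by (simp add: fact_Suc)
  finally show ?thesis by (simp add: tay_def[abs_def] k Suc_diff_le)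
next
  case False
  then have "tay j k = (\<lambda>s. if j = k then 1 else 0)" "tay (Suc j) k s = 0" by (auto simp: tay_def[abs_def])
  then show ?thesis by simp
qed

lemma tay_at_zero: "tay j k 0 = (if j = k then 1 else 0)"
  by (auto simp: tay_def)

lemma tay_self [simp]: "tay k k s = 1"
  by (simp add: tay_def)

lemma tay_0: "j > k \<Longrightarrow> tay j k s = 0"
  by (simp add: tay_def)

lemma tay_scale: "\<tau> ^ j * tay j k (s * \<tau>) = \<tau> ^ k * tay j k s"
  by (auto simp: tay_def power_mult_distrib power_add[symmetric])

text \<open>
  Downward induction on \<open>j\<close>: the remainder for \<open>j\<close> vanishes at \<open>t\<close> and its derivative is the remainder for
  \<open>j + 1\<close>, so the mean value inequality gains one power of \<open>\<bar>s - t\<bar>\<close>. The derivatives are one-sided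
  at the end points of \<open>J\<close>.
\<close>

lemma taylor_vector:
  fixes f :: "nat \<Rightarrow> real \<Rightarrow> 'h::real_normed_vector"
  assumes J: "is_interval J" and t: "t \<in> J"
    and der: "\<And>k x. k < p \<Longrightarrow> x \<in> J \<Longrightarrow> (f k has_vector_derivative f (Suc k) x) (at x within J)"
    and bd: "\<And>x. x \<in> J \<Longrightarrow> norm (f p x) \<le> B"
    and "j \<le> p" "s \<in> J"
  shows "norm (f j s - (\<Sum>k\<in>{j..<p}. tay j k (s - t) *\<^sub>R f k t)) \<le> B * \<bar>s - t\<bar> ^ (p - j)"
  using \<open>j \<le> p\<close> \<open>s \<in> J\<close>
proof (induction j arbitrary: s rule: inc_induct)
  case base
  then show ?case using bd by simp
next
  case (step j)
  define R where "R x = f j x - (\<Sum>k\<in>{j..<p}. tay j k (x - t) *\<^sub>R f k t)" for x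
  define R' where "R' x = f (Suc j) x - (\<Sum>k\<in>{Suc j..<p}. tay (Suc j) k (x - t) *\<^sub>R f k t)" for x
  let ?S = "closed_segment t s"
  have sub: "?S \<subseteq> J" using J t step.prems by (simp add: is_interval_convex_1 closed_segment_subset)
  have R: "(R has_vector_derivative R' x) (at x within ?S)" if "x \<in> ?S" for x
  proof -
    have "((\<lambda>x. tay j k (x - t)) has_real_derivative tay (Suc j) k (x - t)) (at x within ?S)" for k
      using DERIV_shift[of "tay j k" "tay (Suc j) k (x - t)" x "- t"] tay_deriv[of j k "x - t" UNIV]
      by (auto intro: has_field_derivative_at_within)
    then have "((\<lambda>x. tay j k (x - t) *\<^sub>R f k t) has_vector_derivative tay (Suc j) k (x - t) *\<^sub>R f k t) (at x within ?S)" for k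
      by (auto intro!: derivative_eq_intros simp: has_real_derivative_iff_has_vector_derivative)
    moreover have "(f j has_vector_derivative f (Suc j) x) (at x within ?S)"
      using der[of j x] step.hyps that sub by (auto intro: has_vector_derivative_within_subset)
    ultimately have "(R has_vector_derivative f (Suc j) x - (\<Sum>k\<in>{j..<p}. tay (Suc j) k (x - t) *\<^sub>R f k t)) (at x within ?S)"
      unfolding R_def by (intro has_vector_derivative_diff has_vector_derivative_sum)
    also have "(\<Sum>k\<in>{j..<p}. tay (Suc j) k (x - t) *\<^sub>R f k t) = (\<Sum>k\<in>{Suc j..<p}. tay (Suc j) k (x - t) *\<^sub>R f k t)"
      using step.hyps by (subst sum.atLeast_Suc_lessThan) (auto simp: tay_0)
    finally show ?thesis by (simp add: R'_def)
  qed
  have B: "0 \<le> B" using order_trans[OF norm_ge_zero bd[OF t]] .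
  have R': "norm (R' x) \<le> B * \<bar>s - t\<bar> ^ (p - Suc j)" if "x \<in> ?S" for x
  proof -
    have "norm (R' x) \<le> B * \<bar>x - t\<bar> ^ (p - Suc j)"
      unfolding R'_def using step.IH[of x] that sub by auto
    also have "\<dots> \<le> B * \<bar>s - t\<bar> ^ (p - Suc j)"
    proof -
      have "\<bar>x - t\<bar> \<le> \<bar>s - t\<bar>" using that by (auto simp: closed_segment_eq_real_ivl split: if_splits)
      then show ?thesis using B by (intro mult_left_mono power_mono) auto
    qed
    finally show ?thesis .
  qed
  have "norm (R s - R t) \<le> (B * \<bar>s - t\<bar> ^ (p - Suc j)) * norm (s - t)"
  proof (rule differentiable_bound[of ?S R "\<lambda>x h. h *\<^sub>R R' x"])
    show "(R has_derivative (\<lambda>h. h *\<^sub>R R' x)) (at x within ?S)" if "x \<in> ?S" for x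
      using R[OF that] by (simp add: has_vector_derivative_def)
    show "onorm (\<lambda>h. h *\<^sub>R R' x) \<le> B * \<bar>s - t\<bar> ^ (p - Suc j)" if "x \<in> ?S" for x
      using R'[OF that] B by (intro onorm_bound) (auto simp: mult.commute[of "\<bar>_\<bar>"] intro!: mult_right_mono)
  qed auto
  moreover have "R t = 0"
  proof -
    have "(\<Sum>k\<in>{j..<p}. tay j k (t - t) *\<^sub>R f k t) = (\<Sum>k\<in>{j..<p}. if k = j then f j t else 0)"
      by (intro sum.cong) (auto simp: tay_at_zero)
    then show ?thesis using step.hyps by (simp add: R_def)
  qed
  moreover have "p - j = Suc (p - Suc j)" using step.hyps by simp
  ultimately show ?case by (simp add: R_def mult_ac)
qed

text \<open>
  Taylor's formula is exact for polynomials of degree \<open>q\<close>.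
\<close>

lemma tay_add: "tay j q (t + s) = (\<Sum>k\<le>q. tay j k s * tay k q t)"
proof (cases "j \<le> q")
  case True
  have "norm (tay j q (t + s) - (\<Sum>k\<in>{j..<Suc q}. tay j k (t + s - t) *\<^sub>R tay k q t)) \<le> 0 * \<bar>t + s - t\<bar> ^ (Suc q - j)"
    by (rule taylor_vector[of UNIV t "Suc q" "\<lambda>k. tay k q"])
      (use True in \<open>auto simp: tay_0 tay_deriv has_real_derivative_iff_has_vector_derivative[symmetric]\<close>)
  then have "tay j q (t + s) = (\<Sum>k\<in>{j..<Suc q}. tay j k s * tay k q t)" by simp
  also have "\<dots> = (\<Sum>k\<le>q. tay j k s * tay k q t)"
    by (rule sum.mono_neutral_left) (auto simp: tay_0)
  finally show ?thesis .
qed (auto simp: tay_0 intro!: sum.neutral[symmetric])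

text \<open>
  The function \<open>f k\<close> is the \<open>k\<close>-th derivative of \<open>f 0\<close>, and \<open>B\<close> is a common bound of the derivatives.
\<close>

definition smooth_family :: "real set \<Rightarrow> nat \<Rightarrow> real \<Rightarrow> (nat \<Rightarrow> real \<Rightarrow> 'h::real_normed_vector) \<Rightarrow> bool" where
  "smooth_family J m B f \<longleftrightarrow> (\<forall>k\<le>m. \<forall>t\<in>J. norm (f k t) \<le> B) \<and>
     (\<forall>k<m. \<forall>t\<in>J. (f k has_vector_derivative f (Suc k) t) (at t within J))"

text \<open>
  \<open>\<Phi> f \<tau> t\<close> stands for a linear expression in \<open>\<tau>\<^sup>j f\<^sup>(\<^sup>j\<^sup>)(t + s \<tau>)\<close> with \<open>s \<in> S\<close>, and \<open>a k\<close> for the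
  coefficient of \<open>\<tau>\<^sup>k f\<^sup>(\<^sup>k\<^sup>)(t)\<close> in its expansion. The constant is uniform in \<open>f\<close>, which enters through
  the bound \<open>B\<close> only; the residuals of all time steps are thus estimated at once.
\<close>

definition remainder_bound ::
    "real \<Rightarrow> nat \<Rightarrow> nat \<Rightarrow> real set \<Rightarrow> ((nat \<Rightarrow> real \<Rightarrow> 'h::real_normed_vector) \<Rightarrow> real \<Rightarrow> real \<Rightarrow> 'h) \<Rightarrow>
     (nat \<Rightarrow> real) \<Rightarrow> bool" where
  "remainder_bound C m p S \<Phi> a \<longleftrightarrow> (\<forall>J B f \<tau> t. is_interval J \<and> smooth_family J m B f \<and> 0 < \<tau> \<and> \<tau> \<le> 1 \<and>
     t \<in> J \<and> (\<forall>s\<in>S. t + s * \<tau> \<in> J) \<longrightarrow>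
     norm (\<Phi> f \<tau> t - (\<Sum>k<p. (\<tau> ^ k * a k) *\<^sub>R f k t)) \<le> C * B * \<tau> ^ p)"

definition expands ::
    "nat \<Rightarrow> nat \<Rightarrow> real set \<Rightarrow> ((nat \<Rightarrow> real \<Rightarrow> 'h::real_normed_vector) \<Rightarrow> real \<Rightarrow> real \<Rightarrow> 'h) \<Rightarrow> (nat \<Rightarrow> real) \<Rightarrow> bool" where
  "expands m p S \<Phi> a \<longleftrightarrow> (\<exists>C\<ge>0. remainder_bound C m p S \<Phi> a)"

lemma remainder_boundI:
  assumes "\<And>J B f \<tau> t. is_interval J \<Longrightarrow> smooth_family J m B f \<Longrightarrow> 0 < \<tau> \<Longrightarrow> \<tau> \<le> 1 \<Longrightarrow> t \<in> J \<Longrightarrow>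
     (\<And>s. s \<in> S \<Longrightarrow> t + s * \<tau> \<in> J) \<Longrightarrow> 0 \<le> B \<Longrightarrow>
     norm (\<Phi> f \<tau> t - (\<Sum>k<p. (\<tau> ^ k * a k) *\<^sub>R f k t)) \<le> C * B * \<tau> ^ p"
  shows "remainder_bound C m p S \<Phi> a"
  unfolding remainder_bound_def
proof (intro allI impI)
  fix J B \<tau> t and f :: "nat \<Rightarrow> real \<Rightarrow> 'a"
  assume *: "is_interval J \<and> smooth_family J m B f \<and> 0 < \<tau> \<and> \<tau> \<le> 1 \<and> t \<in> J \<and> (\<forall>s\<in>S. t + s * \<tau> \<in> J)"
  then have "norm (f 0 t) \<le> B" unfolding smooth_family_def by blast
  then have "0 \<le> B" by (rule order_trans[OF norm_ge_zero])
  with * show "norm (\<Phi> f \<tau> t - (\<Sum>k<p. (\<tau> ^ k * a k) *\<^sub>R f k t)) \<le> C * B * \<tau> ^ p"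
    by (intro assms[where J=J]) simp_all
qed

lemma remainder_boundD:
  assumes "remainder_bound C m p S \<Phi> a" "is_interval J" "smooth_family J m B f" "0 < \<tau>" "\<tau> \<le> 1" "t \<in> J"
    "\<And>s. s \<in> S \<Longrightarrow> t + s * \<tau> \<in> J"
  shows "norm (\<Phi> f \<tau> t - (\<Sum>k<p. (\<tau> ^ k * a k) *\<^sub>R f k t)) \<le> C * B * \<tau> ^ p"
  using assms(1)[unfolded remainder_bound_def, rule_format, of J B f \<tau> t] assms(2-) by simp

lemma expandsI: "0 \<le> C \<Longrightarrow> remainder_bound C m p S \<Phi> a \<Longrightarrow> expands m p S \<Phi> a"
  by (auto simp: expands_def)

lemma expands_atom:
  assumes s: "s \<in> S" and j: "j \<le> m" and p: "p \<le> m"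
  shows "expands m p S (\<lambda>f \<tau> t. \<tau> ^ j *\<^sub>R f j (t + s * \<tau>)) (\<lambda>k. tay j k s)"
proof (rule expandsI[of "max 1 \<bar>s\<bar> ^ p"], simp, rule remainder_boundI)
  fix J B \<tau> t and f :: "nat \<Rightarrow> real \<Rightarrow> 'a"
  assume J: "is_interval J" and sm: "smooth_family J m B f" and \<tau>: "0 < \<tau>" "\<tau> \<le> 1" and t: "t \<in> J"
    and S: "\<And>s. s \<in> S \<Longrightarrow> t + s * \<tau> \<in> J" and B: "0 \<le> B"
  have s1: "1 \<le> max 1 \<bar>s\<bar> ^ p" by (rule one_le_power) simp
  show "norm (\<tau> ^ j *\<^sub>R f j (t + s * \<tau>) - (\<Sum>k<p. (\<tau> ^ k * tay j k s) *\<^sub>R f k t)) \<le> max 1 \<bar>s\<bar> ^ p * B * \<tau> ^ p"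
  proof (cases "j \<le> p")
    case True
    have "(\<Sum>k<p. (\<tau> ^ k * tay j k s) *\<^sub>R f k t) = (\<Sum>k\<in>{j..<p}. (\<tau> ^ k * tay j k s) *\<^sub>R f k t)"
      by (rule sum.mono_neutral_right) (auto simp: tay_0)
    also have "\<dots> = \<tau> ^ j *\<^sub>R (\<Sum>k\<in>{j..<p}. tay j k (t + s * \<tau> - t) *\<^sub>R f k t)"
      by (simp add: scaleR_sum_right tay_scale)
    finally have "norm (\<tau> ^ j *\<^sub>R f j (t + s * \<tau>) - (\<Sum>k<p. (\<tau> ^ k * tay j k s) *\<^sub>R f k t))
        = \<tau> ^ j * norm (f j (t + s * \<tau>) - (\<Sum>k\<in>{j..<p}. tay j k (t + s * \<tau> - t) *\<^sub>R f k t))"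
      using \<tau> by (simp only: scaleR_diff_right[symmetric] norm_scaleR) simp
    also have "\<dots> \<le> \<tau> ^ j * (B * \<bar>t + s * \<tau> - t\<bar> ^ (p - j))"
      using sm p \<tau> J t S[OF s] True unfolding smooth_family_def by (intro mult_left_mono taylor_vector) auto
    also have "\<dots> = B * (\<bar>s\<bar> ^ (p - j) * \<tau> ^ p)"
      using \<tau> True by (simp add: abs_mult power_mult_distrib mult_ac power_add[symmetric])
    also have "\<dots> \<le> B * (max 1 \<bar>s\<bar> ^ p * \<tau> ^ p)"
    proof -
      have "\<bar>s\<bar> ^ (p - j) \<le> max 1 \<bar>s\<bar> ^ (p - j)" by (intro power_mono) auto
      also have "\<dots> \<le> max 1 \<bar>s\<bar> ^ p" by (intro power_increasing) auto
      finally show ?thesis using B \<tau> by (intro mult_left_mono mult_right_mono) auto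
    qed
    finally show ?thesis by (simp add: mult_ac)
  next
    case False
    then have "(\<Sum>k<p. (\<tau> ^ k * tay j k s) *\<^sub>R f k t) = 0" by (intro sum.neutral) (auto simp: tay_0)
    then have "norm (\<tau> ^ j *\<^sub>R f j (t + s * \<tau>) - (\<Sum>k<p. (\<tau> ^ k * tay j k s) *\<^sub>R f k t)) = \<tau> ^ j * norm (f j (t + s * \<tau>))"
      using \<tau> by simp
    also have "\<dots> \<le> \<tau> ^ p * B"
      using False \<tau> sm j S[OF s] unfolding smooth_family_def by (intro mult_mono power_decreasing) auto
    also have "\<dots> \<le> max 1 \<bar>s\<bar> ^ p * (\<tau> ^ p * B)"
      using mult_right_mono[OF s1, of "\<tau> ^ p * B"] B \<tau> by simp
    finally show ?thesis by (simp add: mult_ac)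
  qed
qed

lemma expands_scale:
  assumes "expands m p S \<Phi> a"
  shows "expands m p S (\<lambda>f \<tau> t. r *\<^sub>R \<Phi> f \<tau> t) (\<lambda>k. r * a k)"
proof -
  from assms obtain C where C: "0 \<le> C" and "remainder_bound C m p S \<Phi> a"
    by (auto simp: expands_def)
  note b = remainder_boundD[OF this(2)]
  show ?thesis
  proof (rule expandsI[of "\<bar>r\<bar> * C"], use C in simp, rule remainder_boundI)
    fix J B \<tau> t and f :: "nat \<Rightarrow> real \<Rightarrow> 'a"
    assume *: "is_interval J" "smooth_family J m B f" "0 < \<tau>" "\<tau> \<le> 1" "t \<in> J" "\<And>s. s \<in> S \<Longrightarrow> t + s * \<tau> \<in> J"
    have "r *\<^sub>R \<Phi> f \<tau> t - (\<Sum>k<p. (\<tau> ^ k * (r * a k)) *\<^sub>R f k t) = r *\<^sub>R (\<Phi> f \<tau> t - (\<Sum>k<p. (\<tau> ^ k * a k) *\<^sub>R f k t))"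
      by (simp add: scaleR_diff_right scaleR_sum_right mult_ac)
    then show "norm (r *\<^sub>R \<Phi> f \<tau> t - (\<Sum>k<p. (\<tau> ^ k * (r * a k)) *\<^sub>R f k t)) \<le> \<bar>r\<bar> * C * B * \<tau> ^ p"
      using mult_left_mono[OF b[OF *], of "\<bar>r\<bar>"] by (simp add: mult.assoc)
  qed
qed

lemma expands_add:
  assumes "expands m p S \<Phi> a" "expands m p S \<Psi> b"
  shows "expands m p S (\<lambda>f \<tau> t. \<Phi> f \<tau> t + \<Psi> f \<tau> t) (\<lambda>k. a k + b k)"
proof -
  from assms(1) obtain C where C: "0 \<le> C" and "remainder_bound C m p S \<Phi> a"
    by (auto simp: expands_def)
  note c = remainder_boundD[OF this(2)]
  from assms(2) obtain D where D: "0 \<le> D" and "remainder_bound D m p S \<Psi> b"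
    by (auto simp: expands_def)
  note d = remainder_boundD[OF this(2)]
  show ?thesis
  proof (rule expandsI[of "C + D"], use C D in simp, rule remainder_boundI)
    fix J B \<tau> t and f :: "nat \<Rightarrow> real \<Rightarrow> 'a"
    assume *: "is_interval J" "smooth_family J m B f" "0 < \<tau>" "\<tau> \<le> 1" "t \<in> J" "\<And>s. s \<in> S \<Longrightarrow> t + s * \<tau> \<in> J"
    have eq: "\<Phi> f \<tau> t + \<Psi> f \<tau> t - (\<Sum>k<p. (\<tau> ^ k * (a k + b k)) *\<^sub>R f k t)
        = (\<Phi> f \<tau> t - (\<Sum>k<p. (\<tau> ^ k * a k) *\<^sub>R f k t)) + (\<Psi> f \<tau> t - (\<Sum>k<p. (\<tau> ^ k * b k) *\<^sub>R f k t))"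
      by (simp add: distrib_left scaleR_add_left sum.distrib)
    show "norm (\<Phi> f \<tau> t + \<Psi> f \<tau> t - (\<Sum>k<p. (\<tau> ^ k * (a k + b k)) *\<^sub>R f k t)) \<le> (C + D) * B * \<tau> ^ p"
      unfolding eq distrib_right by (rule norm_triangle_le[OF add_mono[OF c[OF *] d[OF *]]])
  qed
qed

lemma expands_diff:
  assumes "expands m p S \<Phi> a" "expands m p S \<Psi> b"
  shows "expands m p S (\<lambda>f \<tau> t. \<Phi> f \<tau> t - \<Psi> f \<tau> t) (\<lambda>k. a k - b k)"
  using expands_add[OF assms(1) expands_scale[OF assms(2), of "- 1"]] by simp

lemma expands_zero: "expands m p S (\<lambda>f \<tau> t. 0) (\<lambda>k. 0)"
  by (rule expandsI[of 0], simp, rule remainder_boundI) simp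

lemma expands_sum:
  assumes "finite I" "\<And>i. i \<in> I \<Longrightarrow> expands m p S (\<Phi> i) (a i)"
  shows "expands m p S (\<lambda>f \<tau> t. \<Sum>i\<in>I. \<Phi> i f \<tau> t) (\<lambda>k. \<Sum>i\<in>I. a i k)"
  using assms
proof (induction I rule: finite_induct)
  case empty
  then show ?case by (simp add: expands_zero)
next
  case (insert i I)
  then show ?case using expands_add[of m p S "\<Phi> i" "a i"] by simp
qed

text \<open>
  The summands of the residuals. With the power of \<open>\<tau>\<close> included, the coefficients of their expansions
  are free of \<open>\<tau>\<close>.
\<close>

definition node :: "nat \<Rightarrow> real \<Rightarrow> (nat \<Rightarrow> real \<Rightarrow> 'h::real_vector) \<Rightarrow> real \<Rightarrow> real \<Rightarrow> 'h" where
  "node j s f \<tau> t = \<tau> ^ j *\<^sub>R f j (t + s * \<tau>)"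

lemma expands_node: "s \<in> S \<Longrightarrow> j \<le> m \<Longrightarrow> p \<le> m \<Longrightarrow> expands m p S (node j s) (\<lambda>k. tay j k s)"
  using expands_atom[of s S j m p] by (simp add: node_def[abs_def])

text \<open>
  \<open>wvec M k\<close> has a meaning only for \<open>k \<le> wdeg M\<close>, while the stage order may exceed \<open>wdeg M\<close>.
\<close>

definition wext :: "('s::finite, 'r::finite) gltd \<Rightarrow> nat \<Rightarrow> real^'r" where
  "wext M k = (if k \<le> wdeg M then wvec M k else 0)"

text \<open>
  The coefficients up to order \<open>q\<close> of the two residuals below vanish, for the external values
  \<open>\<Sum>\<^sub>l\<^sub>\<le>\<^sub>q w\<^sub>l \<tau>\<^sup>l u\<^sup>(\<^sup>l\<^sup>)\<close>. The vectors \<open>w\<^sub>l\<close> need not be those of the method.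
\<close>

definition order_conditions :: "('s::finite, 'r::finite) gltd \<Rightarrow> (nat \<Rightarrow> real^'r) \<Rightarrow> nat \<Rightarrow> bool" where
  "order_conditions M w q \<longleftrightarrow> (\<forall>k\<le>q.
     (\<forall>i. tay 0 k (absc M $ i) = (\<Sum>j\<in>UNIV. D11 M $ i $ j * tay 1 k (absc M $ j)) + (\<Sum>j\<in>UNIV. D12 M $ i $ j * w k $ j)) \<and>
     (\<forall>i. (\<Sum>l\<le>q. w l $ i * tay l k 1) = (\<Sum>j\<in>UNIV. D21 M $ i $ j * tay 1 k (absc M $ j)) + (\<Sum>j\<in>UNIV. D22 M $ i $ j * w k $ j)))"

definition stage_residual ::
    "('s::finite, 'r::finite) gltd \<Rightarrow> (nat \<Rightarrow> real^'r) \<Rightarrow> nat \<Rightarrow> 's \<Rightarrow> (nat \<Rightarrow> real \<Rightarrow> 'h::real_vector) \<Rightarrow> real \<Rightarrow> real \<Rightarrow> 'h" where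
  "stage_residual M w q i f \<tau> t = node 0 (absc M $ i) f \<tau> t
     - ((\<Sum>j\<in>UNIV. D11 M $ i $ j *\<^sub>R node 1 (absc M $ j) f \<tau> t)
        + (\<Sum>j\<in>UNIV. D12 M $ i $ j *\<^sub>R (\<Sum>l\<le>q. w l $ j *\<^sub>R node l 0 f \<tau> t)))"

definition step_residual ::
    "('s::finite, 'r::finite) gltd \<Rightarrow> (nat \<Rightarrow> real^'r) \<Rightarrow> nat \<Rightarrow> 'r \<Rightarrow> (nat \<Rightarrow> real \<Rightarrow> 'h::real_vector) \<Rightarrow> real \<Rightarrow> real \<Rightarrow> 'h" where
  "step_residual M w q i f \<tau> t = (\<Sum>l\<le>q. w l $ i *\<^sub>R node l 1 f \<tau> t)
     - ((\<Sum>j\<in>UNIV. D21 M $ i $ j *\<^sub>R node 1 (absc M $ j) f \<tau> t)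
        + (\<Sum>j\<in>UNIV. D22 M $ i $ j *\<^sub>R (\<Sum>l\<le>q. w l $ j *\<^sub>R node l 0 f \<tau> t)))"

text \<open>
  The external values \<open>u\<^sub>i(t)\<close> of the method minus those for which the residuals are small.
\<close>

definition modification ::
    "('s::finite, 'r::finite) gltd \<Rightarrow> (nat \<Rightarrow> real^'r) \<Rightarrow> nat \<Rightarrow> 'r \<Rightarrow> (nat \<Rightarrow> real \<Rightarrow> 'h::real_vector) \<Rightarrow> real \<Rightarrow> real \<Rightarrow> 'h" where
  "modification M w q i f \<tau> t = (\<Sum>l\<le>wdeg M. wvec M l $ i *\<^sub>R node l 0 f \<tau> t) - (\<Sum>l\<le>q. w l $ i *\<^sub>R node l 0 f \<tau> t)"

definition extrapolation_residual ::
    "('s::finite, 'r::finite) gltd \<Rightarrow> real^'s^'s \<Rightarrow> real^'r^'s \<Rightarrow> 's \<Rightarrow> (nat \<Rightarrow> real \<Rightarrow> 'h::real_vector) \<Rightarrow> real \<Rightarrow> real \<Rightarrow> 'h" where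
  "extrapolation_residual M \<alpha> \<beta> i f \<tau> t = node 0 (1 + absc M $ i) f \<tau> t
     - ((\<Sum>j\<in>UNIV. \<alpha> $ i $ j *\<^sub>R node 0 (absc M $ j) f \<tau> t)
        + (\<Sum>j\<in>UNIV. \<beta> $ i $ j *\<^sub>R (\<Sum>l\<le>wdeg M. wvec M l $ j *\<^sub>R node l 1 f \<tau> t)))"

lemma sum_tay_at_zero: "(\<Sum>l\<le>q. w l * tay l k 0) = (if k \<le> q then w k else 0)"
  by (simp add: tay_at_zero if_distrib[where f="\<lambda>x. _ * x"] cong: if_cong)

definition negligible_by ::
    "real \<Rightarrow> real set \<Rightarrow> nat \<Rightarrow> nat \<Rightarrow> ((nat \<Rightarrow> real \<Rightarrow> 'h::real_normed_vector) \<Rightarrow> real \<Rightarrow> real \<Rightarrow> 'h) \<Rightarrow> bool" where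
  "negligible_by C S m p \<Phi> \<longleftrightarrow> (\<forall>J B f \<tau> t. is_interval J \<and> smooth_family J m B f \<and> 0 < \<tau> \<and> \<tau> \<le> 1 \<and> t \<in> J \<and>
     (\<forall>s\<in>S. t + s * \<tau> \<in> J) \<longrightarrow> norm (\<Phi> f \<tau> t) \<le> C * B * \<tau> ^ p)"

definition negligible ::
    "real set \<Rightarrow> nat \<Rightarrow> nat \<Rightarrow> ((nat \<Rightarrow> real \<Rightarrow> 'h::real_normed_vector) \<Rightarrow> real \<Rightarrow> real \<Rightarrow> 'h) \<Rightarrow> bool" where
  "negligible S m p \<Phi> \<longleftrightarrow> (\<exists>C\<ge>0. negligible_by C S m p \<Phi>)"

lemma negligibleI:
  assumes "expands m p S \<Phi> a" "\<And>k. k < p \<Longrightarrow> a k = 0"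
  shows "negligible S m p \<Phi>"
proof -
  have "(\<Sum>k<p. (\<tau> ^ k * a k) *\<^sub>R f k t) = 0" for \<tau> t and f :: "nat \<Rightarrow> real \<Rightarrow> 'a"
    using assms(2) by (intro sum.neutral) auto
  then show ?thesis
    using assms(1) unfolding expands_def remainder_bound_def negligible_def negligible_by_def by simp
qed

lemma negligible_byD:
  assumes "negligible_by C S m p \<Phi>" "is_interval J" "smooth_family J m B f" "0 < \<tau>" "\<tau> \<le> 1" "t \<in> J"
    "\<And>s. s \<in> S \<Longrightarrow> t + s * \<tau> \<in> J"
  shows "norm (\<Phi> f \<tau> t) \<le> C * B * \<tau> ^ p"
  using assms(1)[unfolded negligible_by_def, rule_format, of J B f \<tau> t] assms(2-) by simp

lemma negligible_uniform:
  fixes \<Phi> :: "'i::finite \<Rightarrow> (nat \<Rightarrow> real \<Rightarrow> 'h::real_normed_vector) \<Rightarrow> real \<Rightarrow> real \<Rightarrow> 'h"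
  assumes "\<And>i. negligible S m p (\<Phi> i)"
  shows "\<exists>C\<ge>0. \<forall>i. negligible_by C S m p (\<Phi> i)"
proof -
  have "\<forall>i. \<exists>C. 0 \<le> C \<and> negligible_by C S m p (\<Phi> i)" using assms by (simp add: negligible_def)
  from choice[OF this] obtain c where c0: "\<And>i. 0 \<le> c i" and c: "\<And>i. negligible_by (c i) S m p (\<Phi> i)" by blast
  have "negligible_by (sum c UNIV) S m p (\<Phi> i)" for i
    unfolding negligible_by_def
  proof (intro allI impI)
    fix J B \<tau> t and f :: "nat \<Rightarrow> real \<Rightarrow> 'h"
    assume *: "is_interval J \<and> smooth_family J m B f \<and> 0 < \<tau> \<and> \<tau> \<le> 1 \<and> t \<in> J \<and> (\<forall>s\<in>S. t + s * \<tau> \<in> J)"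
    then have "norm (f 0 t) \<le> B" unfolding smooth_family_def by blast
    then have B: "0 \<le> B" by (rule order_trans[OF norm_ge_zero])
    have "norm (\<Phi> i f \<tau> t) \<le> c i * B * \<tau> ^ p" using * by (intro negligible_byD[OF c, where J=J]) simp_all
    also have "\<dots> \<le> sum c UNIV * B * \<tau> ^ p"
      using * B c0 by (intro mult_right_mono member_le_sum) auto
    finally show "norm (\<Phi> i f \<tau> t) \<le> sum c UNIV * B * \<tau> ^ p" .
  qed
  then show ?thesis using c0 by (intro exI[of _ "sum c UNIV"]) (simp add: sum_nonneg)
qed

lemma stage_residual_small:
  assumes "order_conditions M w q" "q < m"
  shows "negligible (insert 0 (range (($) (absc M)))) m (q + 1) (stage_residual M w q i)"
proof (rule negligibleI)
  show "expands m (q + 1) (insert 0 (range (($) (absc M)))) (stage_residual M w q i) (\<lambda>k. tay 0 k (absc M $ i)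
     - ((\<Sum>j\<in>UNIV. D11 M $ i $ j * tay 1 k (absc M $ j)) + (\<Sum>j\<in>UNIV. D12 M $ i $ j * (\<Sum>l\<le>q. w l $ j * tay l k 0))))"
    unfolding stage_residual_def
    using assms(2) by (intro expands_diff expands_add expands_sum expands_scale expands_node) auto
qed (use assms(1) in \<open>simp add: order_conditions_def sum_tay_at_zero\<close>)

lemma step_residual_small:
  assumes "order_conditions M w q" "q < m"
  shows "negligible (insert 0 (insert 1 (range (($) (absc M))))) m (q + 1) (step_residual M w q i)"
proof (rule negligibleI)
  show "expands m (q + 1) (insert 0 (insert 1 (range (($) (absc M))))) (step_residual M w q i) (\<lambda>k. (\<Sum>l\<le>q. w l $ i * tay l k 1)
     - ((\<Sum>j\<in>UNIV. D21 M $ i $ j * tay 1 k (absc M $ j)) + (\<Sum>j\<in>UNIV. D22 M $ i $ j * (\<Sum>l\<le>q. w l $ j * tay l k 0))))"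
    unfolding step_residual_def
    using assms(2) by (intro expands_diff expands_add expands_sum expands_scale expands_node) auto
qed (use assms(1) in \<open>simp add: order_conditions_def sum_tay_at_zero\<close>)

lemma modification_small:
  assumes "\<And>k. k < q \<Longrightarrow> w k = wext M k" "q \<le> m" "wdeg M \<le> m"
  shows "negligible {0} m q (modification M w q i)"
proof (rule negligibleI)
  show "expands m q {0} (modification M w q i) (\<lambda>k. (\<Sum>l\<le>wdeg M. wvec M l $ i * tay l k 0) - (\<Sum>l\<le>q. w l $ i * tay l k 0))"
    unfolding modification_def
    using assms(2,3) by (intro expands_diff expands_sum expands_scale expands_node) auto
qed (use assms(1) in \<open>simp add: sum_tay_at_zero wext_def\<close>)

lemma extrapolation_residual_small:
  assumes "\<And>k. k < \<nu> \<Longrightarrow> tay 0 k (1 + absc M $ i) = (\<Sum>j\<in>UNIV. \<alpha> $ i $ j * tay 0 k (absc M $ j))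
       + (\<Sum>j\<in>UNIV. \<beta> $ i $ j * (\<Sum>l\<le>wdeg M. wvec M l $ j * tay l k 1))"
    and "\<nu> \<le> m" "wdeg M \<le> m"
  shows "negligible (insert 1 (range (($) (absc M)) \<union> range (\<lambda>j. 1 + absc M $ j))) m \<nu> (extrapolation_residual M \<alpha> \<beta> i)"
proof (rule negligibleI)
  show "expands m \<nu> (insert 1 (range (($) (absc M)) \<union> range (\<lambda>j. 1 + absc M $ j))) (extrapolation_residual M \<alpha> \<beta> i) (\<lambda>k. tay 0 k (1 + absc M $ i)
     - ((\<Sum>j\<in>UNIV. \<alpha> $ i $ j * tay 0 k (absc M $ j)) + (\<Sum>j\<in>UNIV. \<beta> $ i $ j * (\<Sum>l\<le>wdeg M. wvec M l $ j * tay l k 1))))"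
    unfolding extrapolation_residual_def
    using assms(2,3) by (intro expands_diff expands_add expands_sum expands_scale expands_node) auto
qed (use assms(1) in simp)

section \<open>Extracting algebraic order conditions\<close>

lemma deriv_tay: "deriv (tay j k) = tay (Suc j) k"
  by (intro ext DERIV_imp_deriv tay_deriv)

lemma iter_deriv_tay: "(deriv ^^ j) (tay 0 k) = tay j k"
  by (induction j) (auto simp: deriv_tay)

lemma smooth_tay: "smooth_real (tay 0 k)"
  unfolding smooth_real_def iter_deriv_tay
  using tay_deriv real_differentiable_def by blast

lemma vanishing_coefficient:
  fixes a C :: real
  assumes "0 < \<tau>0" "k < q" "\<And>\<tau>. 0 < \<tau> \<Longrightarrow> \<tau> < \<tau>0 \<Longrightarrow> \<tau> \<le> 1 \<Longrightarrow> \<bar>\<tau> ^ k * a\<bar> \<le> C * \<tau> ^ q"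
  shows "a = 0"
proof (rule ccontr)
  assume a: "a \<noteq> 0"
  define \<tau> where "\<tau> = min (\<tau>0 / 2) (min 1 (\<bar>a\<bar> / (2 * (\<bar>C\<bar> + 1))))"
  have \<tau>: "0 < \<tau>" "\<tau> < \<tau>0" "\<tau> \<le> 1" using a assms(1) by (auto simp: \<tau>_def)
  have "\<tau> ^ k * \<bar>a\<bar> \<le> C * \<tau> ^ q" using assms(3)[OF \<tau>] \<tau> by (simp add: abs_mult)
  also have "\<dots> \<le> \<bar>C\<bar> * \<tau> ^ Suc k"
    using assms(2) \<tau> by (intro mult_mono power_decreasing) auto
  finally have "\<tau> ^ k * \<bar>a\<bar> \<le> \<tau> ^ k * (\<bar>C\<bar> * \<tau>)" by (simp add: mult_ac)
  then have "\<bar>a\<bar> \<le> \<bar>C\<bar> * \<tau>" using \<tau> by simp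
  also have "\<dots> \<le> (\<bar>C\<bar> + 1) * (\<bar>a\<bar> / (2 * (\<bar>C\<bar> + 1)))"
  proof (intro mult_mono)
    show "\<tau> \<le> \<bar>a\<bar> / (2 * (\<bar>C\<bar> + 1))" by (simp add: \<tau>_def)
  qed (use \<tau> in auto)
  also have "\<dots> = \<bar>a\<bar> / 2" by (simp add: field_simps)
  finally show False using a by simp
qed

lemma external_value_tay:
  "external_value M \<tau> (\<lambda>l. tay l k (x * \<tau>)) i = \<tau> ^ k * (\<Sum>l\<le>wdeg M. wvec M l $ i * tay l k x)"
proof -
  have "wvec M l $ i * \<tau> ^ l * tay l k (x * \<tau>) = \<tau> ^ k * (wvec M l $ i * tay l k x)" for l
    using tay_scale[of \<tau> l k x] by (simp add: mult_ac)
  then show ?thesis by (simp only: external_value_def sum_distrib_left)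
qed

lemma abs_sum_le:
  fixes c x :: "'i::finite \<Rightarrow> real"
  assumes "\<And>j. \<bar>x j\<bar> \<le> e"
  shows "\<bar>\<Sum>j\<in>UNIV. c j * x j\<bar> \<le> (\<Sum>j\<in>UNIV. \<bar>c j\<bar>) * e"
proof -
  have "\<bar>\<Sum>j\<in>UNIV. c j * x j\<bar> \<le> (\<Sum>j\<in>UNIV. \<bar>c j\<bar> * e)"
    by (rule order_trans[OF sum_abs sum_mono]) (simp add: abs_mult assms mult_left_mono)
  then show ?thesis by (simp add: sum_distrib_right)
qed

text \<open>
  At \<open>n = 1\<close> the extrapolation error of \<open>t\<^sup>k / k!\<close> is exactly \<open>\<tau>\<^sup>k\<close> times a constant, and it can be of order
  \<open>\<tau>\<^sup>\<nu>\<close> with \<open>\<nu> > k\<close> only if this constant is zero.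
\<close>

lemma extrapolation_conditions:
  assumes "extrapolation M \<nu> \<alpha> \<beta>" "k < \<nu>"
  shows "tay 0 k (1 + absc M $ i) = (\<Sum>j\<in>UNIV. \<alpha> $ i $ j * tay 0 k (absc M $ j))
       + (\<Sum>j\<in>UNIV. \<beta> $ i $ j * (\<Sum>l\<le>wdeg M. wvec M l $ j * tay l k 1))"
proof -
  have "\<forall>g. smooth_real g \<longrightarrow> (\<forall>T>0. \<exists>C. \<exists>\<tau>\<^sub>0>0. \<forall>\<tau>. 0 < \<tau> \<and> \<tau> < \<tau>\<^sub>0 \<longrightarrow>
        (\<forall>n i. 1 \<le> n \<and> real n * \<tau> \<le> T \<longrightarrow>
           \<bar>g (stage_time M \<tau> n i)
             - ((\<Sum>j\<in>UNIV. \<alpha> $ i $ j * g (stage_time M \<tau> (n - 1) j))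
                + (\<Sum>j\<in>UNIV. \<beta> $ i $ j *
                     external_value M \<tau> (\<lambda>k. (deriv ^^ k) g (real n * \<tau>)) j))\<bar> \<le> C * \<tau> ^ \<nu>))"
    using assms(1) unfolding extrapolation_def by (elim conjE)
  from this[THEN spec, THEN mp, OF smooth_tay[of k], THEN spec, THEN mp, OF zero_less_one]
  obtain C \<tau>0 where \<tau>0: "\<tau>0 > 0" and b: "\<forall>\<tau>. 0 < \<tau> \<and> \<tau> < \<tau>0 \<longrightarrow>
        (\<forall>n i. 1 \<le> n \<and> real n * \<tau> \<le> 1 \<longrightarrow>
           \<bar>tay 0 k (stage_time M \<tau> n i)
             - ((\<Sum>j\<in>UNIV. \<alpha> $ i $ j * tay 0 k (stage_time M \<tau> (n - 1) j))
                + (\<Sum>j\<in>UNIV. \<beta> $ i $ j *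
                     external_value M \<tau> (\<lambda>l. (deriv ^^ l) (tay 0 k) (real n * \<tau>)) j))\<bar> \<le> C * \<tau> ^ \<nu>)"
    by (elim exE conjE) (rule that)
  have "tay 0 k (1 + absc M $ i) - ((\<Sum>j\<in>UNIV. \<alpha> $ i $ j * tay 0 k (absc M $ j))
       + (\<Sum>j\<in>UNIV. \<beta> $ i $ j * (\<Sum>l\<le>wdeg M. wvec M l $ j * tay l k 1))) = 0" (is "?a = 0")
  proof (rule vanishing_coefficient[OF \<tau>0 assms(2)])
    fix \<tau> :: real assume \<tau>: "0 < \<tau>" "\<tau> < \<tau>0" "\<tau> \<le> 1"
    have 1: "tay 0 k (stage_time M \<tau> 1 i) = \<tau> ^ k * tay 0 k (1 + absc M $ i)"
      using tay_scale[of \<tau> 0 k "1 + absc M $ i"] by (simp add: stage_time_def distrib_right)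
    have 2: "tay 0 k (stage_time M \<tau> 0 j) = \<tau> ^ k * tay 0 k (absc M $ j)" for j
      using tay_scale[of \<tau> 0 k "absc M $ j"] by (simp add: stage_time_def)
    have 3: "external_value M \<tau> (\<lambda>l. (deriv ^^ l) (tay 0 k) (real 1 * \<tau>)) j = \<tau> ^ k * (\<Sum>l\<le>wdeg M. wvec M l $ j * tay l k 1)" for j
      using external_value_tay[of M \<tau> k 1 j] by (simp add: iter_deriv_tay)
    have "\<tau> ^ k * ?a = tay 0 k (stage_time M \<tau> 1 i)
             - ((\<Sum>j\<in>UNIV. \<alpha> $ i $ j * tay 0 k (stage_time M \<tau> (1 - 1) j))
                + (\<Sum>j\<in>UNIV. \<beta> $ i $ j *
                     external_value M \<tau> (\<lambda>l. (deriv ^^ l) (tay 0 k) (real 1 * \<tau>)) j))"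
      unfolding 1 3 diff_self_eq_0 2 by (simp only: right_diff_distrib distrib_left sum_distrib_left mult.left_commute)
    then show "\<bar>\<tau> ^ k * ?a\<bar> \<le> C * \<tau> ^ \<nu>" using b[rule_format, of \<tau> 1 i] \<tau> by simp
  qed
  then show ?thesis by simp
qed

text \<open>
  The definition of the generalized stage order for the monomial \<open>t\<^sup>k / k!\<close> on the time interval \<open>[0, 1]\<close>.
\<close>

lemma stage_order_monomial:
  assumes "has_generalized_stage_order M q"
  obtains gh C \<tau>0 where "0 < \<tau>0" "0 \<le> C"
    "\<And>\<tau> n i. 0 < \<tau> \<Longrightarrow> \<tau> < \<tau>0 \<Longrightarrow> real n * \<tau> \<le> 1 \<Longrightarrow>
       \<bar>external_value M \<tau> (\<lambda>l. tay l k (real n * \<tau>)) i - gh \<tau> n i\<bar> \<le> C * \<tau> ^ q"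
    "\<And>\<tau> n i. 0 < \<tau> \<Longrightarrow> \<tau> < \<tau>0 \<Longrightarrow> real n * \<tau> \<le> 1 \<Longrightarrow>
       \<bar>tay 0 k (real n * \<tau> + absc M $ i * \<tau>) - (\<tau> * (\<Sum>j\<in>UNIV. D11 M $ i $ j * tay 1 k (real n * \<tau> + absc M $ j * \<tau>))
                    + (\<Sum>j\<in>UNIV. D12 M $ i $ j * gh \<tau> n j))\<bar> \<le> C * \<tau> ^ (q + 1)"
    "\<And>\<tau> n i. 0 < \<tau> \<Longrightarrow> \<tau> < \<tau>0 \<Longrightarrow> real n * \<tau> \<le> 1 \<Longrightarrow>
       \<bar>gh \<tau> (n + 1) i - (\<tau> * (\<Sum>j\<in>UNIV. D21 M $ i $ j * tay 1 k (real n * \<tau> + absc M $ j * \<tau>))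
                    + (\<Sum>j\<in>UNIV. D22 M $ i $ j * gh \<tau> n j))\<bar> \<le> C * \<tau> ^ (q + 1)"
proof -
  from assms[unfolded has_generalized_stage_order_def, THEN spec, THEN mp, OF smooth_tay[of k],
      THEN spec, THEN mp, OF zero_less_one]
  obtain gh C \<tau>0 where \<tau>0: "0 < \<tau>0" and b: "\<forall>\<tau>. 0 < \<tau> \<and> \<tau> < \<tau>0 \<longrightarrow> (\<forall>n. real n * \<tau> \<le> 1 \<longrightarrow>
       (\<forall>i. \<bar>external_value M \<tau> (\<lambda>l. tay l k (real n * \<tau>)) i - gh \<tau> n i\<bar> \<le> C * \<tau> ^ q) \<and>
       (\<forall>i. \<bar>tay 0 k (real n * \<tau> + absc M $ i * \<tau>) - (\<tau> * (\<Sum>j\<in>UNIV. D11 M $ i $ j * tay (Suc 0) k (real n * \<tau> + absc M $ j * \<tau>))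
                    + (\<Sum>j\<in>UNIV. D12 M $ i $ j * gh \<tau> n j))\<bar> \<le> C * \<tau> ^ (q + 1)) \<and>
       (\<forall>i. \<bar>gh \<tau> (n + 1) i - (\<tau> * (\<Sum>j\<in>UNIV. D21 M $ i $ j * tay (Suc 0) k (real n * \<tau> + absc M $ j * \<tau>))
                    + (\<Sum>j\<in>UNIV. D22 M $ i $ j * gh \<tau> n j))\<bar> \<le> C * \<tau> ^ (q + 1)))"
    unfolding iter_deriv_tay stage_time_def deriv_tay by (elim exE conjE) (rule that)
  have "0 \<le> C"
  proof -
    have "\<bar>external_value M (\<tau>0 / 2) (\<lambda>l. tay l k (real 0 * (\<tau>0 / 2))) undefined - gh (\<tau>0 / 2) 0 undefined\<bar> \<le> C * (\<tau>0 / 2) ^ q"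
      using b[rule_format, of "\<tau>0 / 2" 0] \<tau>0 by simp
    then have "0 \<le> C * (\<tau>0 / 2) ^ q" by (rule order_trans[OF abs_ge_zero])
    moreover have "0 < (\<tau>0 / 2) ^ q" using \<tau>0 by simp
    ultimately show ?thesis by (smt (verit) mult_neg_pos)
  qed
  show ?thesis
    by (rule that[of \<tau>0 C gh]) (use \<tau>0 \<open>0 \<le> C\<close> b[rule_format] in simp_all)
qed

lemma sum_wext: "k < q \<Longrightarrow> (\<Sum>l\<le>wdeg M. wvec M l $ i * tay l k x) = (\<Sum>l<q. wext M l $ i * tay l k x)"
proof -
  assume k: "k < q"
  have "(\<Sum>l\<le>wdeg M. wvec M l $ i * tay l k x) = (\<Sum>l\<in>{..wdeg M} \<inter> {..k}. wext M l $ i * tay l k x)"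
    by (intro sum.mono_neutral_cong_right) (auto simp: tay_0 wext_def)
  also have "\<dots> = (\<Sum>l<q. wext M l $ i * tay l k x)"
    using k by (intro sum.mono_neutral_cong_left) (auto simp: tay_0 wext_def)
  finally show ?thesis .
qed

text \<open>
  In the first step the exact values for \<open>t\<^sup>k / k!\<close> are multiples of \<open>\<tau>\<^sup>k\<close>, whereas the residuals and the
  deviation of \<open>gh\<close> from the external values of the method are of order \<open>\<tau>\<^sup>q\<close>. For \<open>k < q\<close> the multiples
  therefore have to cancel.
\<close>

lemma low_order_conditions:
  assumes "has_generalized_stage_order M q" "k < q"
  shows "tay 0 k (absc M $ i) = (\<Sum>j\<in>UNIV. D11 M $ i $ j * tay 1 k (absc M $ j)) + (\<Sum>j\<in>UNIV. D12 M $ i $ j * wext M k $ j)" (is ?A)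
    and "(\<Sum>l<q. wext M l $ i' * tay l k 1) = (\<Sum>j\<in>UNIV. D21 M $ i' $ j * tay 1 k (absc M $ j)) + (\<Sum>j\<in>UNIV. D22 M $ i' $ j * wext M k $ j)" (is ?B)
proof -
  obtain gh C \<tau>0 where \<tau>0: "0 < \<tau>0" and C: "0 \<le> C" and
    ext: "\<And>\<tau> n i. 0 < \<tau> \<Longrightarrow> \<tau> < \<tau>0 \<Longrightarrow> real n * \<tau> \<le> 1 \<Longrightarrow>
       \<bar>external_value M \<tau> (\<lambda>l. tay l k (real n * \<tau>)) i - gh \<tau> n i\<bar> \<le> C * \<tau> ^ q" and
    st: "\<And>\<tau> n i. 0 < \<tau> \<Longrightarrow> \<tau> < \<tau>0 \<Longrightarrow> real n * \<tau> \<le> 1 \<Longrightarrow>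
       \<bar>tay 0 k (real n * \<tau> + absc M $ i * \<tau>) - (\<tau> * (\<Sum>j\<in>UNIV. D11 M $ i $ j * tay 1 k (real n * \<tau> + absc M $ j * \<tau>))
                    + (\<Sum>j\<in>UNIV. D12 M $ i $ j * gh \<tau> n j))\<bar> \<le> C * \<tau> ^ (q + 1)" and
    ne: "\<And>\<tau> n i. 0 < \<tau> \<Longrightarrow> \<tau> < \<tau>0 \<Longrightarrow> real n * \<tau> \<le> 1 \<Longrightarrow>
       \<bar>gh \<tau> (n + 1) i - (\<tau> * (\<Sum>j\<in>UNIV. D21 M $ i $ j * tay 1 k (real n * \<tau> + absc M $ j * \<tau>))
                    + (\<Sum>j\<in>UNIV. D22 M $ i $ j * gh \<tau> n j))\<bar> \<le> C * \<tau> ^ (q + 1)"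
    by (rule stage_order_monomial[OF assms(1), of k]) (rule that)
  have e0: "\<bar>\<tau> ^ k * wext M k $ i - gh \<tau> 0 i\<bar> \<le> C * \<tau> ^ q" if "0 < \<tau>" "\<tau> < \<tau>0" for \<tau> i
    using ext[of \<tau> 0 i] that external_value_tay[of M \<tau> k 0 i] by (simp add: sum_tay_at_zero wext_def split: if_splits)
  have s0: "tay 0 k (x * \<tau>) = \<tau> ^ k * tay 0 k x" and s1: "\<tau> * tay 1 k (x * \<tau>) = \<tau> ^ k * tay 1 k x" for x \<tau>
    using tay_scale[of \<tau> 0 k x] tay_scale[of \<tau> 1 k x] by simp_all
  have d1: "\<tau> * (\<Sum>j\<in>UNIV. A j * tay 1 k (real 0 * \<tau> + absc M $ j * \<tau>)) = \<tau> ^ k * (\<Sum>j\<in>UNIV. A j * tay 1 k (absc M $ j))" for A \<tau>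
  proof -
    have "\<tau> * (A j * tay 1 k (real 0 * \<tau> + absc M $ j * \<tau>)) = \<tau> ^ k * (A j * tay 1 k (absc M $ j))" for j
    proof -
      have "\<tau> * (A j * tay 1 k (real 0 * \<tau> + absc M $ j * \<tau>)) = A j * (\<tau> * tay 1 k (absc M $ j * \<tau>))" by simp
      also have "\<dots> = \<tau> ^ k * (A j * tay 1 k (absc M $ j))" unfolding s1 by simp
      finally show ?thesis .
    qed
    then show ?thesis by (simp only: sum_distrib_left)
  qed
  have le: "C * \<tau> ^ (q + 1) \<le> C * \<tau> ^ q" if "0 < \<tau>" "\<tau> \<le> 1" for \<tau>
    using C that by (intro mult_left_mono power_decreasing) auto
  have gh: "\<bar>(\<Sum>j\<in>UNIV. A j * gh \<tau> 0 j) - \<tau> ^ k * (\<Sum>j\<in>UNIV. A j * wext M k $ j)\<bar> \<le> (\<Sum>j\<in>UNIV. \<bar>A j\<bar>) * (C * \<tau> ^ q)"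
    if "0 < \<tau>" "\<tau> < \<tau>0" for \<tau> A
  proof -
    have "(\<Sum>j\<in>UNIV. A j * gh \<tau> 0 j) - \<tau> ^ k * (\<Sum>j\<in>UNIV. A j * wext M k $ j)
        = (\<Sum>j\<in>UNIV. A j * (gh \<tau> 0 j - \<tau> ^ k * wext M k $ j))"
      by (simp add: right_diff_distrib sum_subtractf sum_distrib_left mult.left_commute)
    then show ?thesis using abs_sum_le[of "\<lambda>j. gh \<tau> 0 j - \<tau> ^ k * wext M k $ j" "C * \<tau> ^ q" A] e0[OF that]
      by (simp add: abs_minus_commute)
  qed
  have "tay 0 k (absc M $ i) - ((\<Sum>j\<in>UNIV. D11 M $ i $ j * tay 1 k (absc M $ j)) + (\<Sum>j\<in>UNIV. D12 M $ i $ j * wext M k $ j)) = 0" (is "?a = 0")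
  proof (rule vanishing_coefficient[OF \<tau>0 assms(2)])
    fix \<tau> :: real assume \<tau>: "0 < \<tau>" "\<tau> < \<tau>0" "\<tau> \<le> 1"
    have "\<bar>\<tau> ^ k * ?a\<bar> \<le> C * \<tau> ^ q + (\<Sum>j\<in>UNIV. \<bar>D12 M $ i $ j\<bar>) * (C * \<tau> ^ q)"
      using st[of \<tau> 0 i] \<tau> gh[OF \<tau>(1,2), of "\<lambda>j. D12 M $ i $ j"] le[OF \<tau>(1,3)]
      unfolding d1 by (simp add: s0 right_diff_distrib distrib_left)
    then show "\<bar>\<tau> ^ k * ?a\<bar> \<le> (C + (\<Sum>j\<in>UNIV. \<bar>D12 M $ i $ j\<bar>) * C) * \<tau> ^ q" by (simp add: algebra_simps)
  qed
  then show ?A by simp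
  have "(\<Sum>l\<le>wdeg M. wvec M l $ i' * tay l k 1) - ((\<Sum>j\<in>UNIV. D21 M $ i' $ j * tay 1 k (absc M $ j)) + (\<Sum>j\<in>UNIV. D22 M $ i' $ j * wext M k $ j)) = 0" (is "?b = 0")
  proof (rule vanishing_coefficient[OF \<tau>0 assms(2)])
    fix \<tau> :: real assume \<tau>: "0 < \<tau>" "\<tau> < \<tau>0" "\<tau> \<le> 1"
    have "\<bar>\<tau> ^ k * (\<Sum>l\<le>wdeg M. wvec M l $ i' * tay l k 1) - gh \<tau> (0 + 1) i'\<bar> \<le> C * \<tau> ^ q"
      using ext[of \<tau> 1 i'] \<tau> external_value_tay[of M \<tau> k 1 i'] by simp
    then have "\<bar>\<tau> ^ k * ?b\<bar> \<le> 2 * (C * \<tau> ^ q) + (\<Sum>j\<in>UNIV. \<bar>D22 M $ i' $ j\<bar>) * (C * \<tau> ^ q)"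
      using ne[of \<tau> 0 i'] \<tau> gh[OF \<tau>(1,2), of "\<lambda>j. D22 M $ i' $ j"] le[OF \<tau>(1,3)]
      unfolding d1 by (simp add: right_diff_distrib distrib_left)
    then show "\<bar>\<tau> ^ k * ?b\<bar> \<le> (2 * C + (\<Sum>j\<in>UNIV. \<bar>D22 M $ i' $ j\<bar>) * C) * \<tau> ^ q" by (simp add: algebra_simps)
  qed
  then show ?B using sum_wext[OF assms(2), of M i' 1] by simp
qed

lemma closed_range_limit:
  fixes A :: "'a::euclidean_space \<Rightarrow> 'b::euclidean_space"
  assumes "linear A" "\<And>e. 0 < e \<Longrightarrow> \<exists>x. dist (A x) b < e"
  shows "\<exists>x. A x = b"
proof -
  have "closed (range A)"
    using assms(1) by (intro closed_subspace linear_subspace_image subspace_UNIV)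
  moreover have "b \<in> closure (range A)"
    unfolding closure_approachable using assms(2) by auto
  ultimately show ?thesis by (auto simp: closure_closed)
qed

text \<open>
  For the monomial of degree \<open>q\<close> the functions \<open>gh\<close> are \<open>\<Sum>\<^sub>k\<^sub><\<^sub>q w\<^sub>k \<tau>\<^sup>k u\<^sup>(\<^sup>k\<^sup>)(t\<^sub>n) + \<tau>\<^sup>q \<delta> n\<close> with bounded \<open>\<delta> n\<close>
  that may depend on \<open>n\<close>. The residual conditions say that \<open>D12 \<delta> n\<close> and \<open>D22 \<delta> n - \<delta> (n + 1)\<close> are constant up
  to terms of order \<open>\<tau>\<close>. In the mean over the \<open>1 / \<tau>\<close> steps of the unit interval the difference
  \<open>\<delta> (n + 1) - \<delta> n\<close> telescopes and is of order \<open>\<tau>\<close>, so the mean solves the equations for \<open>w\<close> approximately. Since a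
  linear map between Euclidean spaces has closed range, there is an exact solution.
\<close>

lemma top_order_condition:
  assumes so: "has_generalized_stage_order M q" and q: "1 \<le> q"
  shows "\<exists>w :: real^'r. (\<forall>i. tay 0 q (absc M $ i) = (\<Sum>j\<in>UNIV. D11 M $ i $ j * tay 1 q (absc M $ j)) + (\<Sum>j\<in>UNIV. D12 M $ i $ j * w $ j)) \<and>
    (\<forall>i. (\<Sum>l<q. wext M l $ i * tay l q 1) + w $ i = (\<Sum>j\<in>UNIV. D21 (M :: ('s::finite, 'r::finite) gltd) $ i $ j * tay 1 q (absc M $ j)) + (\<Sum>j\<in>UNIV. D22 M $ i $ j * w $ j))"
proof -
  define a :: "real^'s" where "a = (\<chi> i. tay 0 q (absc M $ i) - (\<Sum>j\<in>UNIV. D11 M $ i $ j * tay 1 q (absc M $ j)))"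
  define b :: "real^'r" where "b = (\<chi> i. (\<Sum>l<q. wext M l $ i * tay l q 1) - (\<Sum>j\<in>UNIV. D21 M $ i $ j * tay 1 q (absc M $ j)))"
  define A where "A x = (D12 M *v x, D22 M *v x - x)" for x
  obtain gh C \<tau>0 where \<tau>0: "0 < \<tau>0" and C: "0 \<le> C" and
    ext: "\<And>\<tau> n i. 0 < \<tau> \<Longrightarrow> \<tau> < \<tau>0 \<Longrightarrow> real n * \<tau> \<le> 1 \<Longrightarrow>
       \<bar>external_value M \<tau> (\<lambda>l. tay l q (real n * \<tau>)) i - gh \<tau> n i\<bar> \<le> C * \<tau> ^ q" and
    st: "\<And>\<tau> n i. 0 < \<tau> \<Longrightarrow> \<tau> < \<tau>0 \<Longrightarrow> real n * \<tau> \<le> 1 \<Longrightarrow>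
       \<bar>tay 0 q (real n * \<tau> + absc M $ i * \<tau>) - (\<tau> * (\<Sum>j\<in>UNIV. D11 M $ i $ j * tay 1 q (real n * \<tau> + absc M $ j * \<tau>))
                    + (\<Sum>j\<in>UNIV. D12 M $ i $ j * gh \<tau> n j))\<bar> \<le> C * \<tau> ^ (q + 1)" and
    ne: "\<And>\<tau> n i. 0 < \<tau> \<Longrightarrow> \<tau> < \<tau>0 \<Longrightarrow> real n * \<tau> \<le> 1 \<Longrightarrow>
       \<bar>gh \<tau> (n + 1) i - (\<tau> * (\<Sum>j\<in>UNIV. D21 M $ i $ j * tay 1 q (real n * \<tau> + absc M $ j * \<tau>))
                    + (\<Sum>j\<in>UNIV. D22 M $ i $ j * gh \<tau> n j))\<bar> \<le> C * \<tau> ^ (q + 1)"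
    by (rule stage_order_monomial[OF so, of q]) (rule that)
  define C' where "C' = C + norm (wext M q)"
  have approx: "\<exists>x. dist (A x) (a, b) \<le> (real CARD('s) * C + real CARD('r) * (C + 2 * C')) * (1 / real N)"
    if N: "0 < N" "1 / real N < \<tau>0" for N
  proof -
    define \<tau> where "\<tau> = 1 / real N"
    have \<tau>: "0 < \<tau>" "\<tau> < \<tau>0" "real N * \<tau> = 1" using N by (auto simp: \<tau>_def)
    have n\<tau>: "real n * \<tau> \<le> 1" if "n \<le> N" for n
      using mult_right_mono[of "real n" "real N" \<tau>] that \<tau> by simp
    define u where "u n k = \<tau> ^ k * tay k q (real n * \<tau>)" for n k
    define \<delta> where "\<delta> n = (\<chi> j. (gh \<tau> n j - (\<Sum>k<q. wext M k $ j * u n k)) / \<tau> ^ q)" for n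
    have gh: "gh \<tau> n j = (\<Sum>k<q. wext M k $ j * u n k) + \<tau> ^ q * \<delta> n $ j" for n j
      using \<tau> by (simp add: \<delta>_def)
    have node: "\<tau> ^ l * tay l q (real n * \<tau> + x * \<tau>) = (\<Sum>k<q. tay l k x * u n k) + \<tau> ^ q * tay l q x" for l n x
    proof -
      have "\<tau> ^ l * tay l q (real n * \<tau> + x * \<tau>) = (\<Sum>k\<le>q. (\<tau> ^ l * tay l k (x * \<tau>)) * tay k q (real n * \<tau>))"
        by (simp add: tay_add sum_distrib_left mult.assoc)
      also have "\<dots> = (\<Sum>k\<le>q. tay l k x * u n k)" unfolding tay_scale by (simp add: u_def mult_ac)
      also have "\<dots> = (\<Sum>k<q. tay l k x * u n k) + \<tau> ^ q * tay l q x"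
        by (simp add: lessThan_Suc_atMost[symmetric] u_def mult.commute)
      finally show ?thesis .
    qed
    have node0: "tay 0 q (real n * \<tau> + x * \<tau>) = (\<Sum>k<q. tay 0 k x * u n k) + \<tau> ^ q * tay 0 q x" for n x
      using node[of 0 n x] by simp
    have node1: "\<tau> * (\<Sum>j\<in>UNIV. B j * tay 1 q (real n * \<tau> + absc M $ j * \<tau>))
        = (\<Sum>k<q. (\<Sum>j\<in>UNIV. B j * tay 1 k (absc M $ j)) * u n k) + \<tau> ^ q * (\<Sum>j\<in>UNIV. B j * tay 1 q (absc M $ j))" for B n
    proof -
      have "\<tau> * (\<Sum>j\<in>UNIV. B j * tay 1 q (real n * \<tau> + absc M $ j * \<tau>))
          = (\<Sum>j\<in>UNIV. B j * (\<tau> ^ 1 * tay 1 q (real n * \<tau> + absc M $ j * \<tau>)))"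
        by (simp add: sum_distrib_left mult.left_commute)
      also have "\<dots> = (\<Sum>j\<in>UNIV. B j * (\<Sum>k<q. tay 1 k (absc M $ j) * u n k)) + \<tau> ^ q * (\<Sum>j\<in>UNIV. B j * tay 1 q (absc M $ j))"
        unfolding node by (simp add: distrib_left sum.distrib sum_distrib_left mult.left_commute)
      also have "(\<Sum>j\<in>UNIV. B j * (\<Sum>k<q. tay 1 k (absc M $ j) * u n k)) = (\<Sum>k<q. (\<Sum>j\<in>UNIV. B j * tay 1 k (absc M $ j)) * u n k)"
        unfolding sum_distrib_left sum_distrib_right by (subst sum.swap) (simp add: mult.assoc)
      finally show ?thesis .
    qed
    have ghs: "(\<Sum>j\<in>UNIV. B j * gh \<tau> n j) = (\<Sum>k<q. (\<Sum>j\<in>UNIV. B j * wext M k $ j) * u n k) + \<tau> ^ q * (\<Sum>j\<in>UNIV. B j * \<delta> n $ j)" for B n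
    proof -
      have "(\<Sum>j\<in>UNIV. B j * (\<Sum>k<q. wext M k $ j * u n k)) = (\<Sum>k<q. (\<Sum>j\<in>UNIV. B j * wext M k $ j) * u n k)"
        unfolding sum_distrib_left sum_distrib_right by (subst sum.swap) (simp add: mult.assoc)
      then show ?thesis unfolding gh by (simp add: distrib_left sum.distrib sum_distrib_left mult.left_commute)
    qed
    have cancel: "\<bar>x\<bar> \<le> c" if "\<bar>\<tau> ^ q * x\<bar> \<le> c * \<tau> ^ q" for x c
      using that \<tau> by (simp add: abs_mult mult.commute[of c])
    have st': "\<bar>a $ i - (D12 M *v \<delta> n) $ i\<bar> \<le> C * \<tau>" if n: "n < N" for n i
    proof (rule cancel)
      have "\<tau> ^ q * (a $ i - (D12 M *v \<delta> n) $ i) = tay 0 q (real n * \<tau> + absc M $ i * \<tau>)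
          - (\<tau> * (\<Sum>j\<in>UNIV. D11 M $ i $ j * tay 1 q (real n * \<tau> + absc M $ j * \<tau>)) + (\<Sum>j\<in>UNIV. D12 M $ i $ j * gh \<tau> n j))"
        unfolding node0 node1 ghs using low_order_conditions(1)[OF so]
        by (simp add: a_def matrix_vector_mult_def distrib_right right_diff_distrib sum.distrib)
      then show "\<bar>\<tau> ^ q * (a $ i - (D12 M *v \<delta> n) $ i)\<bar> \<le> C * \<tau> * \<tau> ^ q"
        using st[OF \<tau>(1,2) n\<tau>[of n], of i] n by (simp add: mult_ac)
    qed
    have ne': "\<bar>b $ i + \<delta> (Suc n) $ i - (D22 M *v \<delta> n) $ i\<bar> \<le> C * \<tau>" if n: "n < N" for n i
    proof (rule cancel)
      have "(\<Sum>k<q. wext M k $ i * u (Suc n) k) = (\<Sum>k<q. (\<Sum>l<q. wext M l $ i * tay l k 1) * u n k) + \<tau> ^ q * (\<Sum>l<q. wext M l $ i * tay l q 1)"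
      proof -
        have "u (Suc n) l = (\<Sum>k<q. tay l k 1 * u n k) + \<tau> ^ q * tay l q 1" for l
          using node[of l n 1] by (simp add: u_def distrib_right add.commute)
        then have "(\<Sum>k<q. wext M k $ i * u (Suc n) k) = (\<Sum>l<q. wext M l $ i * (\<Sum>k<q. tay l k 1 * u n k)) + \<tau> ^ q * (\<Sum>l<q. wext M l $ i * tay l q 1)"
          by (simp add: distrib_left sum.distrib sum_distrib_left mult.left_commute)
        also have "(\<Sum>l<q. wext M l $ i * (\<Sum>k<q. tay l k 1 * u n k)) = (\<Sum>k<q. (\<Sum>l<q. wext M l $ i * tay l k 1) * u n k)"
          unfolding sum_distrib_left sum_distrib_right by (subst sum.swap) (simp add: mult.assoc)
        finally show ?thesis .
      qed
      then have "\<tau> ^ q * (b $ i + \<delta> (Suc n) $ i - (D22 M *v \<delta> n) $ i) = gh \<tau> (n + 1) i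
          - (\<tau> * (\<Sum>j\<in>UNIV. D21 M $ i $ j * tay 1 q (real n * \<tau> + absc M $ j * \<tau>)) + (\<Sum>j\<in>UNIV. D22 M $ i $ j * gh \<tau> n j))"
        unfolding node1 ghs using low_order_conditions(2)[OF so]
        by (simp add: b_def gh[of "Suc n"] matrix_vector_mult_def distrib_right right_diff_distrib distrib_left sum.distrib)
      then show "\<bar>\<tau> ^ q * (b $ i + \<delta> (Suc n) $ i - (D22 M *v \<delta> n) $ i)\<bar> \<le> C * \<tau> * \<tau> ^ q"
        using ne[OF \<tau>(1,2) n\<tau>[of n], of i] n by (simp add: mult_ac)
    qed
    have \<delta>: "\<bar>\<delta> n $ i\<bar> \<le> C'" if n: "n \<le> N" for n i
    proof (rule cancel)
      have "external_value M \<tau> (\<lambda>l. tay l q (real n * \<tau>)) i = (\<Sum>l\<in>{..wdeg M}. wext M l $ i * u n l)"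
        by (simp add: external_value_def u_def wext_def mult.assoc)
      also have "\<dots> = (\<Sum>l\<in>{..wdeg M} \<inter> {..q}. wext M l $ i * u n l)"
        by (intro sum.mono_neutral_right) (auto simp: u_def tay_0)
      also have "\<dots> = (\<Sum>l\<le>q. wext M l $ i * u n l)"
        by (intro sum.mono_neutral_left) (auto simp: wext_def)
      also have "\<dots> = (\<Sum>l<q. wext M l $ i * u n l) + \<tau> ^ q * wext M q $ i"
        by (simp add: lessThan_Suc_atMost[symmetric] u_def)
      finally have "\<bar>\<tau> ^ q * \<delta> n $ i - \<tau> ^ q * wext M q $ i\<bar> \<le> C * \<tau> ^ q"
        using ext[OF \<tau>(1,2) n\<tau>[OF n], of i] unfolding gh[of n i] by (simp add: abs_minus_commute)
      moreover have "\<bar>\<tau> ^ q * wext M q $ i\<bar> \<le> norm (wext M q) * \<tau> ^ q"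
        using \<tau> Finite_Cartesian_Product.norm_nth_le[of "wext M q" i] by (simp add: abs_mult mult.commute mult_right_mono)
      ultimately show "\<bar>\<tau> ^ q * \<delta> n $ i\<bar> \<le> C' * \<tau> ^ q" by (simp add: C'_def distrib_right)
    qed
    \<comment> \<open>the mean of \<open>\<delta> n\<close>, as \<open>N \<tau> = 1\<close>\<close>
    define x where "x = \<tau> *\<^sub>R (\<Sum>n<N. \<delta> n)"
    have avg: "\<bar>\<tau> * (\<Sum>n<N. y n)\<bar> \<le> c" if "\<And>n. n < N \<Longrightarrow> \<bar>y n\<bar> \<le> c" for y c
    proof -
      have "\<bar>\<Sum>n<N. y n\<bar> \<le> (\<Sum>n<N. c)" by (rule order_trans[OF sum_abs sum_mono]) (use that in auto)
      then have "\<tau> * \<bar>\<Sum>n<N. y n\<bar> \<le> \<tau> * (real N * c)" using \<tau> by (intro mult_left_mono) auto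
      also have "\<dots> = (real N * \<tau>) * c" by (simp only: mult_ac)
      finally show ?thesis using \<tau> by (simp add: abs_mult)
    qed
    have const: "z = \<tau> * (\<Sum>n<N. z)" for z :: real
      using \<tau>(3) by (simp add: mult.assoc[symmetric] mult.commute)
    have lin: "(B *v x) $ i = \<tau> * (\<Sum>n<N. (B *v \<delta> n) $ i)" for B :: "real^'r^'b" and i
    proof -
      have "(B *v x) $ i = \<tau> * (B *v (\<Sum>n<N. \<delta> n)) $ i" by (simp add: x_def matrix_vector_mult_scaleR)
      also have "B *v (\<Sum>n<N. \<delta> n) = (\<Sum>n<N. B *v \<delta> n)"
        by (rule linear_sum[OF matrix_vector_mul_linear])
      finally show ?thesis by simp
    qed
    have fst: "\<bar>a $ i - (D12 M *v x) $ i\<bar> \<le> C * \<tau>" for i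
    proof -
      have "a $ i - (D12 M *v x) $ i = \<tau> * (\<Sum>n<N. a $ i - (D12 M *v \<delta> n) $ i)"
        unfolding lin sum_subtractf right_diff_distrib using const[of "a $ i"] by simp
      then show ?thesis using avg[of "\<lambda>n. a $ i - (D12 M *v \<delta> n) $ i" "C * \<tau>"] st' by simp
    qed
    have snd: "\<bar>b $ i - (D22 M *v x - x) $ i\<bar> \<le> (C + 2 * C') * \<tau>" for i
    proof -
      have tel: "(\<Sum>n<N. \<delta> (Suc n) $ i) = (\<Sum>n<N. \<delta> n $ i) + (\<delta> N $ i - \<delta> 0 $ i)"
        using sum_lessThan_telescope[of "\<lambda>n. \<delta> n $ i" N] by (simp add: sum_subtractf)
      have "b $ i - (D22 M *v x - x) $ i
          = \<tau> * (\<Sum>n<N. b $ i + \<delta> (Suc n) $ i - (D22 M *v \<delta> n) $ i) - \<tau> * (\<delta> N $ i - \<delta> 0 $ i)"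
        unfolding vector_minus_component lin sum_subtractf sum.distrib tel
        using const[of "b $ i"] by (simp add: x_def algebra_simps)
      moreover have "\<bar>\<tau> * (\<Sum>n<N. b $ i + \<delta> (Suc n) $ i - (D22 M *v \<delta> n) $ i)\<bar> \<le> C * \<tau>"
        by (rule avg) (rule ne')
      moreover have "\<bar>\<tau> * (\<delta> N $ i - \<delta> 0 $ i)\<bar> \<le> \<tau> * (2 * C')"
        using \<delta>[of N i] \<delta>[of 0 i] \<tau> unfolding abs_mult by (intro mult_mono) auto
      moreover have "(C + 2 * C') * \<tau> = C * \<tau> + \<tau> * (2 * C')" by (simp add: algebra_simps)
      ultimately show ?thesis by linarith
    qed
    have "dist (A x) (a, b) = norm (a - D12 M *v x, b - (D22 M *v x - x))"
      by (simp add: A_def dist_norm norm_Pair norm_minus_commute)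
    also have "\<dots> \<le> norm (a - D12 M *v x) + norm (b - (D22 M *v x - x))" by (rule norm_Pair_le)
    also have "\<dots> \<le> real CARD('s) * (C * \<tau>) + real CARD('r) * ((C + 2 * C') * \<tau>)"
      using fst snd by (intro add_mono norm_vec_le_const) auto
    finally show ?thesis by (intro exI[of _ x]) (simp add: \<tau>_def algebra_simps)
  qed
  have "\<exists>x. A x = (a, b)"
  proof (rule closed_range_limit)
    show "linear A" unfolding A_def
      by (intro linearI) (auto simp: matrix_vector_right_distrib matrix_vector_mult_scaleR scaleR_diff_right)
    fix e :: real assume e: "0 < e"
    define K where "K = real CARD('s) * C + real CARD('r) * (C + 2 * C')"
    have K: "K \<ge> 0" using C by (simp add: K_def C'_def)
    define m where "m = min \<tau>0 (e / (K + 1))"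
    have "m > 0" using e K \<tau>0 by (simp add: m_def)
    then obtain N where N: "0 < N" "1 / real N < m" by (metis ex_inverse_of_nat_less inverse_eq_divide)
    then obtain x where "dist (A x) (a, b) \<le> K * (1 / real N)" using approx[of N] by (auto simp: m_def K_def)
    also have "\<dots> \<le> K * (e / (K + 1))" using N K by (intro mult_left_mono) (auto simp: m_def)
    also have "\<dots> < e" using e K by (simp add: field_simps)
    finally show "\<exists>x. dist (A x) (a, b) < e" by blast
  qed
  then obtain x where x: "D12 M *v x = a" "D22 M *v x - x = b" by (auto simp: A_def)
  show ?thesis
  proof (intro exI[of _ x] conjI allI)
    fix i
    show "tay 0 q (absc M $ i) = (\<Sum>j\<in>UNIV. D11 M $ i $ j * tay 1 q (absc M $ j)) + (\<Sum>j\<in>UNIV. D12 M $ i $ j * x $ j)"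
      using arg_cong[OF x(1), of "\<lambda>v. v $ i"] by (simp add: a_def matrix_vector_mult_def)
  next
    fix i
    show "(\<Sum>l<q. wext M l $ i * tay l q 1) + x $ i = (\<Sum>j\<in>UNIV. D21 M $ i $ j * tay 1 q (absc M $ j)) + (\<Sum>j\<in>UNIV. D22 M $ i $ j * x $ j)"
      using arg_cong[OF x(2), of "\<lambda>v. v $ i"] by (simp add: b_def matrix_vector_mult_def)
  qed
qed

lemma order_conditions_exist:
  assumes so: "has_generalized_stage_order M q" and q: "1 \<le> q"
  shows "\<exists>w. order_conditions M w q \<and> (\<forall>k<q. w k = wext M k)"
proof -
  from top_order_condition[OF assms] obtain x where x:
    "\<And>i. tay 0 q (absc M $ i) = (\<Sum>j\<in>UNIV. D11 M $ i $ j * tay 1 q (absc M $ j)) + (\<Sum>j\<in>UNIV. D12 M $ i $ j * x $ j)"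
    "\<And>i. (\<Sum>l<q. wext M l $ i * tay l q 1) + x $ i = (\<Sum>j\<in>UNIV. D21 M $ i $ j * tay 1 q (absc M $ j)) + (\<Sum>j\<in>UNIV. D22 M $ i $ j * x $ j)"
    by blast
  define w where "w = (wext M)(q := x)"
  have sum: "(\<Sum>l\<le>q. w l $ i * tay l k 1) = (\<Sum>l<q. wext M l $ i * tay l k 1) + x $ i * tay q k 1" for i k
    by (simp add: w_def lessThan_Suc_atMost[symmetric])
  have "order_conditions M w q"
    unfolding order_conditions_def
  proof (intro allI impI conjI)
    fix k i assume "k \<le> q"
    then show "tay 0 k (absc M $ i) = (\<Sum>j\<in>UNIV. D11 M $ i $ j * tay 1 k (absc M $ j)) + (\<Sum>j\<in>UNIV. D12 M $ i $ j * w k $ j)"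
      using x(1)[of i] low_order_conditions(1)[OF so, of k i] by (cases "k = q") (simp_all add: w_def)
  next
    fix k i assume "k \<le> q"
    then show "(\<Sum>l\<le>q. w l $ i * tay l k 1) = (\<Sum>j\<in>UNIV. D21 M $ i $ j * tay 1 k (absc M $ j)) + (\<Sum>j\<in>UNIV. D22 M $ i $ j * w k $ j)"
      unfolding sum using x(2)[of i] low_order_conditions(2)[OF so, of k i] by (cases "k = q") (simp_all add: w_def tay_0)
  qed
  then show ?thesis by (intro exI[of _ w]) (simp add: w_def)
qed

section \<open>The Hilbert space of square-integrable functions\<close>

lemma L2_measurable [measurable_dest]: "v \<in> L2 \<Omega> \<Longrightarrow> v \<in> borel_measurable (lebesgue_on \<Omega>)"
  by (simp add: L2_def)

lemma L2_square_integrable: "v \<in> L2 \<Omega> \<Longrightarrow> integrable (lebesgue_on \<Omega>) (\<lambda>x. (v x)\<^sup>2)"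
  by (simp add: L2_def)

lemma L2_mult_integrable:
  assumes v: "v \<in> L2 \<Omega>" and w: "w \<in> L2 \<Omega>"
  shows "integrable (lebesgue_on \<Omega>) (\<lambda>x. v x * w x)"
proof (rule Bochner_Integration.integrable_bound)
  show "integrable (lebesgue_on \<Omega>) (\<lambda>x. (v x)\<^sup>2 + (w x)\<^sup>2)"
    using v w by (intro Bochner_Integration.integrable_add L2_square_integrable)
  show "(\<lambda>x. v x * w x) \<in> borel_measurable (lebesgue_on \<Omega>)"
    using v w by (intro borel_measurable_times L2_measurable)
  have "\<bar>a * b\<bar> \<le> \<bar>a\<^sup>2 + b\<^sup>2\<bar>" for a b :: real
  proof -
    have "0 \<le> (\<bar>a\<bar> - \<bar>b\<bar>)\<^sup>2" "0 \<le> \<bar>a\<bar> * \<bar>b\<bar>" by simp_all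
    then have "\<bar>a\<bar> * \<bar>b\<bar> \<le> a\<^sup>2 + b\<^sup>2" unfolding power2_diff power2_abs by linarith
    then show ?thesis by (simp add: abs_mult)
  qed
  then show "AE x in lebesgue_on \<Omega>. norm (v x * w x) \<le> norm ((v x)\<^sup>2 + (w x)\<^sup>2)" by simp
qed

lemma L2_lincomb:
  assumes v: "v \<in> L2 \<Omega>" and w: "w \<in> L2 \<Omega>"
  shows "(\<lambda>x. a * v x + b * w x) \<in> L2 \<Omega>"
proof -
  have "integrable (lebesgue_on \<Omega>) (\<lambda>x. a\<^sup>2 * (v x)\<^sup>2 + (2 * a * b) * (v x * w x) + b\<^sup>2 * (w x)\<^sup>2)"
    using v w by (intro Bochner_Integration.integrable_add integrable_mult_right L2_square_integrable L2_mult_integrable)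
  moreover have "a\<^sup>2 * (v x)\<^sup>2 + (2 * a * b) * (v x * w x) + b\<^sup>2 * (w x)\<^sup>2 = (a * v x + b * w x)\<^sup>2" for x
    by (simp add: power2_sum power_mult_distrib mult_ac)
  moreover have "(\<lambda>x. a * v x + b * w x) \<in> borel_measurable (lebesgue_on \<Omega>)"
    using v w by (intro borel_measurable_add borel_measurable_times borel_measurable_const L2_measurable)
  ultimately show ?thesis by (simp add: L2_def)
qed

lemma L2_zero: "(\<lambda>x. 0) \<in> L2 \<Omega>"
  by (simp add: L2_def)

lemma L2_scale: "v \<in> L2 \<Omega> \<Longrightarrow> (\<lambda>x. a * v x) \<in> L2 \<Omega>"
  using L2_lincomb[of v \<Omega> v a 0] by simp

lemma L2_minus: "v \<in> L2 \<Omega> \<Longrightarrow> (\<lambda>x. - v x) \<in> L2 \<Omega>"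
  using L2_scale[of v \<Omega> "-1"] by simp

lemma L2_add: "v \<in> L2 \<Omega> \<Longrightarrow> w \<in> L2 \<Omega> \<Longrightarrow> (\<lambda>x. v x + w x) \<in> L2 \<Omega>"
  using L2_lincomb[of v \<Omega> w 1 1] by simp

lemma L2_diff: "v \<in> L2 \<Omega> \<Longrightarrow> w \<in> L2 \<Omega> \<Longrightarrow> (\<lambda>x. v x - w x) \<in> L2 \<Omega>"
  using L2_lincomb[of v \<Omega> w 1 "-1"] by simp

lemma L2_inner_cong:
  assumes "v \<in> L2 \<Omega>" "v' \<in> L2 \<Omega>" "w \<in> L2 \<Omega>" "w' \<in> L2 \<Omega>" "eqL2 \<Omega> v v'" "eqL2 \<Omega> w w'"
  shows "L2_inner \<Omega> v w = L2_inner \<Omega> v' w'"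
  unfolding L2_inner_def
proof (rule integral_cong_AE)
  show "AE x in lebesgue_on \<Omega>. v x * w x = v' x * w' x"
    using assms(5,6) unfolding eqL2_def by eventually_elim simp
qed (use assms in \<open>auto intro!: borel_measurable_times L2_measurable\<close>)

lemma L2_inner_self_nonneg: "0 \<le> L2_inner \<Omega> v v"
  unfolding L2_inner_def by (rule Bochner_Integration.integral_nonneg) simp

lemma L2_inner_self_eq_0:
  assumes "v \<in> L2 \<Omega>"
  shows "L2_inner \<Omega> v v = 0 \<longleftrightarrow> eqL2 \<Omega> v (\<lambda>x. 0)"
  unfolding L2_inner_def eqL2_def
  by (subst integral_nonneg_eq_0_iff_AE) (auto intro: L2_mult_integrable assms)

lemma L2_inner_add_left:
  assumes "u \<in> L2 \<Omega>" "v \<in> L2 \<Omega>" "w \<in> L2 \<Omega>"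
  shows "L2_inner \<Omega> (\<lambda>x. u x + v x) w = L2_inner \<Omega> u w + L2_inner \<Omega> v w"
  unfolding L2_inner_def distrib_right
  by (rule Bochner_Integration.integral_add) (auto intro: L2_mult_integrable assms)

lemma L2_inner_scale_left: "L2_inner \<Omega> (\<lambda>x. a * u x) w = a * L2_inner \<Omega> u w"
  unfolding L2_inner_def by (simp add: mult.assoc)

text \<open>
  Functions on the whole space, identified almost everywhere. Functions on a domain are represented
  by their continuation by zero, so that one type serves all domains.
\<close>

quotient_type (overloaded) 'a l2 = "'a::euclidean_space \<Rightarrow> real" / partial: "\<lambda>f g. f \<in> L2 UNIV \<and> g \<in> L2 UNIV \<and> eqL2 UNIV f g"
proof (rule part_equivpI)
  show "\<exists>f :: 'a \<Rightarrow> real. f \<in> L2 UNIV \<and> f \<in> L2 UNIV \<and> eqL2 UNIV f f"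
    by (intro exI[of _ "\<lambda>x. 0"]) (simp add: L2_zero eqL2_def)
  show "symp (\<lambda>f g :: 'a \<Rightarrow> real. f \<in> L2 UNIV \<and> g \<in> L2 UNIV \<and> eqL2 UNIV f g)"
    by (auto simp: symp_def eqL2_def)
  show "transp (\<lambda>f g :: 'a \<Rightarrow> real. f \<in> L2 UNIV \<and> g \<in> L2 UNIV \<and> eqL2 UNIV f g)"
    by (auto simp: transp_def eqL2_def elim: AE_mp)
qed

instantiation l2 :: (euclidean_space) real_inner
begin

lift_definition zero_l2 :: "'a l2" is "\<lambda>x. 0"
  by (simp add: L2_zero eqL2_def)

lift_definition plus_l2 :: "'a l2 \<Rightarrow> 'a l2 \<Rightarrow> 'a l2" is "\<lambda>f g x. f x + g x"
  by (auto intro!: L2_add simp: eqL2_def)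

lift_definition minus_l2 :: "'a l2 \<Rightarrow> 'a l2 \<Rightarrow> 'a l2" is "\<lambda>f g x. f x - g x"
  by (auto intro!: L2_diff simp: eqL2_def)

lift_definition uminus_l2 :: "'a l2 \<Rightarrow> 'a l2" is "\<lambda>f x. - f x"
  by (auto intro!: L2_minus simp: eqL2_def)

lift_definition scaleR_l2 :: "real \<Rightarrow> 'a l2 \<Rightarrow> 'a l2" is "\<lambda>r f x. r * f x"
  by (auto intro!: L2_scale simp: eqL2_def)

lift_definition inner_l2 :: "'a l2 \<Rightarrow> 'a l2 \<Rightarrow> real" is "L2_inner UNIV"
  by (auto intro: L2_inner_cong)

definition norm_l2 :: "'a l2 \<Rightarrow> real" where "norm_l2 x = sqrt (inner x x)"
definition dist_l2 :: "'a l2 \<Rightarrow> 'a l2 \<Rightarrow> real" where "dist_l2 x y = norm (x - y)"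
definition sgn_l2 :: "'a l2 \<Rightarrow> 'a l2" where "sgn_l2 x = scaleR (inverse (norm x)) x"
definition uniformity_l2 :: "('a l2 \<times> 'a l2) filter" where
  "uniformity_l2 = (INF e\<in>{0 <..}. principal {(x, y). dist x y < e})"
definition open_l2 :: "'a l2 set \<Rightarrow> bool" where
  "open_l2 U = (\<forall>x\<in>U. eventually (\<lambda>(x', y). x' = x \<longrightarrow> y \<in> U) uniformity)"

instance
proof
  fix x y z :: "'a l2" and a b :: real
  show "x + y + z = x + (y + z)" by transfer (auto simp: eqL2_def add.assoc intro!: L2_add)
  show "x + y = y + x" by transfer (auto simp: eqL2_def add.commute intro!: L2_add)
  show "0 + x = x" by transfer (auto simp: eqL2_def)
  show "- x + x = 0" by transfer (auto simp: eqL2_def L2_zero)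
  show "x - y = x + - y" by transfer (auto simp: eqL2_def intro!: L2_add L2_diff L2_minus)
  show "a *\<^sub>R (x + y) = a *\<^sub>R x + a *\<^sub>R y"
    by transfer (auto simp: eqL2_def distrib_left intro!: L2_add L2_scale)
  show "(a + b) *\<^sub>R x = a *\<^sub>R x + b *\<^sub>R x"
    by transfer (auto simp: eqL2_def distrib_right intro!: L2_add L2_scale)
  show "a *\<^sub>R b *\<^sub>R x = (a * b) *\<^sub>R x"
    by transfer (auto simp: eqL2_def mult.assoc intro!: L2_scale)
  show "1 *\<^sub>R x = x" by transfer (auto simp: eqL2_def)
  show "dist x y = norm (x - y)" by (rule dist_l2_def)
  show "sgn x = scaleR (inverse (norm x)) x" by (rule sgn_l2_def)
  show "uniformity = (INF e\<in>{0 <..}. principal {(x :: 'a l2, y). dist x y < e})" by (rule uniformity_l2_def)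
  show "open U = (\<forall>x\<in>U. eventually (\<lambda>(x', y). x' = x \<longrightarrow> y \<in> U) uniformity)" for U :: "'a l2 set"
    by (rule open_l2_def)
  show "inner x y = inner y x" by transfer (simp add: L2_inner_def mult.commute)
  show "inner (x + y) z = inner x z + inner y z" by transfer (auto intro: L2_inner_add_left)
  show "inner (a *\<^sub>R x) y = a * inner x y" by transfer (rule L2_inner_scale_left)
  show "0 \<le> inner x x" by transfer (rule L2_inner_self_nonneg)
  show "inner x x = 0 \<longleftrightarrow> x = 0" by transfer (auto simp: L2_inner_self_eq_0 L2_zero)
  show "norm x = sqrt (inner x x)" by (rule norm_l2_def)
qed

end

lemma rep_l2_in_L2: "rep_l2 x \<in> L2 UNIV"
  using Quotient3_rep_reflp[OF Quotient3_l2, of x] by simp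

lemma rep_abs_l2: "f \<in> L2 UNIV \<Longrightarrow> eqL2 UNIV (rep_l2 (abs_l2 f)) f"
  using Quotient3_rep_abs[OF Quotient3_l2, of f] by (simp add: eqL2_def)

lemma abs_rep_l2: "abs_l2 (rep_l2 x) = x"
  by (rule Quotient3_abs_rep[OF Quotient3_l2])

lemma abs_l2_eq_iff: "f \<in> L2 UNIV \<Longrightarrow> g \<in> L2 UNIV \<Longrightarrow> abs_l2 f = abs_l2 g \<longleftrightarrow> eqL2 UNIV f g"
  using Quotient3_rel[OF Quotient3_l2, of f g] by (simp add: eqL2_def)

lemma inner_abs_l2: "f \<in> L2 UNIV \<Longrightarrow> g \<in> L2 UNIV \<Longrightarrow> inner (abs_l2 f) (abs_l2 g) = L2_inner UNIV f g"
  by (rule inner_l2.abs_eq) (simp_all add: eqL2_def)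

lemma diff_abs_l2: "f \<in> L2 UNIV \<Longrightarrow> g \<in> L2 UNIV \<Longrightarrow> abs_l2 f - abs_l2 g = abs_l2 (\<lambda>x. f x - g x)"
  by (rule minus_l2.abs_eq) (simp_all add: eqL2_def)

lemma lincomb_abs_l2:
  "f \<in> L2 UNIV \<Longrightarrow> g \<in> L2 UNIV \<Longrightarrow> a *\<^sub>R abs_l2 f + b *\<^sub>R abs_l2 g = abs_l2 (\<lambda>x. a * f x + b * g x)"
  by (simp add: scaleR_l2.abs_eq plus_l2.abs_eq eqL2_def L2_scale)

lemma nn_integral_square:
  assumes "f \<in> L2 UNIV"
  shows "(\<integral>\<^sup>+x. ennreal ((f x)\<^sup>2) \<partial>lebesgue) = ennreal ((norm (abs_l2 f))\<^sup>2)"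
proof -
  have "(\<integral>\<^sup>+x. ennreal ((f x)\<^sup>2) \<partial>lebesgue) = ennreal (\<integral>x. (f x)\<^sup>2 \<partial>lebesgue)"
    using L2_square_integrable[OF assms] by (intro nn_integral_eq_integral) (auto simp: lebesgue_on_UNIV_eq)
  also have "(\<integral>x. (f x)\<^sup>2 \<partial>lebesgue) = (norm (abs_l2 f))\<^sup>2"
    unfolding power2_norm_eq_inner inner_abs_l2[OF assms assms]
    by (simp add: L2_inner_def lebesgue_on_UNIV_eq power2_eq_square)
  finally show ?thesis .
qed

text \<open>
  The function \<open>\<Sum>\<^sub>k 4\<^sup>k (f\<^sub>k\<^sub>+\<^sub>1 - f\<^sub>k)\<^sup>2\<close> is integrable, hence finite almost everywhere, and there
  \<open>\<bar>f\<^sub>k\<^sub>+\<^sub>1 - f\<^sub>k\<bar>\<close> is bounded by a geometric sequence.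
\<close>

lemma rapid_l2_sequence_converges_AE:
  fixes f :: "nat \<Rightarrow> 'a::euclidean_space \<Rightarrow> real"
  assumes f: "\<And>k. f k \<in> L2 UNIV"
    and rapid: "\<And>k. (norm (abs_l2 (f (Suc k)) - abs_l2 (f k)))\<^sup>2 \<le> (1 / 8) ^ k"
  shows "AE x in lebesgue. convergent (\<lambda>k. f k x)"
proof -
  define d where "d k x = f (Suc k) x - f k x" for k x
  have d: "d k \<in> L2 UNIV" for k unfolding d_def by (intro L2_diff f)
  have [measurable]: "d k \<in> borel_measurable lebesgue" for k
    using L2_measurable[OF d] by (simp add: lebesgue_on_UNIV_eq)
  have "(\<integral>\<^sup>+x. (\<Sum>k. ennreal (4 ^ k * (d k x)\<^sup>2)) \<partial>lebesgue) = (\<Sum>k. \<integral>\<^sup>+x. ennreal (4 ^ k * (d k x)\<^sup>2) \<partial>lebesgue)"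
    by (rule nn_integral_suminf) simp
  also have "\<dots> \<le> (\<Sum>k. ennreal ((1 / 2) ^ k))"
  proof (intro suminf_le summableI)
    fix k
    have "(\<integral>\<^sup>+x. ennreal (4 ^ k * (d k x)\<^sup>2) \<partial>lebesgue) = ennreal (4 ^ k) * (\<integral>\<^sup>+x. ennreal ((d k x)\<^sup>2) \<partial>lebesgue)"
      by (subst nn_integral_cmult[symmetric]) (auto simp: ennreal_mult)
    also have "\<dots> = ennreal (4 ^ k * (norm (abs_l2 (f (Suc k)) - abs_l2 (f k)))\<^sup>2)"
      unfolding nn_integral_square[OF d] by (simp add: d_def[abs_def] diff_abs_l2 f ennreal_mult)
    also have "\<dots> \<le> ennreal (4 ^ k * (1 / 8) ^ k)" by (intro ennreal_leI mult_left_mono rapid) simp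
    also have "4 ^ k * (1 / 8) ^ k = ((1 / 2) ^ k :: real)" by (simp add: power_mult_distrib[symmetric])
    finally show "(\<integral>\<^sup>+x. ennreal (4 ^ k * (d k x)\<^sup>2) \<partial>lebesgue) \<le> ennreal ((1 / 2) ^ k)" .
  qed
  also have "\<dots> = ennreal (\<Sum>k. (1 / 2) ^ k)"
    by (rule suminf_ennreal2) (auto intro: summable_geometric)
  also have "\<dots> < \<infinity>" by simp
  finally have "AE x in lebesgue. (\<Sum>k. ennreal (4 ^ k * (d k x)\<^sup>2)) \<noteq> \<infinity>"
    by (intro nn_integral_PInf_AE) auto
  then show ?thesis
  proof eventually_elim
    case (elim x)
    then have "summable (\<lambda>k. 4 ^ k * (d k x)\<^sup>2)" by (intro summable_suminf_not_top) auto
    then have "Bseq (\<lambda>k. 4 ^ k * (d k x)\<^sup>2)"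
      by (intro convergent_imp_Bseq) (auto simp: convergent_def dest: summable_LIMSEQ_zero)
    then obtain b where b: "b > 0" "\<And>k. 4 ^ k * (d k x)\<^sup>2 \<le> b" by (auto simp: Bseq_def abs_mult)
    have "summable (\<lambda>k. d k x)"
    proof (rule summable_comparison_test')
      show "summable (\<lambda>k. sqrt b * (1 / 2) ^ k :: real)" by (intro summable_mult summable_geometric) simp
      show "norm (d k x) \<le> sqrt b * (1 / 2) ^ k" if "k \<ge> 0" for k
      proof -
        have "(2 ^ k * \<bar>d k x\<bar>)\<^sup>2 \<le> b"
        proof -
          have "(2 ^ k * \<bar>d k x\<bar>)\<^sup>2 = 4 ^ k * (d k x)\<^sup>2"
          proof -
            have "((2 :: real) ^ k)\<^sup>2 = 4 ^ k"
              by (simp only: power2_eq_square power_mult_distrib[symmetric]) simp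
            then show ?thesis by (simp add: power_mult_distrib)
          qed
          then show ?thesis using b(2)[of k] by simp
        qed
        then have "2 ^ k * \<bar>d k x\<bar> \<le> sqrt b" by (rule real_le_rsqrt)
        then show ?thesis by (simp add: field_simps power_divide)
      qed
    qed
    then have "convergent (\<lambda>n. \<Sum>k<n. d k x)" by (simp add: summable_iff_convergent)
    moreover have "(\<Sum>k<n. d k x) = f n x - f 0 x" for n
      unfolding d_def by (rule sum_lessThan_telescope)
    ultimately have "convergent (\<lambda>n. (f n x - f 0 x) + f 0 x)" by (intro convergent_add convergent_const) simp
    then show ?case by simp
  qed
qed

text \<open>
  The Riesz-Fischer theorem. A rapidly converging subsequence has a pointwise limit, and Fatou's lemma shows
  that it is also the limit in the norm.
\<close>

instance l2 :: (euclidean_space) complete_space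
proof
  fix X :: "nat \<Rightarrow> 'a l2" assume C: "Cauchy X"
  have "\<exists>n\<ge>m. \<forall>i\<ge>n. \<forall>j\<ge>n. (norm (X i - X j))\<^sup>2 \<le> (1 / 8) ^ k" for m k :: nat
  proof -
    have "0 < sqrt ((1 / 8) ^ k :: real)" by simp
    from metric_CauchyD[OF C this] obtain n where n: "\<And>i j. i \<ge> n \<Longrightarrow> j \<ge> n \<Longrightarrow> norm (X i - X j) < sqrt ((1 / 8) ^ k)"
      by (auto simp: dist_norm)
    have "(norm (X i - X j))\<^sup>2 \<le> (1 / 8) ^ k" if "i \<ge> max m n" "j \<ge> max m n" for i j
    proof -
      have "(norm (X i - X j))\<^sup>2 \<le> (sqrt ((1 / 8) ^ k))\<^sup>2" using n[of i j] that by (intro power_mono) auto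
      then show ?thesis by simp
    qed
    then show ?thesis by (intro exI[of _ "max m n"]) auto
  qed
  then have "\<exists>r :: nat \<Rightarrow> nat. \<forall>k. (\<forall>i\<ge>r k. \<forall>j\<ge>r k. (norm (X i - X j))\<^sup>2 \<le> (1 / 8) ^ k) \<and> Suc (r k) \<le> r (Suc k)"
    by (intro dependent_nat_choice) blast+
  then obtain r where r: "\<And>k i j. i \<ge> r k \<Longrightarrow> j \<ge> r k \<Longrightarrow> (norm (X i - X j))\<^sup>2 \<le> (1 / 8) ^ k" and "\<And>k. r k < r (Suc k)"
    by (auto simp: Suc_le_eq)
  then have mono: "strict_mono r" by (simp add: strict_mono_Suc_iff)
  define f where "f k = rep_l2 (X (r k))" for k
  have f: "f k \<in> L2 UNIV" for k unfolding f_def by (rule rep_l2_in_L2)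
  have absf: "abs_l2 (f k) = X (r k)" for k unfolding f_def by (rule abs_rep_l2)
  have [measurable]: "f k \<in> borel_measurable lebesgue" for k
    using L2_measurable[OF f] by (simp add: lebesgue_on_UNIV_eq)
  have rk: "r m \<le> r k" if "m \<le> k" for m k using mono that by (simp add: strict_mono_less_eq)
  have conv: "AE x in lebesgue. convergent (\<lambda>k. f k x)"
    by (rule rapid_l2_sequence_converges_AE[OF f]) (use r rk in \<open>simp add: absf\<close>)
  define F where "F x = lim (\<lambda>k. f k x)" for x
  have [measurable]: "F \<in> borel_measurable lebesgue" unfolding F_def by measurable
  have bound: "(\<integral>\<^sup>+x. ennreal ((F x - f m x)\<^sup>2) \<partial>lebesgue) \<le> ennreal ((1 / 8) ^ m)" for m
  proof -
    have "(\<integral>\<^sup>+x. ennreal ((F x - f m x)\<^sup>2) \<partial>lebesgue) = (\<integral>\<^sup>+x. liminf (\<lambda>k. ennreal ((f k x - f m x)\<^sup>2)) \<partial>lebesgue)"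
    proof (rule nn_integral_cong_AE)
      show "AE x in lebesgue. ennreal ((F x - f m x)\<^sup>2) = liminf (\<lambda>k. ennreal ((f k x - f m x)\<^sup>2))"
        using conv
      proof eventually_elim
        case (elim x)
        then have "(\<lambda>k. f k x) \<longlonglongrightarrow> F x" by (simp add: F_def convergent_LIMSEQ_iff)
        then have "(\<lambda>k. ennreal ((f k x - f m x)\<^sup>2)) \<longlonglongrightarrow> ennreal ((F x - f m x)\<^sup>2)" by (intro tendsto_intros)
        then show ?case by (rule lim_imp_Liminf[OF sequentially_bot, symmetric])
      qed
    qed
    also have "\<dots> \<le> liminf (\<lambda>k. \<integral>\<^sup>+x. ennreal ((f k x - f m x)\<^sup>2) \<partial>lebesgue)"
      by (rule nn_integral_liminf) simp
    also have "\<dots> \<le> ennreal ((1 / 8) ^ m)"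
    proof (rule Liminf_le)
      show "\<forall>\<^sub>F k in sequentially. (\<integral>\<^sup>+x. ennreal ((f k x - f m x)\<^sup>2) \<partial>lebesgue) \<le> ennreal ((1 / 8) ^ m)"
      proof (rule eventually_sequentiallyI[of m])
        fix k assume "m \<le> k"
        have "(\<integral>\<^sup>+x. ennreal ((f k x - f m x)\<^sup>2) \<partial>lebesgue) = ennreal ((norm (X (r k) - X (r m)))\<^sup>2)"
          using nn_integral_square[OF L2_diff[OF f f], of k m] by (simp add: diff_abs_l2[OF f f, symmetric] absf)
        also have "\<dots> \<le> ennreal ((1 / 8) ^ m)" using r[of m "r k" "r m"] rk[OF \<open>m \<le> k\<close>] by (intro ennreal_leI) simp
        finally show "(\<integral>\<^sup>+x. ennreal ((f k x - f m x)\<^sup>2) \<partial>lebesgue) \<le> ennreal ((1 / 8) ^ m)" .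
      qed
    qed simp
    finally show ?thesis .
  qed
  have diff: "(\<lambda>x. F x - f m x) \<in> L2 UNIV" for m
  proof -
    have "(\<integral>\<^sup>+x. ennreal (norm ((F x - f m x)\<^sup>2)) \<partial>lebesgue) < \<infinity>"
      using bound[of m] by (auto simp: le_less_trans[OF _ ennreal_less_top])
    then have "integrable lebesgue (\<lambda>x. (F x - f m x)\<^sup>2)" by (intro integrableI_bounded) auto
    then show ?thesis by (simp add: L2_def lebesgue_on_UNIV_eq)
  qed
  have F: "F \<in> L2 UNIV" using L2_add[OF diff f, of 0 0] by simp
  have "(norm (X (r m) - abs_l2 F))\<^sup>2 \<le> (1 / 8) ^ m" for m
  proof -
    have "ennreal ((norm (abs_l2 F - X (r m)))\<^sup>2) \<le> ennreal ((1 / 8) ^ m)"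
      using bound[of m] nn_integral_square[OF diff, of m] by (simp add: diff_abs_l2[OF F f, symmetric] absf)
    then show ?thesis by (simp add: norm_minus_commute)
  qed
  then have "(\<lambda>m. (norm (X (r m) - abs_l2 F))\<^sup>2) \<longlonglongrightarrow> 0"
    by (intro tendsto_sandwich[OF _ _ tendsto_const LIMSEQ_power_zero[of "1 / 8 :: real"]] always_eventually) auto
  then have "(\<lambda>m. sqrt ((norm (X (r m) - abs_l2 F))\<^sup>2)) \<longlonglongrightarrow> sqrt 0" by (intro tendsto_intros)
  then have "(\<lambda>m. norm (X (r m) - abs_l2 F)) \<longlonglongrightarrow> 0" by simp
  then have "(X \<circ> r) \<longlonglongrightarrow> abs_l2 F" by (simp add: o_def LIM_zero_iff tendsto_norm_zero_iff)
  then have "X \<longlonglongrightarrow> abs_l2 F" by (rule Cauchy_converges_subseq[OF C mono])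
  then show "convergent X" by (auto simp: convergent_def)
qed

section \<open>Consequences of consistency and stability\<close>

lemma smooth_real_family:
  assumes g: "smooth_real g"
  obtains B where "0 \<le> B" "smooth_family {a..b} m B (\<lambda>k. (deriv ^^ k) g)"
proof -
  have der: "((deriv ^^ k) g has_real_derivative (deriv ^^ Suc k) g t) (at t within S)" for k t S
  proof -
    have "(deriv ^^ k) g differentiable (at t)" using g unfolding smooth_real_def by blast
    then have "((deriv ^^ k) g has_real_derivative deriv ((deriv ^^ k) g) t) (at t)"
      by (simp add: DERIV_deriv_iff_real_differentiable)
    then show ?thesis by (auto intro: has_field_derivative_at_within)
  qed
  have "\<forall>k. \<exists>B. \<forall>t\<in>{a..b}. norm ((deriv ^^ k) g t) \<le> B"
  proof
    fix k
    have "continuous_on {a..b} ((deriv ^^ k) g)" using der by (intro DERIV_continuous_on)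
    then have "bounded ((deriv ^^ k) g ` {a..b})" by (intro compact_imp_bounded compact_continuous_image) auto
    then show "\<exists>B. \<forall>t\<in>{a..b}. norm ((deriv ^^ k) g t) \<le> B" by (auto simp: bounded_iff)
  qed
  from choice[OF this] obtain B where B: "\<And>k t. t \<in> {a..b} \<Longrightarrow> norm ((deriv ^^ k) g t) \<le> B k" by blast
  have le: "norm ((deriv ^^ k) g t) \<le> (\<Sum>k\<le>m. \<bar>B k\<bar>)" if "t \<in> {a..b}" "k \<le> m" for k t
    using B[OF that(1), of k] member_le_sum[of k "{..m}" "\<lambda>k. \<bar>B k\<bar>"] that by auto
  show ?thesis
  proof (rule that[of "\<Sum>k\<le>m. \<bar>B k\<bar>"])
    show "smooth_family {a..b} m (\<Sum>k\<le>m. \<bar>B k\<bar>) (\<lambda>k. (deriv ^^ k) g)"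
      unfolding smooth_family_def
      using le der by (auto simp: has_real_derivative_iff_has_vector_derivative[symmetric])
  qed (simp add: sum_nonneg)
qed

text \<open>
  The functions required by the definition are \<open>\<Sum>\<^sub>l\<^sub>\<le>\<^sub>q w\<^sub>l \<tau>\<^sup>l g\<^sup>(\<^sup>l\<^sup>)(t\<^sub>n)\<close>.
\<close>

lemma order_conditions_imp_stage_order:
  fixes M :: "('s::finite, 'r::finite) gltd"
  assumes oc: "order_conditions M w q" and w: "\<And>k. k < q \<Longrightarrow> w k = wext M k"
  shows "has_generalized_stage_order M q"
  unfolding has_generalized_stage_order_def
proof (intro allI impI)
  fix g T assume g: "smooth_real g" and T: "(0 :: real) < T"
  define m where "m = q + 1 + wdeg M"
  have m: "q < m" "wdeg M \<le> m" "q \<le> m" by (auto simp: m_def)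
  \<comment> \<open>for \<open>\<tau> \<le> 1\<close> all nodes, including \<open>t + \<tau>\<close>, lie within distance \<open>S\<close> of \<open>t\<close>\<close>
  define S where "S = 1 + (\<Sum>i\<in>UNIV. \<bar>absc M $ i\<bar>)"
  define J where "J = {- S .. T + S}"
  have c: "\<bar>absc M $ i\<bar> \<le> S - 1" for i
    unfolding S_def using member_le_sum[of i UNIV "\<lambda>i. \<bar>absc M $ i\<bar>"] by simp
  have S: "1 \<le> S" unfolding S_def by (simp add: sum_nonneg)
  define f where "f k = (deriv ^^ k) g" for k
  obtain B where B: "0 \<le> B" "smooth_family J m B f" unfolding J_def f_def by (rule smooth_real_family[OF g])
  obtain C1 where C1: "0 \<le> C1" and
    c1: "\<And>i. negligible_by C1 (insert 0 (range (($) (absc M)))) m (q + 1)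
      (stage_residual M w q i :: (nat \<Rightarrow> real \<Rightarrow> real) \<Rightarrow> real \<Rightarrow> real \<Rightarrow> real)"
    using negligible_uniform[where \<Phi>="stage_residual M w q", OF stage_residual_small[OF oc m(1)]] by blast
  obtain C2 where C2: "0 \<le> C2" and
    c2: "\<And>i. negligible_by C2 (insert 0 (insert 1 (range (($) (absc M))))) m (q + 1)
      (step_residual M w q i :: (nat \<Rightarrow> real \<Rightarrow> real) \<Rightarrow> real \<Rightarrow> real \<Rightarrow> real)"
    using negligible_uniform[where \<Phi>="step_residual M w q", OF step_residual_small[OF oc m(1)]] by blast
  obtain C3 where C3: "0 \<le> C3" and
    c3: "\<And>i. negligible_by C3 {0} m q (modification M w q i :: (nat \<Rightarrow> real \<Rightarrow> real) \<Rightarrow> real \<Rightarrow> real \<Rightarrow> real)"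
    using negligible_uniform[where \<Phi>="modification M w q", OF modification_small[OF w m(3,2)]] by blast
  define gh where "gh \<tau> n i = (\<Sum>l\<le>q. w l $ i *\<^sub>R node l 0 f \<tau> (real n * \<tau>))" for \<tau> n i
  show "\<exists>ghat :: real \<Rightarrow> nat \<Rightarrow> 'r \<Rightarrow> real. \<exists>C. \<exists>\<tau>\<^sub>0>0. \<forall>\<tau>. 0 < \<tau> \<and> \<tau> < \<tau>\<^sub>0 \<longrightarrow>
         (\<forall>n. real n * \<tau> \<le> T \<longrightarrow>
           (\<forall>i. \<bar>external_value M \<tau> (\<lambda>k. (deriv ^^ k) g (real n * \<tau>)) i - ghat \<tau> n i\<bar> \<le> C * \<tau> ^ q) \<and>
           (\<forall>i. \<bar>g (stage_time M \<tau> n i)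
                 - (\<tau> * (\<Sum>j\<in>UNIV. D11 M $ i $ j * deriv g (stage_time M \<tau> n j))
                    + (\<Sum>j\<in>UNIV. D12 M $ i $ j * ghat \<tau> n j))\<bar> \<le> C * \<tau> ^ (q + 1)) \<and>
           (\<forall>i. \<bar>ghat \<tau> (n + 1) i
                 - (\<tau> * (\<Sum>j\<in>UNIV. D21 M $ i $ j * deriv g (stage_time M \<tau> n j))
                    + (\<Sum>j\<in>UNIV. D22 M $ i $ j * ghat \<tau> n j))\<bar> \<le> C * \<tau> ^ (q + 1)))"
  proof (rule exI[of _ gh], rule exI[of _ "(C1 + C2 + C3) * B"], rule exI[of _ 1], intro conjI allI impI)
    fix \<tau> :: real and n :: nat
    assume \<tau>: "0 < \<tau> \<and> \<tau> < 1" and n: "real n * \<tau> \<le> T"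
    define t where "t = real n * \<tau>"
    have J: "is_interval J" by (simp add: J_def is_interval_cc)
    have mem: "t + s * \<tau> \<in> J" if "\<bar>s\<bar> \<le> S" for s
    proof -
      have "\<bar>s * \<tau>\<bar> \<le> S * 1" unfolding abs_mult using that \<tau> by (intro mult_mono) auto
      moreover have "0 \<le> t" "t \<le> T" using \<tau> n by (auto simp: t_def)
      ultimately show ?thesis by (auto simp: J_def)
    qed
    have cS: "\<bar>absc M $ i\<bar> \<le> S" for i using c[of i] by simp
    have tJ: "t \<in> J" using mem[of 0] S by simp
    have nodes: "t + s * \<tau> \<in> J" if "s \<in> insert 0 (insert 1 (range (($) (absc M))))" for s
      using that mem[of 1] mem[OF cS] tJ S by auto
    have mono: "C1 * B * \<tau> ^ k \<le> (C1 + C2 + C3) * B * \<tau> ^ k" "C2 * B * \<tau> ^ k \<le> (C1 + C2 + C3) * B * \<tau> ^ k"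
      "C3 * B * \<tau> ^ k \<le> (C1 + C2 + C3) * B * \<tau> ^ k" for k
      using C1 C2 C3 B \<tau> by (auto intro!: mult_right_mono)
    have node_stage: "node 0 (absc M $ i) f \<tau> t = g (stage_time M \<tau> n i)"
      "node 1 (absc M $ i) f \<tau> t = \<tau> * deriv g (stage_time M \<tau> n i)" for i
      by (simp_all add: node_def f_def stage_time_def t_def)
    have node_next: "node l 1 f \<tau> t = node l 0 f \<tau> (real (n + 1) * \<tau>)" for l
      by (simp add: node_def t_def algebra_simps)
    have ext: "external_value M \<tau> (\<lambda>k. (deriv ^^ k) g t) i = (\<Sum>l\<le>wdeg M. wvec M l $ i *\<^sub>R node l 0 f \<tau> t)" for i
      by (simp add: external_value_def node_def f_def mult.assoc)
    {
      fix i
      have "\<bar>modification M w q i f \<tau> t\<bar> \<le> C3 * B * \<tau> ^ q"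
        using negligible_byD[OF c3 J B(2) _ _ tJ, of \<tau> i] \<tau> tJ by simp
      then show "\<bar>external_value M \<tau> (\<lambda>k. (deriv ^^ k) g (real n * \<tau>)) i - gh \<tau> n i\<bar> \<le> (C1 + C2 + C3) * B * \<tau> ^ q"
        using mono(3)[of q] ext[of i] by (simp add: modification_def gh_def t_def)
    next
      fix i
      have "\<bar>stage_residual M w q i f \<tau> t\<bar> \<le> C1 * B * \<tau> ^ (q + 1)"
        using negligible_byD[OF c1 J B(2) _ _ tJ nodes, of i] \<tau> by auto
      moreover have "stage_residual M w q i f \<tau> t = g (stage_time M \<tau> n i)
                 - (\<tau> * (\<Sum>j\<in>UNIV. D11 M $ i $ j * deriv g (stage_time M \<tau> n j))
                    + (\<Sum>j\<in>UNIV. D12 M $ i $ j * gh \<tau> n j))"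
        unfolding stage_residual_def node_stage gh_def t_def[symmetric]
        by (simp add: sum_distrib_left mult.left_commute)
      ultimately show "\<bar>g (stage_time M \<tau> n i)
                 - (\<tau> * (\<Sum>j\<in>UNIV. D11 M $ i $ j * deriv g (stage_time M \<tau> n j))
                    + (\<Sum>j\<in>UNIV. D12 M $ i $ j * gh \<tau> n j))\<bar> \<le> (C1 + C2 + C3) * B * \<tau> ^ (q + 1)"
        using mono(1)[of "q + 1"] by linarith
    next
      fix i
      have "\<bar>step_residual M w q i f \<tau> t\<bar> \<le> C2 * B * \<tau> ^ (q + 1)"
        using negligible_byD[OF c2 J B(2) _ _ tJ nodes, of i] \<tau> by auto
      moreover have "step_residual M w q i f \<tau> t = gh \<tau> (n + 1) i
                 - (\<tau> * (\<Sum>j\<in>UNIV. D21 M $ i $ j * deriv g (stage_time M \<tau> n j))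
                    + (\<Sum>j\<in>UNIV. D22 M $ i $ j * gh \<tau> n j))"
        unfolding step_residual_def node_stage node_next gh_def t_def[symmetric]
        by (simp add: sum_distrib_left mult.left_commute)
      ultimately show "\<bar>gh \<tau> (n + 1) i
                 - (\<tau> * (\<Sum>j\<in>UNIV. D21 M $ i $ j * deriv g (stage_time M \<tau> n j))
                    + (\<Sum>j\<in>UNIV. D22 M $ i $ j * gh \<tau> n j))\<bar> \<le> (C1 + C2 + C3) * B * \<tau> ^ (q + 1)"
        using mono(2)[of "q + 1"] by linarith
    }
  qed simp
qed

text \<open>
  The consistency relations are the order conditions of orders zero and one, so the method has stage order
  at least one, and \<open>q\<close> is maximal.
\<close>

lemma generalized_stage_order_ge_1:
  assumes cons: "gltd_consistent M" and "generalized_stage_order M q"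
  shows "1 \<le> q"
proof -
  have "order_conditions M (wext M) 1"
    unfolding order_conditions_def
  proof (intro allI impI)
    fix k :: nat assume "k \<le> 1"
    have w: "wext M 0 = wvec M 0" "wext M 1 = wvec M 1" using cons by (auto simp: wext_def gltd_consistent_def)
    have e: "D12 M *v wvec M 0 = 1" "D22 M *v wvec M 0 = wvec M 0"
      "D21 M *v 1 + D22 M *v wvec M 1 = wvec M 0 + wvec M 1" "D11 M *v 1 + D12 M *v wvec M 1 = absc M"
      using cons by (auto simp: gltd_consistent_def)
    have "k = 0 \<or> k = 1" using \<open>k \<le> 1\<close> by auto
    then show "(\<forall>i. tay 0 k (absc M $ i) = (\<Sum>j\<in>UNIV. D11 M $ i $ j * tay 1 k (absc M $ j)) + (\<Sum>j\<in>UNIV. D12 M $ i $ j * wext M k $ j)) \<and>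
        (\<forall>i. (\<Sum>l\<le>1. wext M l $ i * tay l k 1) = (\<Sum>j\<in>UNIV. D21 M $ i $ j * tay 1 k (absc M $ j)) + (\<Sum>j\<in>UNIV. D22 M $ i $ j * wext M k $ j))"
    proof
      assume "k = 0"
      then show ?thesis using w(1) e(1,2) by (simp add: tay_def vec_eq_iff matrix_vector_mult_def)
    next
      assume "k = 1"
      then show ?thesis using w[unfolded One_nat_def] e(3,4) by (simp add: tay_def vec_eq_iff matrix_vector_mult_def)
    qed
  qed
  then have "has_generalized_stage_order M 1" by (rule order_conditions_imp_stage_order) simp
  then show ?thesis using assms(2) unfolding generalized_stage_order_def by blast
qed

lemma positive_definite_factor:
  assumes G: "positive_definite (G :: real^'n^'n)"
  shows "\<exists>C C' :: real^'n^'n. C' ** C = mat 1 \<and> (\<forall>x. x \<bullet> (G *v x) = (norm (C *v x))\<^sup>2)"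
proof -
  have quad: "x \<bullet> (G *v x) = (\<Sum>i\<in>UNIV. \<Sum>j\<in>UNIV. G $ i $ j * x $ i * x $ j)" for x
    by (simp add: inner_vec_def matrix_vector_mult_def sum_distrib_left mult_ac)
  have "\<exists>c. \<forall>i\<in>UNIV. \<forall>j\<in>UNIV. G $ i $ j = (\<Sum>k\<in>(UNIV :: 'n set). c k i * c k j)"
  proof (rule psd_gram_factor)
    show "G $ i $ j = G $ j $ i" for i j
      using G unfolding positive_definite_def transpose_def by (metis vec_lambda_beta)
    show "0 \<le> (\<Sum>i\<in>UNIV. \<Sum>j\<in>UNIV. G $ i $ j * x i * x j)" for x
    proof -
      have "0 \<le> y \<bullet> (G *v y)" for y
        using G unfolding positive_definite_def by (cases "y = 0") (auto intro: less_imp_le)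
      from this[of "\<chi> i. x i"] show ?thesis unfolding quad by simp
    qed
  qed simp
  then obtain c where c: "\<And>i j. G $ i $ j = (\<Sum>k\<in>(UNIV :: 'n set). c k i * c k j)" by auto
  define C where "C = (\<chi> k i. c k i)"
  have sq: "x \<bullet> (G *v x) = (norm (C *v x))\<^sup>2" for x
  proof -
    have "(norm (C *v x))\<^sup>2 = (\<Sum>k\<in>UNIV. \<Sum>i\<in>UNIV. \<Sum>j\<in>UNIV. c k i * c k j * x $ i * x $ j)"
      by (simp add: power2_norm_eq_inner inner_vec_def C_def matrix_vector_mult_def sum_product mult_ac)
    also have "\<dots> = (\<Sum>i\<in>UNIV. \<Sum>k\<in>UNIV. \<Sum>j\<in>UNIV. c k i * c k j * x $ i * x $ j)" by (rule sum.swap)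
    also have "\<dots> = (\<Sum>i\<in>UNIV. \<Sum>j\<in>UNIV. \<Sum>k\<in>UNIV. c k i * c k j * x $ i * x $ j)"
      by (intro sum.cong refl sum.swap)
    finally show ?thesis unfolding quad c by (simp add: sum_distrib_right)
  qed
  have "x = 0" if "C *v x = 0" for x
    using G sq[of x] that unfolding positive_definite_def by force
  then have "\<exists>C'. C' ** C = mat 1" by (simp add: matrix_left_invertible_ker)
  with sq show ?thesis by blast
qed

lemma inner_transpose_mult: "x \<bullet> (transpose A *v y) = (A *v x) \<bullet> (y :: real^'n)"
  by (metis dot_lmul_matrix inner_commute transpose_matrix_vector)

lemma diagonal_mult: "diagonal H \<Longrightarrow> (H *v y) $ i = H $ i $ i * y $ i"
proof -
  assume "diagonal H"
  then have "(H *v y) $ i = (\<Sum>j\<in>UNIV. if j = i then H $ i $ i * y $ i else 0)"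
    unfolding matrix_vector_mult_def vec_lambda_beta diagonal_def by (intro sum.cong) auto
  then show ?thesis by simp
qed

lemma diagonal_entry: "axis i 1 \<bullet> (H *v axis i 1) = (H :: real^'n^'n) $ i $ i"
  by (simp add: inner_axis' matrix_vector_mult_basis column_def)

lemma block_quadratic_form:
  fixes x :: "real^'r::finite" and y :: "real^'s::finite"
  shows "(\<chi> a. case_sum (($) x) (($) y) a) \<bullet> (block_matrix A B C E *v (\<chi> a. case_sum (($) x) (($) y) a))
     = x \<bullet> (A *v x) + x \<bullet> (B *v y) + y \<bullet> (C *v x) + y \<bullet> (E *v y)"
proof -
  have split: "(\<Sum>a\<in>(UNIV :: ('r + 's) set). g a) = (\<Sum>i\<in>UNIV. g (Inl i)) + (\<Sum>i\<in>UNIV. g (Inr i))" for g :: "'r + 's \<Rightarrow> real"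
    unfolding UNIV_sum by (subst sum.union_disjoint) (auto simp: sum.reindex)
  show ?thesis
    by (simp add: inner_vec_def matrix_vector_mult_def block_matrix_def split distrib_left sum.distrib)
qed

text \<open>
  A positive definite matrix is \<open>C\<^sup>T C\<close> with invertible \<open>C\<close>. Applied to \<open>H' D11 + D11\<^sup>T H'\<close> this shows that
  \<open>D11\<close> is invertible, and the substitution \<open>z = D11 y\<close> turns diagonal stability into coercivity of the
  inverse.
\<close>

lemma stable_method_exists:
  fixes M :: "('s::finite, 'r::finite) gltd"
  assumes "algebraically_stable M" "diagonally_stable M"
  shows "\<exists>Cg Ci h Ai hh \<kappa>. stable_method (D11 M) (D12 M) (D21 M) (D22 M) Cg Ci h Ai hh \<kappa>"
proof -
  from assms(1) obtain G :: "real^'r^'r" and H :: "real^'s^'s" where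
    G: "positive_definite G" and H: "diagonal H" "nonneg_definite H" and
    block: "nonneg_definite (block_matrix
          (G - transpose (D22 M) ** G ** D22 M)
          (transpose (D12 M) ** H - transpose (D22 M) ** G ** D21 M)
          (H ** D12 M - transpose (D21 M) ** G ** D22 M)
          (transpose (D11 M) ** H + H ** D11 M - transpose (D21 M) ** G ** D21 M))"
    unfolding algebraically_stable_def by blast
  from assms(2) obtain H' :: "real^'s^'s" where H': "diagonal H'" "positive_definite H'" and
    P: "positive_definite (H' ** D11 M + transpose (D11 M) ** H')"
    unfolding diagonally_stable_def by blast
  obtain Cg Ci :: "real^'r^'r" where Ci: "Ci ** Cg = mat 1" and Cg: "\<And>x. x \<bullet> (G *v x) = (norm (Cg *v x))\<^sup>2"
    using positive_definite_factor[OF G] by blast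
  obtain C2 C2' :: "real^'s^'s" where C2': "C2' ** C2 = mat 1" and
    C2: "\<And>x. x \<bullet> ((H' ** D11 M + transpose (D11 M) ** H') *v x) = (norm (C2 *v x))\<^sup>2"
    using positive_definite_factor[OF P] by blast
  define h where "h = (\<chi> i. H $ i $ i)"
  define hh where "hh = (\<chi> i. H' $ i $ i)"
  have h: "0 \<le> h $ i" for i
    using H(2) unfolding nonneg_definite_def h_def by (simp add: diagonal_entry[symmetric])
  have hh: "0 < hh $ i" for i
    using H'(2) unfolding positive_definite_def hh_def by (simp add: diagonal_entry[symmetric] axis_eq_0_iff)
  have Hin: "y \<bullet> (H *v u) = (\<Sum>i\<in>UNIV. h $ i * (y $ i * u $ i))" "(H *v u) \<bullet> y = (\<Sum>i\<in>UNIV. h $ i * (y $ i * u $ i))" for y u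
    unfolding inner_vec_def by (simp_all add: diagonal_mult[OF H(1)] h_def mult_ac)
  have H'in: "y \<bullet> (H' *v u) = (\<Sum>i\<in>UNIV. hh $ i * (y $ i * u $ i))" for y u
    unfolding inner_vec_def by (simp add: diagonal_mult[OF H'(1)] hh_def mult_ac)
  have alg: "(norm (Cg *v (D21 M *v y + D22 M *v x)))\<^sup>2
        \<le> (norm (Cg *v x))\<^sup>2 + 2 * (\<Sum>i\<in>UNIV. h $ i * (y $ i * (D11 M *v y + D12 M *v x) $ i))" for x y
  proof -
    have Gsym: "(norm (Cg *v (D21 M *v y + D22 M *v x)))\<^sup>2 = (D21 M *v y) \<bullet> (G *v (D21 M *v y))
        + (D21 M *v y) \<bullet> (G *v (D22 M *v x)) + (D22 M *v x) \<bullet> (G *v (D21 M *v y)) + (D22 M *v x) \<bullet> (G *v (D22 M *v x))"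
      unfolding Cg[symmetric] by (simp add: matrix_vector_right_distrib inner_add_left inner_add_right)
    define z where "z = (\<chi> a. case_sum (($) x) (($) y) a)"
    have "0 \<le> z \<bullet> (block_matrix
          (G - transpose (D22 M) ** G ** D22 M)
          (transpose (D12 M) ** H - transpose (D22 M) ** G ** D21 M)
          (H ** D12 M - transpose (D21 M) ** G ** D22 M)
          (transpose (D11 M) ** H + H ** D11 M - transpose (D21 M) ** G ** D21 M) *v z)"
      using block unfolding nonneg_definite_def by blast
    moreover have "(\<Sum>i\<in>UNIV. h $ i * ((D11 M *v y) $ i * y $ i)) = (\<Sum>i\<in>UNIV. h $ i * (y $ i * (D11 M *v y) $ i))"
      "(\<Sum>i\<in>UNIV. h $ i * ((D12 M *v x) $ i * y $ i)) = (\<Sum>i\<in>UNIV. h $ i * (y $ i * (D12 M *v x) $ i))"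
      by (simp_all add: mult.commute)
    ultimately have "0 \<le> (norm (Cg *v x))\<^sup>2 - (norm (Cg *v (D21 M *v y + D22 M *v x)))\<^sup>2
        + 2 * (\<Sum>i\<in>UNIV. h $ i * (y $ i * (D11 M *v y) $ i)) + 2 * (\<Sum>i\<in>UNIV. h $ i * (y $ i * (D12 M *v x) $ i))"
      unfolding z_def block_quadratic_form matrix_vector_mult_diff_rdistrib matrix_vector_mult_add_rdistrib
        inner_diff_right inner_add_right
        matrix_vector_mul_assoc[symmetric] inner_transpose_mult Cg Gsym Hin
      by linarith
    then show ?thesis by (simp add: distrib_left sum.distrib)
  qed
  have Pq: "2 * (\<Sum>i\<in>UNIV. hh $ i * (y $ i * (D11 M *v y) $ i)) = (norm (C2 *v y))\<^sup>2" for y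
  proof -
    have "y \<bullet> ((transpose (D11 M) ** H') *v y) = y \<bullet> (H' *v (D11 M *v y))"
      by (simp only: matrix_vector_mul_assoc[symmetric] inner_transpose_mult H'in mult_ac)
    then show ?thesis
      unfolding C2[symmetric] by (simp add: matrix_vector_mult_add_rdistrib inner_add_right matrix_vector_mul_assoc[symmetric] H'in)
  qed
  have inj2: "y = 0" if "C2 *v y = 0" for y
  proof -
    have "(C2' ** C2) *v y = 0" using that by (simp add: matrix_vector_mul_assoc[symmetric])
    then show ?thesis by (simp add: C2')
  qed
  have "y = 0" if "D11 M *v y = 0" for y
  proof (rule inj2)
    show "C2 *v y = 0" using Pq[of y] that by simp
  qed
  then have "\<exists>Ai :: real^'s^'s. Ai ** D11 M = mat 1" by (simp add: matrix_left_invertible_ker)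
  then obtain Ai :: "real^'s^'s" where Ai: "Ai ** D11 M = mat 1" by blast
  have Ai': "D11 M ** Ai = mat 1" by (rule iffD1[OF matrix_left_right_inverse Ai])
  obtain K where K: "K > 0" "\<And>x :: real^'s. norm (C2' \<star> x) \<le> K * norm x"
    using mact_bounded[of C2', where ?'h=real] by blast
  obtain Ka where Ka: "Ka > 0" "\<And>x :: real^'s. norm (D11 M \<star> x) \<le> Ka * norm x"
    using mact_bounded[of "D11 M", where ?'h=real] by blast
  define \<kappa> where "\<kappa> = 1 / (2 * (Ka * K)\<^sup>2)"
  have co: "\<kappa> * (norm z)\<^sup>2 \<le> (\<Sum>i\<in>UNIV. hh $ i * (z $ i * (Ai *v z) $ i))" for z
  proof -
    define y where "y = Ai *v z"
    have z: "z = D11 M *v y" by (simp add: y_def matrix_vector_mul_assoc Ai')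
    have "norm z \<le> Ka * norm y" using Ka(2)[of y] by (simp add: z mact_real)
    also have "\<dots> \<le> Ka * (K * norm (C2 *v y))"
    proof -
      have "C2' *v (C2 *v y) = y" by (simp add: matrix_vector_mul_assoc C2')
      then have "norm y \<le> K * norm (C2 *v y)" using K(2)[of "C2 *v y"] by (simp add: mact_real)
      then show ?thesis using Ka by (intro mult_left_mono) auto
    qed
    finally have "(norm z)\<^sup>2 \<le> (Ka * K * norm (C2 *v y))\<^sup>2" by (intro power_mono) (auto simp: mult.assoc)
    then have "(norm z)\<^sup>2 \<le> (Ka * K)\<^sup>2 * (2 * (\<Sum>i\<in>UNIV. hh $ i * (y $ i * (D11 M *v y) $ i)))"
      unfolding Pq by (simp add: power_mult_distrib)
    then have "\<kappa> * (norm z)\<^sup>2 \<le> (\<Sum>i\<in>UNIV. hh $ i * (y $ i * (D11 M *v y) $ i))"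
      using K Ka by (simp add: \<kappa>_def field_simps)
    then show ?thesis unfolding z[symmetric] by (simp add: y_def mult.commute)
  qed
  have "stable_method (D11 M) (D12 M) (D21 M) (D22 M) Cg Ci h Ai hh \<kappa>"
    by unfold_locales (use h alg Ci Ai Ai' hh co K Ka in \<open>auto simp: \<kappa>_def\<close>)
  then show ?thesis by blast
qed

section \<open>Functions on a domain as elements of the Hilbert space\<close>

definition l2_class :: "'a::euclidean_space set \<Rightarrow> ('a \<Rightarrow> real) \<Rightarrow> 'a l2" where
  "l2_class \<Omega> v = abs_l2 (\<lambda>x. indicator \<Omega> x * v x)"

lemma eqL2_UNIV_imp: "eqL2 UNIV v w \<Longrightarrow> \<Omega> \<in> sets lebesgue \<Longrightarrow> eqL2 \<Omega> v w"
  unfolding eqL2_def lebesgue_on_UNIV_eq by (subst AE_restrict_space_iff) auto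

locale lebesgue_region =
  fixes \<Omega> :: "'a::euclidean_space set"
  assumes meas: "\<Omega> \<in> sets lebesgue"
begin

abbreviation cls where "cls \<equiv> l2_class \<Omega>"

lemma int_space: "\<Omega> \<inter> space lebesgue \<in> sets lebesgue"
  using meas by simp

lemma L2_extend_iff: "v \<in> L2 \<Omega> \<longleftrightarrow> (\<lambda>x. indicator \<Omega> x * v x) \<in> L2 UNIV"
proof -
  have "indicator \<Omega> x *\<^sub>R (v x)\<^sup>2 = (indicator \<Omega> x * v x)\<^sup>2" for x
    by (simp add: indicator_def)
  then show ?thesis
    unfolding L2_def lebesgue_on_UNIV_eq
    by (simp add: borel_measurable_restrict_space_iff[OF int_space] integrable_restrict_space[OF int_space])
qed

lemma L2_inner_extend: "L2_inner \<Omega> v w = L2_inner UNIV (\<lambda>x. indicator \<Omega> x * v x) w"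
  unfolding L2_inner_def lebesgue_on_UNIV_eq integral_restrict_space[OF int_space]
  by (simp add: mult.assoc)

lemma L2_inner_extend2: "L2_inner \<Omega> v w = L2_inner UNIV (\<lambda>x. indicator \<Omega> x * v x) (\<lambda>x. indicator \<Omega> x * w x)"
proof -
  have "indicator \<Omega> x * v x * w x = indicator \<Omega> x * v x * (indicator \<Omega> x * w x)" for x
    by (simp add: indicator_def)
  then show ?thesis unfolding L2_inner_extend[of v w] by (simp only: L2_inner_def)
qed

lemma eqL2_extend_iff: "eqL2 \<Omega> v w \<longleftrightarrow> eqL2 UNIV (\<lambda>x. indicator \<Omega> x * v x) (\<lambda>x. indicator \<Omega> x * w x)"
  unfolding eqL2_def lebesgue_on_UNIV_eq AE_restrict_space_iff[OF int_space]
  by (intro AE_cong) (simp add: indicator_def)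

lemma L2_UNIV_imp: "v \<in> L2 UNIV \<Longrightarrow> v \<in> L2 \<Omega>"
proof -
  assume v: "v \<in> L2 UNIV"
  have "integrable lebesgue (\<lambda>x. indicator \<Omega> x *\<^sub>R (v x)\<^sup>2)"
    using L2_square_integrable[OF v] meas by (intro integrable_mult_indicator) (auto simp: lebesgue_on_UNIV_eq)
  moreover have "v \<in> borel_measurable (lebesgue_on \<Omega>)"
    using L2_measurable[OF v] by (auto simp: lebesgue_on_UNIV_eq intro: measurable_restrict_space1)
  ultimately show "v \<in> L2 \<Omega>"
    unfolding L2_def by (simp add: integrable_restrict_space[OF int_space])
qed

lemma L2_cong:
  assumes w: "w \<in> L2 \<Omega>" and eq: "eqL2 \<Omega> v w"
  shows "v \<in> L2 \<Omega>"
proof -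
  let ?v = "\<lambda>x. indicator \<Omega> x * v x" and ?w = "\<lambda>x. indicator \<Omega> x * w x"
  have w': "?w \<in> L2 UNIV" using w by (simp add: L2_extend_iff)
  have "AE x in lebesgue. ?v x = ?w x"
    using eq[unfolded eqL2_extend_iff] unfolding eqL2_def lebesgue_on_UNIV_eq .
  then have ae: "AE x in lebesgue. ?w x = ?v x" by eventually_elim (rule sym)
  have mw: "?w \<in> borel_measurable lebesgue" using L2_measurable[OF w'] by (simp add: lebesgue_on_UNIV_eq)
  have mv: "?v \<in> borel_measurable lebesgue" by (rule borel_measurable_AE[OF mw ae])
  have "integrable lebesgue (\<lambda>x. (?v x)\<^sup>2)"
  proof (rule integrable_cong_AE_imp)
    show "integrable lebesgue (\<lambda>x. (?w x)\<^sup>2)" using L2_square_integrable[OF w'] by (simp add: lebesgue_on_UNIV_eq)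
    show "AE x in lebesgue. (?w x)\<^sup>2 = (?v x)\<^sup>2" using ae by eventually_elim auto
  qed (use mv in simp)
  then have "?v \<in> L2 UNIV" using mv by (simp add: L2_def lebesgue_on_UNIV_eq)
  then show ?thesis by (simp add: L2_extend_iff)
qed

lemma inner_cls: "v \<in> L2 \<Omega> \<Longrightarrow> w \<in> L2 \<Omega> \<Longrightarrow> cls v \<bullet> cls w = L2_inner \<Omega> v w"
  unfolding l2_class_def L2_inner_extend2 by (rule inner_abs_l2) (simp_all add: L2_extend_iff[symmetric])

lemma norm_cls: "v \<in> L2 \<Omega> \<Longrightarrow> norm (cls v) = L2_norm \<Omega> v"
  by (simp add: norm_eq_sqrt_inner inner_cls L2_norm_def)

lemma cls_eq_iff: "v \<in> L2 \<Omega> \<Longrightarrow> w \<in> L2 \<Omega> \<Longrightarrow> cls v = cls w \<longleftrightarrow> eqL2 \<Omega> v w"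
  unfolding l2_class_def eqL2_extend_iff by (rule abs_l2_eq_iff) (simp_all add: L2_extend_iff[symmetric])

lemma cls_lincomb:
  assumes "v \<in> L2 \<Omega>" "w \<in> L2 \<Omega>"
  shows "cls (\<lambda>x. a * v x + b * w x) = a *\<^sub>R cls v + b *\<^sub>R cls w"
proof -
  have "(\<lambda>x. indicator \<Omega> x * v x) \<in> L2 UNIV" "(\<lambda>x. indicator \<Omega> x * w x) \<in> L2 UNIV"
    using assms by (simp_all add: L2_extend_iff)
  from lincomb_abs_l2[OF this, of a b] show ?thesis by (simp add: l2_class_def algebra_simps)
qed

lemma cls_scale: "v \<in> L2 \<Omega> \<Longrightarrow> cls (\<lambda>x. a * v x) = a *\<^sub>R cls v"
  using cls_lincomb[of v v a 0] by simp

lemma cls_diff: "v \<in> L2 \<Omega> \<Longrightarrow> w \<in> L2 \<Omega> \<Longrightarrow> cls (\<lambda>x. v x - w x) = cls v - cls w"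
  using cls_lincomb[of v w 1 "-1"] by simp

lemma cls_add: "v \<in> L2 \<Omega> \<Longrightarrow> w \<in> L2 \<Omega> \<Longrightarrow> cls (\<lambda>x. v x + w x) = cls v + cls w"
  using cls_lincomb[of v w 1 1] by simp

lemma L2_sum: "finite I \<Longrightarrow> (\<And>i. i \<in> I \<Longrightarrow> v i \<in> L2 \<Omega>) \<Longrightarrow> (\<lambda>x. \<Sum>i\<in>I. a i * v i x) \<in> L2 \<Omega>"
  by (induction I rule: finite_induct) (auto intro!: L2_zero L2_add L2_scale)

lemma cls_sum:
  "finite I \<Longrightarrow> (\<And>i. i \<in> I \<Longrightarrow> v i \<in> L2 \<Omega>) \<Longrightarrow> cls (\<lambda>x. \<Sum>i\<in>I. a i * v i x) = (\<Sum>i\<in>I. a i *\<^sub>R cls (v i))"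
proof (induction I rule: finite_induct)
  case empty
  then show ?case using cls_scale[OF L2_zero, of 0] by simp
next
  case (insert i I)
  have "cls (\<lambda>x. a i * v i x + (\<Sum>i\<in>I. a i * v i x)) = cls (\<lambda>x. a i * v i x) + cls (\<lambda>x. \<Sum>i\<in>I. a i * v i x)"
    using insert by (intro cls_add L2_scale L2_sum) auto
  then show ?case using insert by (simp add: cls_scale)
qed

lemma rep_in_L2: "rep_l2 x \<in> L2 \<Omega>"
  by (rule L2_UNIV_imp[OF rep_l2_in_L2])

lemma inner_cls_left: "v \<in> L2 \<Omega> \<Longrightarrow> cls v \<bullet> x = L2_inner \<Omega> v (rep_l2 x)"
  using inner_abs_l2[of "\<lambda>x. indicator \<Omega> x * v x" "rep_l2 x"]
  by (simp add: l2_class_def L2_extend_iff[symmetric] rep_l2_in_L2 abs_rep_l2 L2_inner_extend)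

lemma rep_cls: "v \<in> L2 \<Omega> \<Longrightarrow> eqL2 \<Omega> (rep_l2 (cls v)) v"
proof -
  assume "v \<in> L2 \<Omega>"
  then have "eqL2 UNIV (rep_l2 (cls v)) (\<lambda>x. indicator \<Omega> x * v x)"
    unfolding l2_class_def by (intro rep_abs_l2) (simp add: L2_extend_iff[symmetric])
  then have "eqL2 \<Omega> (rep_l2 (cls v)) (\<lambda>x. indicator \<Omega> x * v x)" using meas by (rule eqL2_UNIV_imp)
  then show ?thesis unfolding eqL2_def AE_restrict_space_iff[OF int_space]
    by (auto elim!: AE_mp intro!: AE_I2)
qed

lemma rep_lincomb: "eqL2 \<Omega> (rep_l2 (a *\<^sub>R x + b *\<^sub>R y)) (\<lambda>t. a * rep_l2 x t + b * rep_l2 y t)"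
proof -
  have "a *\<^sub>R x + b *\<^sub>R y = abs_l2 (\<lambda>t. a * rep_l2 x t + b * rep_l2 y t)"
    using lincomb_abs_l2[OF rep_l2_in_L2 rep_l2_in_L2, of a x b y] by (simp add: abs_rep_l2)
  then have "eqL2 UNIV (rep_l2 (a *\<^sub>R x + b *\<^sub>R y)) (\<lambda>t. a * rep_l2 x t + b * rep_l2 y t)"
    by (simp add: rep_abs_l2 L2_lincomb rep_l2_in_L2)
  then show ?thesis using meas by (rule eqL2_UNIV_imp)
qed

text \<open>
  The representative of a class is a function on the whole space, and membership in \<open>Dm\<close> depends only on its
  values almost everywhere in \<open>\<Omega>\<close>. A class orthogonal to all functions on \<open>\<Omega>\<close> is therefore in the domain and is mapped to
  zero. For self-adjointness this means that \<open>g\<close> is orthogonal to all such classes, hence comes from a function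
  on \<open>\<Omega>\<close>, and the self-adjointness on \<open>\<Omega>\<close> can be used.
\<close>

lemma selfadjoint_extension:
  assumes op: "nonneg_selfadjoint_operator \<Omega> Dm Lop"
  shows "nonneg_selfadjoint {x. rep_l2 x \<in> Dm} (\<lambda>x. cls (Lop (rep_l2 x)))"
proof -
  have Dm: "v \<in> Dm \<Longrightarrow> v \<in> L2 \<Omega>" and LL2: "v \<in> Dm \<Longrightarrow> Lop v \<in> L2 \<Omega>"
    and cong: "v \<in> Dm \<Longrightarrow> eqL2 \<Omega> w v \<Longrightarrow> w \<in> Dm \<and> eqL2 \<Omega> (Lop w) (Lop v)"
    and zero: "(\<lambda>x. 0) \<in> Dm"
    and lin: "v \<in> Dm \<Longrightarrow> w \<in> Dm \<Longrightarrow> (\<lambda>x. a * v x + b * w x) \<in> Dm \<and>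
        eqL2 \<Omega> (Lop (\<lambda>x. a * v x + b * w x)) (\<lambda>x. a * Lop v x + b * Lop w x)"
    and sym: "v \<in> Dm \<Longrightarrow> w \<in> Dm \<Longrightarrow> L2_inner \<Omega> (Lop v) w = L2_inner \<Omega> v (Lop w)"
    and nonneg: "v \<in> Dm \<Longrightarrow> 0 \<le> L2_inner \<Omega> (Lop v) v"
    and adj: "v \<in> L2 \<Omega> \<Longrightarrow> g \<in> L2 \<Omega> \<Longrightarrow> (\<forall>w\<in>Dm. L2_inner \<Omega> (Lop w) v = L2_inner \<Omega> w g) \<Longrightarrow> v \<in> Dm \<and> eqL2 \<Omega> (Lop v) g"
    for v w g a b
    using op unfolding nonneg_selfadjoint_operator_def by blast+
  have comb: "rep_l2 (a *\<^sub>R x + b *\<^sub>R y) \<in> Dm"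
      "cls (Lop (rep_l2 (a *\<^sub>R x + b *\<^sub>R y))) = a *\<^sub>R cls (Lop (rep_l2 x)) + b *\<^sub>R cls (Lop (rep_l2 y))"
    if "rep_l2 x \<in> Dm" "rep_l2 y \<in> Dm" for a b x y
  proof -
    note l = lin[OF that, of a b]
    note c = cong[OF conjunct1[OF l] rep_lincomb]
    show "rep_l2 (a *\<^sub>R x + b *\<^sub>R y) \<in> Dm" using c by blast
    have "cls (Lop (rep_l2 (a *\<^sub>R x + b *\<^sub>R y))) = cls (Lop (\<lambda>t. a * rep_l2 x t + b * rep_l2 y t))"
      using c l by (subst cls_eq_iff) (auto intro: LL2)
    also have "\<dots> = cls (\<lambda>t. a * Lop (rep_l2 x) t + b * Lop (rep_l2 y) t)"
      using l that by (subst cls_eq_iff) (auto intro: LL2 L2_lincomb)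
    also have "\<dots> = a *\<^sub>R cls (Lop (rep_l2 x)) + b *\<^sub>R cls (Lop (rep_l2 y))"
      using that by (intro cls_lincomb LL2)
    finally show "cls (Lop (rep_l2 (a *\<^sub>R x + b *\<^sub>R y))) = \<dots>" .
  qed
  have outside: "rep_l2 x \<in> Dm \<and> cls (Lop (rep_l2 x)) = 0" if "\<And>v. v \<in> L2 \<Omega> \<Longrightarrow> cls v \<bullet> x = 0" for x
  proof -
    have "L2_inner \<Omega> (rep_l2 x) (rep_l2 x) = 0" using that[OF rep_in_L2] by (simp add: inner_cls_left[OF rep_in_L2])
    then have x0: "eqL2 \<Omega> (rep_l2 x) (\<lambda>x. 0)" by (simp add: L2_inner_self_eq_0 rep_in_L2)
    have r: "rep_l2 x \<in> Dm" using cong[OF zero x0] by simp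
    have "cls (Lop (rep_l2 (0 *\<^sub>R x + 0 *\<^sub>R x))) = 0" using comb(2)[OF r r, of 0 0] by simp
    moreover have "eqL2 \<Omega> (rep_l2 (0 *\<^sub>R x + 0 *\<^sub>R x)) (rep_l2 x)"
      using rep_lincomb[of 0 x 0 x] x0 unfolding eqL2_def by eventually_elim simp
    then have "cls (Lop (rep_l2 (0 *\<^sub>R x + 0 *\<^sub>R x))) = cls (Lop (rep_l2 x))"
      using cong[OF r] r by (subst cls_eq_iff) (auto intro: LL2)
    ultimately show ?thesis using r by simp
  qed
  have memcls: "rep_l2 (cls w) \<in> Dm \<and> cls (Lop (rep_l2 (cls w))) = cls (Lop w)" if "w \<in> Dm" for w
    using cong[OF that rep_cls[OF Dm[OF that]]] that by (subst cls_eq_iff) (auto intro: LL2)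
  show ?thesis
  proof (rule nonneg_selfadjoint.intro)
    show "subspace {x. rep_l2 x \<in> Dm}"
    proof (rule subspaceI)
      show "0 \<in> {x. rep_l2 x \<in> Dm}" using outside[of 0] by simp
      show "x + y \<in> {x. rep_l2 x \<in> Dm}" if "x \<in> {x. rep_l2 x \<in> Dm}" "y \<in> {x. rep_l2 x \<in> Dm}" for x y
        using comb(1)[of x y 1 1] that by simp
      show "r *\<^sub>R x \<in> {x. rep_l2 x \<in> Dm}" if "x \<in> {x. rep_l2 x \<in> Dm}" for r x
        using comb(1)[of x x r 0] that by simp
    qed
    fix x y :: "'a l2" and r :: real
    assume x: "x \<in> {x. rep_l2 x \<in> Dm}"
    show "cls (Lop (rep_l2 (r *\<^sub>R x))) = r *\<^sub>R cls (Lop (rep_l2 x))" using comb(2)[of x x r 0] x by simp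
    show "0 \<le> cls (Lop (rep_l2 x)) \<bullet> x" using nonneg[of "rep_l2 x"] x by (simp add: inner_cls_left LL2)
    assume y: "y \<in> {x. rep_l2 x \<in> Dm}"
    show "cls (Lop (rep_l2 (x + y))) = cls (Lop (rep_l2 x)) + cls (Lop (rep_l2 y))"
      using comb(2)[of x y 1 1] x y by simp
    show "cls (Lop (rep_l2 x)) \<bullet> y = x \<bullet> cls (Lop (rep_l2 y))"
    proof -
      have "cls (Lop (rep_l2 x)) \<bullet> y = L2_inner \<Omega> (Lop (rep_l2 x)) (rep_l2 y)" using x by (simp add: inner_cls_left LL2)
      also have "\<dots> = L2_inner \<Omega> (rep_l2 x) (Lop (rep_l2 y))" using x y by (intro sym) auto
      also have "\<dots> = L2_inner \<Omega> (Lop (rep_l2 y)) (rep_l2 x)" by (simp add: L2_inner_def mult.commute)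
      also have "\<dots> = cls (Lop (rep_l2 y)) \<bullet> x" using y by (simp add: inner_cls_left LL2)
      finally show ?thesis by (simp add: inner_commute)
    qed
  next
    fix v g :: "'a l2"
    assume H: "\<And>w. w \<in> {x. rep_l2 x \<in> Dm} \<Longrightarrow> cls (Lop (rep_l2 w)) \<bullet> v = w \<bullet> g"
    have g: "g = cls (rep_l2 g)"
    proof -
      define w where "w = g - cls (rep_l2 g)"
      have orth: "cls u \<bullet> w = 0" if "u \<in> L2 \<Omega>" for u
        using that by (simp add: w_def inner_diff_right inner_cls_left[OF that, of g] inner_cls rep_in_L2)
      from outside[OF orth] have "w \<bullet> g = 0" using H[of w] by simp
      moreover have "w \<bullet> cls (rep_l2 g) = 0" using orth[OF rep_in_L2] by (simp add: inner_commute)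
      ultimately have "w \<bullet> w = 0" by (simp add: w_def inner_diff_right)
      then show ?thesis by (simp add: w_def)
    qed
    have "\<forall>w\<in>Dm. L2_inner \<Omega> (Lop w) (rep_l2 v) = L2_inner \<Omega> w (rep_l2 g)"
    proof
      fix w assume w: "w \<in> Dm"
      have "L2_inner \<Omega> (Lop w) (rep_l2 v) = cls (Lop w) \<bullet> v" using w by (simp add: inner_cls_left LL2)
      also have "\<dots> = cls w \<bullet> g" using H[of "cls w"] memcls[OF w] by simp
      also have "\<dots> = L2_inner \<Omega> w (rep_l2 g)" using w by (simp add: inner_cls_left Dm)
      finally show "L2_inner \<Omega> (Lop w) (rep_l2 v) = L2_inner \<Omega> w (rep_l2 g)" .
    qed
    then have v: "rep_l2 v \<in> Dm \<and> eqL2 \<Omega> (Lop (rep_l2 v)) (rep_l2 g)" by (intro adj rep_in_L2)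
    then have "cls (Lop (rep_l2 v)) = cls (rep_l2 g)" by (simp add: cls_eq_iff LL2 rep_in_L2)
    then show "v \<in> {x. rep_l2 x \<in> Dm} \<and> cls (Lop (rep_l2 v)) = g"
      using v unfolding g[symmetric] by simp
  qed
qed

lemma cls_in_extension:
  assumes op: "nonneg_selfadjoint_operator \<Omega> Dm Lop" and w: "w \<in> Dm"
  shows "cls w \<in> {x. rep_l2 x \<in> Dm}" "cls (Lop (rep_l2 (cls w))) = cls (Lop w)"
proof -
  have "w \<in> L2 \<Omega>" and c: "eqL2 \<Omega> w' w \<Longrightarrow> w' \<in> Dm \<and> eqL2 \<Omega> (Lop w') (Lop w)" and LL2: "v \<in> Dm \<Longrightarrow> Lop v \<in> L2 \<Omega>" for w' v
    using op w unfolding nonneg_selfadjoint_operator_def by blast+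
  note c' = c[OF rep_cls[OF this(1)]]
  show "cls w \<in> {x. rep_l2 x \<in> Dm}" using c' by simp
  show "cls (Lop (rep_l2 (cls w))) = cls (Lop w)" using c' w LL2 by (subst cls_eq_iff) auto
qed

text \<open>
  Differentiability in \<open>L\<^sup>2\<close> says that difference quotients converge in norm; the work is to write the norm of their
  error as the norm of a class.
\<close>

lemma derivative_cls:
  assumes v: "\<And>s. s \<in> J \<Longrightarrow> v s \<in> L2 \<Omega>" and g: "g \<in> L2 \<Omega>" and t: "t \<in> J"
    and d: "has_L2_derivative \<Omega> J v g t"
  shows "((\<lambda>s. cls (v s)) has_vector_derivative cls g) (at t within J)"
  unfolding has_vector_derivative_def has_derivative_within
proof (intro conjI bounded_linear_scaleR_left)
  have eq: "norm ((1 / norm (s - t)) *\<^sub>R (cls (v s) - (cls (v t) + (s - t) *\<^sub>R cls g)))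
      = L2_norm \<Omega> (\<lambda>x. (v s x - v t x) / (s - t) - g x)" if s: "s \<in> J" "s \<noteq> t" for s
  proof -
    have m: "(\<lambda>x. (1 / (s - t)) * (v s x - v t x)) \<in> L2 \<Omega>" using v s t by (intro L2_scale L2_diff)
    have "L2_norm \<Omega> (\<lambda>x. (v s x - v t x) / (s - t) - g x) = norm (cls (\<lambda>x. (1 / (s - t)) * (v s x - v t x) - g x))"
      using norm_cls[OF L2_diff[OF m g]] by simp
    also have "cls (\<lambda>x. (1 / (s - t)) * (v s x - v t x) - g x) = (1 / (s - t)) *\<^sub>R (cls (v s) - cls (v t)) - cls g"
      using v s t g m by (simp only: cls_diff cls_scale L2_diff)
    also have "\<dots> = (1 / (s - t)) *\<^sub>R (cls (v s) - (cls (v t) + (s - t) *\<^sub>R cls g))"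
      using s by (simp add: scaleR_diff_right scaleR_add_right diff_diff_eq)
    finally show ?thesis by simp
  qed
  have "((\<lambda>s. norm ((1 / norm (s - t)) *\<^sub>R (cls (v s) - (cls (v t) + (s - t) *\<^sub>R cls g)))) \<longlongrightarrow> 0) (at t within J)"
    using d unfolding has_L2_derivative_def
  proof (rule Lim_transform_eventually)
    show "\<forall>\<^sub>F s in at t within J. L2_norm \<Omega> (\<lambda>x. (v s x - v t x) / (s - t) - g x)
        = norm ((1 / norm (s - t)) *\<^sub>R (cls (v s) - (cls (v t) + (s - t) *\<^sub>R cls g)))"
      unfolding eventually_at_filter
      by (rule always_eventually, intro allI impI, rule eq[symmetric])
  qed
  then show "((\<lambda>s. (1 / norm (s - t)) *\<^sub>R (cls (v s) - (cls (v t) + (s - t) *\<^sub>R cls g))) \<longlongrightarrow> 0) (at t within J)"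
    by (simp only: tendsto_norm_zero_iff)
qed

end

section \<open>The error equations of the scheme\<close>

definition stage_errors :: "('s::finite, 'r::finite) gltd \<Rightarrow> (nat \<Rightarrow> real \<Rightarrow> 'h::real_vector) \<Rightarrow> real \<Rightarrow> real \<Rightarrow> ('s \<Rightarrow> 'h) \<Rightarrow> 'h^'s" where
  "stage_errors M f \<tau> t U = (\<chi> i. node 0 (absc M $ i) f \<tau> t - U i)"

definition increment_errors :: "('s::finite, 'r::finite) gltd \<Rightarrow> (nat \<Rightarrow> real \<Rightarrow> 'h::real_vector) \<Rightarrow> real \<Rightarrow> real \<Rightarrow> ('s \<Rightarrow> 'h) \<Rightarrow> 'h^'s" where
  "increment_errors M f \<tau> t V = (\<chi> i. node 1 (absc M $ i) f \<tau> t - \<tau> *\<^sub>R V i)"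

text \<open>
  The errors with respect to the modified external values. With them the residuals in the recursion are of order
  \<open>\<tau>\<^sup>q\<^sup>+\<^sup>1\<close>, whereas the plain external errors would leave residuals of order \<open>\<tau>\<^sup>q\<close>.
\<close>

definition modified_errors :: "(nat \<Rightarrow> real^'r) \<Rightarrow> nat \<Rightarrow> (nat \<Rightarrow> real \<Rightarrow> 'h::real_vector) \<Rightarrow> real \<Rightarrow> real \<Rightarrow> ('r::finite \<Rightarrow> 'h) \<Rightarrow> 'h^'r" where
  "modified_errors w q f \<tau> t v = (\<chi> i. (\<Sum>l\<le>q. w l $ i *\<^sub>R node l 0 f \<tau> t) - v i)"

definition external_errors :: "('s::finite, 'r::finite) gltd \<Rightarrow> (nat \<Rightarrow> real \<Rightarrow> 'h::real_vector) \<Rightarrow> real \<Rightarrow> real \<Rightarrow> ('r \<Rightarrow> 'h) \<Rightarrow> 'h^'r" where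
  "external_errors M f \<tau> t v = (\<chi> i. (\<Sum>l\<le>wdeg M. wvec M l $ i *\<^sub>R node l 0 f \<tau> t) - v i)"

lemma external_errors_eq:
  "external_errors M f \<tau> t v = modified_errors w q f \<tau> t v + (\<chi> i. modification M w q i f \<tau> t)"
  by (simp add: external_errors_def modified_errors_def modification_def vec_eq_iff)

lemma stage_error_equation:
  assumes "\<And>i. U i = \<tau> *\<^sub>R (\<Sum>j\<in>UNIV. D11 M $ i $ j *\<^sub>R V j) + (\<Sum>j\<in>UNIV. D12 M $ i $ j *\<^sub>R v j)"
  shows "stage_errors M f \<tau> t U = D11 M \<star> increment_errors M f \<tau> t V + D12 M \<star> modified_errors w q f \<tau> t v
    + (\<chi> i. stage_residual M w q i f \<tau> t)"
  by (simp add: stage_errors_def increment_errors_def modified_errors_def stage_residual_def vec_eq_iff assms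
      scaleR_diff_right sum_subtractf scaleR_sum_right mult.commute[of \<tau>])

lemma step_error_equation:
  assumes "\<And>i. v' i = \<tau> *\<^sub>R (\<Sum>j\<in>UNIV. D21 M $ i $ j *\<^sub>R V j) + (\<Sum>j\<in>UNIV. D22 M $ i $ j *\<^sub>R v j)"
  shows "modified_errors w q f \<tau> (t + \<tau>) v' = D21 M \<star> increment_errors M f \<tau> t V + D22 M \<star> modified_errors w q f \<tau> t v
    + (\<chi> i. step_residual M w q i f \<tau> t)"
proof -
  have "node l 1 f \<tau> t = node l 0 f \<tau> (t + \<tau>)" for l by (simp add: node_def)
  then show ?thesis
    by (simp add: increment_errors_def modified_errors_def step_residual_def vec_eq_iff assms
      scaleR_diff_right sum_subtractf scaleR_sum_right mult.commute[of \<tau>])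
qed

text \<open>
  The extrapolation is based on the external values themselves, so here the plain external errors appear.
\<close>

lemma extrapolation_error_equation:
  "(\<chi> i. node 0 (absc M $ i) f \<tau> (t + \<tau>) - ((\<Sum>j\<in>UNIV. \<alpha> $ i $ j *\<^sub>R U j) + (\<Sum>j\<in>UNIV. \<beta> $ i $ j *\<^sub>R v j)))
    = \<alpha> \<star> stage_errors M f \<tau> t U + \<beta> \<star> external_errors M f \<tau> (t + \<tau>) v + (\<chi> i. extrapolation_residual M \<alpha> \<beta> i f \<tau> t)"
proof -
  have "node l 1 f \<tau> t = node l 0 f \<tau> (t + \<tau>)" "node 0 (1 + x) f \<tau> t = node 0 x f \<tau> (t + \<tau>)" for l x
    by (simp_all add: node_def algebra_simps)
  then show ?thesis
    by (simp add: stage_errors_def external_errors_def extrapolation_residual_def vec_eq_iff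
      scaleR_diff_right sum_subtractf)
qed

lemma W_in_L2:
  assumes "sav_setting P" "v \<in> adm P"
  shows "W P v \<in> L2 (region P)"
proof -
  have "\<exists>g. g \<in> L2 (region P) \<and> is_variational_derivative (region P) (F1 P) v g"
    using assms unfolding sav_setting_def by blast
  from someI_ex[OF this] have "variational_derivative (region P) (F1 P) v \<in> L2 (region P)"
    unfolding variational_derivative_def by blast
  from L2_scale[OF this, of "1 / sqrt (F1 P v + shift P)"] show ?thesis by (simp add: W_def)
qed

lemma smooth_bounded_family:
  assumes "lebesgue_region (region P)" and sb: "smooth_bounded_solution P J m du dz"
  obtains B where "0 \<le> B" "smooth_family J m B (\<lambda>k t. l2_class (region P) (du k t))" "smooth_family J m B dz"
proof -
  interpret lebesgue_region "region P" by fact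
  have L2: "du j t \<in> L2 (region P)" if "j \<le> m" "t \<in> J" for j t
    using sb that unfolding smooth_bounded_solution_def by blast
  have der: "has_L2_derivative (region P) J (du j) (du (Suc j) t) t" "(dz j has_real_derivative dz (Suc j) t) (at t within J)"
    if "j < m" "t \<in> J" for j t
    using sb that unfolding smooth_bounded_solution_def by blast+
  have "\<forall>j. \<exists>b. j \<le> m \<longrightarrow> (\<forall>t\<in>J. L2_norm (region P) (du j t) \<le> b \<and> \<bar>dz j t\<bar> \<le> b)"
    using sb unfolding smooth_bounded_solution_def by blast
  from choice[OF this] obtain b where b: "\<And>j t. j \<le> m \<Longrightarrow> t \<in> J \<Longrightarrow> L2_norm (region P) (du j t) \<le> b j \<and> \<bar>dz j t\<bar> \<le> b j" by blast
  have le: "b j \<le> (\<Sum>j\<le>m. \<bar>b j\<bar>)" if "j \<le> m" for j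
    using member_le_sum[of j "{..m}" "\<lambda>j. \<bar>b j\<bar>"] that by auto
  show ?thesis
  proof (rule that[of "\<Sum>j\<le>m. \<bar>b j\<bar>"])
    show "smooth_family J m (\<Sum>j\<le>m. \<bar>b j\<bar>) (\<lambda>k t. cls (du k t))"
      unfolding smooth_family_def
    proof (intro conjI allI impI ballI)
      fix k t assume "k \<le> m" "t \<in> J"
      then show "norm (cls (du k t)) \<le> (\<Sum>j\<le>m. \<bar>b j\<bar>)" using b[of k t] le[of k] L2[of k t] by (simp add: norm_cls)
    next
      fix k t assume "k < m" "t \<in> J"
      then show "((\<lambda>t. cls (du k t)) has_vector_derivative cls (du (Suc k) t)) (at t within J)"
        using der(1) by (intro derivative_cls L2) auto
    qed
    show "smooth_family J m (\<Sum>j\<le>m. \<bar>b j\<bar>) dz"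
      unfolding smooth_family_def
      using b le der(2) by (force simp: has_real_derivative_iff_has_vector_derivative[symmetric] intro: order_trans)
  qed (simp add: sum_nonneg)
qed

lemma family_lipschitz:
  assumes "smooth_family J m B f" "1 \<le> m" "is_interval J" "s \<in> J" "t \<in> J"
  shows "norm (f 0 s - f 0 t) \<le> B * \<bar>s - t\<bar>"
proof -
  have "norm (f 0 s - (\<Sum>k\<in>{0..<1}. tay 0 k (s - t) *\<^sub>R f k t)) \<le> B * \<bar>s - t\<bar> ^ (1 - 0)"
    using assms by (intro taylor_vector) (auto simp: smooth_family_def)
  then show ?thesis by simp
qed

section \<open>Convergence of the SAV-GL scheme\<close>

lemma negligible_chi_bound:
  fixes \<Phi> :: "'i::finite \<Rightarrow> (nat \<Rightarrow> real \<Rightarrow> 'h::real_normed_vector) \<Rightarrow> real \<Rightarrow> real \<Rightarrow> 'h"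
  assumes "\<And>i. negligible_by C S m p (\<Phi> i)" "is_interval J" "smooth_family J m B f" "0 < \<tau>" "\<tau> \<le> 1" "t \<in> J"
    "\<And>s. s \<in> S \<Longrightarrow> t + s * \<tau> \<in> J" and Cr: "C * B \<le> Cr" "0 \<le> Cr" and k: "k \<le> p"
  shows "norm (\<Phi> i f \<tau> t) \<le> Cr * \<tau> ^ k" "norm (\<chi> i. \<Phi> i f \<tau> t) \<le> real CARD('i) * Cr * \<tau> ^ k"
proof -
  have c: "norm (\<Phi> i f \<tau> t) \<le> Cr * \<tau> ^ k" for i
  proof -
    have "norm (\<Phi> i f \<tau> t) \<le> C * B * \<tau> ^ p" by (rule negligible_byD) fact+
    also have "\<dots> \<le> Cr * \<tau> ^ p" using Cr assms(4) by (intro mult_right_mono) auto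
    also have "\<dots> \<le> Cr * \<tau> ^ k" using Cr k assms(4,5) by (intro mult_left_mono power_decreasing) auto
    finally show ?thesis .
  qed
  then show "norm (\<Phi> i f \<tau> t) \<le> Cr * \<tau> ^ k" .
  show "norm (\<chi> i. \<Phi> i f \<tau> t) \<le> real CARD('i) * Cr * \<tau> ^ k"
    unfolding mult.assoc by (rule norm_vec_le_const) (simp add: c)
qed

lemma power2_sum_bound:
  fixes a b :: "'i::finite \<Rightarrow> real"
  assumes "\<And>i. \<bar>a i\<bar> \<le> Q" "\<And>i. \<bar>b i\<bar> \<le> Q"
  shows "(\<Sum>i\<in>UNIV. (a i)\<^sup>2 + \<bar>b i\<bar>\<^sup>2) \<le> 2 * real CARD('i) * Q\<^sup>2"
proof -
  have "(\<Sum>i\<in>UNIV. (a i)\<^sup>2 + \<bar>b i\<bar>\<^sup>2) \<le> (\<Sum>i\<in>(UNIV :: 'i set). Q\<^sup>2 + Q\<^sup>2)"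
  proof (intro sum_mono add_mono)
    fix i
    show "(a i)\<^sup>2 \<le> Q\<^sup>2" using power_mono[OF assms(1)[of i], of 2] by simp
    show "\<bar>b i\<bar>\<^sup>2 \<le> Q\<^sup>2" using power_mono[OF assms(2)[of i], of 2] by simp
  qed
  then show ?thesis by simp
qed

text \<open>
  The numerical solution is carried over to the Hilbert space, where its errors form an \<open>error_system\<close> with
  \<open>\<mu> = min q \<nu>\<close> and a constant independent of \<open>\<tau>\<close>. The estimate of the modified errors in \<open>error_bound\<close> then gives the claim, since the modification is of
  order \<open>\<tau>\<^sup>q\<close>.
\<close>

lemma convergence:
  fixes M :: "('s::finite, 'r::finite) gltd"
    and \<nu> q m :: nat and w :: "nat \<Rightarrow> real^'r"
    and \<alpha> :: "real^'s^'s" and \<beta> :: "real^'r^'s"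
    and P :: "('a::euclidean_space) sav_problem" and T C\<^sub>s :: real and J :: "real set"
  assumes sm: "stable_method (D11 M) (D12 M) (D21 M) (D22 M) Cg Ci h Ai hh \<kappa>"
    and q: "1 \<le> q" and \<nu>: "1 \<le> \<nu>"
    and oc: "order_conditions M w q" and wlow: "\<And>k. k < q \<Longrightarrow> w k = wext M k"
    and ec: "\<And>k i. k < \<nu> \<Longrightarrow> tay 0 k (1 + absc M $ i) = (\<Sum>j\<in>UNIV. \<alpha> $ i $ j * tay 0 k (absc M $ j))
       + (\<Sum>j\<in>UNIV. \<beta> $ i $ j * (\<Sum>l\<le>wdeg M. wvec M l $ j * tay l k 1))"
    and m: "q < m" "\<nu> \<le> m" "wdeg M \<le> m"
    and setting: "sav_setting P" and lip: "W_locally_lipschitz P"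
    and T: "0 < T" and J: "is_interval J" "{0..T} \<subseteq> J"
    and exact: "exact_solution P J du dz" and smooth: "smooth_bounded_solution P J m du dz"
  shows "\<exists>C>0. \<exists>\<tau>\<^sub>0>0. \<forall>(K :: nat) (\<tau> :: real) U Z v y.
      0 < K \<and> \<tau> = T / real K \<and> \<tau> < \<tau>\<^sub>0 \<and>
      (\<forall>n<K. \<forall>i. stage_time M \<tau> n i \<in> J) \<and>
      sav_gl_solution M \<alpha> \<beta> P \<tau> K U Z v y \<and>
      (\<Sum>i\<in>UNIV. L2_norm (region P) (stage_err_u M \<tau> du U 0 i) + \<bar>stage_err_z M \<tau> dz Z 0 i\<bar>)
        + (\<Sum>i\<in>UNIV. L2_norm (region P) (ext_err_u M \<tau> du v 1 i) + \<bar>ext_err_z M \<tau> dz y 1 i\<bar>)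
        \<le> C\<^sub>s * \<tau> ^ q \<longrightarrow>
      (\<forall>n. 1 \<le> n \<and> n \<le> K - 1 \<longrightarrow>
        (\<Sum>i\<in>UNIV. (L2_norm (region P) (ext_err_u M \<tau> du v (n + 1) i))\<^sup>2
                    + \<bar>ext_err_z M \<tau> dz y (n + 1) i\<bar>\<^sup>2)
        + \<tau> * (\<Sum>i\<in>UNIV. (L2_norm (region P) (stage_err_u M \<tau> du U n i))\<^sup>2
                    + \<bar>stage_err_z M \<tau> dz Z n i\<bar>\<^sup>2)
        \<le> C * \<tau> ^ min (2 * q) (2 * \<nu>))"
proof -
  define \<Omega> where "\<Omega> = region P"
  define \<mu> where "\<mu> = min q \<nu>"
  have \<mu>: "1 \<le> \<mu>" "\<mu> \<le> q" "\<mu> \<le> \<nu>" "Suc \<mu> \<le> q + 1" using q \<nu> by (auto simp: \<mu>_def)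
  have op: "nonneg_selfadjoint_operator \<Omega> (lop_dom P) (lop P)" and "open \<Omega>" and admL2: "adm P \<subseteq> L2 \<Omega>"
    using setting unfolding sav_setting_def \<Omega>_def by blast+
  interpret lebesgue_region \<Omega> by unfold_locales (use \<open>open \<Omega>\<close> in simp)
  define Dh where "Dh = {x. rep_l2 x \<in> lop_dom P}"
  define Lh where "Lh x = cls (lop P (rep_l2 x))" for x
  interpret S: stable_scheme Dh Lh "D11 M" "D12 M" "D21 M" "D22 M" Cg Ci h Ai hh \<kappa>
    unfolding Dh_def Lh_def[abs_def] by (intro stable_scheme.intro selfadjoint_extension op sm)
  have lopL2: "x \<in> lop_dom P \<Longrightarrow> x \<in> L2 \<Omega>" "x \<in> lop_dom P \<Longrightarrow> lop P x \<in> L2 \<Omega>" for x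
    using op unfolding nonneg_selfadjoint_operator_def by blast+
  have WL2: "x \<in> adm P \<Longrightarrow> W P x \<in> L2 \<Omega>" for x
    unfolding \<Omega>_def by (rule W_in_L2[OF setting])
  have Lcls: "cls x \<in> Dh" "Lh (cls x) = cls (lop P x)" if "x \<in> lop_dom P" for x
    using cls_in_extension[OF op that] by (simp_all add: Dh_def Lh_def)
  define uh where "uh k t = cls (du k t)" for k t
  obtain B where B: "0 \<le> B" "smooth_family J m B uh" "smooth_family J m B dz"
    using smooth_bounded_family[OF _ smooth] lebesgue_region_axioms unfolding uh_def[abs_def] \<Omega>_def by blast
  have duL2: "du k t \<in> L2 \<Omega>" if "k \<le> m" "t \<in> J" for k t
    using smooth that unfolding smooth_bounded_solution_def \<Omega>_def by blast
  have ex: "du 0 t \<in> lop_dom P" "du 0 t \<in> adm P" "du 1 t \<in> L2 \<Omega>"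
    "eqL2 \<Omega> (du 1 t) (\<lambda>x. - (lop P (du 0 t) x + dz 0 t * W P (du 0 t) x))"
    "dz 1 t = 1 / 2 * L2_inner \<Omega> (W P (du 0 t)) (du 1 t)" if "t \<in> J" for t
    using exact that unfolding exact_solution_def \<Omega>_def by blast+
  define Wu where "Wu t = cls (W P (du 0 t))" for t
  have exact_u: "uh 1 t = - (Lh (uh 0 t) + dz 0 t *\<^sub>R Wu t)" if t: "t \<in> J" for t
  proof -
    have l: "(\<lambda>x. (-1) * lop P (du 0 t) x + (- dz 0 t) * W P (du 0 t) x) \<in> L2 \<Omega>"
      using ex(1,2)[OF t] by (intro L2_lincomb lopL2 WL2)
    have "uh 1 t = cls (\<lambda>x. (-1) * lop P (du 0 t) x + (- dz 0 t) * W P (du 0 t) x)"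
      unfolding uh_def using ex(3,4)[OF t] l by (subst cls_eq_iff) auto
    also have "\<dots> = (-1) *\<^sub>R cls (lop P (du 0 t)) + (- dz 0 t) *\<^sub>R Wu t"
      unfolding Wu_def using ex(1,2)[OF t] by (intro cls_lincomb lopL2 WL2)
    finally show ?thesis using Lcls(2)[OF ex(1)[OF t]] by (simp add: uh_def)
  qed
  have exact_z: "dz 1 t = 1 / 2 * (Wu t \<bullet> uh 1 t)" if t: "t \<in> J" for t
    unfolding uh_def Wu_def using ex(5)[OF t] ex(2,3)[OF t] by (simp add: inner_cls WL2)
  have J0: "0 \<in> J" using J T by auto
  have m1: "1 \<le> m" using m q by simp
  \<comment> \<open>extrapolated values within distance \<open>1\<close> of the exact solution lie in the ball of radius \<open>B + 1\<close>\<close>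
  obtain LR where LR: "\<forall>x\<in>adm P. \<forall>y\<in>adm P. L2_norm \<Omega> x \<le> B + 1 \<and> L2_norm \<Omega> y \<le> B + 1 \<longrightarrow>
        L2_norm \<Omega> (\<lambda>t. W P x t - W P y t) \<le> LR * L2_norm \<Omega> (\<lambda>t. x t - y t)"
    using lip unfolding W_locally_lipschitz_def \<Omega>_def by blast
  define \<Lambda> where "\<Lambda> = \<bar>LR\<bar>"
  have \<Lambda>: "0 \<le> \<Lambda>" by (simp add: \<Lambda>_def)
  have Wlip: "norm (cls (W P x) - cls (W P y)) \<le> \<Lambda> * norm (cls x - cls y)"
    if "x \<in> adm P" "y \<in> adm P" "norm (cls x) \<le> B + 1" "norm (cls y) \<le> B + 1" for x y
  proof -
    have L2: "x \<in> L2 \<Omega>" "y \<in> L2 \<Omega>" using that admL2 by auto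
    have "L2_norm \<Omega> (\<lambda>t. W P x t - W P y t) \<le> LR * L2_norm \<Omega> (\<lambda>t. x t - y t)"
      using LR that L2 by (simp add: norm_cls)
    then have "norm (cls (W P x) - cls (W P y)) \<le> LR * norm (cls x - cls y)"
      using that L2 by (simp add: norm_cls[symmetric] cls_diff WL2 L2_diff)
    also have "\<dots> \<le> \<Lambda> * norm (cls x - cls y)" unfolding \<Lambda>_def by (intro mult_right_mono) auto
    finally show ?thesis .
  qed
  have uB: "norm (uh k t) \<le> B" and zB: "\<bar>dz k t\<bar> \<le> B" if "k \<le> m" "t \<in> J" for k t
    using B(2,3) that unfolding smooth_family_def by (auto simp: real_norm_def)
  have lip_ex: "norm (Wu s - Wu t) \<le> \<Lambda> * B * \<bar>s - t\<bar>" if "s \<in> J" "t \<in> J" for s t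
  proof -
    have "norm (Wu s - Wu t) \<le> \<Lambda> * norm (uh 0 s - uh 0 t)"
      unfolding Wu_def uh_def using ex(2) uB[of 0] that by (intro Wlip) (auto simp: uh_def intro: add_increasing2)
    also have "\<dots> \<le> \<Lambda> * (B * \<bar>s - t\<bar>)"
      using family_lipschitz[OF B(2) m1 J(1) that] \<Lambda> by (intro mult_left_mono) auto
    finally show ?thesis by (simp add: mult.assoc)
  qed
  have lip_bar: "norm (Wu t - cls (W P x)) \<le> \<Lambda> * norm (uh 0 t - cls x)"
    if t: "t \<in> J" and x: "x \<in> adm P" and c: "norm (uh 0 t - cls x) \<le> 1" for t x
  proof -
    have "norm (cls x) \<le> norm (uh 0 t) + norm (uh 0 t - cls x)"
      using norm_triangle_ineq2[of "cls x" "uh 0 t"] by (simp add: norm_minus_commute)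
    then have "norm (cls x) \<le> B + 1" using uB[of 0, OF _ t] c by simp
    then show ?thesis
      unfolding Wu_def uh_def using ex(2)[OF t] x uB[of 0, OF _ t] by (intro Wlip) (auto simp: uh_def)
  qed
  define CW where "CW = norm (Wu 0) + \<Lambda> * (2 * B)"
  have CW: "norm (Wu t) \<le> CW" if t: "t \<in> J" for t
  proof -
    have "norm (Wu t - Wu 0) \<le> \<Lambda> * norm (uh 0 t - uh 0 0)"
      unfolding Wu_def uh_def using ex(2) uB[of 0] t J0 by (intro Wlip) (auto simp: uh_def intro: add_increasing2)
    also have "\<dots> \<le> \<Lambda> * (2 * B)"
      using norm_triangle_ineq4[of "uh 0 t" "uh 0 0"] uB[of 0, OF _ t] uB[of 0, OF _ J0] \<Lambda> by (intro mult_left_mono) auto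
    finally show ?thesis using norm_triangle_sub[of "Wu t" "Wu 0"] by (simp add: CW_def)
  qed
  obtain C1 where C1: "0 \<le> C1" and c1: "\<And>i. negligible_by C1 (insert 0 (range (($) (absc M)))) m (q + 1)
      (stage_residual M w q i :: (nat \<Rightarrow> real \<Rightarrow> 'a l2) \<Rightarrow> real \<Rightarrow> real \<Rightarrow> 'a l2)"
    using negligible_uniform[where \<Phi>="stage_residual M w q", OF stage_residual_small[OF oc m(1)]] by blast
  obtain C2 where C2: "0 \<le> C2" and c2: "\<And>i. negligible_by C2 (insert 0 (range (($) (absc M)))) m (q + 1)
      (stage_residual M w q i :: (nat \<Rightarrow> real \<Rightarrow> real) \<Rightarrow> real \<Rightarrow> real \<Rightarrow> real)"
    using negligible_uniform[where \<Phi>="stage_residual M w q", OF stage_residual_small[OF oc m(1)]] by blast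
  obtain C3 where C3: "0 \<le> C3" and c3: "\<And>i. negligible_by C3 (insert 0 (insert 1 (range (($) (absc M))))) m (q + 1)
      (step_residual M w q i :: (nat \<Rightarrow> real \<Rightarrow> 'a l2) \<Rightarrow> real \<Rightarrow> real \<Rightarrow> 'a l2)"
    using negligible_uniform[where \<Phi>="step_residual M w q", OF step_residual_small[OF oc m(1)]] by blast
  obtain C4 where C4: "0 \<le> C4" and c4: "\<And>i. negligible_by C4 (insert 0 (insert 1 (range (($) (absc M))))) m (q + 1)
      (step_residual M w q i :: (nat \<Rightarrow> real \<Rightarrow> real) \<Rightarrow> real \<Rightarrow> real \<Rightarrow> real)"
    using negligible_uniform[where \<Phi>="step_residual M w q", OF step_residual_small[OF oc m(1)]] by blast
  note mod = modification_small[OF wlow less_imp_le[OF m(1)] m(3)]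
  obtain C5 where C5: "0 \<le> C5" and c5: "\<And>i. negligible_by C5 {0} m q
      (modification M w q i :: (nat \<Rightarrow> real \<Rightarrow> 'a l2) \<Rightarrow> real \<Rightarrow> real \<Rightarrow> 'a l2)"
    using negligible_uniform[where \<Phi>="modification M w q", OF mod] by blast
  obtain C6 where C6: "0 \<le> C6" and c6: "\<And>i. negligible_by C6 {0} m q
      (modification M w q i :: (nat \<Rightarrow> real \<Rightarrow> real) \<Rightarrow> real \<Rightarrow> real \<Rightarrow> real)"
    using negligible_uniform[where \<Phi>="modification M w q", OF mod] by blast
  obtain C7 where C7: "0 \<le> C7" and c7: "\<And>i. negligible_by C7 (insert 1 (range (($) (absc M)) \<union> range (\<lambda>j. 1 + absc M $ j))) m \<nu>
      (extrapolation_residual M \<alpha> \<beta> i :: (nat \<Rightarrow> real \<Rightarrow> 'a l2) \<Rightarrow> real \<Rightarrow> real \<Rightarrow> 'a l2)"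
    using negligible_uniform[where \<Phi>="extrapolation_residual M \<alpha> \<beta>", OF extrapolation_residual_small[OF ec m(2,3)]] by blast
  define Cr where "Cr = (C1 + C2 + C3 + C4 + C5 + C6 + C7) * B"
  have Cr: "0 \<le> Cr" "C1 * B \<le> Cr" "C2 * B \<le> Cr" "C3 * B \<le> Cr" "C4 * B \<le> Cr" "C5 * B \<le> Cr" "C6 * B \<le> Cr" "C7 * B \<le> Cr"
    unfolding Cr_def using C1 C2 C3 C4 C5 C6 C7 B(1) by (auto intro!: mult_right_mono)
  obtain K\<alpha> where K\<alpha>: "K\<alpha> > 0" "\<And>x :: 'a l2^'s. norm (\<alpha> \<star> x) \<le> K\<alpha> * norm x"
    using mact_bounded[of \<alpha>, where ?'h="'a l2"] by blast
  obtain K\<beta> where K\<beta>: "K\<beta> > 0" "\<And>x :: 'a l2^'r. norm (\<beta> \<star> x) \<le> K\<beta> * norm x"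
    using mact_bounded[of \<beta>, where ?'h="'a l2"] by blast
  define s r where "s = real CARD('s)" and "r = real CARD('r)"
  have sr: "0 \<le> s" "0 \<le> r" by (simp_all add: s_def r_def)
  define Ac where "Ac = (\<Sum>i\<in>UNIV. \<bar>absc M $ i\<bar>)"
  have Ac: "\<bar>absc M $ i\<bar> \<le> Ac" for i
    unfolding Ac_def using member_le_sum[of i UNIV "\<lambda>i. \<bar>absc M $ i\<bar>"] by simp
  have Ac0: "0 \<le> Ac" unfolding Ac_def by (intro sum_nonneg) simp
  \<comment> \<open>a sum of all the constants that are needed, so that each of them is at most \<open>c\<close>\<close>
  define c where "c = 1 + T + \<bar>C\<^sub>s\<bar> + r * Cr + s * Cr + CW + \<Lambda> * B + K\<alpha> + K\<beta> + (K\<beta> * (r * Cr) + s * Cr)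
      + s * (B * \<Lambda> + (CW + \<Lambda>)) + \<Lambda> + \<Lambda> * B * Ac"
  have CW0: "0 \<le> CW" using CW[OF J0] norm_ge_zero order_trans by blast
  have nn: "0 \<le> r * Cr" "0 \<le> s * Cr" "0 \<le> \<Lambda> * B" "0 \<le> K\<beta> * (r * Cr)" "0 \<le> s * (B * \<Lambda> + (CW + \<Lambda>))" "0 \<le> \<Lambda> * B * Ac"
    using sr Cr(1) \<Lambda> B(1) K\<beta>(1) CW0 Ac0 by (auto intro!: mult_nonneg_nonneg add_nonneg_nonneg)
  have cge: "0 < c" "T \<le> c" "\<bar>C\<^sub>s\<bar> + r * Cr \<le> c" "s * Cr \<le> c" "r * Cr \<le> c" "CW + \<Lambda> \<le> c" "CW \<le> c" "\<Lambda> * B \<le> c"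
    "K\<alpha> \<le> c" "K\<beta> \<le> c" "K\<beta> * (r * Cr) + s * Cr \<le> c" "s * (B * \<Lambda> + (CW + \<Lambda>)) \<le> c" "\<Lambda> \<le> c" "\<Lambda> * B * Ac \<le> c"
    unfolding c_def using nn T CW0 \<Lambda> K\<alpha>(1) K\<beta>(1) by linarith+
  have scale: "x \<le> c * z" if "x \<le> k * z" "k \<le> c" "0 \<le> z" for x k z :: real
    using that mult_right_mono[of k c z] by linarith
  obtain Ke \<tau>1 where Ke: "Ke > 0" and \<tau>1: "\<tau>1 > 0" and
    main: "\<And>\<mu> \<tau> N d n. S.error_system c \<mu> \<tau> N d \<Longrightarrow> \<tau> < \<tau>1 \<Longrightarrow> 1 \<le> n \<Longrightarrow> n \<le> N \<Longrightarrow>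
        norm (erre d (Suc n)) \<le> Ke * \<tau> ^ \<mu> \<and> norm (errd d (Suc n)) \<le> Ke * \<tau> ^ \<mu> \<and>
        norm (errE d n) \<le> Ke * \<tau> ^ \<mu> \<and> norm (errD d n) \<le> Ke * \<tau> ^ \<mu>"
    using S.error_bound[OF cge(1)] by blast
  define Q where "Q = Ke + Cr"
  have Q: "Q > 0" using Ke Cr(1) by (simp add: Q_def)
  define CC where "CC = 2 * (r + s) * Q\<^sup>2 + 1"
  have CC: "CC > 0" using sr by (simp add: CC_def add_nonneg_pos)
  have "(\<Sum>i\<in>UNIV. (L2_norm \<Omega> (ext_err_u M \<tau> du v (n + 1) i))\<^sup>2 + \<bar>ext_err_z M \<tau> dz y (n + 1) i\<bar>\<^sup>2)
        + \<tau> * (\<Sum>i\<in>UNIV. (L2_norm \<Omega> (stage_err_u M \<tau> du U n i))\<^sup>2 + \<bar>stage_err_z M \<tau> dz Z n i\<bar>\<^sup>2)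
        \<le> CC * \<tau> ^ min (2 * q) (2 * \<nu>)"
    if K: "0 < K" and \<tau>K: "\<tau> = T / real K" and small: "\<tau> < min 1 \<tau>1"
      and stages: "\<And>n i. n < K \<Longrightarrow> stage_time M \<tau> n i \<in> J"
      and sol: "sav_gl_solution M \<alpha> \<beta> P \<tau> K U Z v y"
      and init: "(\<Sum>i\<in>UNIV. L2_norm \<Omega> (stage_err_u M \<tau> du U 0 i) + \<bar>stage_err_z M \<tau> dz Z 0 i\<bar>)
        + (\<Sum>i\<in>UNIV. L2_norm \<Omega> (ext_err_u M \<tau> du v 1 i) + \<bar>ext_err_z M \<tau> dz y 1 i\<bar>) \<le> C\<^sub>s * \<tau> ^ q"
      and n: "1 \<le> n" "n \<le> K - 1" for K \<tau> U Z v y n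
  proof -
    \<comment> \<open>steps \<open>1, \<dots>, K - 1\<close> are computed by the scheme, step \<open>0\<close> only provides starting values\<close>
    define N where "N = K - 1"
    have KN: "K = Suc N" using K by (simp add: N_def)
    have \<tau>: "0 < \<tau>" "\<tau> \<le> 1" "\<tau> < \<tau>1" using small T K \<tau>K by auto
    have \<tau>T: "real K * \<tau> = T" using K \<tau>K by simp
    define t where "t k = real k * \<tau>" for k
    have t_Suc: "t (Suc k) = t k + \<tau>" for k by (simp add: t_def distrib_right add.commute)
    have tJ: "t k \<in> J" if "k \<le> K" for k
    proof -
      have "real k * \<tau> \<le> real K * \<tau>" using that \<tau> by (intro mult_right_mono) auto
      then have "t k \<in> {0..T}" using \<tau> \<tau>T by (simp add: t_def)
      then show ?thesis using J(2) by blast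
    qed
    have stJ: "t k + absc M $ i * \<tau> \<in> J" if "k \<le> N" for k i
      using stages[of k i] that by (simp add: stage_time_def t_def KN)
    have nodes1: "t k + x * \<tau> \<in> J" if "k \<le> N" "x \<in> insert 0 (range (($) (absc M)))" for k x
      using that tJ[of k] stJ[of k] KN by auto
    have nodes2: "t k + x * \<tau> \<in> J" if "k \<le> N" "x \<in> insert 0 (insert 1 (range (($) (absc M))))" for k x
      using that tJ[of k] tJ[of "Suc k"] stJ[of k] KN t_Suc[of k] by auto
    have nodes3: "t k + x * \<tau> \<in> J" if "k < N" "x \<in> insert 1 (range (($) (absc M)) \<union> range (\<lambda>j. 1 + absc M $ j))" for k x
      using that tJ[of "Suc k"] stJ[of k] stJ[of "Suc k"] KN t_Suc[of k] by (auto simp: algebra_simps)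
    have nodes4: "t k + x * \<tau> \<in> J" if "k \<le> K" "x \<in> {0}" for k x
      using that tJ[of k] by simp
    define Uc where "Uc k i = cls (U k i)" for k i
    define vc where "vc k i = cls (v k i)" for k i
    define Ub where "Ub k i = Ubar \<alpha> \<beta> U v k i" for k i
    define Wb where "Wb k i = cls (W P (Ub k i))" for k i
    define Vd where "Vd k i = cls (Udot P \<alpha> \<beta> U Z v k i)" for k i
    define Zd where "Zd k i = Zdot P \<alpha> \<beta> U Z v k i" for k i
    have start: "U 0 i \<in> L2 \<Omega>" "v 1 j \<in> L2 \<Omega>" for i j
      using sol unfolding sav_gl_solution_def \<Omega>_def by blast+
    have step: "U k i \<in> lop_dom P" "Ub k i \<in> adm P"
      "eqL2 \<Omega> (U k i) (\<lambda>x. \<tau> * (\<Sum>j\<in>UNIV. D11 M $ i $ j * Udot P \<alpha> \<beta> U Z v k j x) + (\<Sum>j\<in>UNIV. D12 M $ i $ j * v k j x))"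
      "Z k i = \<tau> * (\<Sum>j\<in>UNIV. D11 M $ i $ j * Zdot P \<alpha> \<beta> U Z v k j) + (\<Sum>j\<in>UNIV. D12 M $ i $ j * y k j)"
      if "1 \<le> k" "k \<le> N" for k i
      using sol that unfolding sav_gl_solution_def \<Omega>_def Ub_def N_def by blast+
    have step': "eqL2 \<Omega> (v (k + 1) i) (\<lambda>x. \<tau> * (\<Sum>j\<in>UNIV. D21 M $ i $ j * Udot P \<alpha> \<beta> U Z v k j x) + (\<Sum>j\<in>UNIV. D22 M $ i $ j * v k j x))"
      "y (k + 1) i = \<tau> * (\<Sum>j\<in>UNIV. D21 M $ i $ j * Zdot P \<alpha> \<beta> U Z v k j) + (\<Sum>j\<in>UNIV. D22 M $ i $ j * y k j)"
      if "1 \<le> k" "k \<le> N" for k i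
      using sol that unfolding sav_gl_solution_def \<Omega>_def N_def by blast+
    have UdL2: "Udot P \<alpha> \<beta> U Z v k i \<in> L2 \<Omega>" and Vd: "Vd k i = - (Lh (Uc k i) + Z k i *\<^sub>R Wb k i)"
      and Zd: "Zd k i = 1 / 2 * (Wb k i \<bullet> Vd k i)" if k: "1 \<le> k" "k \<le> N" for k i
    proof -
      have e: "Udot P \<alpha> \<beta> U Z v k i = (\<lambda>x. (-1) * lop P (U k i) x + (- Z k i) * W P (Ub k i) x)"
        by (simp add: Udot_def Ub_def)
      show ud: "Udot P \<alpha> \<beta> U Z v k i \<in> L2 \<Omega>"
        unfolding e using step(1,2)[OF k] by (intro L2_lincomb lopL2 WL2)
      have "Vd k i = (-1) *\<^sub>R cls (lop P (U k i)) + (- Z k i) *\<^sub>R Wb k i"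
        unfolding Vd_def e Wb_def using step(1,2)[OF k] by (intro cls_lincomb lopL2 WL2)
      then show "Vd k i = - (Lh (Uc k i) + Z k i *\<^sub>R Wb k i)"
        using Lcls(2)[OF step(1)[OF k, of i]] by (simp add: Uc_def)
      show "Zd k i = 1 / 2 * (Wb k i \<bullet> Vd k i)"
        unfolding Zd_def Wb_def Vd_def Zdot_def using ud step(2)[OF k, of i]
        by (simp add: inner_cls WL2 \<Omega>_def[symmetric] Ub_def)
    qed
    have vL2: "v k i \<in> L2 \<Omega>" if "1 \<le> k" "k \<le> Suc N" for k i
      using that
    proof (induction k arbitrary: i rule: dec_induct)
      case (step k)
      have "(\<lambda>x. \<tau> * (\<Sum>j\<in>UNIV. D21 M $ i $ j * Udot P \<alpha> \<beta> U Z v k j x) + (\<Sum>j\<in>UNIV. D22 M $ i $ j * v k j x)) \<in> L2 \<Omega>"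
        using step by (intro L2_add L2_scale L2_sum UdL2) auto
      then show ?case using step'(1)[of k i] step by (auto intro: L2_cong)
    qed (rule start(2))
    have comb: "cls (\<lambda>x. \<tau> * (\<Sum>j\<in>UNIV. A j * Udot P \<alpha> \<beta> U Z v k j x) + (\<Sum>j\<in>UNIV. A' j * v k j x))
        = \<tau> *\<^sub>R (\<Sum>j\<in>UNIV. A j *\<^sub>R Vd k j) + (\<Sum>j\<in>UNIV. A' j *\<^sub>R vc k j)"
        "(\<lambda>x. \<tau> * (\<Sum>j\<in>UNIV. A j * Udot P \<alpha> \<beta> U Z v k j x) + (\<Sum>j\<in>UNIV. A' j * v k j x)) \<in> L2 \<Omega>"
      if k: "1 \<le> k" "k \<le> N" for k A A'
    proof -
      have 1: "(\<lambda>x. \<Sum>j\<in>UNIV. A j * Udot P \<alpha> \<beta> U Z v k j x) \<in> L2 \<Omega>" "(\<lambda>x. \<Sum>j\<in>UNIV. A' j * v k j x) \<in> L2 \<Omega>"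
        using k by (auto intro!: L2_sum UdL2 vL2)
      show "(\<lambda>x. \<tau> * (\<Sum>j\<in>UNIV. A j * Udot P \<alpha> \<beta> U Z v k j x) + (\<Sum>j\<in>UNIV. A' j * v k j x)) \<in> L2 \<Omega>"
        by (intro L2_add L2_scale 1)
      have "cls (\<lambda>x. \<tau> * (\<Sum>j\<in>UNIV. A j * Udot P \<alpha> \<beta> U Z v k j x) + (\<Sum>j\<in>UNIV. A' j * v k j x))
          = \<tau> *\<^sub>R cls (\<lambda>x. \<Sum>j\<in>UNIV. A j * Udot P \<alpha> \<beta> U Z v k j x) + cls (\<lambda>x. \<Sum>j\<in>UNIV. A' j * v k j x)"
        using cls_lincomb[OF 1, of \<tau> 1] by simp
      also have "cls (\<lambda>x. \<Sum>j\<in>UNIV. A j * Udot P \<alpha> \<beta> U Z v k j x) = (\<Sum>j\<in>UNIV. A j *\<^sub>R Vd k j)"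
        unfolding Vd_def using k by (intro cls_sum UdL2) auto
      also have "cls (\<lambda>x. \<Sum>j\<in>UNIV. A' j * v k j x) = (\<Sum>j\<in>UNIV. A' j *\<^sub>R vc k j)"
        unfolding vc_def using k by (intro cls_sum vL2) auto
      finally show "cls (\<lambda>x. \<tau> * (\<Sum>j\<in>UNIV. A j * Udot P \<alpha> \<beta> U Z v k j x) + (\<Sum>j\<in>UNIV. A' j * v k j x))
        = \<tau> *\<^sub>R (\<Sum>j\<in>UNIV. A j *\<^sub>R Vd k j) + (\<Sum>j\<in>UNIV. A' j *\<^sub>R vc k j)" .
    qed
    have Ueq: "Uc k i = \<tau> *\<^sub>R (\<Sum>j\<in>UNIV. D11 M $ i $ j *\<^sub>R Vd k j) + (\<Sum>j\<in>UNIV. D12 M $ i $ j *\<^sub>R vc k j)"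
      if k: "1 \<le> k" "k \<le> N" for k i
      unfolding comb(1)[OF k, symmetric] Uc_def
      using step(1,3)[OF k, of i] comb(2)[OF k] by (subst cls_eq_iff) (auto intro: lopL2)
    have veq: "vc (Suc k) i = \<tau> *\<^sub>R (\<Sum>j\<in>UNIV. D21 M $ i $ j *\<^sub>R Vd k j) + (\<Sum>j\<in>UNIV. D22 M $ i $ j *\<^sub>R vc k j)"
      if k: "1 \<le> k" "k \<le> N" for k i
      unfolding comb(1)[OF k, symmetric] vc_def[of "Suc k"]
      using step'(1)[OF k, of i] comb(2)[OF k] vL2[of "Suc k" i] k by (subst cls_eq_iff) auto
    have Zeq: "Z k i = \<tau> *\<^sub>R (\<Sum>j\<in>UNIV. D11 M $ i $ j *\<^sub>R Zd k j) + (\<Sum>j\<in>UNIV. D12 M $ i $ j *\<^sub>R y k j)"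
      and yeq: "y (Suc k) i' = \<tau> *\<^sub>R (\<Sum>j\<in>UNIV. D21 M $ i' $ j *\<^sub>R Zd k j) + (\<Sum>j\<in>UNIV. D22 M $ i' $ j *\<^sub>R y k j)"
      if k: "1 \<le> k" "k \<le> N" for k i i'
      using step(4)[OF k, of i] step'(2)[OF k, of i'] by (simp_all add: Zd_def)
    have UL2: "U k i \<in> L2 \<Omega>" if "k \<le> N" for k i
      using start(1) step(1)[of k i] that by (cases "k = 0") (auto intro: lopL2)
    have Ubeq: "cls (Ub (Suc k) i) = (\<Sum>j\<in>UNIV. \<alpha> $ i $ j *\<^sub>R Uc k j) + (\<Sum>j\<in>UNIV. \<beta> $ i $ j *\<^sub>R vc (Suc k) j)"
      if "k < N" for k i
      unfolding Ub_def Ubar_def Uc_def vc_def using that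
      by (subst cls_add) (auto intro!: L2_sum UL2 vL2 simp: cls_sum UL2 vL2)
    \<comment> \<open>in \<open>src\<close> the difference of \<open>z W(u)\<close> is split such that the difference of \<open>W\<close> is not
      multiplied by the numerical \<open>Z\<close>, for which no bound is known yet\<close>
    define d where "d = \<lparr>errE = (\<lambda>k. stage_errors M uh \<tau> (t k) (Uc k)),
      errX = (\<lambda>k. increment_errors M uh \<tau> (t k) (Vd k)),
      erre = (\<lambda>k. modified_errors w q uh \<tau> (t k) (vc k)),
      resE = (\<lambda>k. \<chi> i. stage_residual M w q i uh \<tau> (t k)),
      rese = (\<lambda>k. \<chi> i. step_residual M w q i uh \<tau> (t k)),
      src = (\<lambda>k. \<chi> i. dz 0 (t k + absc M $ i * \<tau>) *\<^sub>R (Wu (t k + absc M $ i * \<tau>) - Wb k i)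
                + (dz 0 (t k + absc M $ i * \<tau>) - Z k i) *\<^sub>R Wb k i),
      errD = (\<lambda>k. stage_errors M dz \<tau> (t k) (Z k)),
      errY = (\<lambda>k. increment_errors M dz \<tau> (t k) (Zd k)),
      errd = (\<lambda>k. modified_errors w q dz \<tau> (t k) (y k)),
      resD = (\<lambda>k. \<chi> i. stage_residual M w q i dz \<tau> (t k)),
      resd = (\<lambda>k. \<chi> i. step_residual M w q i dz \<tau> (t k)),
      Wbar = (\<lambda>k. \<chi> i. Wb k i), Wref = (\<lambda>k. Wu (t k)),
      extr = (\<lambda>k. norm (\<chi> i. node 0 (absc M $ i) uh \<tau> (t k) - cls (Ub k i)))\<rparr>"
    note sel = error_data.select_convs
    have mod_u: "norm (\<chi> i. modification M w q i uh \<tau> (t k)) \<le> r * Cr * \<tau> ^ \<mu>"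
        "norm (modification M w q i uh \<tau> (t k)) \<le> Cr * \<tau> ^ \<mu>" if "k \<le> K" for k i
      using negligible_chi_bound[OF c5 J(1) B(2) \<tau>(1,2) tJ[OF that] nodes4[OF that] Cr(6,1) \<mu>(2)] by (simp_all add: r_def)
    have mod_z: "norm (\<chi> i. modification M w q i dz \<tau> (t k)) \<le> r * Cr * \<tau> ^ \<mu>"
        "norm (modification M w q i dz \<tau> (t k)) \<le> Cr * \<tau> ^ \<mu>" if "k \<le> K" for k i
      using negligible_chi_bound[OF c6 J(1) B(3) \<tau>(1,2) tJ[OF that] nodes4[OF that] Cr(7,1) \<mu>(2)] by (simp_all add: r_def)
    have ext_u: "cls (ext_err_u M \<tau> du v k i) = external_errors M uh \<tau> (t k) (vc k) $ i"
      "ext_err_u M \<tau> du v k i \<in> L2 \<Omega>" if k: "1 \<le> k" "k \<le> K" for k i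
    proof -
      have e: "ext_err_u M \<tau> du v k i = (\<lambda>x. (\<Sum>l\<le>wdeg M. (wvec M l $ i * \<tau> ^ l) * du l (t k) x) - v k i x)"
        by (simp add: ext_err_u_def external_value_def t_def)
      have s: "(\<lambda>x. \<Sum>l\<le>wdeg M. (wvec M l $ i * \<tau> ^ l) * du l (t k) x) \<in> L2 \<Omega>"
        using m tJ[OF k(2)] by (intro L2_sum duL2) auto
      have v: "v k i \<in> L2 \<Omega>" using vL2 k KN by simp
      show "ext_err_u M \<tau> du v k i \<in> L2 \<Omega>" unfolding e by (intro L2_diff s v)
      have "cls (ext_err_u M \<tau> du v k i) = (\<Sum>l\<le>wdeg M. (wvec M l $ i * \<tau> ^ l) *\<^sub>R uh l (t k)) - vc k i"
        unfolding e cls_diff[OF s v] vc_def uh_def using m tJ[OF k(2)] by (subst cls_sum) (auto intro: duL2)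
      then show "cls (ext_err_u M \<tau> du v k i) = external_errors M uh \<tau> (t k) (vc k) $ i"
        by (simp add: external_errors_def node_def)
    qed
    have ext_z: "ext_err_z M \<tau> dz y k i = external_errors M dz \<tau> (t k) (y k) $ i" for k i
      by (simp add: ext_err_z_def external_value_def external_errors_def node_def t_def mult.assoc)
    have st_u: "cls (stage_err_u M \<tau> du U k i) = stage_errors M uh \<tau> (t k) (Uc k) $ i"
      "stage_err_u M \<tau> du U k i \<in> L2 \<Omega>" if "k \<le> N" for k i
      using duL2[of 0] stJ[OF that, of i] UL2[OF that, of i]
      by (auto simp: stage_err_u_def stage_errors_def node_def uh_def Uc_def stage_time_def t_def[symmetric] cls_diff intro: L2_diff)
    have st_z: "stage_err_z M \<tau> dz Z k i = stage_errors M dz \<tau> (t k) (Z k) $ i" for k i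
      by (simp add: stage_err_z_def stage_errors_def node_def stage_time_def t_def)
    have sys: "S.error_system c \<mu> \<tau> N d"
      unfolding S.error_system_def
    proof (intro conjI allI impI)
      show "0 < \<tau>" "\<tau> \<le> 1" "1 \<le> \<mu>" using \<tau> \<mu> by auto
      have "real N * \<tau> \<le> real K * \<tau>" using \<tau> KN by (intro mult_right_mono) auto
      then show "real N * \<tau> \<le> c" using \<tau>T cge(2) by linarith
      have \<tau>\<mu>: "0 \<le> \<tau> ^ \<mu>" using \<tau> by simp
      have Cs: "C\<^sub>s * \<tau> ^ q \<le> \<bar>C\<^sub>s\<bar> * \<tau> ^ \<mu>"
      proof -
        have "C\<^sub>s * \<tau> ^ q \<le> \<bar>C\<^sub>s\<bar> * \<tau> ^ q" using \<tau> by (intro mult_right_mono) auto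
        also have "\<dots> \<le> \<bar>C\<^sub>s\<bar> * \<tau> ^ \<mu>" using \<tau> \<mu>(2) by (intro mult_left_mono power_decreasing) auto
        finally show ?thesis .
      qed
      have i1: "(\<Sum>i\<in>UNIV. norm (stage_errors M uh \<tau> (t 0) (Uc 0) $ i)) \<le> \<bar>C\<^sub>s\<bar> * \<tau> ^ \<mu>"
        and i2: "(\<Sum>i\<in>UNIV. norm (external_errors M uh \<tau> (t 1) (vc 1) $ i)) \<le> \<bar>C\<^sub>s\<bar> * \<tau> ^ \<mu>"
        and i3: "(\<Sum>i\<in>UNIV. norm (external_errors M dz \<tau> (t 1) (y 1) $ i)) \<le> \<bar>C\<^sub>s\<bar> * \<tau> ^ \<mu>"
      proof -
        have 1: "norm (stage_errors M uh \<tau> (t 0) (Uc 0) $ i) = L2_norm \<Omega> (stage_err_u M \<tau> du U 0 i)" for i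
          using st_u[of 0 i] by (simp add: norm_cls[symmetric])
        have 2: "norm (external_errors M uh \<tau> (t 1) (vc 1) $ i) = L2_norm \<Omega> (ext_err_u M \<tau> du v 1 i)" for i
          using ext_u[of 1 i] KN by (simp add: norm_cls[symmetric])
        have p: "0 \<le> (\<Sum>i\<in>UNIV. norm (stage_errors M uh \<tau> (t 0) (Uc 0) $ i))"
          "0 \<le> (\<Sum>i\<in>UNIV. norm (external_errors M uh \<tau> (t 1) (vc 1) $ i))"
          "0 \<le> (\<Sum>i\<in>UNIV. norm (external_errors M dz \<tau> (t 1) (y 1) $ i))"
          "0 \<le> (\<Sum>i\<in>UNIV. \<bar>stage_err_z M \<tau> dz Z 0 i\<bar>)"
          by (intro sum_nonneg, simp)+
        have "(\<Sum>i\<in>UNIV. norm (stage_errors M uh \<tau> (t 0) (Uc 0) $ i)) + (\<Sum>i\<in>UNIV. \<bar>stage_err_z M \<tau> dz Z 0 i\<bar>)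
            + ((\<Sum>i\<in>UNIV. norm (external_errors M uh \<tau> (t 1) (vc 1) $ i))
               + (\<Sum>i\<in>UNIV. norm (external_errors M dz \<tau> (t 1) (y 1) $ i))) \<le> C\<^sub>s * \<tau> ^ q"
          using init unfolding sum.distrib ext_z 1 2 real_norm_def .
        with p Cs show "(\<Sum>i\<in>UNIV. norm (stage_errors M uh \<tau> (t 0) (Uc 0) $ i)) \<le> \<bar>C\<^sub>s\<bar> * \<tau> ^ \<mu>"
          "(\<Sum>i\<in>UNIV. norm (external_errors M uh \<tau> (t 1) (vc 1) $ i)) \<le> \<bar>C\<^sub>s\<bar> * \<tau> ^ \<mu>"
          "(\<Sum>i\<in>UNIV. norm (external_errors M dz \<tau> (t 1) (y 1) $ i)) \<le> \<bar>C\<^sub>s\<bar> * \<tau> ^ \<mu>"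
          by linarith+
      qed
      show "norm (errE d 0) \<le> c * \<tau> ^ \<mu>"
        unfolding d_def sel
        by (rule scale[OF order_trans[OF norm_vec_le_sum i1]]) (use cge nn \<tau>\<mu> in linarith)+
      show "norm (erre d 1) \<le> c * \<tau> ^ \<mu>"
      proof (rule scale[OF _ cge(3) \<tau>\<mu>])
        have "erre d 1 = external_errors M uh \<tau> (t 1) (vc 1) - (\<chi> i. modification M w q i uh \<tau> (t 1))"
          using external_errors_eq[of M uh \<tau> "t 1" "vc 1" w q] by (simp add: d_def)
        then have "norm (erre d 1) \<le> norm (external_errors M uh \<tau> (t 1) (vc 1)) + norm (\<chi> i. modification M w q i uh \<tau> (t 1))"
          by (simp add: norm_triangle_ineq4)
        then show "norm (erre d 1) \<le> (\<bar>C\<^sub>s\<bar> + r * Cr) * \<tau> ^ \<mu>"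
          using order_trans[OF norm_vec_le_sum i2] mod_u(1)[of 1] K unfolding distrib_right by linarith
      qed
      show "norm (errd d 1) \<le> c * \<tau> ^ \<mu>"
      proof (rule scale[OF _ cge(3) \<tau>\<mu>])
        have "errd d 1 = external_errors M dz \<tau> (t 1) (y 1) - (\<chi> i. modification M w q i dz \<tau> (t 1))"
          using external_errors_eq[of M dz \<tau> "t 1" "y 1" w q] by (simp add: d_def)
        then have "norm (errd d 1) \<le> norm (external_errors M dz \<tau> (t 1) (y 1)) + norm (\<chi> i. modification M w q i dz \<tau> (t 1))"
          by (simp add: norm_triangle_ineq4)
        then show "norm (errd d 1) \<le> (\<bar>C\<^sub>s\<bar> + r * Cr) * \<tau> ^ \<mu>"
          using order_trans[OF norm_vec_le_sum i3] mod_z(1)[of 1] K unfolding distrib_right by linarith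
      qed
    next
      fix k assume k: "1 \<le> k \<and> k \<le> Suc N"
      show "norm (Wref d k) \<le> c" using CW[OF tJ[of k]] k KN cge(7) by (simp add: d_def)
    next
      fix k assume k': "1 \<le> k \<and> k \<le> N"
      then have k: "1 \<le> k" "k \<le> N" "k \<le> K" by (auto simp: KN)
      have \<tau>\<mu>: "0 \<le> \<tau> ^ \<mu>" "0 \<le> \<tau> ^ Suc \<mu>" using \<tau> by auto
      show "S.stage \<tau> (errE d k) (errX d k) (erre d k) (resE d k) (src d k)"
        unfolding S.stage_def
      proof (intro conjI allI)
        fix i
        have E: "errE d k $ i = uh 0 (t k + absc M $ i * \<tau>) - Uc k i"
          by (simp add: d_def stage_errors_def node_def)
        have mem: "uh 0 (t k + absc M $ i * \<tau>) \<in> Dh" "Uc k i \<in> Dh"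
          unfolding uh_def Uc_def using ex(1)[OF stJ[OF k(2), of i]] step(1)[OF k(1,2), of i] by (auto intro: Lcls)
        show "errE d k $ i \<in> Dh" unfolding E by (rule subspace_diff[OF S.domain mem])
        have X: "errX d k $ i = \<tau> *\<^sub>R (uh 1 (t k + absc M $ i * \<tau>) - Vd k i)"
          by (simp add: d_def increment_errors_def node_def scaleR_diff_right)
        show "errX d k $ i = - (\<tau> *\<^sub>R (Lh (errE d k $ i) + src d k $ i))"
          unfolding X E S.L_diff[OF mem] exact_u[OF stJ[OF k(2), of i]] Vd[OF k(1,2), of i]
          by (simp add: d_def algebra_simps)
        show "errE d k = D11 M \<star> errX d k + D12 M \<star> erre d k + resE d k"
          unfolding d_def sel by (rule stage_error_equation[OF Ueq[OF k(1,2)]])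
      qed
      show "erre d (Suc k) = D21 M \<star> errX d k + D22 M \<star> erre d k + rese d k"
        unfolding d_def sel t_Suc by (rule step_error_equation[OF veq[OF k(1,2)]])
      show "errD d k = D11 M \<star> errY d k + D12 M \<star> errd d k + resD d k"
        unfolding d_def sel by (rule stage_error_equation[OF Zeq[OF k(1,2)]])
      show "errd d (Suc k) = D21 M \<star> errY d k + D22 M \<star> errd d k + resd d k"
        unfolding d_def sel t_Suc by (rule step_error_equation[OF yeq[OF k(1,2)]])
      show "norm (resE d k) \<le> c * \<tau> ^ Suc \<mu>"
        unfolding d_def sel
        by (rule scale[OF negligible_chi_bound(2)[OF c1 J(1) B(2) \<tau>(1,2) tJ[OF k(3)] nodes1[OF k(2)] Cr(2,1) \<mu>(4)]])
          (use cge(4) \<tau>\<mu> in \<open>simp_all add: s_def\<close>)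
      show "norm (resD d k) \<le> c * \<tau> ^ Suc \<mu>"
        unfolding d_def sel
        by (rule scale[OF negligible_chi_bound(2)[OF c2 J(1) B(3) \<tau>(1,2) tJ[OF k(3)] nodes1[OF k(2)] Cr(3,1) \<mu>(4)]])
          (use cge(4) \<tau>\<mu> in \<open>simp_all add: s_def\<close>)
      show "norm (rese d k) \<le> c * \<tau> ^ Suc \<mu>"
        unfolding d_def sel
        by (rule scale[OF negligible_chi_bound(2)[OF c3 J(1) B(2) \<tau>(1,2) tJ[OF k(3)] nodes2[OF k(2)] Cr(4,1) \<mu>(4)]])
          (use cge(5) \<tau>\<mu> in \<open>simp_all add: r_def\<close>)
      show "norm (resd d k) \<le> c * \<tau> ^ Suc \<mu>"
        unfolding d_def sel
        by (rule scale[OF negligible_chi_bound(2)[OF c4 J(1) B(3) \<tau>(1,2) tJ[OF k(3)] nodes2[OF k(2)] Cr(5,1) \<mu>(4)]])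
          (use cge(5) \<tau>\<mu> in \<open>simp_all add: r_def\<close>)
      show "norm (Wref d (Suc k) - Wref d k) \<le> c * \<tau>"
      proof (rule scale[OF _ cge(8)])
        show "norm (Wref d (Suc k) - Wref d k) \<le> \<Lambda> * B * \<tau>"
          using lip_ex[OF tJ[of "Suc k"] tJ[OF k(3)]] k KN \<tau> by (simp add: d_def t_Suc)
      qed (use \<tau> in simp)
      show "0 \<le> extr d k" by (simp add: d_def)
      show "extr d k \<le> c * (norm (errE d (k - 1)) + norm (erre d k) + \<tau> ^ \<mu>)"
      proof -
        obtain j where j: "k = Suc j" using k by (cases k) auto
        have jN: "j < N" using k by (simp add: j)
        define e where "e = external_errors M uh \<tau> (t k) (vc k)"
        define x where "x = (\<chi> i. extrapolation_residual M \<alpha> \<beta> i uh \<tau> (t j))"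
        have "extr d k = norm (\<alpha> \<star> errE d j + \<beta> \<star> e + x)"
          unfolding d_def sel j Ubeq[OF jN] t_Suc extrapolation_error_equation e_def x_def ..
        also have "\<dots> \<le> K\<alpha> * norm (errE d j) + K\<beta> * norm e + norm x"
          using norm_triangle_ineq[of "\<alpha> \<star> errE d j + \<beta> \<star> e" x] norm_triangle_ineq[of "\<alpha> \<star> errE d j" "\<beta> \<star> e"]
            K\<alpha>(2)[of "errE d j"] K\<beta>(2)[of e] by linarith
        also have "norm e \<le> norm (erre d k) + r * Cr * \<tau> ^ \<mu>"
          unfolding e_def external_errors_eq[of M uh \<tau> "t k" "vc k" w q]
          using norm_triangle_ineq[of "erre d k" "\<chi> i. modification M w q i uh \<tau> (t k)"] mod_u(1)[OF k(3)]
          by (simp add: d_def)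
        also have "norm x \<le> s * Cr * \<tau> ^ \<mu>"
          unfolding x_def s_def
          by (rule negligible_chi_bound(2)[OF c7 J(1) B(2) \<tau>(1,2) tJ nodes3[OF jN] Cr(8,1) \<mu>(3)]) (use jN KN in simp)
        finally have "extr d k \<le> K\<alpha> * norm (errE d j) + K\<beta> * norm (erre d k) + (K\<beta> * (r * Cr) + s * Cr) * \<tau> ^ \<mu>"
          using K\<beta>(1) by (simp add: algebra_simps)
        also have "\<dots> \<le> c * norm (errE d j) + c * norm (erre d k) + c * \<tau> ^ \<mu>"
          using cge \<tau>\<mu> by (intro add_mono mult_right_mono) auto
        finally show ?thesis by (simp add: j distrib_left)
      qed
      assume small: "extr d k \<le> 1"
      have close: "norm (uh 0 (t k + absc M $ i * \<tau>) - cls (Ub k i)) \<le> extr d k" for i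
        using Finite_Cartesian_Product.norm_nth_le[of "\<chi> i. node 0 (absc M $ i) uh \<tau> (t k) - cls (Ub k i)" i]
        by (simp add: d_def node_def)
      have dW: "norm (Wu (t k + absc M $ i * \<tau>) - Wb k i) \<le> \<Lambda> * extr d k" for i
      proof -
        have "norm (Wu (t k + absc M $ i * \<tau>) - Wb k i) \<le> \<Lambda> * norm (uh 0 (t k + absc M $ i * \<tau>) - cls (Ub k i))"
          unfolding Wb_def using close[of i] small step(2)[OF k(1,2)] stJ[OF k(2)] by (intro lip_bar) auto
        also have "\<dots> \<le> \<Lambda> * extr d k" using close[of i] \<Lambda> by (rule mult_left_mono)
        finally show ?thesis .
      qed
      have ext0: "0 \<le> extr d k" by (simp add: d_def)
      have Wb: "norm (Wb k i) \<le> CW + \<Lambda>" for i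
      proof -
        have "\<Lambda> * extr d k \<le> \<Lambda> * 1" using small \<Lambda> by (intro mult_left_mono)
        then show ?thesis
          using norm_triangle_sub[of "Wb k i" "Wu (t k + absc M $ i * \<tau>)"] CW[OF stJ[OF k(2), of i]] dW[of i]
          by (simp add: norm_minus_commute)
      qed
      show "norm (src d k) \<le> c * (extr d k + norm (errD d k))"
      proof -
        have D: "\<bar>dz 0 (t k + absc M $ i * \<tau>) - Z k i\<bar> \<le> norm (errD d k)" for i
          using Finite_Cartesian_Product.norm_nth_le[of "errD d k" i] by (simp add: d_def stage_errors_def node_def)
        have "norm (src d k $ i) \<le> (B * \<Lambda> + (CW + \<Lambda>)) * (extr d k + norm (errD d k))" for i
        proof -
          have "norm (src d k $ i) \<le> \<bar>dz 0 (t k + absc M $ i * \<tau>)\<bar> * norm (Wu (t k + absc M $ i * \<tau>) - Wb k i)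
              + \<bar>dz 0 (t k + absc M $ i * \<tau>) - Z k i\<bar> * norm (Wb k i)"
            by (simp add: d_def norm_triangle_le)
          also have "\<dots> \<le> B * (\<Lambda> * extr d k) + norm (errD d k) * (CW + \<Lambda>)"
            using zB[of 0, OF _ stJ[OF k(2), of i]] dW[of i] D[of i] Wb[of i] B(1) by (intro add_mono mult_mono) auto
          also have "\<dots> \<le> (B * \<Lambda> + (CW + \<Lambda>)) * (extr d k + norm (errD d k))"
          proof -
            have "0 \<le> B * \<Lambda> * norm (errD d k)" "0 \<le> (CW + \<Lambda>) * extr d k"
              using B(1) \<Lambda> CW0 ext0 by auto
            then show ?thesis by (simp add: algebra_simps)
          qed
          finally show ?thesis .
        qed
        then have "norm (src d k) \<le> s * ((B * \<Lambda> + (CW + \<Lambda>)) * (extr d k + norm (errD d k)))"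
          unfolding s_def by (rule norm_vec_le_const)
        then have "norm (src d k) \<le> (s * (B * \<Lambda> + (CW + \<Lambda>))) * (extr d k + norm (errD d k))"
          by (simp only: mult.assoc)
        then show ?thesis by (rule scale[OF _ cge(12)]) (use ext0 in simp)
      qed
      fix i
      show "norm (Wbar d k $ i) \<le> c" using Wb[of i] cge(6) by (simp add: d_def)
      show "norm (Wbar d k $ i - Wref d k) \<le> c * (extr d k + \<tau>)"
      proof -
        have "norm (Wu (t k + absc M $ i * \<tau>) - Wu (t k)) \<le> \<Lambda> * B * (Ac * \<tau>)"
        proof -
          have "norm (Wu (t k + absc M $ i * \<tau>) - Wu (t k)) \<le> \<Lambda> * B * \<bar>absc M $ i * \<tau>\<bar>"
            using lip_ex[OF stJ[OF k(2), of i] tJ[OF k(3)]] by simp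
          also have "\<dots> \<le> \<Lambda> * B * (Ac * \<tau>)"
            using \<tau> Ac[of i] nn(3) unfolding abs_mult by (intro mult_left_mono mult_mono) auto
          finally show ?thesis .
        qed
        moreover have "norm (Wb k i - Wu (t k)) \<le> norm (Wu (t k + absc M $ i * \<tau>) - Wb k i) + norm (Wu (t k + absc M $ i * \<tau>) - Wu (t k))"
          using norm_triangle_ineq[of "Wb k i - Wu (t k + absc M $ i * \<tau>)" "Wu (t k + absc M $ i * \<tau>) - Wu (t k)"]
          by (simp add: norm_minus_commute)
        ultimately have "norm (Wb k i - Wu (t k)) \<le> \<Lambda> * extr d k + (\<Lambda> * B * Ac) * \<tau>"
          using dW[of i] by simp
        also have "\<dots> \<le> c * extr d k + c * \<tau>" using cge ext0 \<tau> by (intro add_mono mult_right_mono) auto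
        finally show ?thesis by (simp add: d_def distrib_left)
      qed
      show "\<bar>errY d k $ i - 1 / 2 * (Wbar d k $ i \<bullet> errX d k $ i)\<bar> \<le> c * \<tau> * extr d k"
      proof -
        define \<sigma> where "\<sigma> = t k + absc M $ i * \<tau>"
        have \<sigma>: "\<sigma> \<in> J" using stJ[OF k(2)] by (simp add: \<sigma>_def)
        have "errY d k $ i - 1 / 2 * (Wbar d k $ i \<bullet> errX d k $ i) = \<tau> * (1 / 2 * ((Wu \<sigma> - Wb k i) \<bullet> uh 1 \<sigma>))"
          using exact_z[OF \<sigma>] Zd[OF k(1,2), of i]
          by (simp add: d_def increment_errors_def node_def \<sigma>_def inner_simps algebra_simps)
        also have "\<bar>\<dots>\<bar> \<le> \<tau> * (norm (Wu \<sigma> - Wb k i) * norm (uh 1 \<sigma>))"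
          using Cauchy_Schwarz_ineq2[of "Wu \<sigma> - Wb k i" "uh 1 \<sigma>"] \<tau> by (simp add: abs_mult)
        also have "\<dots> \<le> \<tau> * ((\<Lambda> * extr d k) * B)"
          using dW[of i] uB[of 1, OF m1 \<sigma>] \<tau> \<Lambda> ext0 by (intro mult_left_mono mult_mono) (auto simp: \<sigma>_def)
        also have "\<dots> = (\<Lambda> * B) * (\<tau> * extr d k)" by (simp only: mult_ac)
        finally have "\<bar>errY d k $ i - 1 / 2 * (Wbar d k $ i \<bullet> errX d k $ i)\<bar> \<le> c * (\<tau> * extr d k)"
          by (rule scale[OF _ cge(8)]) (use \<tau> ext0 in simp)
        then show ?thesis by (simp only: mult.assoc)
      qed
    qed
    have nN: "1 \<le> n" "n \<le> N" "Suc n \<le> K" using n by (auto simp: N_def)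
    have res: "norm (erre d (Suc n)) \<le> Ke * \<tau> ^ \<mu>" "norm (errd d (Suc n)) \<le> Ke * \<tau> ^ \<mu>"
        "norm (errE d n) \<le> Ke * \<tau> ^ \<mu>" "norm (errD d n) \<le> Ke * \<tau> ^ \<mu>"
      using main[OF sys \<tau>(3) nN(1,2)] by blast+
    have \<tau>\<mu>: "0 \<le> \<tau> ^ \<mu>" using \<tau> by simp
    have QK: "Ke * \<tau> ^ \<mu> + Cr * \<tau> ^ \<mu> = Q * \<tau> ^ \<mu>" "Ke * \<tau> ^ \<mu> \<le> Q * \<tau> ^ \<mu>"
      using Cr(1) \<tau>\<mu> by (auto simp: Q_def distrib_right)
    have f1: "\<bar>L2_norm \<Omega> (ext_err_u M \<tau> du v (n + 1) i)\<bar> \<le> Q * \<tau> ^ \<mu>" for i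
    proof -
      have "L2_norm \<Omega> (ext_err_u M \<tau> du v (n + 1) i) = norm (external_errors M uh \<tau> (t (Suc n)) (vc (Suc n)) $ i)"
        using ext_u[of "Suc n" i] nN by (simp add: norm_cls[symmetric])
      also have "\<dots> = norm (erre d (Suc n) $ i + modification M w q i uh \<tau> (t (Suc n)))"
        by (simp add: external_errors_eq[of M uh \<tau> "t (Suc n)" "vc (Suc n)" w q] d_def)
      also have "\<dots> \<le> Q * \<tau> ^ \<mu>"
        using norm_triangle_ineq[of "erre d (Suc n) $ i" "modification M w q i uh \<tau> (t (Suc n))"]
          Finite_Cartesian_Product.norm_nth_le[of "erre d (Suc n)" i] res(1) mod_u(2)[OF nN(3), of i] QK(1) by linarith
      finally have "L2_norm \<Omega> (ext_err_u M \<tau> du v (n + 1) i) \<le> Q * \<tau> ^ \<mu>" .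
      moreover have "0 \<le> L2_norm \<Omega> (ext_err_u M \<tau> du v (n + 1) i)"
        by (simp add: L2_norm_def L2_inner_self_nonneg)
      ultimately show ?thesis by simp
    qed
    have f2: "\<bar>ext_err_z M \<tau> dz y (n + 1) i\<bar> \<le> Q * \<tau> ^ \<mu>" for i
    proof -
      have "ext_err_z M \<tau> dz y (n + 1) i = errd d (Suc n) $ i + modification M w q i dz \<tau> (t (Suc n))"
        by (simp add: ext_z external_errors_eq[of M dz \<tau> "t (Suc n)" "y (Suc n)" w q] d_def)
      then show ?thesis
        using norm_triangle_ineq[of "errd d (Suc n) $ i" "modification M w q i dz \<tau> (t (Suc n))"]
          Finite_Cartesian_Product.norm_nth_le[of "errd d (Suc n)" i] res(2) mod_z(2)[OF nN(3), of i] QK(1)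
        unfolding real_norm_def by linarith
    qed
    have f3: "\<bar>L2_norm \<Omega> (stage_err_u M \<tau> du U n i)\<bar> \<le> Q * \<tau> ^ \<mu>" for i
    proof -
      have "L2_norm \<Omega> (stage_err_u M \<tau> du U n i) = norm (errE d n $ i)"
        using st_u[OF nN(2), of i] by (simp add: norm_cls[symmetric] d_def)
      then show ?thesis
        using Finite_Cartesian_Product.norm_nth_le[of "errE d n" i] res(3) QK(2) by simp
    qed
    have f4: "\<bar>stage_err_z M \<tau> dz Z n i\<bar> \<le> Q * \<tau> ^ \<mu>" for i
      using Finite_Cartesian_Product.norm_nth_le[of "errD d n" i] res(4) QK(2) by (simp add: st_z d_def)
    have "(\<Sum>i\<in>UNIV. (L2_norm \<Omega> (ext_err_u M \<tau> du v (n + 1) i))\<^sup>2 + \<bar>ext_err_z M \<tau> dz y (n + 1) i\<bar>\<^sup>2)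
        + \<tau> * (\<Sum>i\<in>UNIV. (L2_norm \<Omega> (stage_err_u M \<tau> du U n i))\<^sup>2 + \<bar>stage_err_z M \<tau> dz Z n i\<bar>\<^sup>2)
        \<le> 2 * r * (Q * \<tau> ^ \<mu>)\<^sup>2 + 1 * (2 * s * (Q * \<tau> ^ \<mu>)\<^sup>2)"
      unfolding r_def s_def using \<tau>
      by (intro add_mono mult_mono power2_sum_bound f1 f2 f3 f4) (auto intro!: sum_nonneg)
    also have "\<dots> = (2 * (r + s) * Q\<^sup>2) * (\<tau> ^ \<mu>)\<^sup>2" by (simp add: power_mult_distrib algebra_simps)
    also have "\<dots> \<le> CC * (\<tau> ^ \<mu>)\<^sup>2" unfolding CC_def by (intro mult_right_mono) auto
    also have "(\<tau> ^ \<mu>)\<^sup>2 = \<tau> ^ min (2 * q) (2 * \<nu>)"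
      by (simp add: power_mult[symmetric] \<mu>_def min_def mult.commute)
    finally show ?thesis .
  qed
  note bound = this[unfolded \<Omega>_def]
  show ?thesis
  proof (rule exI[of _ CC], intro conjI CC, rule exI[of _ "min 1 \<tau>1"], intro conjI allI impI)
    show "0 < min 1 \<tau>1" using \<tau>1 by simp
  qed (elim conjE, rule bound, simp_all)
qed

theorem theorem4p3:
  fixes M :: "('s::finite, 'r::finite) gltd"
    and \<nu> q :: nat
    and \<alpha> :: "real^'s^'s" and \<beta> :: "real^'r^'s"
  assumes "gltd_consistent M"
    and "algebraically_stable M"
    and "diagonally_stable M"
    and "generalized_stage_order M q"
    and "extrapolation M \<nu> \<alpha> \<beta>"
  shows "\<exists>m. \<forall>(P :: ('a::euclidean_space) sav_problem) (T :: real) (J :: real set) du dz C\<^sub>s.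
    sav_setting P \<and> W_locally_lipschitz P \<and>
    0 < T \<and> is_interval J \<and> {0..T} \<subseteq> J \<and>
    exact_solution P J du dz \<and> smooth_bounded_solution P J m du dz \<longrightarrow>
    (\<exists>C>0. \<exists>\<tau>\<^sub>0>0. \<forall>(K :: nat) (\<tau> :: real) U Z v y.
      0 < K \<and> \<tau> = T / real K \<and> \<tau> < \<tau>\<^sub>0 \<and>
      (\<forall>n<K. \<forall>i. stage_time M \<tau> n i \<in> J) \<and>
      sav_gl_solution M \<alpha> \<beta> P \<tau> K U Z v y \<and>
      (\<Sum>i\<in>UNIV. L2_norm (region P) (stage_err_u M \<tau> du U 0 i) + \<bar>stage_err_z M \<tau> dz Z 0 i\<bar>)
        + (\<Sum>i\<in>UNIV. L2_norm (region P) (ext_err_u M \<tau> du v 1 i) + \<bar>ext_err_z M \<tau> dz y 1 i\<bar>)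
        \<le> C\<^sub>s * \<tau> ^ q \<longrightarrow>
      (\<forall>n. 1 \<le> n \<and> n \<le> K - 1 \<longrightarrow>
        (\<Sum>i\<in>UNIV. (L2_norm (region P) (ext_err_u M \<tau> du v (n + 1) i))\<^sup>2
                    + \<bar>ext_err_z M \<tau> dz y (n + 1) i\<bar>\<^sup>2)
        + \<tau> * (\<Sum>i\<in>UNIV. (L2_norm (region P) (stage_err_u M \<tau> du U n i))\<^sup>2
                    + \<bar>stage_err_z M \<tau> dz Z n i\<bar>\<^sup>2)
        \<le> C * \<tau> ^ min (2 * q) (2 * \<nu>)))"
proof -
  have q: "1 \<le> q" by (rule generalized_stage_order_ge_1[OF assms(1,4)])
  have \<nu>: "1 \<le> \<nu>" using assms(5) unfolding extrapolation_def by (elim conjE)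
  obtain Cg Ci h Ai hh \<kappa> where sm: "stable_method (D11 M) (D12 M) (D21 M) (D22 M) Cg Ci h Ai hh \<kappa>"
    using stable_method_exists[OF assms(2,3)] by (elim exE) (rule that)
  have "has_generalized_stage_order M q" using assms(4) unfolding generalized_stage_order_def by (elim conjE)
  from order_conditions_exist[OF this q] obtain w where
    w: "order_conditions M w q" "\<And>k. k < q \<Longrightarrow> w k = wext M k" by auto
  define m where "m = q + 1 + \<nu> + wdeg M"
  have m: "q < m" "\<nu> \<le> m" "wdeg M \<le> m" by (auto simp: m_def)
  show ?thesis
    by (rule exI[of _ m], intro allI impI, elim conjE)
      (rule convergence[OF sm q \<nu> w extrapolation_conditions[OF assms(5)] m])
qed

end
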